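(* Suppose $v$ satisfies Assumptions A1 and A2 (stated in the context) with constants $s_0,c_0$. Let $s\ge s^*$ be such that $\mathcal U(s)\subset\Theta$, and suppose $\epsilon_3,\epsilon_4(s)\lesssim1$. Let $\bar x=\int x\,d\pi(x)$, $\delta\hat x=\int xS(x)\,d\hat\gamma(x)$, $\hat x_S=\int x\,d\hat\gamma_S(x)=\hat x+\delta\hat x$, and $R_{\bar x}=\bar x-\hat x-\delta\hat x$. Then $$\delta\hat x=-\frac12H_V^{-1}\langle\nabla^3V(\hat x),H_V^{-1}\rangle,$$ and $$\|R_{\bar x}\|_{H_V}=\|\bar x-\hat x_S\|_{H_V}\lesssim E_s\big(\epsilon_3^2+\epsilon_4(s)^2\big)+\tau_s. \qquad ( * )$$ If $v\in C^5(\Theta)$, then $( * )$ can be tightened to $$\|\bar x-\hat x_S\|_{H_V}\lesssim E_s\big(\epsilon_3^2+\epsilon_4(s)^2\big)\big(\epsilon_3+\epsilon_4(s)^2\big)+d^{-1/2}\epsilon_5(s)^3+\tau_s. \qquad ( ** )$$ Finally, $\|\delta\hat x\|_{H_V}\le\bar\epsilon_3$, and hence $$\|\bar x-\hat x\|_{H_V}\le\bar\epsilon_3+\|R_{\bar x}\|_{H_V},$$ where $\|R_{\bar x}\|_{H_V}$ is bounded as in $( * )$ or $( ** )$, depending on the regularity of $v$.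
   Context: Setting: $d\ge1$ is an integer, $n>0$, $\Theta\subseteq\mathbb R^d$ is open, $v:\Theta\to\mathbb R$, $V=nv$, and $\pi$ is the probability measure with density proportional to $e^{-V}$ on $\Theta$ (and zero outside $\Theta$). Notation: $\langle T,S\rangle$ is the entrywise inner product of tensors of the same order. For a symmetric positive definite matrix $H$, $\|x\|_H=\sqrt{x^\top Hx}$ for vectors and $\|T\|_H=\sup_{\|u\|_H=1}|\langle T,u^{\otimes k}\rangle|$ for symmetric tensors of order $k\ge2$. $\|T\|_F$ is the Frobenius norm. For a symmetric order-3 tensor $T$ and symmetric matrix $A$, $\langle T,A\rangle\in\mathbb R^d$ has coordinates $\langle T,A\rangle_i=\sum_{j,k}T_{ijk}A_{jk}$. Assumption A1: $v\in C^4(\Theta)$ has a unique global minimizer $\hat x\in\Theta$, and $H_v:=\nabla^2v(\hat x)\succ0$. Local region: $\mathcal U(s)=\{x\in\mathbb R^d:\|x-\hat x\|_{H_v}\le s\sqrt{d/n}\}$. Assumption A2: there exist $s_0>0$ and $c_0$ with $1\ge c_0>C/\sqrt d$ for some absolute constant $C>0$ such that $v(x)-v(\hat x)\ge c_0\sqrt{d/n}\,\|x-\hat x\|_{H_v}$ for all $x\in\Theta\setminus\mathcal U(s_0)$. Laplace approximation and correction: $H_V=\nabla^2V(\hat x)=nH_v$, $\hat\gamma=\mathcal N(\hat x,H_V^{-1})$, $S(x)=-\frac16\langle\nabla^3V(\hat x),(x-\hat x)^{\otimes3}\rangle$, and $\hat\gamma_S$ is the signed measure $d\hat\gamma_S=(1+S)\,d\hat\gamma$.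 Small quantities: with $W(x)=V(\hat x+H_V^{-1/2}x)$, $\bar\epsilon_3\ge0$ is defined by $\bar\epsilon_3^2=\frac16\|\nabla^3W(0)\|_F^2+\frac14\|\langle\nabla^3W(0),I_d\rangle\|^2$. Further, $\epsilon_3=d\,\|\nabla^3V(\hat x)\|_{H_V}$, $\epsilon_4(s)=d\sup_{x\in\mathcal U(s)}\|\nabla^4V(x)\|_{H_V}^{1/2}$, and (when $v\in C^5(\Theta)$) $\epsilon_5(s)=d\sup_{x\in\mathcal U(s)}\|\nabla^5V(x)\|_{H_V}^{1/3}$. Also $E_s=\exp\big((\epsilon_3^2+\epsilon_4(s)^2)s^4\big)$, $\tau_s=d\,e^{-c_0sd/8}$, $s^*=\max\big(s_0,\frac{8}{c_0}\log\frac{2e}{c_0}\big)$. Convention: $a\lesssim b$ means $a\le Cb$ for an absolute constant $C>0$; the hypothesis "$\epsilon_3,\epsilon_4(s)\lesssim1$" means both are bounded by some absolute constant, and the constants in the conclusions may depend on that bound and on the absolute constant in A2, but on nothing else. *)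

theory Defs
  imports
    "HOL-Probability.Probability"
    "Jordan_Normal_Form.Determinant"
    "Jordan_Normal_Form.Gauss_Jordan_Elimination"
begin

text \<open>
  The constants in the theorem are uniform in the dimension \<open>d\<close>, so \<open>d\<close> has to be a bound
  variable and cannot be encoded as a type. Points of \<open>\<real>\<^sup>d\<close> are the functions
  \<open>x :: nat \<Rightarrow> real\<close> that are extensional on \<open>{..<d}\<close>. They are the points of the library's
  finite product topology and finite product measure. Matrices are \<open>real mat\<close> of
  dimension \<open>d \<times> d\<close>. A tensor of order \<open>k\<close> is a function on index lists, of which
  only the lists of length \<open>k\<close> with entries below \<open>d\<close> matter.
\<close>

section \<open>Vectors, matrices and tensors\<close>

abbreviation Rd :: "nat \<Rightarrow> (nat \<Rightarrow> real) set" where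
  "Rd d \<equiv> {..<d} \<rightarrow>\<^sub>E UNIV"

abbreviation Rtop :: "nat \<Rightarrow> (nat \<Rightarrow> real) topology" where
  "Rtop d \<equiv> product_topology (\<lambda>_. euclideanreal) {..<d}"

abbreviation Leb :: "nat \<Rightarrow> (nat \<Rightarrow> real) measure" where
  "Leb d \<equiv> (\<Pi>\<^sub>M i\<in>{..<d}. lborel)"

definition vadd :: "nat \<Rightarrow> (nat \<Rightarrow> real) \<Rightarrow> (nat \<Rightarrow> real) \<Rightarrow> nat \<Rightarrow> real" where
  "vadd d x y = (\<lambda>i\<in>{..<d}. x i + y i)"

definition vsub :: "nat \<Rightarrow> (nat \<Rightarrow> real) \<Rightarrow> (nat \<Rightarrow> real) \<Rightarrow> nat \<Rightarrow> real" where
  "vsub d x y = (\<lambda>i\<in>{..<d}. x i - y i)"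

definition vscale :: "nat \<Rightarrow> real \<Rightarrow> (nat \<Rightarrow> real) \<Rightarrow> nat \<Rightarrow> real" where
  "vscale d c x = (\<lambda>i\<in>{..<d}. c * x i)"

definition mvec :: "nat \<Rightarrow> real mat \<Rightarrow> (nat \<Rightarrow> real) \<Rightarrow> nat \<Rightarrow> real" where
  "mvec d A x = (\<lambda>i\<in>{..<d}. \<Sum>j<d. A $$ (i, j) * x j)"

definition quad_form :: "nat \<Rightarrow> real mat \<Rightarrow> (nat \<Rightarrow> real) \<Rightarrow> real" where
  "quad_form d A x = (\<Sum>i<d. \<Sum>j<d. x i * A $$ (i, j) * x j)"

definition pos_def :: "nat \<Rightarrow> real mat \<Rightarrow> bool" where
  "pos_def d A \<longleftrightarrow> A \<in> carrier_mat d d \<and> transpose_mat A = A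
     \<and> (\<forall>x. (\<exists>i<d. x i \<noteq> 0) \<longrightarrow> 0 < quad_form d A x)"

definition minv :: "real mat \<Rightarrow> real mat" where
  "minv A = the (mat_inverse A)"

text \<open>For positive definite \<open>A\<close>, this is the positive definite root \<open>A\<^bsup>-1/2\<^esup>\<close>.\<close>
definition inv_sqrt_mat :: "nat \<Rightarrow> real mat \<Rightarrow> real mat" where
  "inv_sqrt_mat d A = (THE B. pos_def d B \<and> B * B = minv A)"

definition hnorm :: "nat \<Rightarrow> real mat \<Rightarrow> (nat \<Rightarrow> real) \<Rightarrow> real" where
  "hnorm d H x = sqrt (quad_form d H x)"

type_synonym tensor = "nat list \<Rightarrow> real"

definition tidx :: "nat \<Rightarrow> nat \<Rightarrow> nat list set" where
  "tidx d k = {is. length is = k \<and> set is \<subseteq> {..<d}}"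

definition tinner :: "nat \<Rightarrow> nat \<Rightarrow> tensor \<Rightarrow> tensor \<Rightarrow> real" where
  "tinner d k T S = (\<Sum>is\<in>tidx d k. T is * S is)"

definition tpow :: "(nat \<Rightarrow> real) \<Rightarrow> tensor" where
  "tpow u = (\<lambda>is. prod_list (map u is))"

definition tnorm :: "nat \<Rightarrow> nat \<Rightarrow> real mat \<Rightarrow> tensor \<Rightarrow> real" where
  "tnorm d k H T = (SUP u\<in>{u \<in> Rd d. hnorm d H u = 1}. \<bar>tinner d k T (tpow u)\<bar>)"

definition frob_norm :: "nat \<Rightarrow> nat \<Rightarrow> tensor \<Rightarrow> real" where
  "frob_norm d k T = L2_set T (tidx d k)"

definition contract3 :: "nat \<Rightarrow> tensor \<Rightarrow> real mat \<Rightarrow> nat \<Rightarrow> real" where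
  "contract3 d T A = (\<lambda>i\<in>{..<d}. \<Sum>j<d. \<Sum>k<d. T [i, j, k] * A $$ (j, k))"

section \<open>Derivatives\<close>

definition pdiff :: "nat \<Rightarrow> ((nat \<Rightarrow> real) \<Rightarrow> real) \<Rightarrow> (nat \<Rightarrow> real) \<Rightarrow> real" where
  "pdiff i f = (\<lambda>x. deriv (\<lambda>t. f (x(i := t))) (x i))"

text \<open>
  \<open>nabla f x [i\<^sub>1, \<dots>, i\<^sub>k]\<close> is the partial derivative
  \<open>\<partial>\<^bsub>i\<^sub>1\<^esub> \<cdots> \<partial>\<^bsub>i\<^sub>k\<^esub> f (x)\<close>, so \<open>nabla f x\<close>
  contains the derivative tensors of all orders.
\<close>
definition nabla :: "((nat \<Rightarrow> real) \<Rightarrow> real) \<Rightarrow> (nat \<Rightarrow> real) \<Rightarrow> tensor" where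
  "nabla f x = (\<lambda>is. foldr pdiff is f x)"

definition hessian :: "nat \<Rightarrow> ((nat \<Rightarrow> real) \<Rightarrow> real) \<Rightarrow> (nat \<Rightarrow> real) \<Rightarrow> real mat" where
  "hessian d f x = mat d d (\<lambda>(i, j). nabla f x [i, j])"

text \<open>\<open>C\<^sup>k\<close> on the open set \<open>U\<close>: all partial derivatives up to order \<open>k\<close> exist and are continuous.\<close>
primrec Ck_on :: "nat \<Rightarrow> nat \<Rightarrow> (nat \<Rightarrow> real) set \<Rightarrow> ((nat \<Rightarrow> real) \<Rightarrow> real) \<Rightarrow> bool" where
  "Ck_on d 0 U f \<longleftrightarrow> continuous_map (subtopology (Rtop d) U) euclideanreal f"
| "Ck_on d (Suc k) U f \<longleftrightarrow> continuous_map (subtopology (Rtop d) U) euclideanreal f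
     \<and> (\<forall>i<d. (\<forall>x\<in>U. (\<lambda>t. f (x(i := t))) differentiable (at (x i))) \<and> Ck_on d k U (pdiff i f))"

section \<open>Measures\<close>

definition mean :: "nat \<Rightarrow> (nat \<Rightarrow> real) measure \<Rightarrow> nat \<Rightarrow> real" where
  "mean d \<mu> = (\<lambda>i\<in>{..<d}. \<integral>x. x i \<partial>\<mu>)"

definition posterior :: "nat \<Rightarrow> (nat \<Rightarrow> real) set \<Rightarrow> ((nat \<Rightarrow> real) \<Rightarrow> real) \<Rightarrow> (nat \<Rightarrow> real) measure" where
  "posterior d \<Theta> V = density (Leb d)
     (\<lambda>x. ennreal (indicator \<Theta> x * exp (- V x) / (\<integral>y. indicator \<Theta> y * exp (- V y) \<partial>Leb d)))"

definition gaussian :: "nat \<Rightarrow> (nat \<Rightarrow> real) \<Rightarrow> real mat \<Rightarrow> (nat \<Rightarrow> real) measure" where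
  "gaussian d m \<Sigma> = density (Leb d)
     (\<lambda>x. ennreal (exp (- (1/2) * quad_form d (minv \<Sigma>) (vsub d x m))
                     / sqrt ((2 * pi) ^ d * Determinant.det \<Sigma>)))"

section \<open>Assumptions and local region\<close>

definition A1 :: "nat \<Rightarrow> (nat \<Rightarrow> real) set \<Rightarrow> ((nat \<Rightarrow> real) \<Rightarrow> real) \<Rightarrow> (nat \<Rightarrow> real) \<Rightarrow> bool" where
  "A1 d \<Theta> v xh \<longleftrightarrow> Ck_on d 4 \<Theta> v \<and> xh \<in> \<Theta> \<and> (\<forall>x\<in>\<Theta>. x \<noteq> xh \<longrightarrow> v xh < v x)
     \<and> pos_def d (hessian d v xh)"

definition local_region ::
  "nat \<Rightarrow> real \<Rightarrow> ((nat \<Rightarrow> real) \<Rightarrow> real) \<Rightarrow> (nat \<Rightarrow> real) \<Rightarrow> real \<Rightarrow> (nat \<Rightarrow> real) set" where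
  "local_region d n v xh s =
     {x \<in> Rd d. hnorm d (hessian d v xh) (vsub d x xh) \<le> s * sqrt (d / n)}"

definition A2 ::
  "real \<Rightarrow> nat \<Rightarrow> real \<Rightarrow> (nat \<Rightarrow> real) set \<Rightarrow> ((nat \<Rightarrow> real) \<Rightarrow> real) \<Rightarrow> (nat \<Rightarrow> real)
     \<Rightarrow> real \<Rightarrow> real \<Rightarrow> bool" where
  "A2 C d n \<Theta> v xh s0 c0 \<longleftrightarrow> s0 > 0 \<and> c0 \<le> 1 \<and> c0 > C / sqrt d
     \<and> (\<forall>x \<in> \<Theta> - local_region d n v xh s0.
          v x - v xh \<ge> c0 * sqrt (d / n) * hnorm d (hessian d v xh) (vsub d x xh))"

section \<open>Laplace approximation and its correction\<close>

definition laplace :: "nat \<Rightarrow> ((nat \<Rightarrow> real) \<Rightarrow> real) \<Rightarrow> (nat \<Rightarrow> real) \<Rightarrow> (nat \<Rightarrow> real) measure" where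
  "laplace d V xh = gaussian d xh (minv (hessian d V xh))"

definition Scorr :: "nat \<Rightarrow> ((nat \<Rightarrow> real) \<Rightarrow> real) \<Rightarrow> (nat \<Rightarrow> real) \<Rightarrow> (nat \<Rightarrow> real) \<Rightarrow> real" where
  "Scorr d V xh x = - (1/6) * tinner d 3 (nabla V xh) (tpow (vsub d x xh))"

definition delta_xh :: "nat \<Rightarrow> ((nat \<Rightarrow> real) \<Rightarrow> real) \<Rightarrow> (nat \<Rightarrow> real) \<Rightarrow> nat \<Rightarrow> real" where
  "delta_xh d V xh = (\<lambda>i\<in>{..<d}. \<integral>x. x i * Scorr d V xh x \<partial>laplace d V xh)"

text \<open>
  The library has no signed measures; an integral against the signed measure with density
  \<open>1 + S\<close> with respect to the Laplace approximation is written as the integral of the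
  integrand times \<open>1 + S\<close>.
\<close>
definition xh_S :: "nat \<Rightarrow> ((nat \<Rightarrow> real) \<Rightarrow> real) \<Rightarrow> (nat \<Rightarrow> real) \<Rightarrow> nat \<Rightarrow> real" where
  "xh_S d V xh = (\<lambda>i\<in>{..<d}. \<integral>x. x i * (1 + Scorr d V xh x) \<partial>laplace d V xh)"

section \<open>Small quantities\<close>

definition eps3bar :: "nat \<Rightarrow> ((nat \<Rightarrow> real) \<Rightarrow> real) \<Rightarrow> (nat \<Rightarrow> real) \<Rightarrow> real" where
  "eps3bar d V xh =
     (let W = (\<lambda>x. V (vadd d xh (mvec d (inv_sqrt_mat d (hessian d V xh)) x)));
          T = nabla W (\<lambda>i\<in>{..<d}. 0)
      in sqrt (1/6 * (frob_norm d 3 T)\<^sup>2 + 1/4 * (L2_set (contract3 d T (1\<^sub>m d)) {..<d})\<^sup>2))"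

definition eps3 :: "nat \<Rightarrow> ((nat \<Rightarrow> real) \<Rightarrow> real) \<Rightarrow> (nat \<Rightarrow> real) \<Rightarrow> real" where
  "eps3 d V xh = d * tnorm d 3 (hessian d V xh) (nabla V xh)"

text \<open>In \<open>eps4\<close> and \<open>eps5\<close>, the argument \<open>U\<close> is to be the local region.\<close>
definition eps4 ::
  "nat \<Rightarrow> ((nat \<Rightarrow> real) \<Rightarrow> real) \<Rightarrow> (nat \<Rightarrow> real) \<Rightarrow> (nat \<Rightarrow> real) set \<Rightarrow> real" where
  "eps4 d V xh U = d * (SUP x\<in>U. sqrt (tnorm d 4 (hessian d V xh) (nabla V x)))"

definition eps5 ::
  "nat \<Rightarrow> ((nat \<Rightarrow> real) \<Rightarrow> real) \<Rightarrow> (nat \<Rightarrow> real) \<Rightarrow> (nat \<Rightarrow> real) set \<Rightarrow> real" where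
  "eps5 d V xh U = d * (SUP x\<in>U. root 3 (tnorm d 5 (hessian d V xh) (nabla V x)))"

definition Efac :: "real \<Rightarrow> real \<Rightarrow> real \<Rightarrow> real" where
  "Efac e3 e4 s = exp ((e3\<^sup>2 + e4\<^sup>2) * s ^ 4)"

definition tau :: "nat \<Rightarrow> real \<Rightarrow> real \<Rightarrow> real" where
  "tau d c0 s = d * exp (- c0 * s * d / 8)"

definition s_star :: "real \<Rightarrow> real \<Rightarrow> real" where
  "s_star s0 c0 = max s0 (8 / c0 * ln (2 * exp 1 / c0))"

end

theory Submission
  imports Defs
begin

text \<open>
  In coordinates \<open>x = xh + a y\<close> with \<open>a a\<^bsup>T\<^esup> = H\<^bsup>-1\<^esup>\<close> the potential is
  \<open>\<bar>y\<bar>\<^sup>2/2 + f + r\<close>, with a cubic form \<open>6 f\<close> that is at most \<open>(\<epsilon>\<^sub>3/d) \<bar>y\<bar>\<^sup>3\<close> and a remainder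
  \<open>r = O((\<epsilon>\<^sub>4/d)\<^sup>2 \<bar>y\<bar>\<^sup>4)\<close>. The density relative to the standard Gaussian is \<open>exp (- f - r)\<close>, and the
  linear term \<open>- f\<close> of its expansion produces exactly the correction of the mean. The point is to
  control \<open>f\<close> without loss in \<open>d\<close>: its gradient is of size \<open>\<epsilon>\<^sub>3\<close> on the typical sphere
  \<open>\<bar>y\<bar> \<approx> \<surd>d\<close>, so the Maurey--Pisier inequality (compare \<open>f(x)\<close> with \<open>\<nabla>f(x) \<cdot> y\<close> for an independent
  Gaussian \<open>y\<close>) gives \<open>O(\<epsilon>\<^sub>3)\<close> for all moments of \<open>f\<close>, and the factor \<open>E\<^sub>s\<close> for its exponential moment
  on the ball of radius \<open>s \<surd>d\<close>. The error terms then follow from Cauchy--Schwarz. Against an odd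
  function the even terms \<open>f\<^sup>2/2\<close> and the quartic part of \<open>r\<close> integrate to zero, which improves the
  bound when \<open>v\<close> is \<open>C\<^sup>5\<close>. Outside the ball, the linear growth in A2 leaves \<open>\<tau>\<^sub>s\<close>.
\<close>

section \<open>Affine changes of variables\<close>

text \<open>The pointwise bound on the cubic form is useless on the typical sphere: there it is of
  order \<epsilon>_3 sqrt d, while all constants must be free of d. This is why f is only ever
  handled through moments under the Gaussian. The factor E_s leaves little slack. The second moment
  of the truncated density must be at most a constant times E_s^2, so the exponential moment of f
  may only cost exp (2 \<epsilon>_3^2 s^4). The gradient constant 15/4 and the bound s >= 12, which
  follows from s >= s_star and c0 <= 1, are just good enough for this. The root a of H^-1 is taken
  triangular, not symmetric: the substitution then reduces to one-dimensional integrals and its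
  Jacobian is the product of the diagonal. The symmetric root enters through the definition of
  \<open>eps3bar\<close>; its existence is derived from a by a polar decomposition, and the
  quantities compared depend on a a^T only. The posterior mean is a ratio N / D. It is compared with
  the predicted shift \<Delta> through N - \<Delta> D, with a lower bound for D that depends on M
  alone.\<close>

interpretation Leb: product_sigma_finite "\<lambda>_::nat. lborel :: real measure" ..

lemma Leb_sigma_finite: "sigma_finite_measure (Leb d)"
  by (intro Leb.sigma_finite) auto

text \<open>Only the entries on and above the diagonal enter. With the last coordinate fixed, the
  others undergo an affine map of the same kind, so the substitution rule needs one-dimensional
  integrals only.\<close>

definition affine_map :: "nat \<Rightarrow> (nat \<Rightarrow> real) \<Rightarrow> (nat \<Rightarrow> nat \<Rightarrow> real) \<Rightarrow> (nat \<Rightarrow> real) \<Rightarrow> nat \<Rightarrow> real" where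
  "affine_map d b a y = (\<lambda>i\<in>{..<d}. b i + (\<Sum>j\<in>{i..<d}. a i j * y j))"

lemma measurable_affine_map [measurable]: "affine_map d b a \<in> measurable (Leb d) (Leb d)"
  unfolding affine_map_def
  by (intro measurable_restrict borel_measurable_add borel_measurable_sum borel_measurable_times
      borel_measurable_const measurable_component_singleton) (auto intro!: borel_measurable_add borel_measurable_sum borel_measurable_times measurable_component_singleton simp: measurable_lborel2)

lemma measurable_fun_upd_PiM:
  "(\<lambda>(x, y). x(d := y)) \<in> measurable (Leb d \<Otimes>\<^sub>M lborel) (Leb (Suc d))"
proof -
  have "(\<lambda>(x, y). x(d := y)) \<in> measurable (Leb d \<Otimes>\<^sub>M lborel) (PiM (insert d {..<d}) (\<lambda>_. lborel))"
    by (rule measurable_add_dim)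
  thus ?thesis by (simp add: lessThan_Suc)
qed

lemma nn_integral_Leb_Suc:
  assumes [measurable]: "F \<in> borel_measurable (Leb (Suc d))"
  shows "(\<integral>\<^sup>+x. F x \<partial>Leb (Suc d)) = (\<integral>\<^sup>+t. (\<integral>\<^sup>+x. F (x(d := t)) \<partial>Leb d) \<partial>lborel)"
  using Leb.product_nn_integral_insert_rev[of "{..<d}" d F] assms by (simp add: lessThan_Suc)

lemma nn_integral_Leb_affine:
  assumes "F \<in> borel_measurable (Leb d)" "\<And>i. i < d \<Longrightarrow> a i i \<noteq> 0"
  shows "(\<integral>\<^sup>+x. F x \<partial>Leb d) = ennreal (\<Prod>i<d. \<bar>a i i\<bar>) * (\<integral>\<^sup>+y. F (affine_map d b a y) \<partial>Leb d)"
  using assms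
proof (induction d arbitrary: F b)
  case 0
  have "affine_map 0 b a y = (\<lambda>_. undefined)" for y by (auto simp: affine_map_def)
  then show ?case by (simp add: PiM_empty nn_integral_count_space_finite)
next
  case (Suc d)
  note [measurable] = Suc.prems(1) measurable_fun_upd_PiM
  have slice: "(\<lambda>x. F (x(d := t))) \<in> borel_measurable (Leb d)" for t
  proof -
    have "(\<lambda>x. (x, t)) \<in> measurable (Leb d) (Leb d \<Otimes>\<^sub>M lborel)" by measurable
    from measurable_compose[OF measurable_compose[OF this measurable_fun_upd_PiM] Suc.prems(1)]
    show ?thesis by simp
  qed
  have meas1: "(\<lambda>t. \<integral>\<^sup>+x. F (x(d := t)) \<partial>Leb d) \<in> borel_measurable lborel"
  proof -
    interpret sigma_finite_measure "Leb d" by (rule Leb_sigma_finite)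
    have "(\<lambda>(t, x). F (x(d := t))) \<in> borel_measurable (lborel \<Otimes>\<^sub>M Leb d)"
    proof -
      have "(\<lambda>(t::real, x). (x, t)) \<in> measurable (lborel \<Otimes>\<^sub>M Leb d) (Leb d \<Otimes>\<^sub>M lborel)"
        by measurable
      from measurable_compose[OF measurable_compose[OF this measurable_fun_upd_PiM] Suc.prems(1)]
      show ?thesis by (simp add: case_prod_beta)
    qed
    then show ?thesis by measurable
  qed
  \<comment> \<open>The value t of the last coordinate merely shifts the translation vector of the
    remaining map; this is why b is arbitrary in the induction.\<close>
  let ?b = "\<lambda>t i. b i + a i d * t"
  have aff: "affine_map (Suc d) b a (y(d := t)) = (affine_map d (?b t) a y)(d := b d + a d d * t)" for y t
    unfolding affine_map_def
    by (auto simp: fun_eq_iff less_Suc_eq atLeastLessThanSuc intro!: sum.cong)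
  have "(\<integral>\<^sup>+x. F x \<partial>Leb (Suc d)) = (\<integral>\<^sup>+t. (\<integral>\<^sup>+x. F (x(d := t)) \<partial>Leb d) \<partial>lborel)"
    by (rule nn_integral_Leb_Suc) fact
  also have "\<dots> = ennreal \<bar>a d d\<bar> * (\<integral>\<^sup>+t. (\<integral>\<^sup>+x. F (x(d := b d + a d d * t)) \<partial>Leb d) \<partial>lborel)"
    using meas1 Suc.prems(2)[of d] by (subst nn_integral_real_affine[where c="a d d" and t="b d"]) auto
  also have "(\<integral>\<^sup>+t. (\<integral>\<^sup>+x. F (x(d := b d + a d d * t)) \<partial>Leb d) \<partial>lborel) =
    (\<integral>\<^sup>+t. ennreal (\<Prod>i<d. \<bar>a i i\<bar>) * (\<integral>\<^sup>+y. F (affine_map (Suc d) b a (y(d := t))) \<partial>Leb d) \<partial>lborel)"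
  proof (intro nn_integral_cong)
    fix t :: real
    show "(\<integral>\<^sup>+x. F (x(d := b d + a d d * t)) \<partial>Leb d) =
       ennreal (\<Prod>i<d. \<bar>a i i\<bar>) * (\<integral>\<^sup>+y. F (affine_map (Suc d) b a (y(d := t))) \<partial>Leb d)"
      unfolding aff using Suc.prems(2) by (intro Suc.IH slice) auto
  qed
  also have "\<dots> = ennreal (\<Prod>i<d. \<bar>a i i\<bar>) * (\<integral>\<^sup>+t. (\<integral>\<^sup>+y. F (affine_map (Suc d) b a (y(d := t))) \<partial>Leb d) \<partial>lborel)"
  proof (intro nn_integral_cmult)
    interpret sigma_finite_measure "Leb d" by (rule Leb_sigma_finite)
    have "(\<lambda>(t::real, x). (x, t)) \<in> measurable (lborel \<Otimes>\<^sub>M Leb d) (Leb d \<Otimes>\<^sub>M lborel)"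
      by measurable
    from measurable_compose[OF measurable_compose[OF measurable_compose[OF this measurable_fun_upd_PiM] measurable_affine_map] Suc.prems(1)]
    have "(\<lambda>(t, x). F (affine_map (Suc d) b a (x(d := t)))) \<in> borel_measurable (lborel \<Otimes>\<^sub>M Leb d)"
      by (simp add: case_prod_beta)
    then show "(\<lambda>t. \<integral>\<^sup>+y. F (affine_map (Suc d) b a (y(d := t))) \<partial>Leb d) \<in> borel_measurable lborel"
      by measurable
  qed
  also have "(\<integral>\<^sup>+t. (\<integral>\<^sup>+y. F (affine_map (Suc d) b a (y(d := t))) \<partial>Leb d) \<partial>lborel) =
     (\<integral>\<^sup>+y. F (affine_map (Suc d) b a y) \<partial>Leb (Suc d))"
    by (rule nn_integral_Leb_Suc[symmetric]) measurable
  finally show ?case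
    by (simp add: ennreal_mult prod_nonneg mult_ac)
qed

text \<open>Writing Lebesgue measure itself as a scaled image measure carries the rule over from
  nonnegative integrals to Bochner integrals without splitting into positive and negative
  parts.\<close>

lemma Leb_affine_density:
  assumes "\<And>i. i < d \<Longrightarrow> a i i \<noteq> 0"
  shows "Leb d = density (distr (Leb d) (Leb d) (affine_map d b a)) (\<lambda>_. ennreal (\<Prod>i<d. \<bar>a i i\<bar>))"
proof (rule measure_eqI)
  fix X assume X: "X \<in> sets (Leb d)"
  have "emeasure (Leb d) X = (\<integral>\<^sup>+x. indicator X x \<partial>Leb d)"
    using X by simp
  also have "\<dots> = ennreal (\<Prod>i<d. \<bar>a i i\<bar>) * (\<integral>\<^sup>+y. indicator X (affine_map d b a y) \<partial>Leb d)"
    using X by (intro nn_integral_Leb_affine assms) auto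
  also have "\<dots> = emeasure (density (distr (Leb d) (Leb d) (affine_map d b a)) (\<lambda>_. ennreal (\<Prod>i<d. \<bar>a i i\<bar>))) X"
  proof -
    have "(\<integral>\<^sup>+y. indicator X (affine_map d b a y) \<partial>Leb d) =
        (\<integral>\<^sup>+y. indicator X y \<partial>distr (Leb d) (Leb d) (affine_map d b a))"
      using X by (subst nn_integral_distr) auto
    then show ?thesis using X by (simp add: emeasure_density nn_integral_cmult)
  qed
  finally show "emeasure (Leb d) X = \<dots>" .
qed simp

lemma integral_Leb_affine:
  fixes F :: "(nat \<Rightarrow> real) \<Rightarrow> real"
  assumes [measurable]: "F \<in> borel_measurable (Leb d)" and nz: "\<And>i. i < d \<Longrightarrow> a i i \<noteq> 0"
  shows "(\<integral>x. F x \<partial>Leb d) = (\<Prod>i<d. \<bar>a i i\<bar>) * (\<integral>y. F (affine_map d b a y) \<partial>Leb d)"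
proof -
  have "(\<integral>x. F x \<partial>Leb d) = (\<integral>x. F x \<partial>density (distr (Leb d) (Leb d) (affine_map d b a)) (\<lambda>_. ennreal (\<Prod>i<d. \<bar>a i i\<bar>)))"
    using Leb_affine_density[of d a b, OF nz] by simp
  also have "\<dots> = (\<Prod>i<d. \<bar>a i i\<bar>) * (\<integral>y. F (affine_map d b a y) \<partial>Leb d)"
    by (subst integral_density) (auto simp: integral_distr prod_nonneg)
  finally show ?thesis .
qed

definition diag :: "real \<Rightarrow> nat \<Rightarrow> nat \<Rightarrow> real" where
  "diag c i j = (if i = j then c else 0)"

lemma affine_map_diag: "affine_map d b (diag c) y = (\<lambda>i\<in>{..<d}. b i + c * y i)"
  by (auto simp: affine_map_def fun_eq_iff diag_def if_distrib[of "\<lambda>z. z * _"] cong: if_cong)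

lemma nn_integral_Leb_shift:
  assumes "F \<in> borel_measurable (Leb d)"
  shows "(\<integral>\<^sup>+x. F (\<lambda>i\<in>{..<d}. b i + x i) \<partial>Leb d) = (\<integral>\<^sup>+x. F x \<partial>Leb d)"
  using nn_integral_Leb_affine[OF assms, of "diag 1" b]
  by (simp add: affine_map_diag) (simp add: diag_def)

lemma nn_integral_Leb_neg:
  assumes "F \<in> borel_measurable (Leb d)"
  shows "(\<integral>\<^sup>+x. F (\<lambda>i\<in>{..<d}. - x i) \<partial>Leb d) = (\<integral>\<^sup>+x. F x \<partial>Leb d)"
  using nn_integral_Leb_affine[OF assms, of "diag (-1)" "\<lambda>_. 0"]
  by (simp add: affine_map_diag) (simp add: diag_def)

lemma integral_Leb_neg:
  fixes F :: "(nat \<Rightarrow> real) \<Rightarrow> real"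
  assumes "F \<in> borel_measurable (Leb d)"
  shows "(\<integral>x. F (\<lambda>i\<in>{..<d}. - x i) \<partial>Leb d) = (\<integral>x. F x \<partial>Leb d)"
  using integral_Leb_affine[OF assms, of "diag (-1)" "\<lambda>_. 0"]
  by (simp add: affine_map_diag) (simp add: diag_def)

section \<open>The standard Gaussian measure\<close>

lemma measurable_coord [measurable]: "i < d \<Longrightarrow> (\<lambda>y. y i) \<in> borel_measurable (Leb d)"
  using measurable_component_singleton[of i "{..<d}" "\<lambda>_. lborel :: real measure"] by (simp add: measurable_lborel1)

lemma measurable_coord_fst [measurable]: "i < d \<Longrightarrow> (\<lambda>p. fst p i) \<in> borel_measurable (Leb d \<Otimes>\<^sub>M N)"
  by (rule measurable_compose[OF measurable_fst measurable_coord])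

lemma measurable_coord_snd [measurable]: "i < d \<Longrightarrow> (\<lambda>p. snd p i) \<in> borel_measurable (N \<Otimes>\<^sub>M Leb d)"
  by (rule measurable_compose[OF measurable_snd measurable_coord])

lemma measurable_to_Leb:
  "(\<And>i. i < d \<Longrightarrow> (\<lambda>w. f w i) \<in> borel_measurable N) \<Longrightarrow> (\<lambda>w. \<lambda>i\<in>{..<d}. f w i) \<in> measurable N (Leb d)"
  by (intro measurable_restrict) (simp add: measurable_lborel2)

section \<open>Shears and rotations of a pair of points\<close>

abbreviation lin2 :: "nat \<Rightarrow> real \<Rightarrow> real \<Rightarrow> (nat \<Rightarrow> real) \<Rightarrow> (nat \<Rightarrow> real) \<Rightarrow> nat \<Rightarrow> real" where
  "lin2 d a b x y \<equiv> (\<lambda>i\<in>{..<d}. a * x i + b * y i)"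

lemma nn_integral_shear_snd:
  assumes "(\<lambda>p. F (fst p) (snd p)) \<in> borel_measurable (Leb d \<Otimes>\<^sub>M Leb d)"
  shows "(\<integral>\<^sup>+x. (\<integral>\<^sup>+y. F x (lin2 d b 1 x y) \<partial>Leb d) \<partial>Leb d) = (\<integral>\<^sup>+x. (\<integral>\<^sup>+y. F x y \<partial>Leb d) \<partial>Leb d)"
proof (rule nn_integral_cong)
  fix x assume x: "x \<in> space (Leb d)"
  have "(\<lambda>y. F x y) \<in> borel_measurable (Leb d)"
    using measurable_compose[OF measurable_Pair1'[OF x] assms] by simp
  from nn_integral_Leb_shift[OF this, of "\<lambda>i. b * x i"]
  show "(\<integral>\<^sup>+y. F x (lin2 d b 1 x y) \<partial>Leb d) = (\<integral>\<^sup>+y. F x y \<partial>Leb d)" by simp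
qed

lemma nn_integral_Leb_swap:
  assumes "(\<lambda>p. F (fst p) (snd p)) \<in> borel_measurable (Leb d \<Otimes>\<^sub>M Leb d)"
  shows "(\<integral>\<^sup>+x. (\<integral>\<^sup>+y. F x y \<partial>Leb d) \<partial>Leb d) = (\<integral>\<^sup>+y. (\<integral>\<^sup>+x. F x y \<partial>Leb d) \<partial>Leb d)"
proof -
  interpret pair_sigma_finite "Leb d" "Leb d"
    unfolding pair_sigma_finite_def by (auto intro: Leb_sigma_finite)
  show ?thesis using Fubini'[of F] assms by (simp add: case_prod_beta')
qed

lemma nn_integral_shear_fst:
  assumes [measurable]: "(\<lambda>p. F (fst p) (snd p)) \<in> borel_measurable (Leb d \<Otimes>\<^sub>M Leb d)"
  shows "(\<integral>\<^sup>+x. (\<integral>\<^sup>+y. F (lin2 d 1 a x y) y \<partial>Leb d) \<partial>Leb d) = (\<integral>\<^sup>+x. (\<integral>\<^sup>+y. F x y \<partial>Leb d) \<partial>Leb d)"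
proof -
  have m: "(\<lambda>p. (lin2 d 1 a (fst p) (snd p), snd p)) \<in> measurable (Leb d \<Otimes>\<^sub>M Leb d) (Leb d \<Otimes>\<^sub>M Leb d)"
    by (intro measurable_Pair measurable_to_Leb) auto
  have "(\<integral>\<^sup>+x. (\<integral>\<^sup>+y. F (lin2 d 1 a x y) y \<partial>Leb d) \<partial>Leb d) = (\<integral>\<^sup>+y. (\<integral>\<^sup>+x. F (lin2 d 1 a x y) y \<partial>Leb d) \<partial>Leb d)"
    using measurable_compose[OF m assms] by (intro nn_integral_Leb_swap) simp
  also have "\<dots> = (\<integral>\<^sup>+y. (\<integral>\<^sup>+x. F (lin2 d a 1 y x) y \<partial>Leb d) \<partial>Leb d)"
    by (simp add: add.commute)
  also have "\<dots> = (\<integral>\<^sup>+y. (\<integral>\<^sup>+x. F x y \<partial>Leb d) \<partial>Leb d)"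
    by (intro nn_integral_shear_snd[where F="\<lambda>y x. F x y"]) (use measurable_compose[OF measurable_pair_swap' assms] in \<open>simp add: case_prod_beta\<close>)
  also have "\<dots> = (\<integral>\<^sup>+x. (\<integral>\<^sup>+y. F x y \<partial>Leb d) \<partial>Leb d)"
    by (intro nn_integral_Leb_swap[symmetric] assms)
  finally show ?thesis .
qed

text \<open>A rotation of the plane is a product of three shears, with \<open>a = tan (\<theta>/2)\<close>.\<close>
lemma nn_integral_rotation:
  assumes [measurable]: "(\<lambda>p. F (fst p) (snd p)) \<in> borel_measurable (Leb d \<Otimes>\<^sub>M Leb d)"
    and a: "1 - a * s = c" "a * (1 + c) = s"
  shows "(\<integral>\<^sup>+x. (\<integral>\<^sup>+y. F (lin2 d c s x y) (lin2 d (-s) c x y) \<partial>Leb d) \<partial>Leb d) =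
    (\<integral>\<^sup>+x. (\<integral>\<^sup>+y. F x y \<partial>Leb d) \<partial>Leb d)"
proof -
  define F1 where "F1 x y = F (lin2 d 1 a x y) y" for x y
  define F2 where "F2 x y = F1 x (lin2 d (-s) 1 x y)" for x y
  have m1: "(\<lambda>p. (lin2 d 1 a (fst p) (snd p), snd p)) \<in> measurable (Leb d \<Otimes>\<^sub>M Leb d) (Leb d \<Otimes>\<^sub>M Leb d)"
    by (intro measurable_Pair measurable_to_Leb) auto
  have m2: "(\<lambda>p. (fst p, lin2 d (-s) 1 (fst p) (snd p))) \<in> measurable (Leb d \<Otimes>\<^sub>M Leb d) (Leb d \<Otimes>\<^sub>M Leb d)"
    by (intro measurable_Pair measurable_to_Leb) auto
  have F1: "(\<lambda>p. F1 (fst p) (snd p)) \<in> borel_measurable (Leb d \<Otimes>\<^sub>M Leb d)"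
    unfolding F1_def using measurable_compose[OF m1 assms(1)] by simp
  have F2: "(\<lambda>p. F2 (fst p) (snd p)) \<in> borel_measurable (Leb d \<Otimes>\<^sub>M Leb d)"
    unfolding F2_def using measurable_compose[OF m2 F1] by simp
  \<comment> \<open>The entries of the product of the three shears: 1 - a s = c on the diagonal and
    2 a - a^2 s = a (1 + c) = s in the upper corner.\<close>
  have e1: "u - a * (s * u) = c * u" for u using arg_cong[OF a(1), of "\<lambda>z. z * u"] by (simp add: algebra_simps)
  have e2: "v * a + (v * a - a * (a * (s * v))) = s * v" for v
  proof -
    have "v * a + (v * a - a * (a * (s * v))) = a * (1 + (1 - a * s)) * v" by (simp add: algebra_simps)
    then show ?thesis using a by simp
  qed
  have "F2 (lin2 d 1 a x y) y = F (lin2 d c s x y) (lin2 d (-s) c x y)" for x y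
  proof -
    have eq1: "lin2 d 1 a (lin2 d 1 a x y) (lin2 d (-s) 1 (lin2 d 1 a x y) y) = lin2 d c s x y"
    proof (rule restrict_ext)
      fix i assume "i \<in> {..<d}"
      then show "1 * lin2 d 1 a x y i + a * lin2 d (-s) 1 (lin2 d 1 a x y) y i = c * x i + s * y i"
        using e1[of "x i"] e2[of "y i"] by (simp add: algebra_simps)
    qed
    have eq2: "lin2 d (-s) 1 (lin2 d 1 a x y) y = lin2 d (-s) c x y"
    proof (rule restrict_ext)
      fix i assume "i \<in> {..<d}"
      then show "(-s) * lin2 d 1 a x y i + 1 * y i = (-s) * x i + c * y i"
        using e1[of "y i"] by (simp add: algebra_simps)
    qed
    show ?thesis by (simp only: F2_def F1_def eq1) (simp only: eq2)
  qed
  then have "(\<integral>\<^sup>+x. (\<integral>\<^sup>+y. F (lin2 d c s x y) (lin2 d (-s) c x y) \<partial>Leb d) \<partial>Leb d) =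
      (\<integral>\<^sup>+x. (\<integral>\<^sup>+y. F2 (lin2 d 1 a x y) y \<partial>Leb d) \<partial>Leb d)" by (simp only:)
  also have "\<dots> = (\<integral>\<^sup>+x. (\<integral>\<^sup>+y. F1 x (lin2 d (-s) 1 x y) \<partial>Leb d) \<partial>Leb d)"
    unfolding nn_integral_shear_fst[OF F2, of a] by (simp only: F2_def[abs_def])
  also have "\<dots> = (\<integral>\<^sup>+x. (\<integral>\<^sup>+y. F (lin2 d 1 a x y) y \<partial>Leb d) \<partial>Leb d)"
    unfolding nn_integral_shear_snd[OF F1, of "-s"] by (simp only: F1_def[abs_def])
  also have "\<dots> = (\<integral>\<^sup>+x. (\<integral>\<^sup>+y. F x y \<partial>Leb d) \<partial>Leb d)"
    by (rule nn_integral_shear_fst[OF assms(1)])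
  finally show ?thesis .
qed

definition nrm :: "nat \<Rightarrow> (nat \<Rightarrow> real) \<Rightarrow> real" where "nrm d y = L2_set y {..<d}"

definition dotp :: "nat \<Rightarrow> (nat \<Rightarrow> real) \<Rightarrow> (nat \<Rightarrow> real) \<Rightarrow> real" where "dotp d x y = (\<Sum>i<d. x i * y i)"

lemma nrm_sq: "(nrm d y)\<^sup>2 = (\<Sum>i<d. (y i)\<^sup>2)"
  by (simp add: nrm_def L2_set_def sum_nonneg)

lemma nrm_nonneg [simp]: "nrm d y \<ge> 0" by (simp add: nrm_def)

lemma dotp_self: "dotp d y y = (nrm d y)\<^sup>2"
  unfolding nrm_sq by (simp add: dotp_def power2_eq_square)

lemma dotp_le: "\<bar>dotp d x y\<bar> \<le> nrm d x * nrm d y"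
proof -
  have "\<bar>dotp d x y\<bar> \<le> (\<Sum>i<d. \<bar>x i\<bar> * \<bar>y i\<bar>)"
    unfolding dotp_def by (rule order_trans[OF sum_abs]) (simp add: abs_mult)
  also have "\<dots> \<le> nrm d x * nrm d y" unfolding nrm_def by (rule L2_set_mult_ineq)
  finally show ?thesis .
qed

lemma measurable_nrm [measurable]: "nrm d \<in> borel_measurable (Leb d)"
  unfolding nrm_def L2_set_def by measurable

lemma measurable_dotp [measurable]: "dotp d u \<in> borel_measurable (Leb d)"
  unfolding dotp_def by measurable

definition gd :: "nat \<Rightarrow> (nat \<Rightarrow> real) \<Rightarrow> real" where "gd d y = (\<Prod>i<d. std_normal_density (y i))"

definition gam :: "nat \<Rightarrow> (nat \<Rightarrow> real) measure" where "gam d = density (Leb d) (\<lambda>y. ennreal (gd d y))"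

lemma gd_pos: "gd d y > 0"
  unfolding gd_def by (intro prod_pos normal_density_pos) simp

lemma gd_nonneg [simp]: "gd d y \<ge> 0" using gd_pos[of d y] by simp

lemma measurable_gd [measurable]: "gd d \<in> borel_measurable (Leb d)"
  unfolding gd_def by measurable

text \<open>The density is a function of the norm alone; this makes a pair of independent Gaussian
  points rotation invariant.\<close>

lemma gd_eq: "gd d y = exp (- (nrm d y)\<^sup>2 / 2) / sqrt (2 * pi) ^ d"
  by (simp add: gd_def std_normal_density_def prod_dividef nrm_sq exp_sum[symmetric] sum_negf sum_divide_distrib power_one_over)

lemma sets_gam [measurable_cong, simp]: "sets (gam d) = sets (Leb d)" by (simp add: gam_def)
lemma space_gam [simp]: "space (gam d) = space (Leb d)" by (simp add: gam_def)

lemma nn_integral_gam: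
  assumes [measurable]: "F \<in> borel_measurable (Leb d)"
  shows "(\<integral>\<^sup>+y. F y \<partial>gam d) = (\<integral>\<^sup>+y. ennreal (gd d y) * F y \<partial>Leb d)"
  unfolding gam_def by (rule nn_integral_density) auto

lemma integral_gam:
  fixes F :: "(nat \<Rightarrow> real) \<Rightarrow> real"
  assumes [measurable]: "F \<in> borel_measurable (Leb d)"
  shows "(\<integral>y. F y \<partial>gam d) = (\<integral>y. gd d y * F y \<partial>Leb d)"
  unfolding gam_def by (subst integral_density) auto

lemma integrable_gam:
  fixes F :: "(nat \<Rightarrow> real) \<Rightarrow> real"
  assumes [measurable]: "F \<in> borel_measurable (Leb d)"
  shows "integrable (gam d) F \<longleftrightarrow> integrable (Leb d) (\<lambda>y. gd d y * F y)"
  unfolding gam_def by (subst integrable_density) auto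

lemma nn_integral_gam_prod:
  assumes [measurable]: "\<And>i. i < d \<Longrightarrow> f i \<in> borel_measurable borel" and "\<And>i t. i < d \<Longrightarrow> 0 \<le> f i t"
  shows "(\<integral>\<^sup>+y. ennreal (\<Prod>i<d. f i (y i)) \<partial>gam d) = (\<Prod>i<d. \<integral>\<^sup>+t. ennreal (std_normal_density t * f i t) \<partial>lborel)"
proof -
  have "ennreal (gd d y) * ennreal (\<Prod>i<d. f i (y i)) = (\<Prod>i<d. ennreal (std_normal_density (y i) * f i (y i)))" for y
  proof -
    have "ennreal (gd d y) * ennreal (\<Prod>i<d. f i (y i)) = ennreal (\<Prod>i<d. std_normal_density (y i) * f i (y i))"
      using assms(2) by (subst ennreal_mult[symmetric]) (auto simp: gd_def prod.distrib intro!: prod_nonneg)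
    also have "\<dots> = (\<Prod>i<d. ennreal (std_normal_density (y i) * f i (y i)))"
      using assms(2) by (intro prod_ennreal[symmetric]) simp
    finally show ?thesis .
  qed
  then have "(\<integral>\<^sup>+y. ennreal (\<Prod>i<d. f i (y i)) \<partial>gam d) = (\<integral>\<^sup>+y. (\<Prod>i<d. ennreal (std_normal_density (y i) * f i (y i))) \<partial>Leb d)"
    by (subst nn_integral_gam) auto
  also have "\<dots> = (\<Prod>i<d. \<integral>\<^sup>+t. ennreal (std_normal_density t * f i t) \<partial>lborel)"
    by (intro Leb.product_nn_integral_prod) auto
  finally show ?thesis .
qed

text \<open>Completing the square leaves exp (b^2 / 2) times the normal density with mean b.\<close>

lemma nn_integral_std_exp: "(\<integral>\<^sup>+t. ennreal (std_normal_density t * exp (b * t)) \<partial>lborel) = ennreal (exp (b\<^sup>2 / 2))"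
proof -
  have "std_normal_density t * exp (b * t) = exp (b\<^sup>2 / 2) * normal_density b 1 t" for t
    by (simp add: std_normal_density_def normal_density_def exp_add[symmetric] exp_diff[symmetric] mult_exp_exp field_simps power2_eq_square)
  then have "(\<integral>\<^sup>+t. ennreal (std_normal_density t * exp (b * t)) \<partial>lborel) = ennreal (exp (b\<^sup>2 / 2)) * (\<integral>\<^sup>+t. ennreal (normal_density b 1 t) \<partial>lborel)"
    by (simp add: ennreal_mult nn_integral_cmult)
  also have "(\<integral>\<^sup>+t. ennreal (normal_density b 1 t) \<partial>lborel) = 1"
    using prob_space.emeasure_space_1[OF prob_space_normal_density[of 1 b]] by (simp add: emeasure_density)
  finally show ?thesis by simp
qed

lemma prob_space_gam: "prob_space (gam d)"
proof
  have "emeasure (gam d) (space (gam d)) = (\<integral>\<^sup>+y. ennreal (\<Prod>i<d. (\<lambda>_ _. 1) i (y i)) \<partial>gam d)"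
    by simp
  also have "\<dots> = (\<Prod>i<d. \<integral>\<^sup>+t. ennreal (std_normal_density t * 1) \<partial>lborel)"
    by (rule nn_integral_gam_prod) auto
  also have "\<dots> = 1" using nn_integral_std_exp[of 0] by simp
  finally show "emeasure (gam d) (space (gam d)) = 1" .
qed

lemma nn_integral_gam_exp: "(\<integral>\<^sup>+y. ennreal (exp (dotp d b y)) \<partial>gam d) = ennreal (exp ((nrm d b)\<^sup>2 / 2))"
proof -
  have "(\<integral>\<^sup>+y. ennreal (exp (dotp d b y)) \<partial>gam d) = (\<integral>\<^sup>+y. ennreal (\<Prod>i<d. exp (b i * y i)) \<partial>gam d)"
    by (simp add: dotp_def exp_sum)
  also have "\<dots> = (\<Prod>i<d. ennreal (exp ((b i)\<^sup>2 / 2)))"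
    by (subst nn_integral_gam_prod) (auto simp: nn_integral_std_exp)
  also have "\<dots> = ennreal (exp ((nrm d b)\<^sup>2 / 2))"
    by (simp add: prod_ennreal nrm_sq sum_divide_distrib exp_sum)
  finally show ?thesis .
qed

text \<open>Per coordinate, the integrand is sqrt 2 times the centred normal density of variance 2.
  This is the exponential moment behind the Chernoff bound in \<open>gauss_tail\<close>.\<close>

lemma nn_integral_gam_exp_sq: "(\<integral>\<^sup>+y. ennreal (exp ((nrm d y)\<^sup>2 / 4)) \<partial>gam d) = ennreal (sqrt 2 ^ d)"
proof -
  have eq: "std_normal_density t * exp (t\<^sup>2 / 4) = sqrt 2 * normal_density 0 (sqrt 2) t" for t
    by (simp add: std_normal_density_def normal_density_def mult_exp_exp real_sqrt_mult field_simps)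
  have one: "(\<integral>\<^sup>+t. ennreal (std_normal_density t * exp (t\<^sup>2 / 4)) \<partial>lborel) = ennreal (sqrt 2)"
  proof -
    have "(\<integral>\<^sup>+t. ennreal (std_normal_density t * exp (t\<^sup>2 / 4)) \<partial>lborel) = ennreal (sqrt 2) * (\<integral>\<^sup>+t. ennreal (normal_density 0 (sqrt 2) t) \<partial>lborel)"
      unfolding eq by (simp add: ennreal_mult nn_integral_cmult)
    also have "(\<integral>\<^sup>+t. ennreal (normal_density 0 (sqrt 2) t) \<partial>lborel) = 1"
      using prob_space.emeasure_space_1[OF prob_space_normal_density[of "sqrt 2" 0]] by (simp add: emeasure_density)
    finally show ?thesis by simp
  qed
  have "(\<integral>\<^sup>+y. ennreal (exp ((nrm d y)\<^sup>2 / 4)) \<partial>gam d) = (\<integral>\<^sup>+y. ennreal (\<Prod>i<d. exp ((y i)\<^sup>2 / 4)) \<partial>gam d)"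
    by (simp add: nrm_sq exp_sum sum_divide_distrib)
  also have "\<dots> = (\<Prod>i<d. ennreal (sqrt 2))"
    by (subst nn_integral_gam_prod) (auto simp: one)
  finally show ?thesis by (simp add: ennreal_power)
qed

section \<open>Dimension-free Gaussian moments of linear forms and of the norm\<close>

lemma power_le_fact_exp:
  fixes x :: real
  shows "\<bar>x\<bar> ^ n \<le> fact n * (exp x + exp (- x))"
proof -
  have "\<bar>x\<bar> ^ n / fact n \<le> exp \<bar>x\<bar>"
  proof -
    have "(\<lambda>m. \<bar>x\<bar> ^ m / fact m) sums exp \<bar>x\<bar>"
      using exp_converges[of "\<bar>x\<bar>"] by (simp add: field_simps)
    from sum_le_suminf[OF sums_summable[OF this], of "{n}"] sums_unique[OF this] show ?thesis by simp
  qed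
  moreover have "exp \<bar>x\<bar> \<le> exp x + exp (- x)" by (cases "x \<ge> 0") auto
  ultimately have "\<bar>x\<bar> ^ n / fact n \<le> exp x + exp (- x)" by linarith
  then show ?thesis by (simp add: field_simps)
qed

text \<open>A bound for the n-th absolute moment of a standard normal variable rather than its
  value: n! from one term of the exponential series, twice exp (1/2) from the generating functions
  at 1 and -1.\<close>

definition mom :: "nat \<Rightarrow> real" where "mom n = 2 * fact n * exp (1/2)"

lemma mom_pos: "mom n > 0" by (simp add: mom_def)

lemma nn_integral_gam_dotp:
  "(\<integral>\<^sup>+y. ennreal (\<bar>dotp d b y\<bar> ^ n) \<partial>gam d) \<le> ennreal (mom n * nrm d b ^ n)"
proof (cases "nrm d b = 0")
  case True
  then have "dotp d b y = 0" for y using dotp_le[of d b y] by simp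
  \<comment> \<open>For n = 0 the integrand is 1 even though b vanishes, so \<open>mom 0\<close> has
    to be at least 1.\<close>
  have "1 \<le> 2 * exp (1/2 :: real)" using exp_ge_add_one_self[of "1/2"] by linarith
  show ?thesis using True \<open>\<And>y. dotp d b y = 0\<close> prob_space.emeasure_space_1[OF prob_space_gam[of d]]
    by (cases "n = 0") (auto simp: mom_def zero_power \<open>1 \<le> 2 * exp (1/2 :: real)\<close>)
next
  case False
  define \<beta> where "\<beta> = nrm d b"
  have \<beta>: "\<beta> > 0" using False nrm_nonneg[of d b] by (simp add: \<beta>_def less_le)
  have dl: "dotp d (\<lambda>i. c * b i) y = c * dotp d b y" for c y by (simp add: dotp_def sum_distrib_left mult_ac)
  have nl: "(nrm d (\<lambda>i. c * b i))\<^sup>2 = c\<^sup>2 * \<beta>\<^sup>2" for c by (simp add: nrm_sq \<beta>_def power_mult_distrib sum_distrib_left)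
  have n1: "(nrm d (\<lambda>i. b i / \<beta>))\<^sup>2 = 1" using nl[of "1/\<beta>"] \<beta> by (simp add: power_divide)
  have n2: "(nrm d (\<lambda>i. - (b i / \<beta>)))\<^sup>2 = 1" using nl[of "-1/\<beta>"] \<beta> by (simp add: power_divide)
  \<comment> \<open>Division by the norm of b comes first, so that both generating functions are
    evaluated at unit vectors.\<close>
  have pw: "\<bar>dotp d b y\<bar> ^ n \<le> \<beta> ^ n * fact n * (exp (dotp d (\<lambda>i. (1/\<beta>) * b i) y) + exp (dotp d (\<lambda>i. (-1/\<beta>) * b i) y))" for y
    using mult_left_mono[OF power_le_fact_exp[of "dotp d b y / \<beta>" n], of "\<beta> ^ n"] \<beta>
    unfolding dl by (simp add: power_divide field_simps)
  have "(\<integral>\<^sup>+y. ennreal (\<bar>dotp d b y\<bar> ^ n) \<partial>gam d) \<le>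
     (\<integral>\<^sup>+y. ennreal (\<beta> ^ n * fact n) * (ennreal (exp (dotp d (\<lambda>i. (1/\<beta>) * b i) y)) + ennreal (exp (dotp d (\<lambda>i. (-1/\<beta>) * b i) y))) \<partial>gam d)"
    using \<beta> pw by (intro nn_integral_mono) (simp add: ennreal_mult[symmetric] ennreal_plus[symmetric] ennreal_leI del: ennreal_plus)
  also have "\<dots> = ennreal (\<beta> ^ n * fact n) * (ennreal (exp (1/2)) + ennreal (exp (1/2)))"
    using \<beta> by (subst nn_integral_cmult) (auto simp: nn_integral_add nn_integral_gam_exp n1 n2)
  also have "\<dots> = ennreal (mom n * nrm d b ^ n)"
    using \<beta> by (simp add: mom_def ennreal_mult[symmetric] ennreal_plus[symmetric] \<beta>_def mult_ac del: ennreal_plus)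
  finally show ?thesis .
qed

lemma convex_power_nonneg: "convex_on {0::real..} (\<lambda>x. x ^ n)"
  using convex_power_odd[of n] convex_on_subset[OF convex_power_even[of n], of "{0..}"] by (cases "even n") auto

text \<open>The quotient is the average of the squared coordinates, so by Jensen its k-th power is
  at most the average of their 2k-th powers. Each of these has the same one-dimensional moment,
  hence no dependence on d.\<close>

lemma nn_integral_gam_nrm:
  assumes "d \<ge> 1"
  shows "(\<integral>\<^sup>+y. ennreal (((nrm d y)\<^sup>2 / d) ^ k) \<partial>gam d) \<le> ennreal (mom (2 * k))"
proof -
  have d: "real d > 0" using assms by simp
  have pw: "((nrm d y)\<^sup>2 / d) ^ k \<le> (\<Sum>i<d. (1 / d) * \<bar>dotp d (\<lambda>j. if j = i then 1 else 0) y\<bar> ^ (2 * k))" for y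
  proof -
    have "(\<lambda>x::real. x ^ k) (\<Sum>i<d. (1 / real d) *\<^sub>R (y i)\<^sup>2) \<le> (\<Sum>i<d. (1 / real d) * ((y i)\<^sup>2) ^ k)"
      using d assms by (intro convex_on_sum[of _ "{0..}"] convex_power_nonneg) (auto simp: lessThan_empty_iff)
    moreover have "dotp d (\<lambda>j. if j = i then 1 else 0) y = y i" if "i < d" for i
      using that by (simp add: dotp_def if_distrib[of "\<lambda>z. z * _"] cong: if_cong)
    ultimately show ?thesis
      by (simp add: nrm_sq sum_divide_distrib power_mult)
  qed
  have nb: "nrm d (\<lambda>j. if j = i then 1 else 0) = 1" if "i < d" for i
  proof -
    have "(nrm d (\<lambda>j. if j = i then 1 else 0))\<^sup>2 = 1" using that
      by (simp add: nrm_sq if_distrib[of "\<lambda>z. z\<^sup>2"] cong: if_cong)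
    then show ?thesis using nrm_nonneg by (metis abs_of_nonneg real_sqrt_abs real_sqrt_one)
  qed
  have "(\<integral>\<^sup>+y. ennreal (((nrm d y)\<^sup>2 / d) ^ k) \<partial>gam d) \<le>
     (\<integral>\<^sup>+y. (\<Sum>i<d. ennreal (1/d) * ennreal (\<bar>dotp d (\<lambda>j. if j = i then 1 else 0) y\<bar> ^ (2 * k))) \<partial>gam d)"
    using pw by (intro nn_integral_mono) (simp add: ennreal_mult[symmetric] sum_ennreal ennreal_leI)
  also have "\<dots> = (\<Sum>i<d. ennreal (1/d) * (\<integral>\<^sup>+y. ennreal (\<bar>dotp d (\<lambda>j. if j = i then 1 else 0) y\<bar> ^ (2 * k)) \<partial>gam d))"
    by (subst nn_integral_sum) (auto simp: nn_integral_cmult)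
  also have "\<dots> \<le> (\<Sum>i<d. ennreal (1/d) * ennreal (mom (2 * k)))"
  proof (intro sum_mono mult_left_mono)
    fix i assume "i \<in> {..<d}"
    then show "(\<integral>\<^sup>+y. ennreal (\<bar>dotp d (\<lambda>j. if j = i then 1 else 0) y\<bar> ^ (2 * k)) \<partial>gam d) \<le> ennreal (mom (2 * k))"
      using nn_integral_gam_dotp[of d "\<lambda>j. if j = i then 1 else 0" "2 * k"] nb[of i] by simp
  qed simp
  also have "\<dots> = ennreal (mom (2*k))"
    using d mom_pos[of "2 * k"] by (simp add: ennreal_mult[symmetric] ennreal_of_nat_eq_real_of_nat)
  finally show ?thesis .
qed

section \<open>The Maurey--Pisier inequality for cubic forms\<close>

definition tri :: "nat \<Rightarrow> (nat \<Rightarrow> nat \<Rightarrow> nat \<Rightarrow> real) \<Rightarrow> (nat \<Rightarrow> real) \<Rightarrow> (nat \<Rightarrow> real) \<Rightarrow> (nat \<Rightarrow> real) \<Rightarrow> real" where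
  "tri d t x y z = (\<Sum>i<d. \<Sum>j<d. \<Sum>k<d. t i j k * x i * y j * z k)"

definition cub :: "nat \<Rightarrow> (nat \<Rightarrow> nat \<Rightarrow> nat \<Rightarrow> real) \<Rightarrow> (nat \<Rightarrow> real) \<Rightarrow> real" where
  "cub d t x = tri d t x x x"

text \<open>The derivative of \<open>cub d t\<close> at x in direction y. The coefficients t are not
  assumed symmetric, hence one term for each slot.\<close>

definition dcub :: "nat \<Rightarrow> (nat \<Rightarrow> nat \<Rightarrow> nat \<Rightarrow> real) \<Rightarrow> (nat \<Rightarrow> real) \<Rightarrow> (nat \<Rightarrow> real) \<Rightarrow> real" where
  "dcub d t x y = tri d t y x x + tri d t x y x + tri d t x x y"

definition grad_cub :: "nat \<Rightarrow> (nat \<Rightarrow> nat \<Rightarrow> nat \<Rightarrow> real) \<Rightarrow> (nat \<Rightarrow> real) \<Rightarrow> nat \<Rightarrow> real" where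
  "grad_cub d t x i = (\<Sum>j<d. \<Sum>k<d. (t i j k + t j i k + t j k i) * x j * x k)"

lemma dcub_eq_dotp: "dcub d t x y = dotp d (grad_cub d t x) y"
proof -
  have 1: "tri d t y x x = (\<Sum>i<d. \<Sum>j<d. \<Sum>k<d. t i j k * x j * x k * y i)"
    unfolding tri_def by (simp add: mult_ac)
  have 2: "tri d t x y x = (\<Sum>i<d. \<Sum>j<d. \<Sum>k<d. t j i k * x j * x k * y i)"
    unfolding tri_def by (subst sum.swap) (simp add: mult_ac)
  have "tri d t x x y = (\<Sum>j<d. \<Sum>i<d. \<Sum>k<d. t j k i * x j * x k * y i)"
    unfolding tri_def by (rule sum.cong[OF refl], subst sum.swap) (simp add: mult_ac)
  then have 3: "tri d t x x y = (\<Sum>i<d. \<Sum>j<d. \<Sum>k<d. t j k i * x j * x k * y i)"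
    by (subst sum.swap) simp
  show ?thesis
    unfolding dcub_def 1 2 3 dotp_def grad_cub_def sum.distrib[symmetric] sum_distrib_right
    by (simp add: algebra_simps)
qed

lemma cub_restrict [simp]: "cub d t (restrict f {..<d}) = cub d t f"
  by (simp add: cub_def tri_def)

lemma nrm_cong: "(\<And>i. i < d \<Longrightarrow> f i = g i) \<Longrightarrow> nrm d f = nrm d g"
  unfolding nrm_def by (intro L2_set_cong) auto

lemma nrm_restrict [simp]: "nrm d (restrict f {..<d}) = nrm d f"
  by (rule nrm_cong) simp

lemma nrm_scale: "nrm d (\<lambda>i. c * f i) = \<bar>c\<bar> * nrm d f"
  by (simp add: nrm_def L2_set_def power_mult_distrib sum_distrib_left[symmetric] real_sqrt_mult)

lemma nrm_minus [simp]: "nrm d (\<lambda>i. - f i) = nrm d f"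
  using nrm_scale[of d "-1" f] by simp

lemma cub_minus [simp]: "cub d t (\<lambda>i. - x i) = - cub d t x"
  by (simp add: cub_def tri_def sum_negf)

lemma cub_add: "cub d t (\<lambda>i. x i + s * y i) = cub d t x + s * dcub d t x y + s\<^sup>2 * dcub d t y x + s ^ 3 * cub d t y"
  by (simp add: cub_def dcub_def tri_def sum_distrib_left sum.distrib[symmetric] power2_eq_square power3_eq_cube algebra_simps)

lemma measurable_cub [measurable]: "cub d t \<in> borel_measurable (Leb d)"
  unfolding cub_def tri_def by measurable

lemma cub_path_deriv:
  "((\<lambda>\<theta>. cub d t (\<lambda>i. cos \<theta> * x i + sin \<theta> * y i)) has_real_derivative
     dcub d t (\<lambda>i. cos \<theta> * x i + sin \<theta> * y i) (\<lambda>i. - sin \<theta> * x i + cos \<theta> * y i)) (at \<theta>)"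
  unfolding cub_def dcub_def tri_def sum.distrib[symmetric]
  by (intro DERIV_sum) (auto intro!: derivative_eq_intros simp: algebra_simps)

text \<open>With the sum of squares fixed, a^3 + b^3 is a function of m = a + b alone, and for m >=
  2 z it is largest at m = 2 z; the proof splits off the factor m - 2 z. Equality holds for a = 3/2
  z and b = 1/2 z.\<close>

lemma sum_cubes_bound:
  fixes a b z :: real
  assumes "a \<ge> 0" "b \<ge> 0" "z \<ge> 0" and sq: "a\<^sup>2 + b\<^sup>2 = 5/2 * z\<^sup>2" and ab: "a + b \<ge> 2 * z"
  shows "a ^ 3 + b ^ 3 \<le> 7/2 * z ^ 3"
proof -
  define m where "m = a + b"
  have "2 * (a ^ 3 + b ^ 3) = m * (3 * (a\<^sup>2 + b\<^sup>2) - m\<^sup>2)"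
    by (simp add: m_def power2_eq_square power3_eq_cube algebra_simps)
  also have "\<dots> = m * (15/2 * z\<^sup>2 - m\<^sup>2)" unfolding sq by simp
  also have "\<dots> \<le> 7 * z ^ 3"
  proof -
    have "7 * z ^ 3 - m * (15/2 * z\<^sup>2 - m\<^sup>2) = (m - 2 * z) * (m\<^sup>2 + 2 * z * m - 7/2 * z\<^sup>2)"
      by (simp add: power2_eq_square power3_eq_cube field_simps)
    moreover have "m\<^sup>2 + 2 * z * m - 7/2 * z\<^sup>2 \<ge> 0"
    proof -
      have "(2 * z)\<^sup>2 \<le> m\<^sup>2" using ab assms(3) by (intro power_mono) (auto simp: m_def)
      then have "4 * z\<^sup>2 \<le> m\<^sup>2" by (simp add: power_mult_distrib)
      moreover have "z * m \<ge> 0" using assms by (simp add: m_def)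
      moreover have "z\<^sup>2 \<ge> 0" by simp
      ultimately show ?thesis by linarith
    qed
    ultimately have "7 * z ^ 3 - m * (15/2 * z\<^sup>2 - m\<^sup>2) \<ge> 0"
      using ab by (simp add: m_def)
    then show ?thesis by simp
  qed
  finally show ?thesis by simp
qed

lemma nrm_triangle: "nrm d (\<lambda>i. x i + y i) \<le> nrm d x + nrm d y"
  unfolding nrm_def by (rule L2_set_triangle_ineq)

lemma nrm_zero_iff: "nrm d y = 0 \<longleftrightarrow> (\<forall>i<d. y i = 0)"
  by (auto simp: nrm_def L2_set_eq_0_iff)

text \<open>Polarization with step \<open>\<bar>x\<bar> / (2\<bar>y\<bar>)\<close>; the optimal constant is \<open>3\<close>.\<close>
lemma dcub_bound:
  assumes c: "\<And>y. \<bar>cub d t y\<bar> \<le> \<kappa> * nrm d y ^ 3"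
  shows "\<bar>dcub d t x y\<bar> \<le> 15/4 * \<kappa> * (nrm d x)\<^sup>2 * nrm d y"
proof (cases "nrm d x = 0 \<or> nrm d y = 0")
  case True
  then have "dcub d t x y = 0" by (auto simp: nrm_zero_iff dcub_def tri_def)
  then show ?thesis using True by auto
next
  case False
  define X Y where "X = nrm d x" and "Y = nrm d y"
  have X: "X > 0" and Y: "Y > 0" using False nrm_nonneg[of d x] nrm_nonneg[of d y] by (auto simp: X_def Y_def less_le)
  define s where "s = X / (2 * Y)"
  have s: "s > 0" and sY: "s * Y = X / 2" using X Y by (auto simp: s_def)
  define a b where "a = nrm d (\<lambda>i. x i + s * y i)" and "b = nrm d (\<lambda>i. x i + (-s) * y i)"
  have "a\<^sup>2 + b\<^sup>2 = 2 * X\<^sup>2 + 2 * (s * Y)\<^sup>2"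
    unfolding a_def b_def X_def Y_def nrm_sq power_mult_distrib
    by (simp add: sum.distrib[symmetric] sum_distrib_left power2_eq_square algebra_simps)
  then have sq: "a\<^sup>2 + b\<^sup>2 = 5/2 * X\<^sup>2" unfolding sY by (simp add: power2_eq_square)
  have "2 * X = nrm d (\<lambda>i. (x i + s * y i) + (x i + (-s) * y i))"
    using nrm_scale[of d 2 x] by (simp add: X_def algebra_simps)
  also have "\<dots> \<le> a + b" unfolding a_def b_def by (rule nrm_triangle)
  finally have ab: "a + b \<ge> 2 * X" .
  have cubes: "a ^ 3 + b ^ 3 \<le> 7/2 * X ^ 3"
    using X by (intro sum_cubes_bound sq ab) (auto simp: a_def b_def)
  have "0 \<le> \<kappa> * X ^ 3" using c[of x] by (simp add: X_def)
  then have k: "\<kappa> \<ge> 0" using X by (simp add: zero_le_mult_iff)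
  have "2 * s * dcub d t x y = cub d t (\<lambda>i. x i + s * y i) - cub d t (\<lambda>i. x i + (-s) * y i) - 2 * s ^ 3 * cub d t y"
    unfolding cub_add by (simp add: algebra_simps)
  then have "2 * s * \<bar>dcub d t x y\<bar> = \<bar>cub d t (\<lambda>i. x i + s * y i) - cub d t (\<lambda>i. x i + (-s) * y i) - 2 * s ^ 3 * cub d t y\<bar>"
    using s by (metis abs_mult abs_of_pos mult_pos_pos zero_less_numeral)
  also have "\<dots> \<le> \<bar>cub d t (\<lambda>i. x i + s * y i)\<bar> + \<bar>cub d t (\<lambda>i. x i + (-s) * y i)\<bar> + 2 * s ^ 3 * \<bar>cub d t y\<bar>"
  proof -
    have "\<bar>2 * s ^ 3 * cub d t y\<bar> = 2 * s ^ 3 * \<bar>cub d t y\<bar>" using s by (simp add: abs_mult)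
    then show ?thesis by linarith
  qed
  also have "\<dots> \<le> \<kappa> * a ^ 3 + \<kappa> * b ^ 3 + 2 * s ^ 3 * (\<kappa> * Y ^ 3)"
    unfolding a_def b_def Y_def using s by (intro add_mono c mult_left_mono) auto
  also have "\<dots> = \<kappa> * (a ^ 3 + b ^ 3 + 2 * (s * Y) ^ 3)" by (simp add: algebra_simps)
  \<comment> \<open>Origin of 15/4: the two shifted points contribute 7/2 and the cubic term in y
    contributes 2/8.\<close>
  also have "\<dots> \<le> \<kappa> * (7/2 * X ^ 3 + 2 * (X/2) ^ 3)"
    unfolding sY using cubes k by (intro mult_left_mono) auto
  also have "\<dots> = 15/4 * \<kappa> * X ^ 3" by (simp add: power3_eq_cube)
  finally have "2 * s * \<bar>dcub d t x y\<bar> \<le> 15/4 * \<kappa> * X ^ 3" .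
  then have le: "Y * (2 * s * \<bar>dcub d t x y\<bar>) \<le> Y * (15/4 * \<kappa> * X ^ 3)" using Y by (intro mult_left_mono) auto
  have eq: "Y * (2 * s * \<bar>dcub d t x y\<bar>) = X * \<bar>dcub d t x y\<bar>" using sY by (simp add: mult_ac)
  have "X * \<bar>dcub d t x y\<bar> \<le> X * (15/4 * \<kappa> * X\<^sup>2 * Y)"
    using le unfolding eq by (simp add: power2_eq_square power3_eq_cube mult_ac)
  then show ?thesis using X by (simp add: X_def Y_def)
qed

text \<open>The derivative bound is applied in the direction of the gradient itself, and one factor
  of its norm is cancelled.\<close>

lemma grad_cub_bound:
  assumes c: "\<And>y. \<bar>cub d t y\<bar> \<le> \<kappa> * nrm d y ^ 3"
  shows "nrm d (grad_cub d t x) \<le> 15/4 * \<kappa> * (nrm d x)\<^sup>2"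
proof -
  let ?g = "grad_cub d t x"
  have "(nrm d ?g)\<^sup>2 \<le> 15/4 * \<kappa> * (nrm d x)\<^sup>2 * nrm d ?g"
    using dcub_bound[OF c, of x ?g] by (simp add: dcub_eq_dotp dotp_self)
  moreover have "0 \<le> 15/4 * \<kappa> * (nrm d x)\<^sup>2"
  proof (cases "nrm d x = 0")
    case False
    then have "nrm d x ^ 3 > 0" using nrm_nonneg[of d x] by (simp add: less_le)
    moreover have "0 \<le> \<kappa> * nrm d x ^ 3" using c[of x] by linarith
    ultimately have "\<kappa> \<ge> 0" by (simp add: zero_le_mult_iff)
    then show ?thesis by simp
  qed simp
  ultimately show ?thesis using nrm_nonneg[of d ?g]
    by (cases "nrm d ?g = 0") (auto simp: power2_eq_square)
qed

section \<open>Averaging along the quarter circle\<close>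

definition arc :: "real measure" where
  "arc = density lborel (\<lambda>\<theta>. ennreal (indicator {0..pi/2} \<theta> * (2 / pi)))"

lemma sets_arc [measurable_cong, simp]: "sets arc = sets borel" by (simp add: arc_def)

lemma prob_space_arc: "prob_space arc"
proof
  have "emeasure arc (space arc) = (\<integral>\<^sup>+\<theta>. ennreal (2/pi) * indicator {0..pi/2} \<theta> \<partial>lborel)"
    unfolding arc_def by (subst emeasure_density) (auto intro!: nn_integral_cong simp: indicator_def)
  also have "\<dots> = ennreal (2/pi) * ennreal (pi/2)"
    by (subst nn_integral_cmult_indicator) auto
  also have "\<dots> = 1" by (subst ennreal_mult[symmetric]) auto
  finally show "emeasure arc (space arc) = 1" .
qed

lemma integrable_arc:
  assumes "continuous_on UNIV (h :: real \<Rightarrow> real)"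
  shows "integrable arc h"
proof -
  have [measurable]: "h \<in> borel_measurable borel" using assms by (rule borel_measurable_continuous_onI)
  have "set_integrable lborel {0..pi/2} h"
    by (intro borel_integrable_atLeastAtMost' continuous_on_subset[OF assms]) auto
  then have "integrable lborel (\<lambda>\<theta>. (2/pi) * (indicator {0..pi/2} \<theta> * h \<theta>))"
    by (intro integrable_mult_right) (simp add: set_integrable_def)
  then show ?thesis unfolding arc_def by (subst integrable_density) (auto simp: mult_ac)
qed

text \<open>The increment of F is the mean of \<open>pi/2 * h\<close> under the uniform distribution
  on the arc, and Jensen applies. The factor pi/2 in all later constants is the length of the
  arc.\<close>

lemma convex_arc_mean:
  fixes \<Phi> :: "real \<Rightarrow> real"
  assumes cv: "convex_on UNIV \<Phi>" and cont: "continuous_on UNIV \<Phi>"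
    and F: "\<And>\<theta>. (F has_real_derivative h \<theta>) (at \<theta>)" and h: "continuous_on UNIV h"
  shows "\<Phi> (F (pi/2) - F 0) \<le> (\<integral>\<theta>. \<Phi> (pi/2 * h \<theta>) \<partial>arc)"
proof -
  interpret prob_space arc by (rule prob_space_arc)
  have [measurable]: "h \<in> borel_measurable borel" using h by (rule borel_measurable_continuous_onI)
  have "(\<integral>\<theta>. pi/2 * h \<theta> \<partial>arc) = (\<integral>\<theta>. (indicator {0..pi/2} \<theta> * h \<theta>) \<partial>lborel)"
    unfolding arc_def by (subst integral_density) (auto intro!: Bochner_Integration.integral_cong simp: indicator_def)
  also have "\<dots> = F (pi/2) - F 0"
    using integral_FTC_Icc_real[of 0 "pi/2" F h] F h
    by (simp add: mult.commute continuous_on_eq_continuous_at)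
  finally have E: "(\<integral>\<theta>. pi/2 * h \<theta> \<partial>arc) = F (pi/2) - F 0" .
  have "\<Phi> (expectation (\<lambda>\<theta>. pi/2 * h \<theta>)) \<le> expectation (\<lambda>\<theta>. \<Phi> (pi/2 * h \<theta>))"
    by (rule jensens_inequality[of _ UNIV])
       (auto intro!: integrable_arc continuous_intros h cv continuous_on_compose2[OF cont])
  then show ?thesis unfolding E .
qed

lemma measurable_dcub2 [measurable]:
  "(\<lambda>p. dcub d t (fst p) (snd p)) \<in> borel_measurable (Leb d \<Otimes>\<^sub>M Leb d)"
  unfolding dcub_def tri_def by measurable

lemma nrm_rotation:
  assumes "c\<^sup>2 + s\<^sup>2 = 1"
  shows "(nrm d (\<lambda>i. c * x i + s * y i))\<^sup>2 + (nrm d (\<lambda>i. - s * x i + c * y i))\<^sup>2 = (nrm d x)\<^sup>2 + (nrm d y)\<^sup>2"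
proof -
  have "(c * x i + s * y i)\<^sup>2 + (- s * x i + c * y i)\<^sup>2 = (c\<^sup>2 + s\<^sup>2) * ((x i)\<^sup>2 + (y i)\<^sup>2)" for i
    by (simp add: power2_eq_square algebra_simps)
  then show ?thesis
    unfolding nrm_sq sum.distrib[symmetric] assms by simp
qed

text \<open>The shear parameter of \<open>nn_integral_rotation\<close> is the tangent of the half
  angle; on this range the cosine of the half angle is positive.\<close>

lemma tan_half_shears:
  assumes "\<theta> \<in> {0..pi/2}"
  shows "1 - tan (\<theta>/2) * sin \<theta> = cos \<theta>" "tan (\<theta>/2) * (1 + cos \<theta>) = sin \<theta>"
proof -
  have "0 \<le> \<theta>" "\<theta> \<le> pi/2" using assms by auto
  then have c: "cos (\<theta>/2) > 0" using pi_gt_zero by (intro cos_gt_zero_pi) linarith+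
  have s2: "sin \<theta> = 2 * sin (\<theta>/2) * cos (\<theta>/2)" using sin_double[of "\<theta>/2"] by simp
  have c2: "cos \<theta> = 1 - 2 * (sin (\<theta>/2))\<^sup>2" using cos_double_sin[of "\<theta>/2"] by simp
  have c3: "cos \<theta> = 2 * (cos (\<theta>/2))\<^sup>2 - 1" using cos_double_cos[of "\<theta>/2"] by simp
  show "1 - tan (\<theta>/2) * sin \<theta> = cos \<theta>" unfolding s2 c2 tan_def using c by (simp add: power2_eq_square)
  show "tan (\<theta>/2) * (1 + cos \<theta>) = sin \<theta>" unfolding s2 c3 tan_def using c by (simp add: power2_eq_square)
qed

lemma ennreal_le_half_add:
  assumes "u \<ge> 0" "v \<ge> 0" "w \<le> u / 2 + v / 2"
  shows "ennreal w \<le> ennreal (1/2) * ennreal u + ennreal (1/2) * ennreal v"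
proof -
  have "ennreal w \<le> ennreal (1/2 * u + 1/2 * v)" using assms by (intro ennreal_leI) simp
  also have "\<dots> = ennreal (1/2 * u) + ennreal (1/2 * v)" using assms by (intro ennreal_plus) auto
  also have "\<dots> = ennreal (1/2) * ennreal u + ennreal (1/2) * ennreal v"
    using assms by (subst (1 2) ennreal_mult) auto
  finally show ?thesis .
qed

text \<open>
  Maurey and Pisier's argument: \<open>cub y - cub x\<close> is the integral of the derivative along the quarter
  circle from \<open>x\<close> to \<open>y\<close>. A weight that depends on \<open>\<bar>x\<bar>\<^sup>2 + \<bar>y\<bar>\<^sup>2\<close> only is rotation
  invariant, so it may include a truncation.
\<close>
lemma maurey_pisier_Leb:
  fixes \<Phi> K :: "real \<Rightarrow> real"
  assumes cv: "convex_on UNIV \<Phi>" and cont: "continuous_on UNIV \<Phi>" and pos: "\<And>u. \<Phi> u \<ge> 0"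
    and K [measurable]: "K \<in> borel_measurable borel" and Kpos: "\<And>u. K u \<ge> 0"
  shows "(\<integral>\<^sup>+x. (\<integral>\<^sup>+y. ennreal (\<Phi> (- cub d t x) * K ((nrm d x)\<^sup>2 + (nrm d y)\<^sup>2)) \<partial>Leb d) \<partial>Leb d) \<le>
    (\<integral>\<^sup>+x. (\<integral>\<^sup>+y. ennreal (\<Phi> (pi/2 * dcub d t x y) * K ((nrm d x)\<^sup>2 + (nrm d y)\<^sup>2)) \<partial>Leb d) \<partial>Leb d)"
    (is "?L \<le> ?R")
proof -
  have P [measurable]: "\<Phi> \<in> borel_measurable borel" using cont by (rule borel_measurable_continuous_onI)
  define k where "k x y = K ((nrm d x)\<^sup>2 + (nrm d y)\<^sup>2)" for x y
  have k0: "k x y \<ge> 0" for x y by (simp add: k_def Kpos)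
  have km [measurable]: "(\<lambda>p. k (fst p) (snd p)) \<in> borel_measurable (Leb d \<Otimes>\<^sub>M Leb d)"
    unfolding k_def by measurable
  have kx [measurable]: "k x \<in> borel_measurable (Leb d)" for x
    unfolding k_def by measurable
  interpret L: sigma_finite_measure "Leb d" by (rule Leb_sigma_finite)
  interpret A: prob_space arc by (rule prob_space_arc)
  interpret LL: pair_sigma_finite "Leb d" "Leb d" ..
  interpret LA: pair_sigma_finite "Leb d \<Otimes>\<^sub>M Leb d" arc
    unfolding pair_sigma_finite_def by (intro conjI LL.sigma_finite_measure_axioms A.sigma_finite_measure_axioms)
  \<comment> \<open>Symmetrization brings in the second point: y and -y have the same weight and
    opposite values of \<open>cub\<close>, and - a is the midpoint of b - a and - b - a. Convexity
    thus replaces - \<open>cub x\<close> by the increment \<open>cub y - cub x\<close>.\<close>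
  have mid: "\<Phi> (- a) \<le> (1/2) * \<Phi> (b - a) + (1/2) * \<Phi> (- b - a)" for a b
  proof -
    have e: "- a = (1 - 1/2) *\<^sub>R (b - a) + (1/2) *\<^sub>R (- b - a)" by (simp add: field_simps)
    show ?thesis using convex_onD[OF cv, of "1/2" "b - a" "- b - a"] unfolding e[symmetric] by simp
  qed
  have step1: "(\<integral>\<^sup>+y. ennreal (\<Phi> (- cub d t x) * k x y) \<partial>Leb d) \<le> (\<integral>\<^sup>+y. ennreal (\<Phi> (cub d t y - cub d t x) * k x y) \<partial>Leb d)" for x
  proof -
    let ?I = "(\<integral>\<^sup>+y. ennreal (\<Phi> (cub d t y - cub d t x) * k x y) \<partial>Leb d)"
    have kn: "k x (\<lambda>i\<in>{..<d}. - y i) = k x y" for y by (simp add: k_def)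
    have neg: "(\<integral>\<^sup>+y. ennreal (\<Phi> (- cub d t y - cub d t x) * k x y) \<partial>Leb d) = ?I"
      using nn_integral_Leb_neg[of "\<lambda>y. ennreal (\<Phi> (cub d t y - cub d t x) * k x y)" d]
      by (simp add: kn)
    have "(\<integral>\<^sup>+y. ennreal (\<Phi> (- cub d t x) * k x y) \<partial>Leb d) \<le>
       (\<integral>\<^sup>+y. ennreal (1/2) * ennreal (\<Phi> (cub d t y - cub d t x) * k x y) + ennreal (1/2) * ennreal (\<Phi> (- cub d t y - cub d t x) * k x y) \<partial>Leb d)"
    proof (intro nn_integral_mono)
      fix y
      have "\<Phi> (- cub d t x) * k x y \<le> ((1/2) * \<Phi> (cub d t y - cub d t x) + (1/2) * \<Phi> (- cub d t y - cub d t x)) * k x y"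
        by (intro mult_right_mono mid k0)
      then show "ennreal (\<Phi> (- cub d t x) * k x y) \<le> ennreal (1/2) * ennreal (\<Phi> (cub d t y - cub d t x) * k x y) + ennreal (1/2) * ennreal (\<Phi> (- cub d t y - cub d t x) * k x y)"
        by (intro ennreal_le_half_add) (auto simp: pos k0 algebra_simps)
    qed
    also have "\<dots> = ennreal (1/2) * ?I + ennreal (1/2) * ?I"
      by (subst nn_integral_add) (auto simp: nn_integral_cmult neg)
    also have "\<dots> = ?I"
    proof -
      have half: "ennreal (1/2) + ennreal (1/2) = 1" by (subst ennreal_plus[symmetric]) auto
      show ?thesis by (simp only: distrib_right[symmetric] half mult_1)
    qed
    finally show ?thesis .
  qed
  define h where "h \<theta> x y = dcub d t (\<lambda>i. cos \<theta> * x i + sin \<theta> * y i) (\<lambda>i. - sin \<theta> * x i + cos \<theta> * y i)" for \<theta> :: real and x y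
  have hc: "continuous_on UNIV (\<lambda>\<theta>. h \<theta> x y)" for x y
    unfolding h_def dcub_def tri_def by (intro continuous_intros)
  have hm [measurable]: "(\<lambda>q. h (snd q) (fst (fst q)) (snd (fst q))) \<in> borel_measurable ((Leb d \<Otimes>\<^sub>M Leb d) \<Otimes>\<^sub>M arc)"
  proof -
    have c1 [measurable]: "(\<lambda>q. fst (fst q) i) \<in> borel_measurable ((Leb d \<Otimes>\<^sub>M Leb d) \<Otimes>\<^sub>M arc)" if "i < d" for i
      by (rule measurable_compose[OF measurable_fst measurable_coord_fst[OF that]])
    have c2 [measurable]: "(\<lambda>q. snd (fst q) i) \<in> borel_measurable ((Leb d \<Otimes>\<^sub>M Leb d) \<Otimes>\<^sub>M arc)" if "i < d" for i
      by (rule measurable_compose[OF measurable_fst measurable_coord_snd[OF that]])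
    show ?thesis unfolding h_def dcub_def tri_def by measurable
  qed
  have km3 [measurable]: "(\<lambda>q. k (fst (fst q)) (snd (fst q))) \<in> borel_measurable ((Leb d \<Otimes>\<^sub>M Leb d) \<Otimes>\<^sub>M arc)"
    by (rule measurable_compose[OF measurable_fst km])
  have step2: "ennreal (\<Phi> (cub d t y - cub d t x) * k x y) \<le> (\<integral>\<^sup>+\<theta>. ennreal (\<Phi> (pi/2 * h \<theta> x y) * k x y) \<partial>arc)" for x y
  proof -
    have i: "integrable arc (\<lambda>\<theta>. \<Phi> (pi/2 * h \<theta> x y))"
      by (intro integrable_arc continuous_on_compose2[OF cont] continuous_intros hc) auto
    have "\<Phi> (cub d t y - cub d t x) \<le> (\<integral>\<theta>. \<Phi> (pi/2 * h \<theta> x y) \<partial>arc)"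
      using convex_arc_mean[OF cv cont cub_path_deriv, of d t x y] hc[of x y] by (simp add: h_def)
    then have "ennreal (\<Phi> (cub d t y - cub d t x)) \<le> ennreal (\<integral>\<theta>. \<Phi> (pi/2 * h \<theta> x y) \<partial>arc)" by (rule ennreal_leI)
    also have "\<dots> = (\<integral>\<^sup>+\<theta>. ennreal (\<Phi> (pi/2 * h \<theta> x y)) \<partial>arc)"
      by (rule nn_integral_eq_integral[symmetric, OF i]) (simp add: pos)
    finally have "ennreal (\<Phi> (cub d t y - cub d t x)) * ennreal (k x y) \<le> (\<integral>\<^sup>+\<theta>. ennreal (\<Phi> (pi/2 * h \<theta> x y)) \<partial>arc) * ennreal (k x y)"
      by (rule mult_right_mono) simp
    also have "\<dots> = (\<integral>\<^sup>+\<theta>. ennreal (\<Phi> (pi/2 * h \<theta> x y)) * ennreal (k x y) \<partial>arc)"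
      using i by (intro nn_integral_multc[symmetric]) (auto dest: borel_measurable_integrable)
    finally show ?thesis by (simp add: ennreal_mult pos k0)
  qed
  \<comment> \<open>The point on the path and its velocity are the image of (x, y) under rotation by
    \<theta>, so this double integral does not depend on \<theta> and the average over the arc costs
    nothing.\<close>
  have rot: "(\<integral>\<^sup>+x. (\<integral>\<^sup>+y. ennreal (\<Phi> (pi/2 * h \<theta> x y) * k x y) \<partial>Leb d) \<partial>Leb d) = ?R" if "\<theta> \<in> {0..pi/2}" for \<theta>
  proof -
    have "k (lin2 d (cos \<theta>) (sin \<theta>) x y) (lin2 d (- sin \<theta>) (cos \<theta>) x y) = k x y" for x y
      unfolding k_def nrm_restrict by (subst nrm_rotation) simp_all
    moreover have "dcub d t (lin2 d (cos \<theta>) (sin \<theta>) x y) (lin2 d (- sin \<theta>) (cos \<theta>) x y) = h \<theta> x y" for x y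
      by (simp add: h_def dcub_def tri_def)
    ultimately show ?thesis
      using nn_integral_rotation[where F="\<lambda>x y. ennreal (\<Phi> (pi/2 * dcub d t x y) * k x y)" and d=d, OF _ tan_half_shears[OF that]]
      unfolding k_def[symmetric] by simp
  qed
  have "?L \<le> (\<integral>\<^sup>+x. (\<integral>\<^sup>+y. (\<integral>\<^sup>+\<theta>. ennreal (\<Phi> (pi/2 * h \<theta> x y) * k x y) \<partial>arc) \<partial>Leb d) \<partial>Leb d)"
    unfolding k_def[symmetric] by (intro nn_integral_mono order_trans[OF step1] step2)
  also have "\<dots> = (\<integral>\<^sup>+p. (\<integral>\<^sup>+\<theta>. ennreal (\<Phi> (pi/2 * h \<theta> (fst p) (snd p)) * k (fst p) (snd p)) \<partial>arc) \<partial>(Leb d \<Otimes>\<^sub>M Leb d))"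
    by (subst L.nn_integral_fst[symmetric]) auto
  also have "\<dots> = (\<integral>\<^sup>+\<theta>. (\<integral>\<^sup>+p. ennreal (\<Phi> (pi/2 * h \<theta> (fst p) (snd p)) * k (fst p) (snd p)) \<partial>(Leb d \<Otimes>\<^sub>M Leb d)) \<partial>arc)"
    by (rule LA.Fubini'[symmetric]) (simp add: case_prod_beta')
  also have "\<dots> = (\<integral>\<^sup>+\<theta>. (\<integral>\<^sup>+x. (\<integral>\<^sup>+y. ennreal (\<Phi> (pi/2 * h \<theta> x y) * k x y) \<partial>Leb d) \<partial>Leb d) \<partial>arc)"
  proof (intro nn_integral_cong)
    fix \<theta> :: real
    have [measurable]: "(\<lambda>p. h \<theta> (fst p) (snd p)) \<in> borel_measurable (Leb d \<Otimes>\<^sub>M Leb d)"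
      unfolding h_def dcub_def tri_def by measurable
    show "(\<integral>\<^sup>+p. ennreal (\<Phi> (pi/2 * h \<theta> (fst p) (snd p)) * k (fst p) (snd p)) \<partial>(Leb d \<Otimes>\<^sub>M Leb d)) =
       (\<integral>\<^sup>+x. (\<integral>\<^sup>+y. ennreal (\<Phi> (pi/2 * h \<theta> x y) * k x y) \<partial>Leb d) \<partial>Leb d)"
      by (subst L.nn_integral_fst[symmetric]) auto
  qed
  also have "\<dots> = (\<integral>\<^sup>+\<theta>. ?R \<partial>arc)"
  proof (rule nn_integral_cong_AE)
    have "AE \<theta> in arc. \<theta> \<in> {0..pi/2}"
      unfolding arc_def by (subst AE_density) (auto simp: indicator_def)
    then show "AE \<theta> in arc. (\<integral>\<^sup>+x. (\<integral>\<^sup>+y. ennreal (\<Phi> (pi/2 * h \<theta> x y) * k x y) \<partial>Leb d) \<partial>Leb d) = ?R"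
      by eventually_elim (rule rot)
  qed
  also have "\<dots> = ?R" by (simp add: A.emeasure_space_1)
  finally show ?thesis .
qed

text \<open>The product of the two Gaussian densities is itself a function of the sum of the squared
  norms, so it can be absorbed into the rotation invariant weight.\<close>

lemma maurey_pisier:
  fixes \<Phi> J :: "real \<Rightarrow> real"
  assumes cv: "convex_on UNIV \<Phi>" and cont: "continuous_on UNIV \<Phi>" and pos: "\<And>u. \<Phi> u \<ge> 0"
    and J [measurable]: "J \<in> borel_measurable borel" and Jpos: "\<And>u. J u \<ge> 0"
  shows "(\<integral>\<^sup>+x. (\<integral>\<^sup>+y. ennreal (\<Phi> (- cub d t x) * J ((nrm d x)\<^sup>2 + (nrm d y)\<^sup>2)) \<partial>gam d) \<partial>gam d) \<le>
    (\<integral>\<^sup>+x. (\<integral>\<^sup>+y. ennreal (\<Phi> (pi/2 * dcub d t x y) * J ((nrm d x)\<^sup>2 + (nrm d y)\<^sup>2)) \<partial>gam d) \<partial>gam d)"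
proof -
  have [measurable]: "\<Phi> \<in> borel_measurable borel" using cont by (rule borel_measurable_continuous_onI)
  interpret L: sigma_finite_measure "Leb d" by (rule Leb_sigma_finite)
  define K where "K u = exp (- u / 2) / (sqrt (2 * pi) ^ d * sqrt (2 * pi) ^ d) * J u" for u
  have K: "K ((nrm d x)\<^sup>2 + (nrm d y)\<^sup>2) = gd d x * gd d y * J ((nrm d x)\<^sup>2 + (nrm d y)\<^sup>2)" for x y
    by (simp add: K_def gd_eq exp_add[symmetric] add_divide_distrib mult_exp_exp)
  have conv: "(\<integral>\<^sup>+x. (\<integral>\<^sup>+y. ennreal (G x y * J ((nrm d x)\<^sup>2 + (nrm d y)\<^sup>2)) \<partial>gam d) \<partial>gam d) =
     (\<integral>\<^sup>+x. (\<integral>\<^sup>+y. ennreal (G x y * K ((nrm d x)\<^sup>2 + (nrm d y)\<^sup>2)) \<partial>Leb d) \<partial>Leb d)"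
    if [measurable]: "(\<lambda>p. G (fst p) (snd p)) \<in> borel_measurable (Leb d \<Otimes>\<^sub>M Leb d)" and G: "\<And>x y. G x y \<ge> 0" for G
  proof -
    have [measurable]: "(\<lambda>(x, y). G x y) \<in> borel_measurable (Leb d \<Otimes>\<^sub>M Leb d)"
      using that(1) by (simp add: case_prod_beta')
    have Gx: "(\<lambda>y. G x y) \<in> borel_measurable (Leb d)" if "x \<in> space (Leb d)" for x
      using that by measurable
    have "(\<integral>\<^sup>+x. (\<integral>\<^sup>+y. ennreal (G x y * J ((nrm d x)\<^sup>2 + (nrm d y)\<^sup>2)) \<partial>gam d) \<partial>gam d) =
       (\<integral>\<^sup>+x. (\<integral>\<^sup>+y. ennreal (gd d y) * ennreal (G x y * J ((nrm d x)\<^sup>2 + (nrm d y)\<^sup>2)) \<partial>Leb d) \<partial>gam d)"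
      using Gx by (intro nn_integral_cong nn_integral_gam) (auto simp: space_gam)
    also have "\<dots> = (\<integral>\<^sup>+x. ennreal (gd d x) * (\<integral>\<^sup>+y. ennreal (gd d y) * ennreal (G x y * J ((nrm d x)\<^sup>2 + (nrm d y)\<^sup>2)) \<partial>Leb d) \<partial>Leb d)"
      by (intro nn_integral_gam L.borel_measurable_nn_integral) measurable
    also have "\<dots> = (\<integral>\<^sup>+x. (\<integral>\<^sup>+y. ennreal (gd d x) * (ennreal (gd d y) * ennreal (G x y * J ((nrm d x)\<^sup>2 + (nrm d y)\<^sup>2))) \<partial>Leb d) \<partial>Leb d)"
      using Gx by (intro nn_integral_cong nn_integral_cmult[symmetric]) measurable
    also have "\<dots> = (\<integral>\<^sup>+x. (\<integral>\<^sup>+y. ennreal (G x y * K ((nrm d x)\<^sup>2 + (nrm d y)\<^sup>2)) \<partial>Leb d) \<partial>Leb d)"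
      unfolding K using G Jpos by (intro nn_integral_cong) (simp add: ennreal_mult[symmetric] mult_ac)
    finally show ?thesis .
  qed
  have "K \<in> borel_measurable borel" unfolding K_def by measurable
  moreover have "K u \<ge> 0" for u by (simp add: K_def Jpos)
  ultimately show ?thesis
    using maurey_pisier_Leb[OF cv cont pos, of K d t] by (subst (1 2) conv) (auto simp: pos)
qed

section \<open>Gaussian moments of cubic forms\<close>

text \<open>pi/2 is the arc length, 15/4 the gradient constant, \<open>mom (2 * k)\<close> the
  moment of the linear form in y, and \<open>mom (4 * k)\<close> that of the squared norm of x in
  the gradient bound.\<close>

definition cmom :: "nat \<Rightarrow> real" where
  "cmom k = (pi / 2 * (15/4)) ^ (2 * k) * mom (2 * k) * mom (4 * k)"

lemma cmom_pos: "cmom k > 0"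
  by (simp add: cmom_def mom_pos)

lemma kappa_nonneg:
  assumes "d \<ge> 1" and c: "\<And>y. \<bar>cub d t y\<bar> \<le> \<kappa> * nrm d y ^ 3"
  shows "\<kappa> \<ge> 0"
proof -
  have "(nrm d (\<lambda>_. 1))\<^sup>2 > 0" using assms(1) by (simp add: nrm_sq)
  then have "nrm d (\<lambda>_. 1) ^ 3 > 0" using nrm_nonneg[of d "\<lambda>_. 1"] by (simp add: less_le)
  moreover have "0 \<le> \<kappa> * nrm d (\<lambda>_. 1) ^ 3" using c[of "\<lambda>_. 1"] by linarith
  ultimately show ?thesis by (simp add: zero_le_mult_iff)
qed

text \<open>Given x, the derivative is a Gaussian linear form in y whose norm is at most 15/4
  \<kappa> times the squared norm of x, that is, of order \<kappa> d. The pointwise bound on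
  \<open>cub\<close> would give \<kappa> d^(3/2).\<close>

lemma cub_moment:
  assumes d: "d \<ge> 1" and c: "\<And>y. \<bar>cub d t y\<bar> \<le> \<kappa> * nrm d y ^ 3"
  shows "(\<integral>\<^sup>+y. ennreal (\<bar>cub d t y\<bar> ^ (2 * k)) \<partial>gam d) \<le> ennreal (cmom k * (\<kappa> * d) ^ (2 * k))"
proof -
  interpret prob_space "gam d" by (rule prob_space_gam)
  have k0: "\<kappa> \<ge> 0" by (rule kappa_nonneg[OF d c])
  define A where "A = (pi / 2 * (15/4)) ^ (2 * k) * mom (2 * k) * (\<kappa> * d) ^ (2 * k)"
  have A0: "A \<ge> 0" using mom_pos[of "2 * k"] k0 by (simp add: A_def)
  have "(\<integral>\<^sup>+x. ennreal (\<bar>cub d t x\<bar> ^ (2 * k)) \<partial>gam d) =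
     (\<integral>\<^sup>+x. (\<integral>\<^sup>+y. ennreal ((- cub d t x) ^ (2 * k) * (\<lambda>_. 1) ((nrm d x)\<^sup>2 + (nrm d y)\<^sup>2)) \<partial>gam d) \<partial>gam d)"
    by (simp add: power_even_abs emeasure_space_1[simplified])
  also have "\<dots> \<le> (\<integral>\<^sup>+x. (\<integral>\<^sup>+y. ennreal ((pi/2 * dcub d t x y) ^ (2 * k) * (\<lambda>_. 1) ((nrm d x)\<^sup>2 + (nrm d y)\<^sup>2)) \<partial>gam d) \<partial>gam d)"
    by (intro maurey_pisier convex_power_even) (auto intro!: continuous_intros)
  also have "\<dots> \<le> (\<integral>\<^sup>+x. ennreal A * ennreal (((nrm d x)\<^sup>2 / d) ^ (2 * k)) \<partial>gam d)"
  proof (intro nn_integral_mono)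
    fix x
    have "(\<integral>\<^sup>+y. ennreal ((pi/2 * dcub d t x y) ^ (2 * k) * (\<lambda>_. 1) ((nrm d x)\<^sup>2 + (nrm d y)\<^sup>2)) \<partial>gam d) =
        (\<integral>\<^sup>+y. ennreal ((pi/2) ^ (2 * k)) * ennreal (\<bar>dotp d (grad_cub d t x) y\<bar> ^ (2 * k)) \<partial>gam d)"
    proof (intro nn_integral_cong)
      fix y
      have "(pi/2 * dcub d t x y) ^ (2 * k) * (\<lambda>_. 1) ((nrm d x)\<^sup>2 + (nrm d y)\<^sup>2) = (pi/2) ^ (2 * k) * \<bar>dotp d (grad_cub d t x) y\<bar> ^ (2 * k)"
        unfolding dcub_eq_dotp power_mult_distrib by (simp add: power_even_abs)
      then show "ennreal ((pi/2 * dcub d t x y) ^ (2 * k) * (\<lambda>_. 1) ((nrm d x)\<^sup>2 + (nrm d y)\<^sup>2)) =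
          ennreal ((pi/2) ^ (2 * k)) * ennreal (\<bar>dotp d (grad_cub d t x) y\<bar> ^ (2 * k))"
        by (simp only: ennreal_mult zero_le_power abs_ge_zero zero_le_divide_iff pi_ge_zero zero_le_numeral simp_thms)
    qed
    also have "\<dots> = ennreal ((pi/2) ^ (2 * k)) * (\<integral>\<^sup>+y. ennreal (\<bar>dotp d (grad_cub d t x) y\<bar> ^ (2 * k)) \<partial>gam d)"
      by (intro nn_integral_cmult) measurable
    also have "\<dots> \<le> ennreal ((pi/2) ^ (2 * k)) * ennreal (mom (2 * k) * nrm d (grad_cub d t x) ^ (2 * k))"
      by (intro mult_left_mono nn_integral_gam_dotp) simp
    also have "\<dots> = ennreal ((pi/2) ^ (2 * k) * (mom (2 * k) * nrm d (grad_cub d t x) ^ (2 * k)))"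
      using mom_pos[of "2 * k"] by (intro ennreal_mult[symmetric]) auto
    also have "\<dots> \<le> ennreal ((pi/2) ^ (2 * k) * (mom (2 * k) * (15/4 * \<kappa> * (nrm d x)\<^sup>2) ^ (2 * k)))"
      using mom_pos[of "2 * k"] by (intro ennreal_leI mult_left_mono power_mono grad_cub_bound[OF c]) auto
    also have "\<dots> = ennreal (A * ((nrm d x)\<^sup>2 / d) ^ (2 * k))"
    proof -
      have e: "pi/2 * (15/4 * \<kappa> * (nrm d x)\<^sup>2) = pi/2 * (15/4) * (\<kappa> * d) * ((nrm d x)\<^sup>2 / d)" using d by simp
      have "(pi/2) ^ (2 * k) * (mom (2 * k) * (15/4 * \<kappa> * (nrm d x)\<^sup>2) ^ (2 * k)) = mom (2 * k) * (pi/2 * (15/4 * \<kappa> * (nrm d x)\<^sup>2)) ^ (2 * k)"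
        by (simp only: power_mult_distrib mult_ac)
      also have "\<dots> = A * ((nrm d x)\<^sup>2 / d) ^ (2 * k)"
        unfolding e A_def by (simp only: power_mult_distrib mult_ac)
      finally show ?thesis by simp
    qed
    also have "\<dots> = ennreal A * ennreal (((nrm d x)\<^sup>2 / d) ^ (2 * k))"
      using A0 by (intro ennreal_mult) auto
    finally show "(\<integral>\<^sup>+y. ennreal ((pi/2 * dcub d t x y) ^ (2 * k) * (\<lambda>_. 1) ((nrm d x)\<^sup>2 + (nrm d y)\<^sup>2)) \<partial>gam d) \<le>
       ennreal A * ennreal (((nrm d x)\<^sup>2 / d) ^ (2 * k))" .
  qed
  also have "\<dots> = ennreal A * (\<integral>\<^sup>+x. ennreal (((nrm d x)\<^sup>2 / d) ^ (2 * k)) \<partial>gam d)"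
    by (intro nn_integral_cmult) measurable
  also have "\<dots> \<le> ennreal A * ennreal (mom (2 * (2 * k)))"
    by (intro mult_left_mono nn_integral_gam_nrm d) simp
  also have "\<dots> = ennreal (cmom k * (\<kappa> * d) ^ (2 * k))"
    using A0 mom_pos[of "4 * k"] by (simp add: ennreal_mult[symmetric] A_def cmom_def mult_ac)
  finally show ?thesis .
qed

text \<open>The value has to be exact: \<open>nn_integral_gam_nrm\<close> only gives a larger
  multiple of d, and the Markov inequality in \<open>gam_ball_half\<close> would then not reach mass
  1/2.\<close>

lemma nn_integral_gam_nrm_sq: "(\<integral>\<^sup>+y. ennreal ((nrm d y)\<^sup>2) \<partial>gam d) = of_nat d"
proof -
  have std2: "(\<integral>\<^sup>+t. ennreal (std_normal_density t * t\<^sup>2) \<partial>lborel) = 1"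
    using std_normal_moment_even[of 1] by (subst nn_integral_eq_integral)
      (auto simp: has_bochner_integral_iff)
  have one: "(\<integral>\<^sup>+t. ennreal (std_normal_density t) \<partial>lborel) = 1"
    using nn_integral_std_exp[of 0] by simp
  have co: "(\<integral>\<^sup>+y. ennreal ((y i)\<^sup>2) \<partial>gam d) = 1" if i: "i < d" for i
  proof -
    have "(\<integral>\<^sup>+y. ennreal ((y i)\<^sup>2) \<partial>gam d) = (\<integral>\<^sup>+y. ennreal (\<Prod>j<d. (\<lambda>j t. if j = i then t\<^sup>2 else 1) j (y j)) \<partial>gam d)"
      using i by (simp add: prod.delta)
    also have "\<dots> = (\<Prod>j<d. (\<integral>\<^sup>+t. ennreal (std_normal_density t * (if j = i then t\<^sup>2 else 1)) \<partial>lborel))"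
      by (rule nn_integral_gam_prod) auto
    also have "\<dots> = 1" by (intro prod.neutral ballI) (case_tac "x = i"; simp add: std2 one)
    finally show ?thesis .
  qed
  have "(\<integral>\<^sup>+y. ennreal ((nrm d y)\<^sup>2) \<partial>gam d) = (\<integral>\<^sup>+y. (\<Sum>i<d. ennreal ((y i)\<^sup>2)) \<partial>gam d)"
    by (simp add: nrm_sq sum_ennreal)
  also have "\<dots> = (\<Sum>i<d. (\<integral>\<^sup>+y. ennreal ((y i)\<^sup>2) \<partial>gam d))"
    by (intro nn_integral_sum) auto
  also have "\<dots> = of_nat d" by (simp add: co)
  finally show ?thesis .
qed

text \<open>Markov's inequality for the squared norm, whose mean is d.\<close>

lemma gam_ball_half:
  assumes "d \<ge> 1"
  shows "(\<integral>\<^sup>+y. ennreal (of_bool ((nrm d y)\<^sup>2 \<le> 2 * d)) \<partial>gam d) \<ge> ennreal (1/2)"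
proof -
  interpret prob_space "gam d" by (rule prob_space_gam)
  let ?P = "(\<integral>\<^sup>+y. ennreal (of_bool ((nrm d y)\<^sup>2 \<le> 2 * d)) \<partial>gam d)"
  have d: "real d > 0" using assms by simp
  have "ennreal 1 = (\<integral>\<^sup>+y. ennreal 1 \<partial>gam d)" using emeasure_space_1 by simp
  also have "\<dots> \<le> (\<integral>\<^sup>+y. ennreal (of_bool ((nrm d y)\<^sup>2 \<le> 2 * d)) + ennreal (1 / (2 * d)) * ennreal ((nrm d y)\<^sup>2) \<partial>gam d)"
  proof (intro nn_integral_mono)
    fix y
    have "1 \<le> of_bool ((nrm d y)\<^sup>2 \<le> 2 * d) + 1 / (2 * d) * (nrm d y)\<^sup>2"
      using d by (auto simp: of_bool_def field_simps)
    then have "ennreal 1 \<le> ennreal (of_bool ((nrm d y)\<^sup>2 \<le> 2 * d) + 1 / (2 * d) * (nrm d y)\<^sup>2)"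
      by (rule ennreal_leI)
    also have "\<dots> = ennreal (of_bool ((nrm d y)\<^sup>2 \<le> 2 * d)) + ennreal (1 / (2 * d)) * ennreal ((nrm d y)\<^sup>2)"
      by (subst ennreal_mult[symmetric]) (auto intro!: ennreal_plus)
    finally show "ennreal 1 \<le> \<dots>" .
  qed
  also have "\<dots> = ?P + ennreal (1 / (2 * d)) * of_nat d"
    by (subst nn_integral_add) (auto simp: nn_integral_cmult nn_integral_gam_nrm_sq)
  also have "ennreal (1 / (2 * d)) * of_nat d = ennreal (1/2)"
    using d by (subst ennreal_of_nat_eq_real_of_nat, subst ennreal_mult[symmetric]) auto
  finally have *: "ennreal 1 \<le> ?P + ennreal (1/2)" .
  show ?thesis
  proof (cases ?P)
    case (real r)
    have "ennreal 1 \<le> ennreal r + ennreal (1/2)" using * unfolding real .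
    also have "\<dots> = ennreal (r + 1/2)" using real by (intro ennreal_plus[symmetric]) auto
    finally have "ennreal 1 \<le> ennreal (r + 1/2)" .
    then have "1 \<le> r + 1/2" using real by (subst (asm) ennreal_le_iff) auto
    then show ?thesis using real by (simp add: ennreal_leI del: ennreal_half)
  qed simp
qed

text \<open>
  The radius of the truncation for the pair of points leaves room for the ball of radius
  \<open>\<surd>(2d)\<close>, which carries at least half of the Gaussian mass, around the second point.
\<close>
lemma cub_exp_moment:
  assumes d: "d \<ge> 1" and c: "\<And>y. \<bar>cub d t y\<bar> \<le> \<kappa> * nrm d y ^ 3" and r: "r \<ge> 0"
  shows "(\<integral>\<^sup>+y. ennreal (exp (- l * cub d t y) * of_bool ((nrm d y)\<^sup>2 \<le> r)) \<partial>gam d) \<le>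
     ennreal (2 * exp (l\<^sup>2 * (pi\<^sup>2 / 8) * (15/4 * \<kappa> * (r + 2 * d))\<^sup>2))"
proof -
  interpret prob_space "gam d" by (rule prob_space_gam)
  have k0: "\<kappa> \<ge> 0" by (rule kappa_nonneg[OF d c])
  define J where "J u = (of_bool (u \<le> r + 2 * d) :: real)" for u
  have Jm [measurable]: "J \<in> borel_measurable borel" unfolding J_def by measurable
  define L where "L = (\<integral>\<^sup>+y. ennreal (exp (- l * cub d t y) * of_bool ((nrm d y)\<^sup>2 \<le> r)) \<partial>gam d)"
  define R where "R = exp (l\<^sup>2 * (pi\<^sup>2 / 8) * (15/4 * \<kappa> * (r + 2 * d))\<^sup>2)"
  have "L * ennreal (1/2) \<le> L * (\<integral>\<^sup>+y. ennreal (of_bool ((nrm d y)\<^sup>2 \<le> 2 * d)) \<partial>gam d)"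
    by (intro mult_left_mono gam_ball_half d) simp
  also have "\<dots> = (\<integral>\<^sup>+x. ennreal (exp (- l * cub d t x) * of_bool ((nrm d x)\<^sup>2 \<le> r)) * (\<integral>\<^sup>+y. ennreal (of_bool ((nrm d y)\<^sup>2 \<le> 2 * d)) \<partial>gam d) \<partial>gam d)"
    unfolding L_def by (intro nn_integral_multc[symmetric]) measurable
  also have "\<dots> = (\<integral>\<^sup>+x. (\<integral>\<^sup>+y. ennreal (exp (- l * cub d t x) * of_bool ((nrm d x)\<^sup>2 \<le> r)) * ennreal (of_bool ((nrm d y)\<^sup>2 \<le> 2 * d)) \<partial>gam d) \<partial>gam d)"
    by (intro nn_integral_cong nn_integral_cmult[symmetric]) measurable
  also have "\<dots> \<le> (\<integral>\<^sup>+x. (\<integral>\<^sup>+y. ennreal (exp (l * - cub d t x) * J ((nrm d x)\<^sup>2 + (nrm d y)\<^sup>2)) \<partial>gam d) \<partial>gam d)"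
    by (intro nn_integral_mono) (auto simp: of_bool_def J_def)
  also have "\<dots> \<le> (\<integral>\<^sup>+x. (\<integral>\<^sup>+y. ennreal (exp (l * (pi/2 * dcub d t x y)) * J ((nrm d x)\<^sup>2 + (nrm d y)\<^sup>2)) \<partial>gam d) \<partial>gam d)"
  proof (intro maurey_pisier Jm)
    show "convex_on UNIV (\<lambda>u. exp (l * u))"
      by (rule f''_ge0_imp_convex[where f' = "\<lambda>u. l * exp (l * u)" and f'' = "\<lambda>u. l * l * exp (l * u)"])
         (auto intro!: derivative_eq_intros)
  qed (auto intro!: continuous_intros simp: J_def)
  also have "\<dots> \<le> (\<integral>\<^sup>+x. ennreal R \<partial>gam d)"
  proof (intro nn_integral_mono)
    fix x
    \<comment> \<open>Given x, the inner integral is a Gaussian moment generating function. The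
      truncation of the pair is relaxed to one on x alone, which caps the gradient; the exponent is
      half the square of l pi/2 times that cap.\<close>
    have eq: "l * (pi/2 * dcub d t x y) = dotp d (\<lambda>i. (l * pi/2) * grad_cub d t x i) y" for y
      by (simp add: dcub_eq_dotp dotp_def sum_distrib_left mult_ac)
    have "(\<integral>\<^sup>+y. ennreal (exp (l * (pi/2 * dcub d t x y)) * J ((nrm d x)\<^sup>2 + (nrm d y)\<^sup>2)) \<partial>gam d) \<le>
       (\<integral>\<^sup>+y. ennreal (of_bool ((nrm d x)\<^sup>2 \<le> r + 2 * d)) * ennreal (exp (dotp d (\<lambda>i. (l * pi/2) * grad_cub d t x i) y)) \<partial>gam d)"
      unfolding eq by (intro nn_integral_mono) (auto simp: J_def of_bool_def, smt (verit, best) zero_le_power2)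
    also have "\<dots> = ennreal (of_bool ((nrm d x)\<^sup>2 \<le> r + 2 * d)) * ennreal (exp ((nrm d (\<lambda>i. (l * pi/2) * grad_cub d t x i))\<^sup>2 / 2))"
      by (subst nn_integral_cmult) (auto simp: nn_integral_gam_exp)
    also have "\<dots> \<le> ennreal R"
    proof (cases "(nrm d x)\<^sup>2 \<le> r + 2 * d")
      case True
      have "nrm d (grad_cub d t x) \<le> 15/4 * \<kappa> * (r + 2 * d)"
      proof -
        have "nrm d (grad_cub d t x) \<le> 15/4 * \<kappa> * (nrm d x)\<^sup>2" by (rule grad_cub_bound[OF c])
        also have "\<dots> \<le> 15/4 * \<kappa> * (r + 2 * d)" using True k0 by (intro mult_left_mono) auto
        finally show ?thesis .
      qed
      then have "(nrm d (grad_cub d t x))\<^sup>2 \<le> (15/4 * \<kappa> * (r + 2 * d))\<^sup>2" by (intro power_mono) auto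
      then have "l\<^sup>2 * (pi\<^sup>2 / 8) * (nrm d (grad_cub d t x))\<^sup>2 \<le> l\<^sup>2 * (pi\<^sup>2 / 8) * (15/4 * \<kappa> * (r + 2 * d))\<^sup>2"
        by (intro mult_left_mono) auto
      moreover have "(nrm d (\<lambda>i. (l * pi/2) * grad_cub d t x i))\<^sup>2 / 2 = l\<^sup>2 * (pi\<^sup>2 / 8) * (nrm d (grad_cub d t x))\<^sup>2"
        unfolding nrm_scale power_mult_distrib power2_abs by (simp add: power_divide power_mult_distrib)
      ultimately show ?thesis using True by (simp add: R_def ennreal_leI)
    qed simp
    finally show "(\<integral>\<^sup>+y. ennreal (exp (l * (pi/2 * dcub d t x y)) * J ((nrm d x)\<^sup>2 + (nrm d y)\<^sup>2)) \<partial>gam d) \<le> ennreal R" .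
  qed
  also have "\<dots> = ennreal R" using emeasure_space_1 by simp
  finally have *: "L * ennreal (1/2) \<le> ennreal R" .
  have "L = L * ennreal (1/2) * ennreal 2"
    by (simp add: mult.assoc ennreal_mult[symmetric] del: ennreal_half ennreal_numeral)
  also have "\<dots> \<le> ennreal R * ennreal 2" using * by (intro mult_right_mono) auto
  also have "\<dots> = ennreal (2 * R)" by (simp add: R_def ennreal_mult[symmetric] mult.commute del: ennreal_numeral)
  finally show ?thesis unfolding L_def R_def .
qed

section \<open>Functions with Gaussian moments\<close>

text \<open>Unlike integrability, this property is closed under products. The integrands below are
  polynomial expressions, possibly times a bounded function, so integrability becomes a matter of
  closure rules.\<close>

definition all_moments :: "nat \<Rightarrow> ((nat \<Rightarrow> real) \<Rightarrow> real) \<Rightarrow> bool" where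
  "all_moments d F \<longleftrightarrow> F \<in> borel_measurable (Leb d) \<and> (\<forall>k::nat. integrable (gam d) (\<lambda>y. \<bar>F y\<bar> ^ k))"

lemma am_measurable: "all_moments d F \<Longrightarrow> F \<in> borel_measurable (Leb d)"
  by (simp add: all_moments_def)

lemma am_measurable_gam: "all_moments d F \<Longrightarrow> F \<in> borel_measurable (gam d)"
  using measurable_cong_sets[OF sets_gam refl] by (auto simp: all_moments_def)

lemma am_integrable:
  assumes "all_moments d F" shows "integrable (gam d) F"
proof -
  have "integrable (gam d) (\<lambda>y. \<bar>F y\<bar> ^ 1)" using assms unfolding all_moments_def by blast
  then show ?thesis using am_measurable_gam[OF assms] by (simp add: integrable_abs_iff)
qed

lemma am_const [intro]: "all_moments d (\<lambda>_. c)"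
proof -
  interpret prob_space "gam d" by (rule prob_space_gam)
  show ?thesis by (auto simp: all_moments_def)
qed

lemma am_add [intro]:
  assumes F: "all_moments d F" and G: "all_moments d G" shows "all_moments d (\<lambda>y. F y + G y)"
  unfolding all_moments_def
proof (intro conjI allI)
  note [measurable] = am_measurable[OF F] am_measurable[OF G]
  show "(\<lambda>y. F y + G y) \<in> borel_measurable (Leb d)" by measurable
  fix k :: nat
  show "integrable (gam d) (\<lambda>y. \<bar>F y + G y\<bar> ^ k)"
  proof (rule Bochner_Integration.integrable_bound)
    show "integrable (gam d) (\<lambda>y. 2 ^ k * (\<bar>F y\<bar> ^ k + \<bar>G y\<bar> ^ k))"
      using F G by (intro integrable_mult_right Bochner_Integration.integrable_add) (auto simp: all_moments_def)
    have "\<bar>a + b\<bar> ^ k \<le> 2 ^ k * (\<bar>a\<bar> ^ k + \<bar>b\<bar> ^ k)" for a b :: real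
    proof -
      have "\<bar>a + b\<bar> ^ k \<le> (2 * max \<bar>a\<bar> \<bar>b\<bar>) ^ k" by (intro power_mono) auto
      also have "\<dots> = 2 ^ k * max \<bar>a\<bar> \<bar>b\<bar> ^ k" by (simp add: power_mult_distrib)
      also have "\<dots> \<le> 2 ^ k * (\<bar>a\<bar> ^ k + \<bar>b\<bar> ^ k)" by (intro mult_left_mono) (auto simp: max_def)
      finally show ?thesis .
    qed
    then show "AE y in gam d. norm (\<bar>F y + G y\<bar> ^ k) \<le> norm (2 ^ k * (\<bar>F y\<bar> ^ k + \<bar>G y\<bar> ^ k))" by simp
  qed measurable
qed

lemma two_mult_le_squares: "2 * (a * b) \<le> a\<^sup>2 + (b::real)\<^sup>2"
  using sum_squares_bound[of a b] by simp

lemma am_mult [intro]: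
  assumes F: "all_moments d F" and G: "all_moments d G" shows "all_moments d (\<lambda>y. F y * G y)"
  unfolding all_moments_def
proof (intro conjI allI)
  note [measurable] = am_measurable[OF F] am_measurable[OF G]
  show "(\<lambda>y. F y * G y) \<in> borel_measurable (Leb d)" by measurable
  fix k :: nat
  show "integrable (gam d) (\<lambda>y. \<bar>F y * G y\<bar> ^ k)"
  proof (rule Bochner_Integration.integrable_bound)
    show "integrable (gam d) (\<lambda>y. \<bar>F y\<bar> ^ (2 * k) + \<bar>G y\<bar> ^ (2 * k))"
      using F G by (intro Bochner_Integration.integrable_add) (auto simp: all_moments_def)
    have "\<bar>a * b\<bar> ^ k \<le> \<bar>a\<bar> ^ (2 * k) + \<bar>b\<bar> ^ (2 * k)" for a b :: real
    proof -
      have "\<bar>a * b\<bar> ^ k = \<bar>a\<bar> ^ k * \<bar>b\<bar> ^ k" by (simp add: abs_mult power_mult_distrib)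
      moreover have "0 \<le> \<bar>a\<bar> ^ k * \<bar>b\<bar> ^ k" by simp
      moreover have "2 * (\<bar>a\<bar> ^ k * \<bar>b\<bar> ^ k) \<le> (\<bar>a\<bar> ^ k)\<^sup>2 + (\<bar>b\<bar> ^ k)\<^sup>2" by (rule two_mult_le_squares)
      moreover have "(\<bar>a\<bar> ^ k)\<^sup>2 = \<bar>a\<bar> ^ (2 * k)" "(\<bar>b\<bar> ^ k)\<^sup>2 = \<bar>b\<bar> ^ (2 * k)"
        by (simp_all add: power_mult[symmetric] mult.commute)
      ultimately show ?thesis by linarith
    qed
    then show "AE y in gam d. norm (\<bar>F y * G y\<bar> ^ k) \<le> norm (\<bar>F y\<bar> ^ (2 * k) + \<bar>G y\<bar> ^ (2 * k))" by simp
  qed measurable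
qed

lemma am_abs [intro]: "all_moments d F \<Longrightarrow> all_moments d (\<lambda>y. \<bar>F y\<bar>)"
  by (auto simp: all_moments_def)

lemma am_power [intro]: "all_moments d F \<Longrightarrow> all_moments d (\<lambda>y. F y ^ k)"
  by (induction k) auto

lemma am_divide [intro]: "all_moments d F \<Longrightarrow> all_moments d (\<lambda>y. F y / c)"
  using am_mult[OF _ am_const[of d "1/c"], of F] by simp

lemma am_sum: "(\<And>i. i \<in> I \<Longrightarrow> all_moments d (F i)) \<Longrightarrow> all_moments d (\<lambda>y. \<Sum>i\<in>I. F i y)"
  by (induction I rule: infinite_finite_induct) auto

lemma integrable_nn_le:
  assumes [measurable]: "F \<in> borel_measurable (Leb d)" and pos: "\<And>y. F y \<ge> 0"
    and le: "(\<integral>\<^sup>+y. ennreal (F y) \<partial>gam d) \<le> ennreal c" and c: "c \<ge> 0"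
  shows "integrable (gam d) F" "(\<integral>y. F y \<partial>gam d) \<le> c"
proof -
  show i: "integrable (gam d) F"
    using le pos by (intro integrableI_nonneg) (auto simp: le_less_trans)
  have "ennreal (\<integral>y. F y \<partial>gam d) \<le> ennreal c"
    using le nn_integral_eq_integral[OF i] pos by simp
  then show "(\<integral>y. F y \<partial>gam d) \<le> c" using c by simp
qed

lemma am_dotp: "all_moments d (dotp d u)"
  unfolding all_moments_def
proof (intro conjI allI)
  fix k :: nat
  show "integrable (gam d) (\<lambda>y. \<bar>dotp d u y\<bar> ^ k)"
    using nn_integral_gam_dotp[of d u k] mom_pos[of k] by (intro integrable_nn_le(1)[where c="mom k * nrm d u ^ k"]) auto
qed measurable

lemma am_coord: "i < d \<Longrightarrow> all_moments d (\<lambda>y. y i)"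
proof -
  assume i: "i < d"
  have "dotp d (\<lambda>j. if j = i then 1 else 0) y = y i" for y
    using i by (simp add: dotp_def if_distrib[of "\<lambda>z. z * _"] cong: if_cong)
  then have "dotp d (\<lambda>j. if j = i then 1 else 0) = (\<lambda>y. y i)" by auto
  then show ?thesis using am_dotp by metis
qed

lemma am_cub: "all_moments d (cub d t)"
  unfolding cub_def tri_def by (intro am_sum am_mult am_const am_coord) auto

lemma am_nrm_sq: "all_moments d (\<lambda>y. (nrm d y)\<^sup>2)"
  unfolding nrm_sq by (intro am_sum am_power am_coord) auto

text \<open>Serves for the cutoff, the truncated density and the truncated remainder, all of which
  are bounded.\<close>

lemma integrable_am_bounded:
  assumes F: "all_moments d F" and [measurable]: "G \<in> borel_measurable (Leb d)" and le: "\<And>y. \<bar>G y\<bar> \<le> C"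
  shows "integrable (gam d) (\<lambda>y. F y * G y)"
proof (rule Bochner_Integration.integrable_bound)
  note [measurable] = am_measurable[OF F]
  show "integrable (gam d) (\<lambda>y. F y * C)" by (intro am_integrable am_mult F am_const)
  show "(\<lambda>y. F y * G y) \<in> borel_measurable (gam d)" by measurable
  show "AE y in gam d. norm (F y * G y) \<le> norm (F y * C)"
    using order_trans[OF le abs_ge_self] by (intro AE_I2) (simp add: abs_mult mult_left_mono)
qed

lemma dotp_minus [simp]: "dotp d u (\<lambda>i. - y i) = - dotp d u y"
  by (simp add: dotp_def sum_negf)

lemma dotp_restrict [simp]: "dotp d u (restrict y {..<d}) = dotp d u y"
  by (simp add: dotp_def)

lemma gd_restrict_minus: "gd d (\<lambda>i\<in>{..<d}. - y i) = gd d y"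
  by (simp add: gd_eq)

text \<open>Reflection at the origin preserves the Gaussian. The parity cancellations of the
  expansion rest on this.\<close>

lemma integral_gam_odd:
  fixes F :: "(nat \<Rightarrow> real) \<Rightarrow> real"
  assumes [measurable]: "F \<in> borel_measurable (Leb d)" and odd: "\<And>y. F (\<lambda>i\<in>{..<d}. - y i) = - F y"
  shows "(\<integral>y. F y \<partial>gam d) = 0"
proof -
  have "(\<integral>y. F y \<partial>gam d) = (\<integral>y. gd d y * F y \<partial>Leb d)" by (rule integral_gam) measurable
  also have "\<dots> = (\<integral>y. gd d (\<lambda>i\<in>{..<d}. - y i) * F (\<lambda>i\<in>{..<d}. - y i) \<partial>Leb d)"
    by (rule integral_Leb_neg[symmetric]) measurable
  also have "\<dots> = - (\<integral>y. F y \<partial>gam d)"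
    unfolding odd gd_restrict_minus by (simp add: integral_gam)
  finally show ?thesis by simp
qed

section \<open>Exponential tails and remainders of the exponential series\<close>

lemma nn_integral_exp_abs:
  assumes c: "c > (0::real)"
  shows "(\<integral>\<^sup>+t. ennreal (exp (- c * \<bar>t\<bar>)) \<partial>lborel) \<le> ennreal (2 / c)"
proof -
  have half: "(\<integral>\<^sup>+t. ennreal (exp (- c * t)) * indicator {0..} t \<partial>lborel) = ennreal (1 / c)"
  proof -
    have "(\<integral>\<^sup>+t. ennreal (exp (- c * t)) * indicator {0..} t \<partial>lborel) = ennreal (0 - (- exp (- c * 0) / c))"
    proof (rule nn_integral_FTC_atLeast)
      show "((\<lambda>t. - exp (- c * t) / c) has_real_derivative exp (- c * t)) (at t)" for t
        using c by (auto intro!: derivative_eq_intros)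
      have "((\<lambda>t. exp (- (c * t))) \<longlongrightarrow> 0) at_top"
        using c by (intro filterlim_compose[OF exp_at_bot] filterlim_uminus_at_bot_at_top[THEN filterlim_compose] filterlim_tendsto_pos_mult_at_top[OF tendsto_const c filterlim_ident])
      from tendsto_divide[OF tendsto_minus[OF this] tendsto_const, of c] c
      show "((\<lambda>t. - exp (- c * t) / c) \<longlongrightarrow> 0) at_top" by simp
    qed auto
    then show ?thesis by simp
  qed
  have "(\<integral>\<^sup>+t. ennreal (exp (- c * \<bar>t\<bar>)) \<partial>lborel) \<le>
     (\<integral>\<^sup>+t. ennreal (exp (- c * t)) * indicator {0..} t + ennreal (exp (- c * (- t))) * indicator {0..} (- t) \<partial>lborel)"
    by (intro nn_integral_mono) (auto simp: indicator_def abs_if)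
  also have "\<dots> = ennreal (1/c) + (\<integral>\<^sup>+t. ennreal (exp (- c * (- t))) * indicator {0..} (- t) \<partial>lborel)"
    by (subst nn_integral_add) (auto simp: half[simplified])
  also have "(\<integral>\<^sup>+t. ennreal (exp (- c * (- t))) * indicator {0..} (- t) \<partial>lborel) = ennreal (1/c)"
  proof -
    define f where "f t = ennreal (exp (- c * t)) * indicator {0..} t" for t
    have [measurable]: "f \<in> borel_measurable borel" unfolding f_def by measurable
    have "(\<integral>\<^sup>+t. f t \<partial>lborel) = (\<integral>\<^sup>+t. f (- t) \<partial>lborel)"
      by (subst nn_integral_real_affine[where c="-1" and t=0]) auto
    then show ?thesis using half by (simp only: f_def)
  qed
  also have "ennreal (1/c) + ennreal (1/c) = ennreal (2/c)"
    using c by (subst ennreal_plus[symmetric]) auto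
  finally show ?thesis .
qed

lemma sum_abs_le_nrm: "(\<Sum>i<d. \<bar>y i\<bar>) \<le> sqrt d * nrm d y"
proof -
  have "(\<Sum>i<d. \<bar>1\<bar> * \<bar>y i\<bar>) \<le> L2_set (\<lambda>_. 1) {..<d} * L2_set y {..<d}" by (rule L2_set_mult_ineq)
  then show ?thesis by (simp add: nrm_def L2_set_def)
qed

text \<open>By Cauchy--Schwarz, sqrt d times the Euclidean norm dominates the sum of the absolute
  coordinates. The integrand is then bounded by a product of one-dimensional exponentials.\<close>

lemma nn_integral_exp_nrm:
  assumes c: "c > (0::real)"
  shows "(\<integral>\<^sup>+y. ennreal (exp (- c * (sqrt d * nrm d y))) \<partial>Leb d) \<le> ennreal ((2 / c) ^ d)"
proof -
  have "(\<integral>\<^sup>+y. ennreal (exp (- c * (sqrt d * nrm d y))) \<partial>Leb d) \<le> (\<integral>\<^sup>+y. (\<Prod>i<d. ennreal (exp (- c * \<bar>y i\<bar>))) \<partial>Leb d)"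
  proof (intro nn_integral_mono)
    fix y
    have "exp (- c * (sqrt d * nrm d y)) \<le> exp (- c * (\<Sum>i<d. \<bar>y i\<bar>))"
      using sum_abs_le_nrm[where d=d and y=y] c by simp
    also have "\<dots> = (\<Prod>i<d. exp (- c * \<bar>y i\<bar>))" by (simp add: sum_distrib_left exp_sum sum_negf[symmetric])
    finally show "ennreal (exp (- c * (sqrt d * nrm d y))) \<le> (\<Prod>i<d. ennreal (exp (- c * \<bar>y i\<bar>)))"
      by (simp add: prod_ennreal ennreal_leI)
  qed
  also have "\<dots> = (\<Prod>i<d. (\<integral>\<^sup>+t. ennreal (exp (- c * \<bar>t\<bar>)) \<partial>lborel))"
    by (intro Leb.product_nn_integral_prod) auto
  also have "\<dots> \<le> (\<Prod>i<d. ennreal (2 / c))"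
    using power_mono_ennreal[OF nn_integral_exp_abs[OF c], of d] by simp
  also have "\<dots> = ennreal ((2 / c) ^ d)" using c by (simp add: ennreal_power)
  finally show ?thesis .
qed

text \<open>The Lagrange point lies between 0 and z, so its exponential is at most the larger of 1
  and exp z. On the ball, with z = - (f + r), the resulting bound 1 + exp z is the weight
  \<open>b + \<psi>\<close> that \<open>weighted\<close> integrates.\<close>

lemma exp_taylor:
  fixes z :: real
  assumes n: "n > 0"
  shows "\<exists>t. exp t \<le> 1 + exp z \<and> exp z = (\<Sum>m<n. z ^ m / fact m) + exp t / fact n * z ^ n"
proof -
  consider "z = 0" | "z > 0" | "z < 0" by linarith
  then show ?thesis
  proof cases
    case 1
    have "(\<Sum>m<n. (0::real) ^ m / fact m) = (\<Sum>m<n. if m = 0 then 1 else 0)" by (intro sum.cong refl) auto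
    then show ?thesis using n 1 by (intro exI[of _ 0]) (auto simp: zero_power)
  next
    case 2
    obtain t where "t < z" "exp z = (\<Sum>m<n. exp 0 / fact m * z ^ m) + exp t / fact n * z ^ n"
      using Maclaurin[OF 2 n, of "\<lambda>_. exp" exp] by auto
    then show ?thesis by (intro exI[of _ t]) (auto intro: order_trans[of _ "exp z"])
  next
    case 3
    obtain t where "t < 0" "exp z = (\<Sum>m<n. exp 0 / fact m * z ^ m) + exp t / fact n * z ^ n"
      using Maclaurin_minus[OF 3 n, of "\<lambda>_. exp" exp] by auto
    moreover have "exp t \<le> 1 + exp z" using \<open>t < 0\<close> exp_ge_zero[of z] exp_less_one_iff[of t] by linarith
    ultimately show ?thesis by (intro exI[of _ t]) (simp only: exp_zero mult_1 times_divide_eq_left simp_thms)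
  qed
qed

lemma exp_remainder1: "\<bar>exp (- x) - 1 + x\<bar> \<le> x\<^sup>2 * (1 + exp (- x :: real))"
proof -
  obtain t where t: "exp t \<le> 1 + exp (-x)" "exp (-x) = (\<Sum>m<2. (-x) ^ m / fact m) + exp t / fact 2 * (-x) ^ 2"
    using exp_taylor[of 2 "-x"] by auto
  have "exp (-x) - 1 + x = x\<^sup>2 * (exp t / 2)" using t(2) by (simp add: numeral_2_eq_2)
  then have "\<bar>exp (- x) - 1 + x\<bar> = \<bar>x\<^sup>2 * (exp t / 2)\<bar>" by (simp only:)
  also have "\<dots> = x\<^sup>2 * (exp t / 2)" by simp
  also have "\<dots> \<le> x\<^sup>2 * (1 + exp (- x))" using t(1) exp_ge_zero[of t] by (intro mult_left_mono) (linarith, simp)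
  finally show ?thesis .
qed

lemma exp_remainder2: "\<bar>exp (- x) - 1 + x - x\<^sup>2 / 2\<bar> \<le> \<bar>x\<bar> ^ 3 * (1 + exp (- x :: real))"
proof -
  obtain t where t: "exp t \<le> 1 + exp (-x)" "exp (-x) = (\<Sum>m<3. (-x) ^ m / fact m) + exp t / fact 3 * (-x) ^ 3"
    using exp_taylor[of 3 "-x"] by auto
  have "exp (-x) - 1 + x - x\<^sup>2 / 2 = - (x ^ 3 * (exp t / 6))" using t(2) by (simp add: eval_nat_numeral)
  then have "\<bar>exp (- x) - 1 + x - x\<^sup>2 / 2\<bar> = \<bar>- (x ^ 3 * (exp t / 6))\<bar>" by (simp only:)
  also have "\<dots> = \<bar>x\<bar> ^ 3 * (exp t / 6)" by (simp add: abs_mult power_abs)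
  also have "\<dots> \<le> \<bar>x\<bar> ^ 3 * (1 + exp (- x))" using t(1) exp_ge_zero[of t] by (intro mult_left_mono) (linarith, simp)
  finally show ?thesis .
qed

section \<open>Density ratio and tails in whitened coordinates\<close>

lemma abs_integral_le:
  fixes F G :: "'a \<Rightarrow> real"
  assumes "integrable M F" "integrable M G" "\<And>y. \<bar>F y\<bar> \<le> G y"
  shows "\<bar>\<integral>y. F y \<partial>M\<bar> \<le> (\<integral>y. G y \<partial>M)"
proof -
  have "\<bar>\<integral>y. F y \<partial>M\<bar> \<le> (\<integral>y. \<bar>F y\<bar> \<partial>M)" by (rule integral_abs_bound)
  also have "\<dots> \<le> (\<integral>y. G y \<partial>M)" using assms by (intro integral_mono) auto
  finally show ?thesis .
qed

lemma sum3_sq: "(a + b + c)\<^sup>2 \<le> 3 * (a\<^sup>2 + b\<^sup>2 + (c::real)\<^sup>2)"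
proof -
  have "3 * (a\<^sup>2 + b\<^sup>2 + c\<^sup>2) - (a + b + c)\<^sup>2 = (a - b)\<^sup>2 + (b - c)\<^sup>2 + (a - c)\<^sup>2"
    by (simp add: power2_eq_square algebra_simps)
  then show ?thesis by (smt (verit) zero_le_power2)
qed

text \<open>
  \<open>KM1\<close>, ..., \<open>KM4\<close> bound second moments of the weights in the error terms, \<open>KD M\<close> is a
  lower bound for the normalizing constant, and \<open>K1\<close>, \<open>K2\<close> are the constants of the two bounds.
\<close>
definition KM1 where "KM1 = 3 * (cmom 2 + mom 16 + mom 8)"
definition KM2 where "KM2 = mom 4 + 27 * (cmom 4 + mom 32 + mom 16)"
definition KM3 where "KM3 = mom 4 + cmom 2"
definition KM4 where "KM4 = 2 * mom 4 + cmom 6 + mom 48"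

text \<open>Chosen so that 2 e3^2, e4^2 and 2 e4^4 are all at most \<open>KN M * S\<close>; the M^2
  pays for replacing one factor e4^2.\<close>

definition KN :: "real \<Rightarrow> real" where "KN M = 2 * (1 + M\<^sup>2)"
definition KD :: "real \<Rightarrow> real" where "KD M = exp (- M\<^sup>2 / 6) / 2"

text \<open>Collects what the two bounds share: the parts outside the ball, and the shift times the
  error of the normalizing constant. The latter occurs with a factor M for the first bound, where e3
  is estimated by M, and without it for the second, where e3 is kept.\<close>

definition KR :: "real \<Rightarrow> real" where
  "KR M = (M * (1 + KM3) + 5) + (1 + KM3) * (M * KN M * (2 + KM1) + KN M * (2 + KM1) + 6 * M)"

definition K1 :: "real \<Rightarrow> real" where "K1 M = (KN M * (2 + KM2) + KR M) / KD M"

definition K2 :: "real \<Rightarrow> real" where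
  "K2 M = (2 * KN M * (2 + KM4) + (mom 2 + mom 10) + 2 * (mom 2 + cmom 2 + mom 16) + KR M) / KD M"

lemma KM_nonneg: "KM1 \<ge> 0" "KM2 \<ge> 0" "KM3 \<ge> 0" "KM4 \<ge> 0"
  unfolding KM1_def KM2_def KM3_def KM4_def
  by (intro add_nonneg_nonneg mult_nonneg_nonneg less_imp_le[OF mom_pos] less_imp_le[OF cmom_pos]; simp)+

lemma KN_pos: "KN M > 0" by (simp add: KN_def add_pos_nonneg)
lemma KD_pos: "KD M > 0" by (simp add: KD_def)

lemma KR_nonneg: "M \<ge> 0 \<Longrightarrow> KR M \<ge> 0"
  using KM_nonneg KN_pos[of M] by (auto simp: KR_def intro!: add_nonneg_nonneg mult_nonneg_nonneg)

lemma K1_pos: "M \<ge> 0 \<Longrightarrow> K1 M > 0"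
  using KM_nonneg KN_pos[of M] KD_pos[of M] KR_nonneg[of M]
  by (auto simp: K1_def intro!: divide_pos_pos add_pos_nonneg mult_pos_pos)

lemma K2_pos: "M \<ge> 0 \<Longrightarrow> K2 M > 0"
  using KM_nonneg KN_pos[of M] KD_pos[of M] KR_nonneg[of M] mom_pos cmom_pos
  by (auto simp: K2_def intro!: divide_pos_pos add_pos_nonneg mult_pos_pos add_nonneg_nonneg mult_nonneg_nonneg less_imp_le)

text \<open>
  \<open>w\<close> is the unnormalized posterior density in whitened coordinates; \<open>r\<close> is the Taylor
  remainder of order 4 of the potential.
\<close>
locale laplace_core =
  fixes d :: nat and t :: "nat \<Rightarrow> nat \<Rightarrow> nat \<Rightarrow> real" and e3 e4 s c0 M :: real
    and w r :: "(nat \<Rightarrow> real) \<Rightarrow> real"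
  assumes d1: "d \<ge> 1" and e3: "0 \<le> e3" "e3 \<le> M" and e4: "0 \<le> e4" "e4 \<le> M"
    and c0: "0 < c0" "c0 \<le> 1" and s12: "s \<ge> 12" and slog: "s \<ge> 8 / c0 * ln (2 * exp 1 / c0)"
    and cub: "\<And>y. \<bar>cub d t y\<bar> \<le> e3 / d * nrm d y ^ 3"
    and rm [measurable]: "r \<in> borel_measurable (Leb d)"
    and r: "\<And>y. nrm d y \<le> s * sqrt d \<Longrightarrow> \<bar>r y\<bar> \<le> (e4 / d)\<^sup>2 / 24 * nrm d y ^ 4"
    and wm [measurable]: "w \<in> borel_measurable (Leb d)" and w0: "\<And>y. 0 \<le> w y"
    and w_in: "\<And>y. nrm d y \<le> s * sqrt d \<Longrightarrow> w y = exp (- (nrm d y)\<^sup>2 / 2 - cub d t y / 6 - r y)"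
    and w_out: "\<And>y. s * sqrt d < nrm d y \<Longrightarrow> w y \<le> exp (- c0 * (sqrt d * nrm d y))"
begin

text \<open>
  \<open>\<psi>\<close> is the density relative to the Gaussian, cut off to the ball. The moments of \<open>\<rho>\<close> and
  \<open>\<phi>\<close> are bounded uniformly in \<open>d\<close>.
\<close>
definition f where "f y = cub d t y / 6"
definition b :: "(nat \<Rightarrow> real) \<Rightarrow> real" where "b y = of_bool (nrm d y \<le> s * sqrt d)"
definition \<psi> where "\<psi> y = b y * exp (- (f y + r y))"
definition \<rho> where "\<rho> y = ((nrm d y)\<^sup>2 / d)\<^sup>2"
definition \<phi> where "\<phi> y = (if e3 = 0 then 0 else \<bar>f y\<bar> / e3)"
definition E where "E = exp ((e3\<^sup>2 + e4\<^sup>2) * s ^ 4)"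
definition \<beta> where "\<beta> = exp (- c0 * s * d / 8)"
definition Z where "Z = sqrt (2 * pi) ^ d"

abbreviation Ex :: "((nat \<Rightarrow> real) \<Rightarrow> real) \<Rightarrow> real" where "Ex F \<equiv> (\<integral>y. F y \<partial>gam d)"

lemma d0: "real d > 0" using d1 by simp
lemma M0: "M \<ge> 0" using e3 by simp
lemma E1: "E \<ge> 1" by (simp add: E_def)
lemma beta_pos: "\<beta> > 0" by (simp add: \<beta>_def)
lemma beta_le1: "\<beta> \<le> 1" using c0 s12 d0 by (simp add: \<beta>_def)

lemma b_cases: "b y = 0 \<or> b y = 1" by (simp add: b_def)
lemma b0: "b y \<ge> 0" "b y \<le> 1" by (auto simp: b_def)

lemma measurable_fbp [measurable]:
  "f \<in> borel_measurable (Leb d)" "b \<in> borel_measurable (Leb d)" "\<psi> \<in> borel_measurable (Leb d)"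
  "\<rho> \<in> borel_measurable (Leb d)" "\<phi> \<in> borel_measurable (Leb d)"
proof -
  show f [measurable]: "f \<in> borel_measurable (Leb d)" unfolding f_def by measurable
  show b [measurable]: "b \<in> borel_measurable (Leb d)" unfolding b_def by measurable
  show "\<psi> \<in> borel_measurable (Leb d)" unfolding \<psi>_def by measurable
  show "\<rho> \<in> borel_measurable (Leb d)" unfolding \<rho>_def by measurable
  show "\<phi> \<in> borel_measurable (Leb d)" unfolding \<phi>_def by (cases "e3 = 0") auto
qed

text \<open>If e3 = 0, the cubic form vanishes identically, which matches the default value in
  \<open>\<phi>\<close>.\<close>

lemma f_eq: "\<bar>f y\<bar> = e3 * \<phi> y"
  using cub[of y] by (auto simp: \<phi>_def f_def)

lemma phi0: "\<phi> y \<ge> 0" using e3 by (simp add: \<phi>_def)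
lemma rho0: "\<rho> y \<ge> 0" by (simp add: \<rho>_def)

lemma r_le: "b y * \<bar>r y\<bar> \<le> e4\<^sup>2 * \<rho> y / 24"
proof (cases "nrm d y \<le> s * sqrt d")
  case True
  have "(nrm d y)\<^sup>2 ^ 2 = nrm d y ^ 4" by (simp add: power_mult[symmetric])
  then have "(e4 / d)\<^sup>2 / 24 * nrm d y ^ 4 = e4\<^sup>2 * \<rho> y / 24"
    by (simp add: \<rho>_def power_divide)
  then show ?thesis using r[OF True] True by (simp add: b_def)
next
  case False then show ?thesis using rho0 by (simp add: b_def)
qed

lemma r_le': "b y * \<bar>r y\<bar> \<le> e4\<^sup>2 * \<rho> y"
proof -
  have "0 \<le> e4\<^sup>2 * \<rho> y" using rho0 by simp
  then show ?thesis using r_le[of y] by linarith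
qed

lemma rho_le: "b y * \<rho> y \<le> s ^ 4"
proof (cases "nrm d y \<le> s * sqrt d")
  case True
  then have "(nrm d y)\<^sup>2 \<le> (s * sqrt d)\<^sup>2" by (intro power_mono) auto
  then have "(nrm d y)\<^sup>2 / d \<le> s\<^sup>2" using d0 by (simp add: power_mult_distrib divide_le_eq)
  then have "\<rho> y \<le> (s\<^sup>2)\<^sup>2" unfolding \<rho>_def by (intro power_mono) auto
  then show ?thesis using True by (simp add: b_def power_mult[symmetric])
qed (simp add: b_def)

lemma am_f: "all_moments d f" unfolding f_def by (intro am_divide am_cub)
lemma am_rho: "all_moments d \<rho>" unfolding \<rho>_def by (intro am_power am_divide am_nrm_sq)
lemma am_phi: "all_moments d \<phi>"
proof (cases "e3 = 0")
  case False then show ?thesis unfolding \<phi>_def by simp (intro am_divide am_abs am_f)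
next
  case True then show ?thesis unfolding \<phi>_def by auto
qed

lemmas am_all = am_f am_rho am_phi am_const am_add am_mult am_abs am_power am_divide am_dotp

lemma f_bound_b: "b y * \<bar>f y\<bar> \<le> e3 / d * (s * sqrt d) ^ 3"
proof (cases "nrm d y \<le> s * sqrt d")
  case True
  have "\<bar>f y\<bar> \<le> \<bar>cub d t y\<bar>" by (simp add: f_def)
  also have "\<dots> \<le> e3 / d * nrm d y ^ 3" by (rule cub)
  also have "\<dots> \<le> e3 / d * (s * sqrt d) ^ 3" using True e3 by (intro mult_left_mono power_mono) auto
  finally show ?thesis using True by (simp add: b_def)
qed (use e3 s12 in \<open>simp add: b_def\<close>)

lemma r_bound_b: "\<bar>b y * r y\<bar> \<le> e4\<^sup>2 * s ^ 4"
proof -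
  have "\<bar>b y * r y\<bar> = b y * (b y * \<bar>r y\<bar>)" using b_cases[of y] by (auto simp: abs_mult)
  also have "\<dots> \<le> b y * (e4\<^sup>2 * \<rho> y)" by (intro mult_left_mono r_le' b0)
  also have "\<dots> = e4\<^sup>2 * (b y * \<rho> y)" by simp
  also have "\<dots> \<le> e4\<^sup>2 * s ^ 4" by (intro mult_left_mono rho_le) simp
  finally show ?thesis .
qed

lemma psi0: "\<psi> y \<ge> 0" using b0 by (simp add: \<psi>_def)

text \<open>Grows with d and serves integrability; the quantitative control of \<open>\<psi>\<close>
  is \<open>psi_sq\<close>.\<close>

lemma psi_bound: "\<bar>\<psi> y\<bar> \<le> exp (e3 / d * (s * sqrt d) ^ 3 + e4\<^sup>2 * s ^ 4)"
proof (cases "b y = 0")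
  case False
  then have b: "b y = 1" using b_cases[of y] by simp
  have "- (f y + r y) \<le> e3 / d * (s * sqrt d) ^ 3 + e4\<^sup>2 * s ^ 4"
    using f_bound_b[of y] r_bound_b[of y] by (simp only: b mult_1)
  then show ?thesis by (simp add: \<psi>_def b)
qed (simp add: \<psi>_def)

lemma b_bound: "\<bar>b y\<bar> \<le> 1" "\<bar>1 - b y\<bar> \<le> 1" using b_cases[of y] by auto

lemmas int_psi = integrable_am_bounded[OF _ measurable_fbp(3) psi_bound]
lemmas int_b = integrable_am_bounded[OF _ measurable_fbp(2) b_bound(1)]

lemma int_1b: "all_moments d F \<Longrightarrow> integrable (gam d) (\<lambda>y. F y * (1 - b y))"
  by (rule integrable_am_bounded[OF _ _ b_bound(2)]) auto

lemma int_br: "all_moments d F \<Longrightarrow> integrable (gam d) (\<lambda>y. F y * (b y * r y))"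
  by (rule integrable_am_bounded[OF _ _ r_bound_b]) auto

text \<open>This is \<open>cub_moment\<close> with \<kappa> = e3 / d: the product \<kappa> d equals
  e3, so d cancels.\<close>

lemma phi_moment: "Ex (\<lambda>y. \<phi> y ^ (2 * k)) \<le> cmom k"
proof (cases "e3 = 0")
  case True
  have "cmom k \<ge> 0" using cmom_pos[of k] by simp
  show ?thesis
  proof (cases "k = 0")
    case True
    interpret prob_space "gam d" by (rule prob_space_gam)
    \<comment> \<open>For k = 0 the integrand is 1 although \<open>\<phi>\<close> vanishes, so
      \<open>cmom 0\<close> has to be at least 1.\<close>
    have "1 \<le> 2 * exp (1/2::real)" using exp_ge_add_one_self[of "1/2"] by linarith
    then have "1 * 1 \<le> (2 * exp (1/2::real)) * (2 * exp (1/2))" by (intro mult_mono) auto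
    then have "1 \<le> cmom 0" unfolding cmom_def mom_def by simp
    then show ?thesis using True prob_space by simp
  next
    case False
    then show ?thesis unfolding \<phi>_def using \<open>e3 = 0\<close> \<open>cmom k \<ge> 0\<close> by (simp add: power_0_left)
  qed
next
  case False
  have "(\<integral>\<^sup>+y. ennreal (\<bar>cub d t y\<bar> ^ (2 * k)) \<partial>gam d) \<le> ennreal (cmom k * (e3 / d * d) ^ (2 * k))"
    by (rule cub_moment[OF d1 cub])
  then have m: "Ex (\<lambda>y. \<bar>cub d t y\<bar> ^ (2 * k)) \<le> cmom k * e3 ^ (2 * k)"
    using d0 cmom_pos[of k] e3 by (intro integrable_nn_le(2)) auto
  have i: "integrable (gam d) (\<lambda>y. \<bar>cub d t y\<bar> ^ (2 * k))"
    by (intro am_integrable am_power am_abs am_cub)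
  have "Ex (\<lambda>y. \<phi> y ^ (2 * k)) \<le> Ex (\<lambda>y. \<bar>cub d t y\<bar> ^ (2 * k) / e3 ^ (2 * k))"
  proof (rule integral_mono)
    show "integrable (gam d) (\<lambda>y. \<phi> y ^ (2 * k))" by (intro am_integrable am_power am_phi)
    show "integrable (gam d) (\<lambda>y. \<bar>cub d t y\<bar> ^ (2 * k) / e3 ^ (2 * k))" using i by simp
    fix y
    have "\<bar>f y\<bar> ^ (2 * k) \<le> \<bar>cub d t y\<bar> ^ (2 * k)" by (intro power_mono) (auto simp: f_def)
    then show "\<phi> y ^ (2 * k) \<le> \<bar>cub d t y\<bar> ^ (2 * k) / e3 ^ (2 * k)"
      using False e3 by (simp add: \<phi>_def power_divide divide_right_mono)
  qed
  also have "\<dots> = Ex (\<lambda>y. \<bar>cub d t y\<bar> ^ (2 * k)) / e3 ^ (2 * k)" by simp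
  also have "\<dots> \<le> cmom k * e3 ^ (2 * k) / e3 ^ (2 * k)"
    using m e3 by (intro divide_right_mono) auto
  also have "\<dots> = cmom k" using False by simp
  finally show ?thesis .
qed

lemma nrm_moment: "Ex (\<lambda>y. ((nrm d y)\<^sup>2 / d) ^ k) \<le> mom (2 * k)"
  using nn_integral_gam_nrm[OF d1, of k] mom_pos[of "2 * k"] by (intro integrable_nn_le(2)) auto

lemma rho_moment: "Ex (\<lambda>y. \<rho> y ^ k) \<le> mom (4 * k)"
  using nrm_moment[of "2 * k"] by (simp add: \<rho>_def power_mult)

lemma dotp_moment: "nrm d u = 1 \<Longrightarrow> Ex (\<lambda>y. \<bar>dotp d u y\<bar> ^ k) \<le> mom k"
  using nn_integral_gam_dotp[of d u k] mom_pos[of k] by (intro integrable_nn_le(2)) auto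

text \<open>The coefficient 1/3 comes from squaring exp (- cub / 6), and 73/72 = 1 + 2/144 from s >=
  12. The numerical factor is about 1.98; the 2 on the right is the exponent that E^2
  allows.\<close>

lemma psi_sq_numeric:
  "(1/3)\<^sup>2 * (pi\<^sup>2 / 8) * (15/4 * (e3 / d) * (s\<^sup>2 * d + 2 * d))\<^sup>2 \<le> 2 * (e3\<^sup>2 * s ^ 4)"
proof -
  have e: "15/4 * (e3 / d) * (s\<^sup>2 * d + 2 * d) = 15/4 * e3 * (s\<^sup>2 + 2)" using d0 by (simp add: field_simps)
  have "12\<^sup>2 \<le> s\<^sup>2" using s12 by (intro power_mono) auto
  then have "s\<^sup>2 + 2 \<le> 73/72 * s\<^sup>2" by simp
  then have "(s\<^sup>2 + 2)\<^sup>2 \<le> (73/72 * s\<^sup>2)\<^sup>2" by (intro power_mono) auto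
  also have "\<dots> = (73/72)\<^sup>2 * s ^ 4" by (simp only: power_mult_distrib) (simp add: power_mult[symmetric])
  finally have s4: "(s\<^sup>2 + 2)\<^sup>2 \<le> (73/72)\<^sup>2 * s ^ 4" .
  have "pi \<le> 3.1416" using pi_approx by simp
  then have "pi\<^sup>2 \<le> 3.1416\<^sup>2" using pi_gt_zero by (intro power_mono) auto
  then have p: "(1/3)\<^sup>2 * (pi\<^sup>2 / 8) * (15/4)\<^sup>2 * (73/72)\<^sup>2 \<le> 2" by (simp add: power2_eq_square)
  have "(1/3)\<^sup>2 * (pi\<^sup>2 / 8) * (15/4 * e3 * (s\<^sup>2 + 2))\<^sup>2 = ((1/3)\<^sup>2 * (pi\<^sup>2 / 8) * (15/4)\<^sup>2 * e3\<^sup>2) * (s\<^sup>2 + 2)\<^sup>2"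
    by (simp only: power_mult_distrib mult_ac)
  also have "\<dots> \<le> ((1/3)\<^sup>2 * (pi\<^sup>2 / 8) * (15/4)\<^sup>2 * e3\<^sup>2) * ((73/72)\<^sup>2 * s ^ 4)"
    by (intro mult_left_mono s4) auto
  also have "\<dots> = ((1/3)\<^sup>2 * (pi\<^sup>2 / 8) * (15/4)\<^sup>2 * (73/72)\<^sup>2) * (e3\<^sup>2 * s ^ 4)" by (simp only: mult_ac)
  also have "\<dots> \<le> 2 * (e3\<^sup>2 * s ^ 4)" by (intro mult_right_mono p) auto
  finally show ?thesis unfolding e .
qed

text \<open>The factor \<open>E\<close> enters here, through the exponential moment of the cubic form on the ball.\<close>
lemma psi_sq: "integrable (gam d) (\<lambda>y. (\<psi> y)\<^sup>2)" "Ex (\<lambda>y. (\<psi> y)\<^sup>2) \<le> 2 * E\<^sup>2"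
proof -
  have le: "(\<psi> y)\<^sup>2 \<le> exp (2 * (e4\<^sup>2 * s ^ 4)) * (exp (- (1/3) * cub d t y) * of_bool ((nrm d y)\<^sup>2 \<le> s\<^sup>2 * d))" for y
  proof (cases "b y = 0")
    case False
    then have b: "b y = 1" "nrm d y \<le> s * sqrt d" by (auto simp: b_def split: if_splits)
    have "(nrm d y)\<^sup>2 \<le> (s * sqrt d)\<^sup>2" using b(2) by (intro power_mono) auto
    then have n: "(nrm d y)\<^sup>2 \<le> s\<^sup>2 * d" by (simp add: power_mult_distrib)
    have "(\<psi> y)\<^sup>2 = exp (2 * (- (f y + r y)))" by (simp only: \<psi>_def b mult_1 exp_double)
    also have "\<dots> \<le> exp (2 * (e4\<^sup>2 * s ^ 4) + - (1/3) * cub d t y)"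
      using r_bound_b[of y] by (simp add: b f_def)
    finally show ?thesis using n by (simp only: exp_add of_bool_eq mult_1_right)
  qed (simp add: \<psi>_def)
  let ?R = "exp ((1/3)\<^sup>2 * (pi\<^sup>2 / 8) * (15/4 * (e3 / d) * (s\<^sup>2 * d + 2 * d))\<^sup>2)"
  have "(\<integral>\<^sup>+y. ennreal ((\<psi> y)\<^sup>2) \<partial>gam d) \<le>
     (\<integral>\<^sup>+y. ennreal (exp (2 * (e4\<^sup>2 * s ^ 4))) * ennreal (exp (- (1/3) * cub d t y) * of_bool ((nrm d y)\<^sup>2 \<le> s\<^sup>2 * d)) \<partial>gam d)"
    using le by (intro nn_integral_mono) (simp add: ennreal_mult[symmetric] ennreal_leI)
  also have "\<dots> = ennreal (exp (2 * (e4\<^sup>2 * s ^ 4))) * (\<integral>\<^sup>+y. ennreal (exp (- (1/3) * cub d t y) * of_bool ((nrm d y)\<^sup>2 \<le> s\<^sup>2 * d)) \<partial>gam d)"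
    by (intro nn_integral_cmult) measurable
  also have "\<dots> \<le> ennreal (exp (2 * (e4\<^sup>2 * s ^ 4))) * ennreal (2 * ?R)"
    by (intro mult_left_mono cub_exp_moment[OF d1 cub]) auto
  also have "\<dots> = ennreal (exp (2 * (e4\<^sup>2 * s ^ 4)) * (2 * ?R))" by (rule ennreal_mult[symmetric]) auto
  also have "\<dots> \<le> ennreal (exp (2 * (e4\<^sup>2 * s ^ 4)) * (2 * exp (2 * (e3\<^sup>2 * s ^ 4))))"
    using psi_sq_numeric by (intro ennreal_leI mult_left_mono) auto
  also have "exp (2 * (e4\<^sup>2 * s ^ 4)) * (2 * exp (2 * (e3\<^sup>2 * s ^ 4))) = 2 * E\<^sup>2"
    by (simp add: E_def power2_eq_square mult_exp_exp algebra_simps)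
  finally have *: "(\<integral>\<^sup>+y. ennreal ((\<psi> y)\<^sup>2) \<partial>gam d) \<le> ennreal (2 * E\<^sup>2)" .
  show "integrable (gam d) (\<lambda>y. (\<psi> y)\<^sup>2)" "Ex (\<lambda>y. (\<psi> y)\<^sup>2) \<le> 2 * E\<^sup>2"
    by (rule integrable_nn_le[OF _ _ *]; simp)+
qed

text \<open>Young's inequality for h times \<open>\<psi>\<close> with weight E: the second moment of
  \<open>\<psi>\<close> is of order E^2 and enters divided by E, so the total cost is E and not
  E^2.\<close>

lemma weighted:
  assumes h: "all_moments d h" "\<And>y. h y \<ge> 0" and c: "Ex (\<lambda>y. (h y)\<^sup>2) \<le> c"
  shows "integrable (gam d) (\<lambda>y. h y * (b y + \<psi> y))" "Ex (\<lambda>y. h y * (b y + \<psi> y)) \<le> E * (2 + c)"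
proof -
  show i: "integrable (gam d) (\<lambda>y. h y * (b y + \<psi> y))"
    using int_b[OF h(1)] int_psi[OF h(1)] by (simp add: distrib_left)
  have E0: "E > 0" using E1 by linarith
  have ih: "integrable (gam d) (\<lambda>y. (h y)\<^sup>2)" by (intro am_integrable am_power h)
  interpret prob_space "gam d" by (rule prob_space_gam)
  have c0: "c \<ge> 0" using order_trans[OF integral_nonneg_AE c] by simp
  have "Ex (\<lambda>y. h y * (b y + \<psi> y)) \<le> Ex (\<lambda>y. (1/2 + (1/2) * (h y)\<^sup>2) + ((E/2) * (h y)\<^sup>2 + (1/(2*E)) * (\<psi> y)\<^sup>2))"
  proof (rule integral_mono[OF i])
    show "integrable (gam d) (\<lambda>y. (1/2 + (1/2) * (h y)\<^sup>2) + ((E/2) * (h y)\<^sup>2 + (1/(2*E)) * (\<psi> y)\<^sup>2))"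
      using ih psi_sq by auto
    fix y
    have "h y * b y \<le> h y" using h(2)[of y] b0[of y] by (simp add: mult_left_le)
    moreover have "2 * h y \<le> 1 + (h y)\<^sup>2" using two_mult_le_squares[of 1 "h y"] by simp
    moreover have "2 * (E * h y * \<psi> y) \<le> (E * h y)\<^sup>2 + (\<psi> y)\<^sup>2" by (rule two_mult_le_squares)
    then have "(2 * (E * h y * \<psi> y)) / (2 * E) \<le> ((E * h y)\<^sup>2 + (\<psi> y)\<^sup>2) / (2 * E)" using E0 by (intro divide_right_mono) auto
    then have "h y * \<psi> y \<le> (E/2) * (h y)\<^sup>2 + (1/(2*E)) * (\<psi> y)\<^sup>2"
      using E0 by (simp add: add_divide_distrib power2_eq_square mult_ac)
    ultimately show "h y * (b y + \<psi> y) \<le> (1/2 + (1/2) * (h y)\<^sup>2) + ((E/2) * (h y)\<^sup>2 + (1/(2*E)) * (\<psi> y)\<^sup>2)"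
      unfolding distrib_left by linarith
  qed
  also have "\<dots> = (1/2 + (1/2) * Ex (\<lambda>y. (h y)\<^sup>2)) + ((E/2) * Ex (\<lambda>y. (h y)\<^sup>2) + (1/(2*E)) * Ex (\<lambda>y. (\<psi> y)\<^sup>2))"
    using ih psi_sq prob_space by (simp add: Bochner_Integration.integral_add)
  also have "\<dots> \<le> (1/2 + (1/2) * c) + ((E/2) * c + (1/(2*E)) * (2 * E\<^sup>2))"
    using c psi_sq E0 by (intro add_mono mult_left_mono order_refl) auto
  also have "\<dots> = 1/2 + c/2 + E * c / 2 + E" using E0 by (simp add: power2_eq_square)
  also have "\<dots> \<le> E * (2 + c)"
  proof -
    have "c \<le> E * c" using E1 c0 by (simp add: mult_right_mono[of 1 E c, simplified])
    then show ?thesis using E1 by (simp add: algebra_simps)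
  qed
  finally show "Ex (\<lambda>y. h y * (b y + \<psi> y)) \<le> E * (2 + c)" .
qed

text \<open>Chernoff's bound with exp of a quarter of the squared norm; sqrt 2 ^ d is absorbed since
  s >= 12. The bound is the square of \<open>\<beta>\<close> because \<open>weighted_tail\<close>
  loses a square root.\<close>

lemma gauss_tail: "Ex (\<lambda>y. 1 - b y) \<le> \<beta>\<^sup>2"
proof -
  have "(\<integral>\<^sup>+y. ennreal (1 - b y) \<partial>gam d) \<le> (\<integral>\<^sup>+y. ennreal (exp (- (s\<^sup>2 * d / 4))) * ennreal (exp ((nrm d y)\<^sup>2 / 4)) \<partial>gam d)"
  proof (intro nn_integral_mono)
    fix y
    have "1 - b y \<le> exp ((nrm d y)\<^sup>2 / 4 - s\<^sup>2 * d / 4)"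
    proof (cases "nrm d y \<le> s * sqrt d")
      case False
      then have "(s * sqrt d)\<^sup>2 \<le> (nrm d y)\<^sup>2" using s12 by (intro power_mono) auto
      then have "0 \<le> (nrm d y)\<^sup>2 / 4 - s\<^sup>2 * d / 4" by (simp add: power_mult_distrib)
      then have "1 \<le> exp ((nrm d y)\<^sup>2 / 4 - s\<^sup>2 * d / 4)" by simp
      then show ?thesis using b0[of y] by linarith
    qed (simp add: b_def)
    also have "\<dots> = exp (- (s\<^sup>2 * d / 4)) * exp ((nrm d y)\<^sup>2 / 4)" by (simp add: exp_add[symmetric])
    finally show "ennreal (1 - b y) \<le> ennreal (exp (- (s\<^sup>2 * d / 4))) * ennreal (exp ((nrm d y)\<^sup>2 / 4))"
      by (simp add: ennreal_mult[symmetric] ennreal_leI)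
  qed
  also have "\<dots> = ennreal (exp (- (s\<^sup>2 * d / 4))) * ennreal (sqrt 2 ^ d)"
    by (subst nn_integral_cmult) (auto simp: nn_integral_gam_exp_sq)
  also have "\<dots> = ennreal (exp (- (s\<^sup>2 * d / 4)) * sqrt 2 ^ d)" by (rule ennreal_mult[symmetric]) auto
  also have "\<dots> \<le> ennreal (\<beta>\<^sup>2)"
  proof (rule ennreal_leI)
    have "sqrt 2 \<le> exp 1"
    proof -
      have "sqrt 2 \<le> sqrt (2\<^sup>2)" by (intro real_sqrt_le_mono) simp
      then show ?thesis using exp_ge_add_one_self[of 1] by simp
    qed
    then have "sqrt 2 ^ d \<le> exp 1 ^ d" by (intro power_mono) auto
    also have "\<dots> = exp (real d)" by (simp add: exp_of_nat_mult[symmetric])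
    finally have "exp (- (s\<^sup>2 * d / 4)) * sqrt 2 ^ d \<le> exp (- (s\<^sup>2 * d / 4)) * exp d" by (intro mult_left_mono) auto
    also have "\<dots> = exp ((1 - s\<^sup>2 / 4) * d)" by (simp add: exp_add[symmetric] algebra_simps)
    also have "\<dots> \<le> exp (- c0 * s / 4 * d)"
    proof -
      have "12 * s \<le> s * s" using s12 by (intro mult_right_mono) auto
      moreover have "c0 * s \<le> 1 * s" using c0 s12 by (intro mult_right_mono) auto
      moreover have "- c0 * s / 4 = - (c0 * s) / 4" by simp
      ultimately have "1 - s\<^sup>2 / 4 \<le> - c0 * s / 4" unfolding power2_eq_square using s12 by linarith
      then have "(1 - s\<^sup>2 / 4) * d \<le> (- c0 * s / 4) * d" using d0 by (intro mult_right_mono) auto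
      then show ?thesis by simp
    qed
    also have "\<dots> = \<beta>\<^sup>2" by (simp add: \<beta>_def exp_double[symmetric] mult_ac)
    finally show "exp (- (s\<^sup>2 * d / 4)) * sqrt 2 ^ d \<le> \<beta>\<^sup>2" .
  qed
  finally show ?thesis using b0 by (intro integrable_nn_le(2)) auto
qed

text \<open>Young's inequality with weight \<open>\<beta>\<close>, which balances the second moment
  of h against the tail mass of order \<beta>^2.\<close>

lemma weighted_tail:
  assumes h: "all_moments d h" "\<And>y. h y \<ge> 0" and c: "Ex (\<lambda>y. (h y)\<^sup>2) \<le> c"
  shows "Ex (\<lambda>y. h y * (1 - b y)) \<le> (1 + c) * \<beta>"
proof -
  have ih: "integrable (gam d) (\<lambda>y. (h y)\<^sup>2)" by (intro am_integrable am_power h)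
  have ib: "integrable (gam d) (\<lambda>y. 1 - b y)" using int_1b[OF am_const[of d 1]] by simp
  have c0: "c \<ge> 0" using order_trans[OF integral_nonneg_AE c] by simp
  have "Ex (\<lambda>y. h y * (1 - b y)) \<le> Ex (\<lambda>y. (\<beta>/2) * (h y)\<^sup>2 + (1/(2*\<beta>)) * (1 - b y))"
  proof (rule integral_mono[OF int_1b[OF h(1)]])
    show "integrable (gam d) (\<lambda>y. (\<beta>/2) * (h y)\<^sup>2 + (1/(2*\<beta>)) * (1 - b y))" using ih ib by auto
    fix y
    show "h y * (1 - b y) \<le> (\<beta>/2) * (h y)\<^sup>2 + (1/(2*\<beta>)) * (1 - b y)"
    proof (cases "b y = 1")
      case False
      then have b: "b y = 0" using b_cases[of y] by simp
      have "2 * (\<beta> * h y * 1) \<le> (\<beta> * h y)\<^sup>2 + 1\<^sup>2" by (rule two_mult_le_squares)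
      then have "(2 * (\<beta> * h y)) / (2 * \<beta>) \<le> ((\<beta> * h y)\<^sup>2 + 1) / (2 * \<beta>)" using beta_pos by (intro divide_right_mono) auto
      then show ?thesis using beta_pos b by (simp add: add_divide_distrib power2_eq_square mult_ac)
    qed (use beta_pos in simp)
  qed
  also have "\<dots> = (\<beta>/2) * Ex (\<lambda>y. (h y)\<^sup>2) + (1/(2*\<beta>)) * Ex (\<lambda>y. 1 - b y)"
    using ih ib by (subst Bochner_Integration.integral_add) auto
  also have "\<dots> \<le> (\<beta>/2) * c + (1/(2*\<beta>)) * \<beta>\<^sup>2"
    using c gauss_tail beta_pos by (intro add_mono mult_left_mono) auto
  also have "\<dots> = (1 + c) * \<beta> / 2" using beta_pos by (simp add: power2_eq_square algebra_simps)
  also have "\<dots> \<le> (1 + c) * \<beta>" using c0 beta_pos by simp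
  finally show ?thesis .
qed

text \<open>With q = exp (- c0 s / 8) the exponential is q^(4 d). One factor q^d is
  \<open>\<beta>\<close>. The lower bound on s gives q <= c0 / (2 e), so the other three factors q^d
  pay for (8 / c0)^d and leave c0^d, which cancels the remaining 1 / c0.\<close>

lemma outer_numeric: "exp (- (c0 * s * d) / 2) * (5 / c0) * (8 / c0) ^ d \<le> 5 * \<beta>"
proof -
  define q where "q = exp (- (c0 * s / 8))"
  have q0: "q > 0" by (simp add: q_def)
  have "ln (2 * exp 1 / c0) \<le> c0 * s / 8" using slog c0 by (simp add: field_simps)
  then have "q \<le> exp (- ln (2 * exp 1 / c0))" by (simp add: q_def)
  also have "\<dots> = c0 / (2 * exp 1)" using c0 by (simp add: exp_minus)
  finally have q: "q \<le> c0 / (2 * exp 1)" .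
  have "q ^ 3 \<le> (c0 / (2 * exp 1)) ^ 3" using q q0 by (intro power_mono) auto
  also have "\<dots> \<le> (c0 / 2) ^ 3"
    using c0 by (intro power_mono divide_left_mono) (auto simp: one_le_exp_iff[of 1, simplified])
  finally have "q ^ 3 * (8 / c0) \<le> (c0 / 2) ^ 3 * (8 / c0)" using c0 by (intro mult_right_mono) auto
  also have "\<dots> = c0\<^sup>2" using c0 by (simp add: power2_eq_square power3_eq_cube)
  also have "\<dots> \<le> c0" using c0 by (simp add: power2_eq_square mult_left_le)
  finally have q3: "q ^ 3 * (8 / c0) \<le> c0" .
  have "exp (- (c0 * s * d) / 2) = q ^ (4 * d)" by (simp add: q_def exp_of_nat_mult[symmetric] mult_ac)
  also have "\<dots> = \<beta> * (q ^ 3) ^ d"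
  proof -
    have "\<beta> = q ^ d" by (simp add: \<beta>_def q_def exp_of_nat_mult[symmetric] mult_ac)
    then show ?thesis by (simp add: power_mult[symmetric] power_add[symmetric])
  qed
  finally have "exp (- (c0 * s * d) / 2) * (5 / c0) * (8 / c0) ^ d = \<beta> * (5 / c0) * (q ^ 3 * (8 / c0)) ^ d"
    by (simp only: power_mult_distrib mult_ac)
  also have "\<dots> \<le> \<beta> * (5 / c0) * c0 ^ d"
    using q3 q0 c0 beta_pos by (intro mult_left_mono power_mono) auto
  also have "\<dots> \<le> \<beta> * (5 / c0) * c0 ^ 1"
    using c0 beta_pos d1 by (intro mult_left_mono power_decreasing) auto
  also have "\<dots> = 5 * \<beta>" using c0 by simp
  finally show ?thesis .
qed

text \<open>The decay exp (- a) with a = c0 sqrt d times the norm is split into portions 1/2, 1/4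
  and 1/4: the first gives the smallness on the exterior, the second absorbs the factor 1 + norm,
  the third is integrated.\<close>

lemma outer_tail:
  "integrable (Leb d) (\<lambda>y. (1 - b y) * (1 + nrm d y) * w y)"
  "(\<integral>y. (1 - b y) * (1 + nrm d y) * w y \<partial>Leb d) \<le> 5 * \<beta>"
proof -
  have "(\<integral>\<^sup>+y. ennreal ((1 - b y) * (1 + nrm d y) * w y) \<partial>Leb d) \<le>
     (\<integral>\<^sup>+y. ennreal (exp (- (c0 * s * d) / 2) * (5 / c0)) * ennreal (exp (- (c0 / 4) * (sqrt d * nrm d y))) \<partial>Leb d)"
  proof (intro nn_integral_mono)
    fix y
    have "(1 - b y) * (1 + nrm d y) * w y \<le> (exp (- (c0 * s * d) / 2) * (5 / c0)) * exp (- (c0 / 4) * (sqrt d * nrm d y))"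
    proof (cases "nrm d y \<le> s * sqrt d")
      case False
      define a where "a = c0 * (sqrt d * nrm d y)"
      have a0: "a \<ge> 0" using c0 by (simp add: a_def)
      have "sqrt d * (s * sqrt d) \<le> sqrt d * nrm d y" using False by (intro mult_left_mono) auto
      then have "c0 * (s * d) \<le> a" unfolding a_def using c0 by (intro mult_left_mono) (auto simp: mult_ac)
      then have e1: "exp (- a / 2) \<le> exp (- (c0 * s * d) / 2)" by (simp add: mult_ac)
      have e2: "(1 + nrm d y) * exp (- a / 4) \<le> 5 / c0"
      proof -
        have "1 \<le> sqrt d" using d1 by simp
        then have "1 * nrm d y \<le> sqrt d * nrm d y" by (intro mult_right_mono) auto
        then have n: "c0 * nrm d y \<le> a" unfolding a_def using c0 by (intro mult_left_mono) auto
        have "c0 * (1 + nrm d y) \<le> 5 * (1 + a / 4)" using n c0 a0 by (simp add: distrib_left)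
        also have "\<dots> \<le> 5 * exp (a / 4)" by (intro mult_left_mono exp_ge_add_one_self) auto
        finally have "(1 + nrm d y) \<le> 5 / c0 * exp (a / 4)" using c0 by (simp add: field_simps)
        then have "(1 + nrm d y) * exp (- a / 4) \<le> 5 / c0 * exp (a / 4) * exp (- a / 4)" by (intro mult_right_mono) auto
        moreover have "exp (a / 4) * exp (- a / 4) = 1" by (simp add: exp_add[symmetric])
        ultimately show ?thesis by (simp only: mult.assoc mult_1_right)
      qed
      have "(1 - b y) * (1 + nrm d y) * w y \<le> (1 + nrm d y) * exp (- a)"
        using w_out[of y] False by (simp add: b_def a_def mult_left_mono)
      also have "exp (- a) = exp (- a / 2) * exp (- a / 4) * exp (- a / 4)" by (simp add: exp_add[symmetric])
      also have "(1 + nrm d y) * (exp (- a / 2) * exp (- a / 4) * exp (- a / 4)) = exp (- a / 2) * ((1 + nrm d y) * exp (- a / 4)) * exp (- a / 4)"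
        by simp
      also have "\<dots> \<le> exp (- (c0 * s * d) / 2) * (5 / c0) * exp (- a / 4)"
        using e1 e2 by (intro mult_right_mono mult_mono) auto
      finally show ?thesis by (simp add: a_def)
    qed (use c0 in \<open>simp add: b_def\<close>)
    then show "ennreal ((1 - b y) * (1 + nrm d y) * w y) \<le> ennreal (exp (- (c0 * s * d) / 2) * (5 / c0)) * ennreal (exp (- (c0 / 4) * (sqrt d * nrm d y)))"
      using c0 by (subst ennreal_mult[symmetric]) (auto intro: ennreal_leI)
  qed
  also have "\<dots> = ennreal (exp (- (c0 * s * d) / 2) * (5 / c0)) * (\<integral>\<^sup>+y. ennreal (exp (- (c0 / 4) * (sqrt d * nrm d y))) \<partial>Leb d)"
    by (intro nn_integral_cmult) measurable
  also have "\<dots> \<le> ennreal (exp (- (c0 * s * d) / 2) * (5 / c0)) * ennreal ((2 / (c0 / 4)) ^ d)"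
    using c0 by (intro mult_left_mono nn_integral_exp_nrm) auto
  also have "\<dots> = ennreal (exp (- (c0 * s * d) / 2) * (5 / c0) * (8 / c0) ^ d)"
    using c0 by (subst ennreal_mult[symmetric]) auto
  also have "\<dots> \<le> ennreal (5 * \<beta>)" by (intro ennreal_leI outer_numeric)
  finally have *: "(\<integral>\<^sup>+y. ennreal ((1 - b y) * (1 + nrm d y) * w y) \<partial>Leb d) \<le> ennreal (5 * \<beta>)" .
  have nn: "0 \<le> (1 - b y) * (1 + nrm d y) * w y" for y using b0 w0 by (simp add: mult_nonneg_nonneg)
  show i: "integrable (Leb d) (\<lambda>y. (1 - b y) * (1 + nrm d y) * w y)"
    using * nn by (intro integrableI_nonneg) (auto simp: le_less_trans)
  have "ennreal (\<integral>y. (1 - b y) * (1 + nrm d y) * w y \<partial>Leb d) \<le> ennreal (5 * \<beta>)"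
    using * nn_integral_eq_integral[OF i] nn by simp
  then show "(\<integral>y. (1 - b y) * (1 + nrm d y) * w y \<partial>Leb d) \<le> 5 * \<beta>" using beta_pos by simp
qed

lemma Z1: "Z \<ge> 1"
proof -
  have "1 \<le> 2 * pi" using pi_gt3 by linarith
  then have "1 \<le> sqrt (2 * pi)" by simp
  then show ?thesis unfolding Z_def by (rule one_le_power)
qed

lemma b_w: "b y * w y = Z * (gd d y * \<psi> y)"
proof (cases "nrm d y \<le> s * sqrt d")
  case True
  have "w y = exp (- (nrm d y)\<^sup>2 / 2) * exp (- (f y + r y))"
    unfolding w_in[OF True] f_def by (simp add: exp_add[symmetric])
  then show ?thesis using True Z1 by (simp add: b_def \<psi>_def gd_eq Z_def)
qed (simp add: b_def \<psi>_def)

text \<open>On the ball, w is exactly Z times the Gaussian density times \<open>\<psi>\<close>. The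
  growth condition on F lets \<open>outer_tail\<close> dominate the exterior, and division by Z >= 1
  preserves that bound.\<close>

lemma integral_w:
  assumes F: "all_moments d F" and le: "\<And>y. \<bar>F y\<bar> \<le> 1 + nrm d y"
  shows "integrable (Leb d) (\<lambda>y. F y * w y)"
    and "\<bar>(\<integral>y. F y * w y \<partial>Leb d) / Z - Ex (\<lambda>y. F y * \<psi> y)\<bar> \<le> 5 * \<beta>"
    and "(\<And>y. F y \<ge> 0) \<Longrightarrow> Ex (\<lambda>y. F y * \<psi> y) \<le> (\<integral>y. F y * w y \<partial>Leb d) / Z"
proof -
  note [measurable] = am_measurable[OF F]
  have "integrable (Leb d) (\<lambda>y. gd d y * (F y * \<psi> y))"
    using int_psi[OF F] by (subst integrable_gam[symmetric]) auto
  then have "integrable (Leb d) (\<lambda>y. Z * (gd d y * (F y * \<psi> y)))" by (rule integrable_mult_right)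
  moreover have "Z * (gd d y * (F y * \<psi> y)) = F y * (b y * w y)" for y unfolding b_w by simp
  ultimately have i1: "integrable (Leb d) (\<lambda>y. F y * (b y * w y))" by simp
  have v1: "(\<integral>y. F y * (b y * w y) \<partial>Leb d) = Z * Ex (\<lambda>y. F y * \<psi> y)"
  proof -
    have "(\<integral>y. F y * (b y * w y) \<partial>Leb d) = (\<integral>y. Z * (gd d y * (F y * \<psi> y)) \<partial>Leb d)"
      unfolding b_w by (simp add: mult_ac)
    then show ?thesis by (simp add: integral_gam)
  qed
  have pw: "\<bar>F y * ((1 - b y) * w y)\<bar> \<le> (1 - b y) * (1 + nrm d y) * w y" for y
  proof -
    have "\<bar>F y * ((1 - b y) * w y)\<bar> = \<bar>F y\<bar> * ((1 - b y) * w y)" using b0[of y] w0[of y] by (simp add: abs_mult)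
    also have "\<dots> \<le> (1 + nrm d y) * ((1 - b y) * w y)" using b0[of y] w0[of y] by (intro mult_right_mono le) auto
    finally show ?thesis by (simp add: mult_ac)
  qed
  have i2: "integrable (Leb d) (\<lambda>y. F y * ((1 - b y) * w y))"
    using pw by (intro Bochner_Integration.integrable_bound[OF outer_tail(1)]) (auto intro!: AE_I2 intro: order_trans[OF _ abs_ge_self])
  have v2: "\<bar>\<integral>y. F y * ((1 - b y) * w y) \<partial>Leb d\<bar> \<le> 5 * \<beta>"
    using abs_integral_le[OF i2 outer_tail(1) pw] outer_tail(2) by linarith
  have sp: "F y * w y = F y * (b y * w y) + F y * ((1 - b y) * w y)" for y by (simp add: algebra_simps)
  show "integrable (Leb d) (\<lambda>y. F y * w y)" unfolding sp using i1 i2 by (rule Bochner_Integration.integrable_add)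
  have "(\<integral>y. F y * w y \<partial>Leb d) = Z * Ex (\<lambda>y. F y * \<psi> y) + (\<integral>y. F y * ((1 - b y) * w y) \<partial>Leb d)"
    unfolding sp v1[symmetric] using i1 i2 by (rule Bochner_Integration.integral_add)
  then have eq: "(\<integral>y. F y * w y \<partial>Leb d) / Z = Ex (\<lambda>y. F y * \<psi> y) + (\<integral>y. F y * ((1 - b y) * w y) \<partial>Leb d) / Z"
    using Z1 by (simp add: add_divide_distrib)
  have "\<bar>(\<integral>y. F y * ((1 - b y) * w y) \<partial>Leb d) / Z\<bar> \<le> \<bar>\<integral>y. F y * ((1 - b y) * w y) \<partial>Leb d\<bar>"
    using Z1 by (simp add: abs_divide divide_le_eq mult_right_mono[of 1 Z, simplified] mult_ge1_I mult_le_cancel_left1)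
  then show "\<bar>(\<integral>y. F y * w y \<partial>Leb d) / Z - Ex (\<lambda>y. F y * \<psi> y)\<bar> \<le> 5 * \<beta>" unfolding eq using v2 by linarith
  assume F0: "\<And>y. F y \<ge> 0"
  have "0 \<le> (\<integral>y. F y * ((1 - b y) * w y) \<partial>Leb d)" using F0 b0 w0 by (intro integral_nonneg_AE AE_I2 mult_nonneg_nonneg) auto
  then show "Ex (\<lambda>y. F y * \<psi> y) \<le> (\<integral>y. F y * w y \<partial>Leb d) / Z" unfolding eq using Z1 by simp
qed

end

section \<open>The expansion of the mean\<close>

lemma quartic_young: "a * (p * r) + a * r\<^sup>2 \<le> 2 * (a\<^sup>2 + p ^ 4 + (r::real) ^ 4)"
proof -
  define P R where "P = p\<^sup>2" and "R = r\<^sup>2"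
  have e: "p ^ 4 = P\<^sup>2" "r ^ 4 = R\<^sup>2" by (simp_all add: P_def R_def power_mult[symmetric])
  have "2 * (a * (p * r)) \<le> a\<^sup>2 + P * R" using two_mult_le_squares[of a "p * r"] by (simp add: power_mult_distrib P_def R_def)
  moreover have "2 * (P * R) \<le> P\<^sup>2 + R\<^sup>2" by (rule two_mult_le_squares)
  moreover have "2 * (a * R) \<le> a\<^sup>2 + R\<^sup>2" by (rule two_mult_le_squares)
  moreover have "0 \<le> P\<^sup>2" "0 \<le> R\<^sup>2" "0 \<le> a\<^sup>2" by simp_all
  ultimately show ?thesis unfolding e R_def[symmetric] distrib_left by linarith
qed

context laplace_core
begin

lemma neg_simps [simp]:
  "f (\<lambda>i\<in>{..<d}. - y i) = - f y" "b (\<lambda>i\<in>{..<d}. - y i) = b y"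
  "dotp d u (\<lambda>i\<in>{..<d}. - y i) = - dotp d u y"
  by (auto simp: f_def b_def)

definition S where "S = e3\<^sup>2 + e4\<^sup>2"
definition h1 where "h1 y = (\<phi> y)\<^sup>2 + (\<rho> y)\<^sup>2 + \<rho> y"
text \<open>On the ball this is exp (- (f + r)) - (1 - f), what the density ratio has beyond its
  linear expansion.\<close>

definition err where "err y = \<psi> y - b y + f y * b y"

lemma S0: "S \<ge> 0" by (simp add: S_def)
lemma h1_nonneg: "h1 y \<ge> 0" using rho0 by (simp add: h1_def)
lemma am_h1: "all_moments d h1" unfolding h1_def by (intro am_all am_phi am_rho)

lemma e4_sq_le: "e4\<^sup>2 \<le> M\<^sup>2" using e4 by (intro power_mono) auto

text \<open>With x = f + r the error is the second-order remainder of exp (- x) minus r. The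
  remainder bound carries the factor 1 + exp (- x), which is \<open>b + \<psi>\<close> on the ball
  and can also be put on r.\<close>

lemma err_le: "\<bar>err y\<bar> \<le> KN M * S * (h1 y * (b y + \<psi> y))"
proof (cases "b y = 0")
  case True then show ?thesis by (simp add: err_def \<psi>_def)
next
  case False
  then have b: "b y = 1" using b_cases[of y] by simp
  define x where "x = f y + r y"
  have psi: "\<psi> y = exp (- x)" by (simp add: \<psi>_def b x_def)
  have rr: "\<bar>r y\<bar> \<le> e4\<^sup>2 * \<rho> y" using r_le'[of y] by (simp add: b)
  have "\<bar>err y\<bar> = \<bar>(exp (- x) - 1 + x) - r y\<bar>" by (simp add: err_def psi b x_def)
  also have "\<dots> \<le> x\<^sup>2 * (1 + exp (- x)) + \<bar>r y\<bar>" using exp_remainder1[of x] by linarith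
  also have "\<dots> \<le> (x\<^sup>2 + \<bar>r y\<bar>) * (1 + exp (- x))" by (simp add: algebra_simps)
  also have "\<dots> \<le> (KN M * S * h1 y) * (1 + exp (- x))"
  proof (rule mult_right_mono)
    have k1: "2 * e3\<^sup>2 \<le> KN M * S" "e4\<^sup>2 \<le> KN M * S"
    proof -
      have "2 * S \<le> KN M * S" using S0 by (intro mult_right_mono) (auto simp: KN_def)
      moreover have "e3\<^sup>2 \<le> S" "e4\<^sup>2 \<le> S" by (auto simp: S_def)
      ultimately show "2 * e3\<^sup>2 \<le> KN M * S" "e4\<^sup>2 \<le> KN M * S"
        using S0 by linarith+
    qed
    have k2: "2 * (e4\<^sup>2)\<^sup>2 \<le> KN M * S"
    proof -
      have "2 * (e4\<^sup>2)\<^sup>2 = 2 * e4\<^sup>2 * e4\<^sup>2" by (simp add: power2_eq_square)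
      also have "\<dots> \<le> KN M * S" using e4_sq_le by (intro mult_mono) (auto simp: KN_def S_def)
      finally show ?thesis .
    qed
    have "x\<^sup>2 \<le> 2 * (f y)\<^sup>2 + 2 * (r y)\<^sup>2"
      unfolding x_def using two_mult_le_squares[of "f y" "r y"] by (simp add: power2_sum)
    also have "(f y)\<^sup>2 = e3\<^sup>2 * (\<phi> y)\<^sup>2" by (metis f_eq power2_abs power_mult_distrib)
    also have "(r y)\<^sup>2 \<le> (e4\<^sup>2 * \<rho> y)\<^sup>2" using rr by (metis power2_abs power_mono abs_ge_zero)
    finally have "x\<^sup>2 + \<bar>r y\<bar> \<le> 2 * e3\<^sup>2 * (\<phi> y)\<^sup>2 + 2 * (e4\<^sup>2)\<^sup>2 * (\<rho> y)\<^sup>2 + e4\<^sup>2 * \<rho> y"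
      using rr by (simp add: power_mult_distrib)
    also have "\<dots> \<le> KN M * S * (\<phi> y)\<^sup>2 + KN M * S * (\<rho> y)\<^sup>2 + KN M * S * \<rho> y"
      using k1 k2 rho0 by (intro add_mono mult_right_mono) auto
    finally show "x\<^sup>2 + \<bar>r y\<bar> \<le> KN M * S * h1 y" by (simp add: h1_def algebra_simps)
  qed (simp add: add_nonneg_nonneg)
  finally show ?thesis by (simp add: b psi mult.assoc)
qed

lemma int_err: "all_moments d F \<Longrightarrow> integrable (gam d) (\<lambda>y. F y * err y)"
proof -
  assume F: "all_moments d F"
  have "integrable (gam d) (\<lambda>y. F y * \<psi> y - F y * b y + (F y * f y) * b y)"
    by (intro Bochner_Integration.integrable_add Bochner_Integration.integrable_diff int_psi int_b am_mult F am_f)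
  then show ?thesis by (simp add: err_def algebra_simps)
qed

lemma h1_sq: "Ex (\<lambda>y. (h1 y)\<^sup>2) \<le> KM1"
proof -
  have "Ex (\<lambda>y. (h1 y)\<^sup>2) \<le> Ex (\<lambda>y. 3 * (\<phi> y ^ (2 * 2) + \<rho> y ^ 4 + \<rho> y ^ 2))"
  proof (rule integral_mono)
    fix y
    have "(h1 y)\<^sup>2 \<le> 3 * (((\<phi> y)\<^sup>2)\<^sup>2 + ((\<rho> y)\<^sup>2)\<^sup>2 + (\<rho> y)\<^sup>2)" unfolding h1_def by (rule sum3_sq)
    then show "(h1 y)\<^sup>2 \<le> 3 * (\<phi> y ^ (2 * 2) + \<rho> y ^ 4 + \<rho> y ^ 2)" by (simp add: power_mult[symmetric])
  qed (intro am_integrable am_all am_phi am_rho am_h1)+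
  also have "\<dots> = 3 * (Ex (\<lambda>y. \<phi> y ^ (2 * 2)) + Ex (\<lambda>y. \<rho> y ^ 4) + Ex (\<lambda>y. \<rho> y ^ 2))"
    using am_integrable[OF am_power[OF am_phi, of "2 * 2"]] am_integrable[OF am_power[OF am_rho, of 4]] am_integrable[OF am_power[OF am_rho, of 2]]
    by simp
  also have "\<dots> \<le> KM1" using phi_moment[of 2] rho_moment[of 4] rho_moment[of 2] by (simp add: KM1_def)
  finally show ?thesis .
qed

context
  fixes u assumes u: "nrm d u = 1"
begin

text \<open>The mean is tested against one unit vector at a time. The estimates are uniform in it,
  and \<open>nrm_le_dual\<close> turns them into a bound on the norm.\<close>

abbreviation g where "g \<equiv> dotp d u"

lemma g_moment: "Ex (\<lambda>y. g y ^ 2) \<le> mom 2" "Ex (\<lambda>y. g y ^ 4) \<le> mom 4"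
  using dotp_moment[OF u, of 2] dotp_moment[OF u, of 4] by (simp_all add: power_even_abs)

lemma h2_sq: "Ex (\<lambda>y. (\<bar>g y\<bar> * h1 y)\<^sup>2) \<le> KM2"
proof -
  have "Ex (\<lambda>y. (\<bar>g y\<bar> * h1 y)\<^sup>2) \<le> Ex (\<lambda>y. g y ^ 4 + 27 * (\<phi> y ^ (2 * 4) + \<rho> y ^ 8 + \<rho> y ^ 4))"
  proof (rule integral_mono)
    fix y
    define A where "A = \<phi> y ^ 4 + \<rho> y ^ 4 + (\<rho> y)\<^sup>2"
    have A0: "A \<ge> 0" by (simp add: A_def)
    have hA: "(h1 y)\<^sup>2 \<le> 3 * A"
      using sum3_sq[of "(\<phi> y)\<^sup>2" "(\<rho> y)\<^sup>2" "\<rho> y"] by (simp add: h1_def A_def power_mult[symmetric])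
    have "(\<bar>g y\<bar> * h1 y)\<^sup>2 = (g y)\<^sup>2 * (h1 y)\<^sup>2" by (simp add: power_mult_distrib)
    also have "\<dots> \<le> (g y)\<^sup>2 * (3 * A)" by (intro mult_left_mono hA) auto
    also have "\<dots> \<le> ((g y)\<^sup>2)\<^sup>2 + (3 * A)\<^sup>2"
    proof -
      have "0 \<le> (g y)\<^sup>2 * (3 * A)" using A0 by simp
      then show ?thesis using two_mult_le_squares[of "(g y)\<^sup>2" "3 * A"] by linarith
    qed
    \<comment> \<open>27 is 9 from the square of 3 A times 3 from \<open>sum3_sq\<close>;
      \<open>KM2\<close> inherits it.\<close>
    also have "(3 * A)\<^sup>2 \<le> 27 * ((\<phi> y ^ 4)\<^sup>2 + (\<rho> y ^ 4)\<^sup>2 + ((\<rho> y)\<^sup>2)\<^sup>2)"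
    proof -
      have "(3 * A)\<^sup>2 = 9 * A\<^sup>2" by (simp add: power_mult_distrib)
      moreover have "A\<^sup>2 \<le> 3 * ((\<phi> y ^ 4)\<^sup>2 + (\<rho> y ^ 4)\<^sup>2 + ((\<rho> y)\<^sup>2)\<^sup>2)" unfolding A_def by (rule sum3_sq)
      ultimately show ?thesis by linarith
    qed
    finally show "(\<bar>g y\<bar> * h1 y)\<^sup>2 \<le> g y ^ 4 + 27 * (\<phi> y ^ (2 * 4) + \<rho> y ^ 8 + \<rho> y ^ 4)"
      by (simp add: power_mult[symmetric])
  qed (intro am_integrable am_all am_phi am_rho am_h1)+
  also have "\<dots> = Ex (\<lambda>y. g y ^ 4) + 27 * (Ex (\<lambda>y. \<phi> y ^ (2 * 4)) + Ex (\<lambda>y. \<rho> y ^ 8) + Ex (\<lambda>y. \<rho> y ^ 4))"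
    using am_integrable[OF am_power[OF am_phi, of "2 * 4"]] am_integrable[OF am_power[OF am_rho, of 8]] am_integrable[OF am_power[OF am_rho, of 4]]
      am_integrable[OF am_power[OF am_dotp, of d u 4]]
    by simp
  also have "\<dots> \<le> KM2" using phi_moment[of 4] rho_moment[of 8] rho_moment[of 4] g_moment(2) by (simp add: KM2_def)
  finally show ?thesis .
qed

lemma h3_sq: "Ex (\<lambda>y. (\<bar>g y\<bar> * \<phi> y)\<^sup>2) \<le> KM3"
proof -
  have "Ex (\<lambda>y. (\<bar>g y\<bar> * \<phi> y)\<^sup>2) \<le> Ex (\<lambda>y. g y ^ 4 + \<phi> y ^ (2 * 2))"
  proof (rule integral_mono)
    fix y
    have "0 \<le> (g y)\<^sup>2 * (\<phi> y)\<^sup>2" by simp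
    then have "(g y)\<^sup>2 * (\<phi> y)\<^sup>2 \<le> ((g y)\<^sup>2)\<^sup>2 + ((\<phi> y)\<^sup>2)\<^sup>2"
      using two_mult_le_squares[of "(g y)\<^sup>2" "(\<phi> y)\<^sup>2"] by linarith
    then show "(\<bar>g y\<bar> * \<phi> y)\<^sup>2 \<le> g y ^ 4 + \<phi> y ^ (2 * 2)"
      by (simp add: power_mult_distrib power_mult[symmetric])
  qed (intro am_integrable am_all am_phi am_rho)+
  also have "\<dots> = Ex (\<lambda>y. g y ^ 4) + Ex (\<lambda>y. \<phi> y ^ (2 * 2))"
    using am_integrable[OF am_power[OF am_phi, of "2 * 2"]] am_integrable[OF am_power[OF am_dotp, of d u 4]] by simp
  also have "\<dots> \<le> KM3" using phi_moment[of 2] g_moment(2) by (simp add: KM3_def)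
  finally show ?thesis .
qed

lemma h4_sq: "Ex (\<lambda>y. (\<bar>g y\<bar> * (\<phi> y ^ 3 + \<rho> y ^ 3))\<^sup>2) \<le> KM4"
proof -
  have "Ex (\<lambda>y. (\<bar>g y\<bar> * (\<phi> y ^ 3 + \<rho> y ^ 3))\<^sup>2) \<le> Ex (\<lambda>y. 2 * g y ^ 4 + \<phi> y ^ (2 * 6) + \<rho> y ^ 12)"
  proof (rule integral_mono)
    fix y
    have "(\<bar>g y\<bar> * (\<phi> y ^ 3 + \<rho> y ^ 3))\<^sup>2 = (g y)\<^sup>2 * (\<phi> y ^ 3 + \<rho> y ^ 3)\<^sup>2" by (simp add: power_mult_distrib)
    also have "\<dots> \<le> (g y)\<^sup>2 * (2 * (\<phi> y ^ 3)\<^sup>2 + 2 * (\<rho> y ^ 3)\<^sup>2)"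
      using two_mult_le_squares[of "\<phi> y ^ 3" "\<rho> y ^ 3"] by (intro mult_left_mono) (auto simp: power2_sum)
    also have "\<dots> = 2 * ((g y)\<^sup>2 * (\<phi> y ^ 3)\<^sup>2) + 2 * ((g y)\<^sup>2 * (\<rho> y ^ 3)\<^sup>2)" by (simp add: algebra_simps)
    also have "\<dots> \<le> (((g y)\<^sup>2)\<^sup>2 + ((\<phi> y ^ 3)\<^sup>2)\<^sup>2) + (((g y)\<^sup>2)\<^sup>2 + ((\<rho> y ^ 3)\<^sup>2)\<^sup>2)"
      by (intro add_mono two_mult_le_squares)
    finally show "(\<bar>g y\<bar> * (\<phi> y ^ 3 + \<rho> y ^ 3))\<^sup>2 \<le> 2 * g y ^ 4 + \<phi> y ^ (2 * 6) + \<rho> y ^ 12"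
      by (simp add: power_mult[symmetric])
  qed (intro am_integrable am_all am_phi am_rho)+
  also have "\<dots> = 2 * Ex (\<lambda>y. g y ^ 4) + Ex (\<lambda>y. \<phi> y ^ (2 * 6)) + Ex (\<lambda>y. \<rho> y ^ 12)"
    using am_integrable[OF am_power[OF am_phi, of "2 * 6"]] am_integrable[OF am_power[OF am_dotp, of d u 4]] am_integrable[OF am_power[OF am_rho, of 12]] by simp
  also have "\<dots> \<le> KM4" using phi_moment[of 6] rho_moment[of 12] g_moment(2) by (simp add: KM4_def)
  finally show ?thesis .
qed

lemma A0_le: "\<bar>Ex err\<bar> \<le> KN M * (2 + KM1) * (E * S)"
proof -
  note W = weighted[OF am_h1 h1_nonneg h1_sq]
  have "\<bar>Ex err\<bar> \<le> Ex (\<lambda>y. KN M * S * (h1 y * (b y + \<psi> y)))"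
    using int_err[OF am_const[of d 1]] W(1) err_le by (intro abs_integral_le) auto
  also have "\<dots> = KN M * S * Ex (\<lambda>y. h1 y * (b y + \<psi> y))" by simp
  also have "\<dots> \<le> KN M * S * (E * (2 + KM1))" using W(2) KN_pos[of M] S0 by (intro mult_left_mono) auto
  finally show ?thesis by (simp add: mult_ac)
qed

lemma A1_le: "\<bar>Ex (\<lambda>y. g y * err y)\<bar> \<le> KN M * (2 + KM2) * (E * S)"
proof -
  have "all_moments d (\<lambda>y. \<bar>g y\<bar> * h1 y)" by (intro am_all am_h1)
  note W = weighted[OF this _ h2_sq]
  have h0: "\<bar>g y\<bar> * h1 y \<ge> 0" for y using h1_nonneg by simp
  have "\<bar>Ex (\<lambda>y. g y * err y)\<bar> \<le> Ex (\<lambda>y. KN M * S * (\<bar>g y\<bar> * h1 y * (b y + \<psi> y)))"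
  proof (rule abs_integral_le[OF int_err[OF am_dotp]])
    show "integrable (gam d) (\<lambda>y. KN M * S * (\<bar>g y\<bar> * h1 y * (b y + \<psi> y)))" using W(1)[OF h0] by (intro integrable_mult_right)
    fix y
    show "\<bar>g y * err y\<bar> \<le> KN M * S * (\<bar>g y\<bar> * h1 y * (b y + \<psi> y))"
      using mult_left_mono[OF err_le[of y], of "\<bar>g y\<bar>"] by (simp add: abs_mult mult_ac)
  qed
  also have "\<dots> = KN M * S * Ex (\<lambda>y. \<bar>g y\<bar> * h1 y * (b y + \<psi> y))" by simp
  also have "\<dots> \<le> KN M * S * (E * (2 + KM2))" using W(2)[OF h0] KN_pos[of M] S0 by (intro mult_left_mono) auto
  finally show ?thesis by (simp add: mult_ac)
qed

text \<open>\<open>\<Delta>\<close> is the shift of the mean in direction u predicted by the linear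
  term; N and D are the numerator and the denominator of the posterior mean, both scaled by the
  Gaussian normalization Z.\<close>

definition \<Delta> where "\<Delta> = - Ex (\<lambda>y. g y * f y)"
definition N where "N = (\<integral>y. g y * w y \<partial>Leb d) / Z"
definition D where "D = (\<integral>y. w y \<partial>Leb d) / Z"

lemma am_h3: "all_moments d (\<lambda>y. \<bar>g y\<bar> * \<phi> y)" by (intro am_all am_phi)

lemma gf_eq: "\<bar>g y * f y\<bar> = e3 * (\<bar>g y\<bar> * \<phi> y)"
  by (simp add: abs_mult f_eq mult_ac)

lemma Delta_le: "\<bar>\<Delta>\<bar> \<le> e3 * (1 + KM3)"
proof -
  interpret prob_space "gam d" by (rule prob_space_gam)
  have i: "integrable (gam d) (\<lambda>y. (\<bar>g y\<bar> * \<phi> y)\<^sup>2)" by (intro am_integrable am_power am_h3)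
  have "\<bar>\<Delta>\<bar> = \<bar>Ex (\<lambda>y. g y * f y)\<bar>" by (simp add: \<Delta>_def)
  also have "\<dots> \<le> Ex (\<lambda>y. e3 * (1 + (\<bar>g y\<bar> * \<phi> y)\<^sup>2))"
  proof (rule abs_integral_le)
    show "integrable (gam d) (\<lambda>y. g y * f y)" by (intro am_integrable am_all am_f)
    show "integrable (gam d) (\<lambda>y. e3 * (1 + (\<bar>g y\<bar> * \<phi> y)\<^sup>2))" using i by auto
    fix y
    have "0 \<le> \<bar>g y\<bar> * \<phi> y" using phi0 by simp
    then have "\<bar>g y\<bar> * \<phi> y \<le> 1 + (\<bar>g y\<bar> * \<phi> y)\<^sup>2" using two_mult_le_squares[of 1 "\<bar>g y\<bar> * \<phi> y"] by simp
    then show "\<bar>g y * f y\<bar> \<le> e3 * (1 + (\<bar>g y\<bar> * \<phi> y)\<^sup>2)" unfolding gf_eq using e3 by (intro mult_left_mono) auto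
  qed
  also have "\<dots> = e3 * (1 + Ex (\<lambda>y. (\<bar>g y\<bar> * \<phi> y)\<^sup>2))" using i prob_space by simp
  also have "\<dots> \<le> e3 * (1 + KM3)" using h3_sq e3 by (intro mult_left_mono) auto
  finally show ?thesis .
qed

text \<open>The price for the cutoff in the linear term, whose exact value \<open>\<Delta>\<close>
  is an integral over the whole space.\<close>

lemma T2_le: "\<bar>Ex (\<lambda>y. g y * f y * (1 - b y))\<bar> \<le> M * (1 + KM3) * \<beta>"
proof -
  have h0: "\<bar>g y\<bar> * \<phi> y \<ge> 0" for y using phi0 by simp
  have "\<bar>Ex (\<lambda>y. g y * f y * (1 - b y))\<bar> \<le> Ex (\<lambda>y. e3 * (\<bar>g y\<bar> * \<phi> y * (1 - b y)))"
  proof (rule abs_integral_le)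
    show "integrable (gam d) (\<lambda>y. g y * f y * (1 - b y))" by (intro int_1b am_all am_f)
    show "integrable (gam d) (\<lambda>y. e3 * (\<bar>g y\<bar> * \<phi> y * (1 - b y)))" by (intro integrable_mult_right int_1b am_h3)
    fix y
    have "\<bar>g y * f y * (1 - b y)\<bar> = \<bar>g y * f y\<bar> * (1 - b y)" using b0[of y] by (simp add: abs_mult)
    then show "\<bar>g y * f y * (1 - b y)\<bar> \<le> e3 * (\<bar>g y\<bar> * \<phi> y * (1 - b y))" unfolding gf_eq by simp
  qed
  also have "\<dots> = e3 * Ex (\<lambda>y. \<bar>g y\<bar> * \<phi> y * (1 - b y))" by simp
  also have "\<dots> \<le> e3 * ((1 + KM3) * \<beta>)" using e3 by (intro mult_left_mono weighted_tail[OF am_h3 h0 h3_sq]) auto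
  also have "\<dots> \<le> M * ((1 + KM3) * \<beta>)" using e3 beta_pos KM_nonneg by (intro mult_right_mono) auto
  finally show ?thesis by simp
qed

text \<open>
  The odd cubic term drops out over the ball of radius \<open>\<surd>(2d)\<close>, which has Gaussian mass at
  least one half.
\<close>
lemma D_ge: "KD M \<le> D"
proof -
  have "1 \<le> (\<integral>y. 1 * w y \<partial>Leb d) / Z - Ex (\<lambda>y. 1 * \<psi> y) + 1"
    using integral_w(3)[OF am_const[of d 1]] by simp
  then have D: "Ex \<psi> \<le> D" by (simp add: D_def)
  define b2 where "b2 y = (of_bool ((nrm d y)\<^sup>2 \<le> 2 * d) :: real)" for y
  have [measurable]: "b2 \<in> borel_measurable (Leb d)" unfolding b2_def by measurable
  have b2b: "\<bar>b2 y\<bar> \<le> 1" for y by (simp add: b2_def)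
  note int_b2 = integrable_am_bounded[OF _ \<open>b2 \<in> borel_measurable (Leb d)\<close> b2b]
  have ib2: "integrable (gam d) b2" using int_b2[OF am_const[of d 1]] by simp
  have half: "1/2 \<le> Ex b2"
  proof -
    have "ennreal (1/2) \<le> (\<integral>\<^sup>+y. ennreal (b2 y) \<partial>gam d)" unfolding b2_def by (rule gam_ball_half[OF d1])
    also have "\<dots> = ennreal (Ex b2)" by (rule nn_integral_eq_integral[OF ib2]) (simp add: b2_def)
    finally have "ennreal (1/2) \<le> ennreal (Ex b2)" .
    moreover have "0 \<le> Ex b2" by (intro integral_nonneg_AE) (simp add: b2_def)
    ultimately show ?thesis using ennreal_le_iff by blast
  qed
  have odd: "Ex (\<lambda>y. f y * b2 y) = 0"
    by (intro integral_gam_odd) (auto simp: b2_def)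
  \<comment> \<open>On this ball \<rho> <= 4, hence r <= 4 M^2 / 24 = M^2 / 6. The other factor is
    bounded below by 1 - f, which is linear in f and therefore open to the parity argument.\<close>
  have pw: "exp (- M\<^sup>2 / 6) * (b2 y - f y * b2 y) \<le> \<psi> y" for y
  proof (cases "(nrm d y)\<^sup>2 \<le> 2 * d")
    case True
    have "2 * real d \<le> s\<^sup>2 * d"
    proof -
      have "12\<^sup>2 \<le> s\<^sup>2" using s12 by (intro power_mono) auto
      then show ?thesis by (intro mult_right_mono) auto
    qed
    then have "(nrm d y)\<^sup>2 \<le> (s * sqrt d)\<^sup>2" using True by (simp add: power_mult_distrib)
    then have "nrm d y \<le> s * sqrt d" using s12 by (intro power2_le_imp_le[of "nrm d y"]) auto
    then have b: "b y = 1" by (simp add: b_def)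
    have "(nrm d y)\<^sup>2 / d \<le> 2" using True d0 by (simp add: divide_le_eq)
    then have "\<rho> y \<le> 2\<^sup>2" unfolding \<rho>_def by (intro power_mono) auto
    then have "e4\<^sup>2 * \<rho> y \<le> M\<^sup>2 * 2\<^sup>2" using e4_sq_le rho0 by (intro mult_mono) auto
    then have "r y \<le> M\<^sup>2 / 6" using r_le[of y] b by simp
    then have "exp (- M\<^sup>2 / 6) \<le> exp (- r y)" by simp
    moreover have "1 - f y \<le> exp (- f y)" using exp_ge_add_one_self[of "- f y"] by simp
    ultimately have "exp (- M\<^sup>2 / 6) * (1 - f y) \<le> exp (- r y) * exp (- f y)"
    proof -
      assume a: "exp (- M\<^sup>2 / 6) \<le> exp (- r y)" "1 - f y \<le> exp (- f y)"
      have "exp (- M\<^sup>2 / 6) * (1 - f y) \<le> exp (- M\<^sup>2 / 6) * exp (- f y)" using a by (intro mult_left_mono) auto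
      also have "\<dots> \<le> exp (- r y) * exp (- f y)" using a by (intro mult_right_mono) auto
      finally show ?thesis .
    qed
    then show ?thesis using True b by (simp add: b2_def \<psi>_def exp_add[symmetric] algebra_simps)
  next
    case False then show ?thesis using psi0 by (simp add: b2_def)
  qed
  have "KD M = exp (- M\<^sup>2 / 6) * (1/2)" by (simp add: KD_def)
  also have "\<dots> \<le> exp (- M\<^sup>2 / 6) * (Ex b2 - Ex (\<lambda>y. f y * b2 y))" using half odd by (intro mult_left_mono) auto
  also have "\<dots> = Ex (\<lambda>y. exp (- M\<^sup>2 / 6) * (b2 y - f y * b2 y))"
    using ib2 int_b2[OF am_f] by simp
  also have "\<dots> \<le> Ex \<psi>"
    using ib2 int_b2[OF am_f] int_psi[OF am_const[of d 1]] pw by (intro integral_mono integrable_mult_right Bochner_Integration.integrable_diff) auto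
  finally show ?thesis using D by linarith
qed

text \<open>The quotient is cleared by working with N - \<Delta> D and the lower bound for D. N is
  \<Delta> plus errors and D is 1 plus errors, so what remains beside the errors of N is \<Delta>
  times the error of D, which has an additional factor e3.\<close>

lemma main_estimate:
  "\<bar>N / D - \<Delta>\<bar> * KD M \<le> \<bar>Ex (\<lambda>y. g y * err y)\<bar> + (1 + KM3) * KN M * (2 + KM1) * (e3 * (E * S))
     + (M * (1 + KM3) + 5 + 6 * M * (1 + KM3)) * \<beta>"
proof -
  interpret prob_space "gam d" by (rule prob_space_gam)
  define A1 where "A1 = Ex (\<lambda>y. g y * err y)"
  define A0 where "A0 = Ex err"
  define T2 where "T2 = Ex (\<lambda>y. g y * f y * (1 - b y))"
  define P where "P = Ex (\<lambda>y. 1 - b y)"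
  have ge: "\<bar>g y\<bar> \<le> 1 + nrm d y" for y using dotp_le[of d u y] u by simp
  have T1: "\<bar>N - Ex (\<lambda>y. g y * \<psi> y)\<bar> \<le> 5 * \<beta>" unfolding N_def by (rule integral_w(2)[OF am_dotp ge])
  have T0: "\<bar>D - Ex \<psi>\<bar> \<le> 5 * \<beta>" using integral_w(2)[OF am_const[of d 1]] by (simp add: D_def)
  have ig: "integrable (gam d) (\<lambda>y. g y * err y)" "integrable (gam d) (\<lambda>y. g y * b y)" "integrable (gam d) (\<lambda>y. g y * f y)"
    "integrable (gam d) (\<lambda>y. g y * f y * (1 - b y))" "integrable (gam d) (\<lambda>y. g y * f y * b y)"
    by (intro int_err int_b int_1b am_integrable am_all am_f)+
  have z1: "Ex (\<lambda>y. g y * b y) = 0" "Ex (\<lambda>y. f y * b y) = 0"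
    by (intro integral_gam_odd; simp)+
  have N: "Ex (\<lambda>y. g y * \<psi> y) = A1 + T2 + \<Delta>"
  proof -
    have "Ex (\<lambda>y. g y * \<psi> y) = Ex (\<lambda>y. (g y * err y + g y * b y + g y * f y * (1 - b y)) - g y * f y)"
      by (intro Bochner_Integration.integral_cong refl) (simp add: err_def algebra_simps)
    also have "\<dots> = A1 + 0 + T2 + \<Delta>"
      using ig z1 by (simp add: A1_def T2_def \<Delta>_def)
    finally show ?thesis by simp
  qed
  have D: "Ex \<psi> = A0 + 1 - P"
  proof -
    have i: "integrable (gam d) err" "integrable (gam d) (\<lambda>y. f y * b y)" "integrable (gam d) (\<lambda>y. 1 - b y)"
      using int_err[OF am_const[of d 1]] int_b[OF am_f] int_1b[OF am_const[of d 1]] by auto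
    have ib: "integrable (gam d) b" using int_b[OF am_const[of d 1]] by simp
    have "Ex \<psi> = Ex (\<lambda>y. err y + 1 - (1 - b y) - f y * b y)"
      by (intro Bochner_Integration.integral_cong refl) (simp add: err_def)
    also have "\<dots> = A0 + 1 - P - 0" using i ib z1 prob_space by (simp add: A0_def P_def)
    finally show ?thesis by simp
  qed
  have P: "0 \<le> P" "P \<le> \<beta>"
  proof -
    show "0 \<le> P" unfolding P_def using b0 by (intro integral_nonneg_AE) auto
    have "\<beta>\<^sup>2 \<le> \<beta>" using beta_le1 beta_pos by (simp add: power2_eq_square mult_left_le)
    then show "P \<le> \<beta>" using gauss_tail by (simp add: P_def)
  qed
  have Dp: "KD M \<le> D" "D > 0" using D_ge KD_pos[of M] by auto
  have "\<bar>N - \<Delta> * D\<bar> \<le> \<bar>A1\<bar> + \<bar>T2\<bar> + 5 * \<beta> + \<bar>\<Delta>\<bar> * (\<bar>A0\<bar> + 6 * \<beta>)"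
  proof -
    have "N - \<Delta> * D = A1 + T2 + (N - Ex (\<lambda>y. g y * \<psi> y)) - \<Delta> * (A0 - P + (D - Ex \<psi>))"
      unfolding N D by (simp add: algebra_simps)
    \<comment> \<open>The 6 is 1 for the Gaussian mass P outside the ball and 5 for the exterior
      part of D.\<close>
    moreover have "\<bar>\<Delta> * (A0 - P + (D - Ex \<psi>))\<bar> \<le> \<bar>\<Delta>\<bar> * (\<bar>A0\<bar> + 6 * \<beta>)"
      unfolding abs_mult using P T0 by (intro mult_left_mono) auto
    ultimately show ?thesis using T1 by linarith
  qed
  also have "\<bar>\<Delta>\<bar> * (\<bar>A0\<bar> + 6 * \<beta>) \<le> (e3 * (1 + KM3)) * (KN M * (2 + KM1) * (E * S) + 6 * \<beta>)"
    using A0_le Delta_le e3 KM_nonneg beta_pos by (intro mult_mono add_mono) (auto simp: A0_def)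
  also have "\<dots> \<le> (1 + KM3) * KN M * (2 + KM1) * (e3 * (E * S)) + M * (1 + KM3) * (6 * \<beta>)"
  proof -
    have "(e3 * (1 + KM3)) * (6 * \<beta>) \<le> (M * (1 + KM3)) * (6 * \<beta>)"
      using e3 KM_nonneg beta_pos by (intro mult_right_mono) auto
    then show ?thesis by (simp add: distrib_left mult_ac)
  qed
  finally have "\<bar>N - \<Delta> * D\<bar> \<le> \<bar>A1\<bar> + (1 + KM3) * KN M * (2 + KM1) * (e3 * (E * S)) + (M * (1 + KM3) + 5 + 6 * M * (1 + KM3)) * \<beta>"
    using T2_le by (simp add: T2_def algebra_simps)
  moreover have "\<bar>N / D - \<Delta>\<bar> * KD M \<le> \<bar>N / D - \<Delta>\<bar> * D" using Dp by (intro mult_left_mono) auto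
  moreover have "\<bar>N / D - \<Delta>\<bar> * D = \<bar>N - \<Delta> * D\<bar>"
  proof -
    have "\<bar>N / D - \<Delta>\<bar> * D = \<bar>(N / D - \<Delta>) * D\<bar>" using Dp by (simp add: abs_mult)
    also have "(N / D - \<Delta>) * D = N - \<Delta> * D" using Dp by (simp add: left_diff_distrib)
    finally show ?thesis .
  qed
  ultimately show ?thesis by (simp add: A1_def)
qed

lemma beta_le_tau: "\<beta> \<le> d * \<beta>"
  using d1 beta_pos by simp

lemma ES0: "0 \<le> E * S" using E1 S0 by simp

text \<open>
  The quadratic terms \<open>f\<^sup>2/2\<close> and \<open>q\<close> of the expansion are even, so they vanish against the
  odd function \<open>g\<close>.
\<close>
lemma second_order_remainder:
  fixes q :: "(nat \<Rightarrow> real) \<Rightarrow> real" and e5 :: real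
  assumes qm [measurable]: "q \<in> borel_measurable (Leb d)" and q_even: "\<And>y. q (\<lambda>i\<in>{..<d}. - y i) = q y"
    and e5: "e5 \<ge> 0" and q: "\<And>y. nrm d y \<le> s * sqrt d \<Longrightarrow> \<bar>r y - q y\<bar> \<le> (e5 / d) ^ 3 / 120 * nrm d y ^ 5"
  shows "\<bar>Ex (\<lambda>y. g y * err y)\<bar> \<le> (2 * KN M * (2 + KM4) + 2 * (mom 2 + cmom 2 + mom 16)) * (E * S * (e3 + e4\<^sup>2))
    + (mom 2 + mom 10) * (e5 ^ 3 / sqrt d)"
proof -
  define G where "G = S * (e3 + e4\<^sup>2)"
  have G0: "G \<ge> 0" using S0 e3 by (simp add: G_def)
  have EG: "G \<le> E * G" using E1 G0 by (simp add: mult_right_mono[of 1 E G, simplified])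
  define x where "x y = f y + r y" for y
  define R where "R y = b y * (exp (- x y) - 1 + x y - (x y)\<^sup>2 / 2)" for y
  define p where "p y = b y * (r y - q y)" for y
  define B where "B y = f y * (b y * r y) + (b y * r y)\<^sup>2 / 2" for y
  have [measurable]: "x \<in> borel_measurable (Leb d)" unfolding x_def by measurable
  have [measurable]: "R \<in> borel_measurable (Leb d)" "p \<in> borel_measurable (Leb d)" "B \<in> borel_measurable (Leb d)"
    unfolding R_def p_def B_def by measurable
  \<comment> \<open>Origin of d^(-1/2) in the refined bound: d^3 is sqrt d times (sqrt d)^5, and the
    five factors normalize the norm of y.\<close>
  have p_le: "\<bar>p y\<bar> \<le> e5 ^ 3 / sqrt d * (nrm d y / sqrt d) ^ 5" for y
  proof (cases "nrm d y \<le> s * sqrt d")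
    case True
    have sd: "sqrt d * sqrt d = d" by simp
    have "\<bar>p y\<bar> \<le> (e5 / d) ^ 3 / 120 * nrm d y ^ 5" using q[OF True] True by (simp add: p_def b_def)
    also have "\<dots> \<le> (e5 / d) ^ 3 * nrm d y ^ 5" using e5 by (intro mult_right_mono) auto
    also have "\<dots> = e5 ^ 3 / sqrt d * (nrm d y / sqrt d) ^ 5"
    proof -
      have "real d ^ 3 = sqrt d * sqrt d ^ 5"
      proof -
        have "sqrt d * sqrt d ^ 5 = (sqrt d * sqrt d) ^ 3" by (simp add: eval_nat_numeral mult_ac)
        then show ?thesis by (simp only: sd)
      qed
      then show ?thesis by (simp add: power_divide)
    qed
    finally show ?thesis .
  next
    case False then show ?thesis using e5 by (simp add: p_def b_def)
  qed
  have p_bound: "\<bar>p y\<bar> \<le> e5 ^ 3 / sqrt d * s ^ 5" for y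
  proof (cases "nrm d y \<le> s * sqrt d")
    case True
    then have "nrm d y / sqrt d \<le> s" using d0 by (simp add: divide_le_eq)
    then have "(nrm d y / sqrt d) ^ 5 \<le> s ^ 5" by (intro power_mono) auto
    then show ?thesis using order_trans[OF p_le[of y] mult_left_mono] e5 by simp
  next
    case False then show ?thesis using e5 s12 by (simp add: p_def b_def)
  qed
  note int_p = integrable_am_bounded[OF _ \<open>p \<in> borel_measurable (Leb d)\<close> p_bound]
  have br2: "\<bar>(b y * r y)\<^sup>2\<bar> \<le> (e4\<^sup>2 * s ^ 4)\<^sup>2" for y
    using power_mono[OF r_bound_b[of y], of 2] by simp
  have int_br2: "integrable (gam d) (\<lambda>y. F y * (b y * r y)\<^sup>2)" if "all_moments d F" for F
    by (rule integrable_am_bounded[OF that _ br2]) measurable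
  have bq: "b y * q y = b y * r y - p y" for y by (simp add: p_def algebra_simps)
  have i: "integrable (gam d) (\<lambda>y. g y * p y)" "integrable (gam d) (\<lambda>y. g y * (b y * r y))"
    "integrable (gam d) (\<lambda>y. g y * (f y)\<^sup>2 * b y)" "integrable (gam d) (\<lambda>y. g y * f y * (b y * r y))"
    "integrable (gam d) (\<lambda>y. g y * (b y * r y)\<^sup>2)" "integrable (gam d) (\<lambda>y. g y * err y)"
    by (intro int_p int_br int_b int_br2 int_err am_all am_f)+
  have iq: "integrable (gam d) (\<lambda>y. g y * (b y * q y))"
    unfolding bq right_diff_distrib by (rule Bochner_Integration.integrable_diff[OF i(2,1)])
  have iB: "integrable (gam d) (\<lambda>y. g y * B y)"
    using i(4,5) by (simp add: B_def distrib_left mult.assoc)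
  have bb: "b y * b y = b y" for y using b_cases[of y] by auto
  \<comment> \<open>R is the third-order remainder of the exponential, p the quintic part of the
    potential, and B the mixed and quadratic terms in r. The terms with q and f^2 are even and
    vanish in the integral against g.\<close>
  have eq: "err y = R y - p y - b y * q y + (f y)\<^sup>2 * b y / 2 + B y" for y
    using b_cases[of y] by (auto simp: err_def R_def p_def B_def \<psi>_def x_def power2_sum algebra_simps add_divide_distrib diff_divide_distrib)
  have iR: "integrable (gam d) (\<lambda>y. g y * R y)"
  proof -
    have "g y * R y = g y * err y + g y * p y + g y * (b y * q y) - (g y * (f y)\<^sup>2 * b y) / 2 - g y * B y" for y
      unfolding eq by (simp add: algebra_simps)
    then show ?thesis using i iq iB by simp
  qed
  have z: "Ex (\<lambda>y. g y * (f y)\<^sup>2 * b y) = 0" "Ex (\<lambda>y. g y * (b y * q y)) = 0"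
    by (intro integral_gam_odd; simp add: q_even)+
  have split: "Ex (\<lambda>y. g y * err y) = Ex (\<lambda>y. g y * R y) - Ex (\<lambda>y. g y * p y) + Ex (\<lambda>y. g y * B y)"
  proof -
    have "Ex (\<lambda>y. g y * err y) = Ex (\<lambda>y. g y * R y - g y * p y - g y * (b y * q y) + (g y * (f y)\<^sup>2 * b y) / 2 + g y * B y)"
      unfolding eq by (intro Bochner_Integration.integral_cong refl) (simp add: algebra_simps)
    also have "\<dots> = Ex (\<lambda>y. g y * R y) - Ex (\<lambda>y. g y * p y) - 0 + 0 / 2 + Ex (\<lambda>y. g y * B y)"
      using i iq iB iR z by simp
    finally show ?thesis by simp
  qed
  have T1: "\<bar>Ex (\<lambda>y. g y * R y)\<bar> \<le> 2 * KN M * (2 + KM4) * (E * G)"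
  proof -
    define h where "h y = \<bar>g y\<bar> * (\<phi> y ^ 3 + \<rho> y ^ 3)" for y
    have amh: "all_moments d h" unfolding h_def by (intro am_all am_phi am_rho)
    have h0: "h y \<ge> 0" for y using phi0 rho0 by (simp add: h_def)
    note W = weighted[OF amh h0 h4_sq[folded h_def]]
    have "\<bar>Ex (\<lambda>y. g y * R y)\<bar> \<le> Ex (\<lambda>y. 2 * KN M * G * (h y * (b y + \<psi> y)))"
    proof (rule abs_integral_le[OF iR])
      show "integrable (gam d) (\<lambda>y. 2 * KN M * G * (h y * (b y + \<psi> y)))" using W(1) by (intro integrable_mult_right)
      fix y
      have "\<bar>R y\<bar> \<le> 2 * KN M * G * (\<phi> y ^ 3 + \<rho> y ^ 3) * (b y + \<psi> y)"
      proof (cases "b y = 0")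
        case False
        then have b: "b y = 1" using b_cases[of y] by simp
        have rr: "\<bar>r y\<bar> \<le> e4\<^sup>2 * \<rho> y" using r_le'[of y] by (simp add: b)
        have cube: "(u + v) ^ 3 \<le> 4 * (u ^ 3 + v ^ 3)" if "0 \<le> u" "0 \<le> v" for u v :: real
        proof -
          have "4 * (u ^ 3 + v ^ 3) - (u + v) ^ 3 = 3 * (u + v) * (u - v)\<^sup>2"
            by (simp add: power2_eq_square power3_eq_cube algebra_simps)
          moreover have "0 \<le> 3 * (u + v) * (u - v)\<^sup>2" using that by simp
          ultimately show ?thesis by linarith
        qed
        \<comment> \<open>G has one factor S and one factor e3 + e4^2, so it dominates e3^3 directly
          and e4^6 after one factor e4^2 is replaced by M^2.\<close>
        have c1: "e3 ^ 3 \<le> G"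
        proof -
          have "e3 ^ 3 = e3\<^sup>2 * e3" by (simp add: power2_eq_square power3_eq_cube)
          also have "\<dots> \<le> G" unfolding G_def S_def using e3 by (intro mult_mono) auto
          finally show ?thesis .
        qed
        have c2: "(e4\<^sup>2) ^ 3 \<le> M\<^sup>2 * G"
        proof -
          have "(e4\<^sup>2) ^ 3 = e4\<^sup>2 * (e4\<^sup>2 * e4\<^sup>2)" by (simp add: power3_eq_cube)
          also have "\<dots> \<le> M\<^sup>2 * G" unfolding G_def S_def using e4_sq_le e3 by (intro mult_mono) auto
          finally show ?thesis .
        qed
        have "\<bar>x y\<bar> ^ 3 \<le> (\<bar>f y\<bar> + \<bar>r y\<bar>) ^ 3" unfolding x_def by (intro power_mono) auto
        also have "\<dots> \<le> (e3 * \<phi> y + e4\<^sup>2 * \<rho> y) ^ 3" using rr unfolding f_eq[symmetric] by (intro power_mono) auto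
        also have "\<dots> \<le> 4 * ((e3 * \<phi> y) ^ 3 + (e4\<^sup>2 * \<rho> y) ^ 3)" using e3 phi0 rho0 by (intro cube) auto
        also have "\<dots> = 4 * (e3 ^ 3 * \<phi> y ^ 3 + (e4\<^sup>2) ^ 3 * \<rho> y ^ 3)" by (simp only: power_mult_distrib)
        also have "\<dots> \<le> 4 * ((1 + M\<^sup>2) * G * \<phi> y ^ 3 + (1 + M\<^sup>2) * G * \<rho> y ^ 3)"
        proof -
          have "G \<le> (1 + M\<^sup>2) * G" "M\<^sup>2 * G \<le> (1 + M\<^sup>2) * G" using G0 by (auto simp: distrib_right)
          then show ?thesis using c1 c2 phi0[of y] rho0[of y] by (intro mult_left_mono add_mono mult_right_mono) auto
        qed
        also have "\<dots> = 2 * KN M * G * (\<phi> y ^ 3 + \<rho> y ^ 3)" by (simp add: KN_def algebra_simps)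
        finally have x3: "\<bar>x y\<bar> ^ 3 \<le> 2 * KN M * G * (\<phi> y ^ 3 + \<rho> y ^ 3)" .
        have "\<bar>R y\<bar> \<le> \<bar>x y\<bar> ^ 3 * (1 + exp (- x y))" using exp_remainder2[of "x y"] by (simp add: R_def b)
        also have "\<dots> \<le> 2 * KN M * G * (\<phi> y ^ 3 + \<rho> y ^ 3) * (1 + exp (- x y))"
          using x3 by (intro mult_right_mono) (auto simp: add_nonneg_nonneg)
        finally show ?thesis by (simp add: b \<psi>_def x_def)
      qed (simp add: R_def \<psi>_def)
      from mult_left_mono[OF this, of "\<bar>g y\<bar>"]
      show "\<bar>g y * R y\<bar> \<le> 2 * KN M * G * (h y * (b y + \<psi> y))" by (simp add: h_def abs_mult algebra_simps)
    qed
    also have "\<dots> = 2 * KN M * G * Ex (\<lambda>y. h y * (b y + \<psi> y))" by simp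
    also have "\<dots> \<le> 2 * KN M * G * (E * (2 + KM4))" using W(2) KN_pos[of M] G0 by (intro mult_left_mono) auto
    finally show ?thesis by (simp add: mult_ac)
  qed
  have T2: "\<bar>Ex (\<lambda>y. g y * p y)\<bar> \<le> (mom 2 + mom 10) * (e5 ^ 3 / sqrt d)"
  proof -
    have am10: "all_moments d (\<lambda>y. ((nrm d y)\<^sup>2 / d) ^ 5)" by (intro am_power am_divide am_nrm_sq)
    have "\<bar>Ex (\<lambda>y. g y * p y)\<bar> \<le> Ex (\<lambda>y. e5 ^ 3 / sqrt d * (g y ^ 2 + ((nrm d y)\<^sup>2 / d) ^ 5))"
    proof (rule abs_integral_le[OF i(1)])
      show "integrable (gam d) (\<lambda>y. e5 ^ 3 / sqrt d * (g y ^ 2 + ((nrm d y)\<^sup>2 / d) ^ 5))"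
        by (intro am_integrable am_mult am_const am_add am_power[OF am_dotp] am10)
      fix y
      define \<sigma> where "\<sigma> = nrm d y / sqrt d"
      have s10: "(\<sigma> ^ 5)\<^sup>2 = ((nrm d y)\<^sup>2 / d) ^ 5"
      proof -
        have "(\<sigma> ^ 5)\<^sup>2 = (\<sigma>\<^sup>2) ^ 5" by (simp add: power_mult[symmetric])
        also have "\<sigma>\<^sup>2 = (nrm d y)\<^sup>2 / d" using d0 by (simp add: \<sigma>_def power_divide)
        finally show ?thesis .
      qed
      have "0 \<le> \<bar>g y\<bar> * \<sigma> ^ 5" by (simp add: \<sigma>_def)
      then have "\<bar>g y\<bar> * \<sigma> ^ 5 \<le> \<bar>g y\<bar>\<^sup>2 + (\<sigma> ^ 5)\<^sup>2" using two_mult_le_squares[of "\<bar>g y\<bar>" "\<sigma> ^ 5"] by linarith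
      then have gs: "\<bar>g y\<bar> * \<sigma> ^ 5 \<le> g y ^ 2 + ((nrm d y)\<^sup>2 / d) ^ 5" unfolding s10 by simp
      have "\<bar>g y * p y\<bar> \<le> \<bar>g y\<bar> * (e5 ^ 3 / sqrt d * \<sigma> ^ 5)" unfolding abs_mult \<sigma>_def by (intro mult_left_mono p_le) auto
      also have "\<dots> = e5 ^ 3 / sqrt d * (\<bar>g y\<bar> * \<sigma> ^ 5)" by simp
      also have "\<dots> \<le> e5 ^ 3 / sqrt d * (g y ^ 2 + ((nrm d y)\<^sup>2 / d) ^ 5)" using gs e5 by (intro mult_left_mono) auto
      finally show "\<bar>g y * p y\<bar> \<le> e5 ^ 3 / sqrt d * (g y ^ 2 + ((nrm d y)\<^sup>2 / d) ^ 5)" .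
    qed
    also have "\<dots> = e5 ^ 3 / sqrt d * (Ex (\<lambda>y. g y ^ 2) + Ex (\<lambda>y. ((nrm d y)\<^sup>2 / d) ^ 5))"
      using am_integrable[OF am10] am_integrable[OF am_power[OF am_dotp, of d u 2]]
      by (subst integral_mult_right_zero, subst Bochner_Integration.integral_add) auto
    also have "\<dots> \<le> e5 ^ 3 / sqrt d * (mom 2 + mom 10)"
      using g_moment(1) nrm_moment[of 5] e5 by (intro mult_left_mono add_mono) auto
    finally show ?thesis by (simp add: mult_ac)
  qed
  have T3: "\<bar>Ex (\<lambda>y. g y * B y)\<bar> \<le> 2 * (mom 2 + cmom 2 + mom 16) * G"
  proof -
    have am3: "all_moments d (\<lambda>y. \<phi> y ^ (2 * 2))" "all_moments d (\<lambda>y. \<rho> y ^ 4)" "all_moments d (\<lambda>y. g y ^ 2)"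
      by (intro am_power am_phi am_rho am_dotp)+
    have "\<bar>Ex (\<lambda>y. g y * B y)\<bar> \<le> Ex (\<lambda>y. 2 * G * (g y ^ 2 + \<phi> y ^ (2 * 2) + \<rho> y ^ 4))"
    proof (rule abs_integral_le[OF iB])
      show "integrable (gam d) (\<lambda>y. 2 * G * (g y ^ 2 + \<phi> y ^ (2 * 2) + \<rho> y ^ 4))"
        by (intro am_integrable am_mult am_const am_add am3)
      fix y
      have br: "\<bar>b y * r y\<bar> \<le> e4\<^sup>2 * \<rho> y" using r_le'[of y] b0[of y] by (simp add: abs_mult)
      have c: "e3 * e4\<^sup>2 \<le> G" "e4\<^sup>2 * e4\<^sup>2 \<le> G"
      proof -
        have "e4\<^sup>2 * e3 \<le> G" "e4\<^sup>2 * e4\<^sup>2 \<le> G" unfolding G_def S_def using e3 by (intro mult_mono; simp)+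
        then show "e3 * e4\<^sup>2 \<le> G" "e4\<^sup>2 * e4\<^sup>2 \<le> G" by (simp_all add: mult.commute)
      qed
      have "\<bar>B y\<bar> \<le> \<bar>f y\<bar> * \<bar>b y * r y\<bar> + \<bar>b y * r y\<bar>\<^sup>2"
      proof -
        have "0 \<le> (b y * r y)\<^sup>2" by simp
        then show ?thesis unfolding B_def abs_mult[symmetric] power2_abs by linarith
      qed
      also have "\<dots> \<le> (e3 * \<phi> y) * (e4\<^sup>2 * \<rho> y) + (e4\<^sup>2 * \<rho> y)\<^sup>2"
        unfolding f_eq using br e3 phi0[of y] by (intro add_mono mult_left_mono power_mono) auto
      also have "\<dots> = (e3 * e4\<^sup>2) * (\<phi> y * \<rho> y) + (e4\<^sup>2 * e4\<^sup>2) * (\<rho> y)\<^sup>2" by (simp add: power2_eq_square mult_ac)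
      also have "\<dots> \<le> G * (\<phi> y * \<rho> y) + G * (\<rho> y)\<^sup>2"
        using c phi0 rho0 by (intro add_mono mult_right_mono) auto
      finally have "\<bar>B y\<bar> \<le> G * (\<phi> y * \<rho> y + (\<rho> y)\<^sup>2)" by (simp add: distrib_left)
      then have "\<bar>g y\<bar> * \<bar>B y\<bar> \<le> \<bar>g y\<bar> * (G * (\<phi> y * \<rho> y + (\<rho> y)\<^sup>2))" by (intro mult_left_mono) auto
      also have "\<dots> = G * (\<bar>g y\<bar> * (\<phi> y * \<rho> y) + \<bar>g y\<bar> * (\<rho> y)\<^sup>2)" by (simp add: algebra_simps)
      also have "\<dots> \<le> G * (2 * (g y ^ 2 + \<phi> y ^ (2 * 2) + \<rho> y ^ 4))"
      proof (rule mult_left_mono[OF _ G0])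
        show "\<bar>g y\<bar> * (\<phi> y * \<rho> y) + \<bar>g y\<bar> * (\<rho> y)\<^sup>2 \<le> 2 * (g y ^ 2 + \<phi> y ^ (2 * 2) + \<rho> y ^ 4)"
          using quartic_young[of "\<bar>g y\<bar>" "\<phi> y" "\<rho> y"] by simp
      qed
      finally show "\<bar>g y * B y\<bar> \<le> 2 * G * (g y ^ 2 + \<phi> y ^ (2 * 2) + \<rho> y ^ 4)" by (simp add: abs_mult mult_ac)
    qed
    also have "\<dots> = 2 * G * (Ex (\<lambda>y. g y ^ 2) + Ex (\<lambda>y. \<phi> y ^ (2 * 2)) + Ex (\<lambda>y. \<rho> y ^ 4))"
      using am3[THEN am_integrable] by simp
    also have "\<dots> \<le> 2 * G * (mom 2 + cmom 2 + mom 16)"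
      using g_moment(1) phi_moment[of 2] rho_moment[of 4] G0 by (intro mult_left_mono add_mono) auto
    finally show ?thesis by (simp add: mult_ac)
  qed
  have "\<bar>Ex (\<lambda>y. g y * err y)\<bar> \<le> \<bar>Ex (\<lambda>y. g y * R y)\<bar> + \<bar>Ex (\<lambda>y. g y * p y)\<bar> + \<bar>Ex (\<lambda>y. g y * B y)\<bar>"
    unfolding split by linarith
  also have "\<dots> \<le> 2 * KN M * (2 + KM4) * (E * G) + (mom 2 + mom 10) * (e5 ^ 3 / sqrt d) + 2 * (mom 2 + cmom 2 + mom 16) * (E * G)"
  proof -
    have "2 * (mom 2 + cmom 2 + mom 16) * G \<le> 2 * (mom 2 + cmom 2 + mom 16) * (E * G)"
      using EG less_imp_le[OF mom_pos] less_imp_le[OF cmom_pos] by (intro mult_left_mono mult_nonneg_nonneg add_nonneg_nonneg) auto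
    then show ?thesis using T1 T2 T3 by linarith
  qed
  finally show ?thesis by (simp add: G_def algebra_simps)
qed

lemma first_order_bound: "\<bar>N / D - \<Delta>\<bar> \<le> K1 M * (E * S + d * \<beta>)"
proof -
  have "\<bar>N / D - \<Delta>\<bar> * KD M \<le> KN M * (2 + KM2) * (E * S) + (1 + KM3) * KN M * (2 + KM1) * (M * (E * S))
     + (M * (1 + KM3) + 5 + 6 * M * (1 + KM3)) * (d * \<beta>)"
    using e3 ES0 KM_nonneg KN_pos[of M] beta_le_tau M0
    by (intro order_trans[OF main_estimate] add_mono A1_le mult_left_mono mult_right_mono) auto
  also have "\<dots> \<le> (KN M * (2 + KM2) + KR M) * (E * S + d * \<beta>)"
  proof -
    define T where "T = d * \<beta>"
    have T: "T \<ge> 0" using beta_pos by (simp add: T_def)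
    define a1 a2 a3 where "a1 = KN M * (2 + KM2)" and "a2 = (1 + KM3) * KN M * (2 + KM1) * M" and "a3 = M * (1 + KM3) + 5 + 6 * M * (1 + KM3)"
    have nn: "0 \<le> a1" "0 \<le> a2" "0 \<le> a3" using KM_nonneg KN_pos[of M] M0 by (auto simp: a1_def a2_def a3_def)
    have KR: "KR M = a2 + a3 + (1 + KM3) * KN M * (2 + KM1)" unfolding KR_def a2_def a3_def by (simp add: algebra_simps)
    have "0 \<le> (1 + KM3) * KN M * (2 + KM1)" using KM_nonneg KN_pos[of M] by simp
    then have c: "a1 + a2 \<le> a1 + KR M" "a3 \<le> a1 + KR M" using nn KR by linarith+
    have "a1 * (E * S) + a2 * (E * S) + a3 * T \<le> (a1 + KR M) * (E * S) + (a1 + KR M) * T"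
      using mult_right_mono[OF c(1) ES0] mult_right_mono[OF c(2) T] by (simp add: distrib_right)
    then show ?thesis unfolding T_def[symmetric] a1_def a2_def a3_def by (simp add: algebra_simps)
  qed
  finally show ?thesis unfolding K1_def using KD_pos[of M] by (simp add: pos_le_divide_eq)
qed

lemma second_order_bound:
  fixes q :: "(nat \<Rightarrow> real) \<Rightarrow> real" and e5 :: real
  assumes "q \<in> borel_measurable (Leb d)" and "\<And>y. q (\<lambda>i\<in>{..<d}. - y i) = q y"
    and e5: "e5 \<ge> 0" and "\<And>y. nrm d y \<le> s * sqrt d \<Longrightarrow> \<bar>r y - q y\<bar> \<le> (e5 / d) ^ 3 / 120 * nrm d y ^ 5"
  shows "\<bar>N / D - \<Delta>\<bar> \<le> K2 M * (E * S * (e3 + e4\<^sup>2) + e5 ^ 3 / sqrt d + d * \<beta>)"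
proof -
  define a1 a2 a3 a4 where "a1 = 2 * KN M * (2 + KM4) + 2 * (mom 2 + cmom 2 + mom 16)" and "a2 = mom 2 + mom 10"
    and "a3 = (1 + KM3) * KN M * (2 + KM1)" and "a4 = M * (1 + KM3) + 5 + 6 * M * (1 + KM3)"
  define X Y T where "X = E * S * (e3 + e4\<^sup>2)" and "Y = e5 ^ 3 / sqrt d" and "T = d * \<beta>"
  have nn: "0 \<le> X" "0 \<le> Y" "0 \<le> T" using ES0 e3 e5 beta_pos by (auto simp: X_def Y_def T_def)
  have ann: "0 \<le> a1" "0 \<le> a2" "0 \<le> a3" "0 \<le> a4"
    using KM_nonneg KN_pos[of M] M0 less_imp_le[OF mom_pos] less_imp_le[OF cmom_pos]
    unfolding a1_def a2_def a3_def a4_def by (auto intro!: add_nonneg_nonneg mult_nonneg_nonneg)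
  have mX: "e3 * (E * S) \<le> X" unfolding X_def using ES0 e3 by (simp add: mult.commute[of e3] mult_left_mono)
  have "\<bar>N / D - \<Delta>\<bar> * KD M \<le> (a1 * X + a2 * Y) + a3 * X + a4 * T"
  proof (rule order_trans[OF main_estimate], intro add_mono)
    show "\<bar>Ex (\<lambda>y. g y * err y)\<bar> \<le> a1 * X + a2 * Y"
      unfolding a1_def a2_def X_def Y_def by (rule second_order_remainder[OF assms])
    show "(1 + KM3) * KN M * (2 + KM1) * (e3 * (E * S)) \<le> a3 * X"
      unfolding a3_def[symmetric] using mX ann by (intro mult_left_mono) auto
    show "(M * (1 + KM3) + 5 + 6 * M * (1 + KM3)) * \<beta> \<le> a4 * T"
      unfolding a4_def[symmetric] T_def using beta_le_tau ann by (intro mult_left_mono) auto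
  qed
  also have "\<dots> \<le> (a1 + a2 + KR M) * (X + Y + T)"
  proof -
    have KR: "KR M = a3 + a4 + M * a3" unfolding KR_def a3_def a4_def by (simp add: algebra_simps)
    have "0 \<le> M * a3" using M0 ann by simp
    then have c: "a1 + a3 \<le> a1 + a2 + KR M" "a2 \<le> a1 + a2 + KR M" "a4 \<le> a1 + a2 + KR M" using ann KR by linarith+
    have "a1 * X + a2 * Y + a3 * X + a4 * T = (a1 + a3) * X + a2 * Y + a4 * T" by (simp add: algebra_simps)
    also have "\<dots> \<le> (a1 + a2 + KR M) * X + (a1 + a2 + KR M) * Y + (a1 + a2 + KR M) * T"
      by (intro add_mono mult_right_mono c nn)
    finally show ?thesis by (simp add: algebra_simps)
  qed
  finally have "\<bar>N / D - \<Delta>\<bar> \<le> (a1 + a2 + KR M) * (X + Y + T) / KD M" using KD_pos[of M] by (simp add: pos_le_divide_eq)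
  moreover have "(a1 + a2 + KR M) / KD M = K2 M" by (simp add: K2_def a1_def a2_def)
  ultimately show ?thesis unfolding X_def Y_def T_def by (metis times_divide_eq_left)
qed

end

end

section \<open>Calculus on open sets\<close>

lemma openin_Rtop_subset: "openin (Rtop d) U \<Longrightarrow> U \<subseteq> Rd d"
  using openin_subset by fastforce

lemma eventually_at_right_0_ex:
  assumes "eventually P (at_right (0::real))"
  obtains e where "e > 0" "P e"
proof -
  obtain b where "b > 0" "\<forall>y>0. y < b \<longrightarrow> P y" using assms unfolding eventually_at_right_field by auto
  then show thesis by (intro that[of "b/2"]) auto
qed

text \<open>A basic open set of the product topology is a box with open sides; as there are finitely
  many coordinates, a common side length can be chosen. Through this the epsilon-delta arguments
  below avoid a metric.\<close>

lemma openin_Rtop_box: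
  assumes "openin (Rtop d) U" "x \<in> U"
  obtains \<epsilon> where "\<epsilon> > 0" "\<And>y. y \<in> Rd d \<Longrightarrow> (\<And>i. i < d \<Longrightarrow> \<bar>y i - x i\<bar> < \<epsilon>) \<Longrightarrow> y \<in> U"
proof -
  obtain X where X: "\<forall>i\<in>{..<d}. openin euclideanreal (X i)" "x \<in> Pi\<^sub>E {..<d} X" "Pi\<^sub>E {..<d} X \<subseteq> U"
    using assms unfolding openin_product_topology_alt by meson
  have "\<forall>i\<in>{..<d}. eventually (\<lambda>e. ball (x i) e \<subseteq> X i) (at_right 0)"
  proof
    fix i assume i: "i \<in> {..<d}"
    then have "open (X i)" "x i \<in> X i" using X by (auto simp: PiE_iff)
    then obtain e where e: "e > 0" "ball (x i) e \<subseteq> X i" using open_contains_ball by metis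
    then show "eventually (\<lambda>e. ball (x i) e \<subseteq> X i) (at_right 0)"
      by (intro eventually_at_rightI[of 0 e]) (auto simp: ball_def)
  qed
  then have "eventually (\<lambda>e. \<forall>i\<in>{..<d}. ball (x i) e \<subseteq> X i) (at_right 0)"
    by (intro eventually_ball_finite) auto
  then obtain e where e: "e > 0" "\<forall>i\<in>{..<d}. ball (x i) e \<subseteq> X i"
    by (rule eventually_at_right_0_ex)
  show thesis
  proof (rule that[OF e(1)])
    fix y assume y: "y \<in> Rd d" "\<And>i. i < d \<Longrightarrow> \<bar>y i - x i\<bar> < e"
    have "y i \<in> X i" if "i < d" for i
      using e(2) y(2)[OF that] that by (force simp: dist_real_def abs_minus_commute)
    then have "y \<in> Pi\<^sub>E {..<d} X" using y(1) by (auto simp: PiE_iff)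
    then show "y \<in> U" using X by blast
  qed
qed

lemma continuous_map_Rtop_box:
  assumes U: "openin (Rtop d) U" and f: "continuous_map (subtopology (Rtop d) U) euclideanreal f"
    and x: "x \<in> U" and e: "e > 0"
  obtains \<delta> where "\<delta> > 0" "\<And>y. y \<in> Rd d \<Longrightarrow> (\<And>i. i < d \<Longrightarrow> \<bar>y i - x i\<bar> < \<delta>) \<Longrightarrow> y \<in> U \<and> \<bar>f y - f x\<bar> < e"
proof -
  have op: "openin (subtopology (Rtop d) U) {y \<in> topspace (subtopology (Rtop d) U). f y \<in> ball (f x) e}"
    using f by (intro openin_continuous_map_preimage) auto
  have "topspace (subtopology (Rtop d) U) = U"
    using openin_Rtop_subset[OF U] by auto
  have "openin (Rtop d) {y \<in> U. f y \<in> ball (f x) e}"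
  proof -
    have "{y \<in> topspace (subtopology (Rtop d) U). f y \<in> ball (f x) e} = {y \<in> U. f y \<in> ball (f x) e}"
      using \<open>topspace (subtopology (Rtop d) U) = U\<close> by simp
    then show ?thesis using openin_trans_full[OF op U] by simp
  qed
  from openin_Rtop_box[OF this, of x] x e obtain \<delta> where "\<delta> > 0"
    "\<And>y. y \<in> Rd d \<Longrightarrow> (\<And>i. i < d \<Longrightarrow> \<bar>y i - x i\<bar> < \<delta>) \<Longrightarrow> y \<in> {y \<in> U. f y \<in> ball (f x) e}"
    by auto
  then show thesis using that by (auto simp: dist_real_def abs_minus_commute)
qed

lemma openin_Rtop_upd:
  assumes "openin (Rtop d) U" "x \<in> U" "i < d"
  shows "eventually (\<lambda>t. x(i := t) \<in> U) (nhds (x i))"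
proof -
  obtain \<epsilon> where e: "\<epsilon> > 0" "\<And>y. y \<in> Rd d \<Longrightarrow> (\<And>i. i < d \<Longrightarrow> \<bar>y i - x i\<bar> < \<epsilon>) \<Longrightarrow> y \<in> U"
    using openin_Rtop_box[OF assms(1,2)] by blast
  have xR: "x \<in> Rd d" using openin_Rtop_subset[OF assms(1)] assms(2) by blast
  show ?thesis unfolding eventually_nhds_metric
  proof (intro exI[of _ \<epsilon>] conjI allI impI e(1))
    fix t assume t: "dist t (x i) < \<epsilon>"
    show "x(i := t) \<in> U"
    proof (rule e(2))
      show "x(i := t) \<in> Rd d" using xR assms(3) by (auto simp: PiE_iff extensional_def)
      show "\<bar>(x(i := t)) j - x j\<bar> < \<epsilon>" if "j < d" for j
        using t e(1) by (simp add: dist_real_def)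
    qed
  qed
qed

lemma pdiff_cong:
  assumes U: "openin (Rtop d) U" "x \<in> U" "i < d" and eq: "\<And>y. y \<in> U \<Longrightarrow> f y = g y"
  shows "pdiff i f x = pdiff i g x"
    and "(\<lambda>t. f (x(i := t))) differentiable (at (x i)) \<longleftrightarrow> (\<lambda>t. g (x(i := t))) differentiable (at (x i))"
proof -
  have ev: "eventually (\<lambda>t. f (x(i := t)) = g (x(i := t))) (nhds (x i))"
    using openin_Rtop_upd[OF U] by eventually_elim (rule eq)
  show "pdiff i f x = pdiff i g x" unfolding pdiff_def by (rule deriv_cong_ev[OF ev refl])
  show "(\<lambda>t. f (x(i := t))) differentiable (at (x i)) \<longleftrightarrow> (\<lambda>t. g (x(i := t))) differentiable (at (x i))"
    unfolding real_differentiable_def using DERIV_cong_ev[OF refl ev refl] by simp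
qed

text \<open>Formulas for derivatives, such as those of a multiple c f, hold on U only; regularity
  must therefore be insensitive to values off U.\<close>

lemma Ck_on_cong:
  assumes U: "openin (Rtop d) U"
  shows "(\<And>y. y \<in> U \<Longrightarrow> f y = g y) \<Longrightarrow> Ck_on d k U f \<longleftrightarrow> Ck_on d k U g"
proof (induction k arbitrary: f g)
  case 0
  have "topspace (subtopology (Rtop d) U) = U" using openin_Rtop_subset[OF U] by auto
  then show ?case using 0 by (auto intro: continuous_map_eq)
next
  case (Suc k)
  have t: "topspace (subtopology (Rtop d) U) = U" using openin_Rtop_subset[OF U] by auto
  have "continuous_map (subtopology (Rtop d) U) euclideanreal f \<longleftrightarrow> continuous_map (subtopology (Rtop d) U) euclideanreal g"
    using Suc.prems t by (auto intro: continuous_map_eq)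
  moreover have "Ck_on d k U (pdiff i f) \<longleftrightarrow> Ck_on d k U (pdiff i g)" if "i < d" for i
    by (rule Suc.IH) (rule pdiff_cong(1)[OF U _ that Suc.prems])
  moreover have "(\<lambda>t. f (x(i := t))) differentiable (at (x i)) \<longleftrightarrow> (\<lambda>t. g (x(i := t))) differentiable (at (x i))"
    if "i < d" "x \<in> U" for i x
    by (rule pdiff_cong(2)[OF U that(2,1) Suc.prems])
  ultimately show ?case by (auto simp del: fun_upd_apply)
qed

lemma Ck_on_Suc_D: "Ck_on d (Suc k) U f \<Longrightarrow> Ck_on d k U f"
  by (induction k arbitrary: f) auto

lemma Ck_on_mono: "Ck_on d k U f \<Longrightarrow> j \<le> k \<Longrightarrow> Ck_on d j U f"
proof (induction k)
  case (Suc k) then show ?case by (cases "j = Suc k") (auto dest: Ck_on_Suc_D simp del: Ck_on.simps simp: le_Suc_eq)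
qed simp

lemma Ck_on_continuous: "Ck_on d k U f \<Longrightarrow> continuous_map (subtopology (Rtop d) U) euclideanreal f"
  by (cases k) auto

lemma Ck_on_pdiff: "Ck_on d (Suc k) U f \<Longrightarrow> i < d \<Longrightarrow> Ck_on d k U (pdiff i f)"
  by simp

lemma Ck_on_deriv:
  "Ck_on d (Suc k) U f \<Longrightarrow> i < d \<Longrightarrow> x \<in> U \<Longrightarrow> ((\<lambda>t. f (x(i := t))) has_real_derivative pdiff i f x) (at (x i))"
  unfolding pdiff_def by (simp add: DERIV_deriv_iff_real_differentiable)

lemma Ck_on_cmult:
  assumes U: "openin (Rtop d) U"
  shows "Ck_on d k U f \<Longrightarrow> Ck_on d k U (\<lambda>x. c * f x)"
    and "Ck_on d (Suc k) U f \<Longrightarrow> i < d \<Longrightarrow> x \<in> U \<Longrightarrow> pdiff i (\<lambda>x. c * f x) x = c * pdiff i f x"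
proof -
  show *: "pdiff i (\<lambda>x. c * f x) x = c * pdiff i f x" if "Ck_on d (Suc k) U f" "i < d" "x \<in> U" for f k i x
  proof -
    have "((\<lambda>t. c * f (x(i := t))) has_real_derivative c * pdiff i f x) (at (x i))"
      by (intro DERIV_cmult Ck_on_deriv[OF that])
    then show ?thesis unfolding pdiff_def[of i "\<lambda>x. c * f x"] by (rule DERIV_imp_deriv)
  qed
  show "Ck_on d k U f \<Longrightarrow> Ck_on d k U (\<lambda>x. c * f x)"
  proof (induction k arbitrary: f)
    case 0 then show ?case by (auto intro: continuous_map_real_mult_left)
  next
    case (Suc k)
    have "Ck_on d k U (pdiff i (\<lambda>x. c * f x))" if "i < d" for i
      using Ck_on_cong[OF U, of "pdiff i (\<lambda>x. c * f x)" "\<lambda>x. c * pdiff i f x" k] *[OF Suc.prems that] Suc.IH[of "pdiff i f"] Suc.prems that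
      by simp
    moreover have "(\<lambda>t. c * f (x(i := t))) differentiable (at (x i))" if "i < d" "x \<in> U" for i x
      using Suc.prems that by (auto intro: differentiable_mult)
    ultimately show ?case using Suc.prems by (auto intro: continuous_map_real_mult_left)
  qed
qed

lemma Ck_on_nabla:
  assumes "Ck_on d k U f" "set is \<subseteq> {..<d}" "length is \<le> k"
  shows "Ck_on d (k - length is) U (\<lambda>x. nabla f x is)"
  using assms(2,3)
proof (induction "is")
  case Nil then show ?case using assms(1) by (simp add: nabla_def)
next
  case (Cons i "is")
  have e: "k - length is = Suc (k - length (i # is))" using Cons.prems by simp
  have "Ck_on d (Suc (k - length (i # is))) U (\<lambda>x. nabla f x is)" using Cons unfolding e[symmetric] by simp
  from Ck_on_pdiff[OF this, of i] Cons.prems show ?case by (simp add: nabla_def)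
qed

lemma nabla_cmult:
  assumes U: "openin (Rtop d) U" and "Ck_on d k U f" "set is \<subseteq> {..<d}" "length is \<le> k" "x \<in> U"
  shows "nabla (\<lambda>x. c * f x) x is = c * nabla f x is"
  using assms(3,4,5)
proof (induction "is" arbitrary: x)
  case Nil then show ?case by (simp add: nabla_def)
next
  case (Cons i "is")
  have C: "Ck_on d (Suc (k - length (i # is))) U (\<lambda>x. nabla f x is)"
  proof -
    have e: "k - length is = Suc (k - length (i # is))" using Cons.prems by simp
    show ?thesis using Ck_on_nabla[OF assms(2), of "is"] Cons.prems unfolding e[symmetric] by simp
  qed
  have "nabla (\<lambda>x. c * f x) x (i # is) = pdiff i (\<lambda>x. nabla (\<lambda>x. c * f x) x is) x" by (simp add: nabla_def)
  also have "\<dots> = pdiff i (\<lambda>x. c * nabla f x is) x"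
    using Cons by (intro pdiff_cong(1)[OF U]) auto
  also have "\<dots> = c * pdiff i (\<lambda>x. nabla f x is) x"
    using Cons.prems by (intro Ck_on_cmult(2)[OF U C]) auto
  finally show ?case by (simp add: nabla_def)
qed

definition ray :: "nat \<Rightarrow> (nat \<Rightarrow> real) \<Rightarrow> (nat \<Rightarrow> real) \<Rightarrow> real \<Rightarrow> nat \<Rightarrow> real" where
  "ray d x u t = (\<lambda>i\<in>{..<d}. x i + t * u i)"

lemma ray_Rd [simp]: "ray d x u t \<in> Rd d" by (simp add: ray_def)

text \<open>Continuous partial derivatives imply differentiability: the increment is telescoped over
  paths that move one coordinate at a time, and each piece is compared with its linear part by the
  mean value inequality.\<close>

lemma deriv_along_ray_0:
  assumes U: "openin (Rtop d) U" and C: "Ck_on d (Suc k) U g" and x: "x \<in> U"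
  shows "((\<lambda>t. g (ray d x u t)) has_real_derivative (\<Sum>i<d. u i * pdiff i g x)) (at 0)"
proof -
  have xR: "x \<in> Rd d" using openin_Rtop_subset[OF U] x by blast
  have x0: "ray d x u 0 = x" using xR by (auto simp: ray_def fun_eq_iff PiE_def extensional_def)
  define S where "S = (\<Sum>i<d. \<bar>u i\<bar>)"
  have S0: "S \<ge> 0" by (simp add: S_def sum_nonneg)
  have ui: "\<bar>u i\<bar> \<le> S" if "i < d" for i unfolding S_def using that by (intro member_le_sum) auto
  show ?thesis unfolding DERIV_def
  proof (rule LIM_I)
    fix r :: real assume r: "r > 0"
    \<comment> \<open>The total error is at most e S, hence below r; S + 1 keeps the divisor
      positive.\<close>
    define e where "e = r / (2 * (S + 1))"
    have e: "e > 0" using r S0 by (simp add: e_def)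
    have "\<forall>i\<in>{..<d}. eventually (\<lambda>\<delta>. \<forall>y\<in>Rd d. (\<forall>j<d. \<bar>y j - x j\<bar> < \<delta>) \<longrightarrow> y \<in> U \<and> \<bar>pdiff i g y - pdiff i g x\<bar> < e) (at_right 0)"
    proof
      fix i assume "i \<in> {..<d}"
      then have "continuous_map (subtopology (Rtop d) U) euclideanreal (pdiff i g)"
        using C by (intro Ck_on_continuous[of d k]) auto
      from continuous_map_Rtop_box[OF U this x e] obtain \<delta> where "\<delta> > 0"
        "\<And>y. y \<in> Rd d \<Longrightarrow> (\<And>j. j < d \<Longrightarrow> \<bar>y j - x j\<bar> < \<delta>) \<Longrightarrow> y \<in> U \<and> \<bar>pdiff i g y - pdiff i g x\<bar> < e" by blast
      then show "eventually (\<lambda>\<delta>. \<forall>y\<in>Rd d. (\<forall>j<d. \<bar>y j - x j\<bar> < \<delta>) \<longrightarrow> y \<in> U \<and> \<bar>pdiff i g y - pdiff i g x\<bar> < e) (at_right 0)"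
        by (intro eventually_at_rightI[of 0 \<delta>]) (auto, (meson less_trans)+)
    qed
    then have "eventually (\<lambda>\<delta>. \<forall>i\<in>{..<d}. \<forall>y\<in>Rd d. (\<forall>j<d. \<bar>y j - x j\<bar> < \<delta>) \<longrightarrow> y \<in> U \<and> \<bar>pdiff i g y - pdiff i g x\<bar> < e) (at_right 0)"
      by (intro eventually_ball_finite) auto
    then obtain \<delta> where \<delta>: "\<delta> > 0" and box': "\<forall>i\<in>{..<d}. \<forall>y\<in>Rd d. (\<forall>j<d. \<bar>y j - x j\<bar> < \<delta>) \<longrightarrow> y \<in> U \<and> \<bar>pdiff i g y - pdiff i g x\<bar> < e"
      by (rule eventually_at_right_0_ex)
    have box: "y \<in> U \<and> \<bar>pdiff i g y - pdiff i g x\<bar> < e" if "i < d" "y \<in> Rd d" "\<And>j. j < d \<Longrightarrow> \<bar>y j - x j\<bar> < \<delta>" for i y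
      using box' that by blast
    have small: "\<bar>h * u i\<bar> < \<delta>" if "\<bar>h\<bar> < \<delta> / (S + 1)" "i < d" for h i
    proof -
      have "\<bar>h * u i\<bar> \<le> \<bar>h\<bar> * S" using ui[OF that(2)] by (simp add: abs_mult mult_left_mono)
      also have "\<dots> \<le> \<bar>h\<bar> * (S + 1)" by (intro mult_left_mono) auto
      also have "\<dots> < \<delta>" using that(1) S0 by (simp add: field_simps)
      finally show ?thesis .
    qed
    show "\<exists>s>0. \<forall>h. h \<noteq> 0 \<and> norm (h - 0) < s \<longrightarrow>
      norm ((g (ray d x u (0 + h)) - g (ray d x u 0)) / h - (\<Sum>i<d. u i * pdiff i g x)) < r"
    proof (intro exI[of _ "\<delta> / (S + 1)"] conjI allI impI)
      show "\<delta> / (S + 1) > 0" using \<delta> S0 by simp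
      fix h :: real assume h: "h \<noteq> 0 \<and> norm (h - 0) < \<delta> / (S + 1)"
      \<comment> \<open>The first k coordinates have already moved to the end point of the
        ray.\<close>
      define z where "z k = (\<lambda>i\<in>{..<d}. x i + (if i < k then h * u i else 0))" for k :: nat
      have step: "\<bar>g (z (Suc k)) - g (z k) - h * (u k * pdiff k g x)\<bar> \<le> e * (\<bar>h\<bar> * \<bar>u k\<bar>)" if k: "k < d" for k
      proof -
        let ?B = "ball (x k) \<delta>"
        have inB: "(z k)(k := s) \<in> U \<and> \<bar>pdiff k g ((z k)(k := s)) - pdiff k g x\<bar> < e" if s: "s \<in> ?B" for s
        proof (rule box[OF k])
          show "(z k)(k := s) \<in> Rd d" using k by (auto simp: z_def PiE_iff extensional_def)
          fix j assume "j < d"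
          then show "\<bar>((z k)(k := s)) j - x j\<bar> < \<delta>"
            using s small[of h j] h \<delta> by (auto simp: z_def dist_real_def abs_minus_commute)
        qed
        have "norm ((g ((z k)(k := x k + h * u k)) - pdiff k g x * (x k + h * u k)) - (g ((z k)(k := x k)) - pdiff k g x * x k))
          \<le> e * norm (x k + h * u k - x k)"
        proof (rule field_differentiable_bound[of ?B "\<lambda>s. g ((z k)(k := s)) - pdiff k g x * s" "\<lambda>s. pdiff k g ((z k)(k := s)) - pdiff k g x" e "x k + h * u k" "x k"])
          fix s assume s: "s \<in> ?B"
          have "((\<lambda>t. g (((z k)(k := s))(k := t))) has_real_derivative pdiff k g ((z k)(k := s))) (at (((z k)(k := s)) k))"
            using inB[OF s] by (intro Ck_on_deriv[OF C k]) auto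
          then show "((\<lambda>s. g ((z k)(k := s)) - pdiff k g x * s) has_real_derivative pdiff k g ((z k)(k := s)) - pdiff k g x) (at s within ?B)"
            by (auto intro!: derivative_eq_intros elim: DERIV_subset)
          show "norm (pdiff k g ((z k)(k := s)) - pdiff k g x) \<le> e" using inB[OF s] by simp
        qed (use small[of h k] h k \<delta> in \<open>auto simp: dist_real_def\<close>)
        moreover have "(z k)(k := x k + h * u k) = z (Suc k)" "(z k)(k := x k) = z k"
          using k by (auto simp: z_def fun_eq_iff less_Suc_eq)
        ultimately show ?thesis by (simp add: algebra_simps abs_mult)
      qed
      have z0: "z 0 = x" using xR by (auto simp: z_def fun_eq_iff PiE_def extensional_def)
      have zd: "z d = ray d x u h" by (auto simp: z_def ray_def)
      have "g (ray d x u h) - g x - h * (\<Sum>i<d. u i * pdiff i g x) = (\<Sum>k<d. g (z (Suc k)) - g (z k) - h * (u k * pdiff k g x))"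
        using sum_lessThan_telescope[of "\<lambda>k. g (z k)" d] by (subst sum_subtractf) (simp add: z0 zd sum_distrib_left)
      also have "\<bar>\<dots>\<bar> \<le> (\<Sum>k<d. e * (\<bar>h\<bar> * \<bar>u k\<bar>))"
        by (rule order_trans[OF sum_abs]) (intro sum_mono step, simp)
      also have "\<dots> = e * S * \<bar>h\<bar>" by (simp add: S_def sum_distrib_left sum_distrib_right mult_ac)
      finally have est: "\<bar>g (ray d x u h) - g x - h * (\<Sum>i<d. u i * pdiff i g x)\<bar> \<le> e * S * \<bar>h\<bar>" .
      have "(g (ray d x u h) - g x) / h - (\<Sum>i<d. u i * pdiff i g x) = (g (ray d x u h) - g x - h * (\<Sum>i<d. u i * pdiff i g x)) / h"
        using h by (simp add: field_simps)
      then have "\<bar>(g (ray d x u h) - g x) / h - (\<Sum>i<d. u i * pdiff i g x)\<bar> \<le> e * S"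
        using est h by (simp add: abs_divide divide_le_eq)
      also have "\<dots> < r"
      proof -
        have "e * S \<le> e * (S + 1)" using e by simp
        also have "\<dots> = r / 2"
        proof -
          have "K * e = r / 2" if "K \<noteq> 0" "e = r / (2 * K)" for K using that by simp
          from this[of "S + 1"] S0 show ?thesis by (simp only: e_def mult.commute[of _ "S + 1"])
        qed
        finally show ?thesis using r by simp
      qed
      finally show "norm ((g (ray d x u (0 + h)) - g (ray d x u 0)) / h - (\<Sum>i<d. u i * pdiff i g x)) < r"
        by (simp add: x0)
    qed
  qed
qed

lemma deriv_along_ray:
  assumes U: "openin (Rtop d) U" and C: "Ck_on d (Suc k) U g" and x: "ray d x u t \<in> U"
  shows "((\<lambda>t. g (ray d x u t)) has_real_derivative (\<Sum>i<d. u i * pdiff i g (ray d x u t))) (at t)"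
proof -
  have "ray d (ray d x u t) u s = ray d x u (s + t)" for s
    by (auto simp: ray_def fun_eq_iff algebra_simps)
  then have "((\<lambda>s. g (ray d x u (s + t))) has_real_derivative (\<Sum>i<d. u i * pdiff i g (ray d x u t))) (at 0)"
    using deriv_along_ray_0[OF U C x, of u] by simp
  then show ?thesis using DERIV_shift[of "\<lambda>t. g (ray d x u t)" _ 0 t] by simp
qed

section \<open>Taylor's formula along a segment\<close>

lemma tidx_Suc: "tidx d (Suc k) = (\<lambda>(i, is). i # is) ` ({..<d} \<times> tidx d k)"
  by (auto simp: tidx_def length_Suc_conv image_iff)

lemma sum_tidx_Suc: "(\<Sum>js\<in>tidx d (Suc k). F js) = (\<Sum>i<d. \<Sum>is\<in>tidx d k. F (i # is))"
proof -
  have "(\<Sum>js\<in>tidx d (Suc k). F js) = (\<Sum>(i, is)\<in>{..<d} \<times> tidx d k. F (i # is))"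
    unfolding tidx_Suc by (subst sum.reindex) (auto simp: inj_on_def case_prod_beta)
  then show ?thesis by (simp add: sum.cartesian_product)
qed

lemma tidx_0 [simp]: "tidx d 0 = {[]}" by (auto simp: tidx_def)

lemma tinner_3: "tinner d 3 T S = (\<Sum>i<d. \<Sum>j<d. \<Sum>k<d. T [i, j, k] * S [i, j, k])"
  by (simp add: tinner_def eval_nat_numeral sum_tidx_Suc)

lemma tinner_2: "tinner d 2 T S = (\<Sum>i<d. \<Sum>j<d. T [i, j] * S [i, j])"
  by (simp add: tinner_def eval_nat_numeral sum_tidx_Suc)

lemma tinner_tpow_cong:
  assumes "\<And>i. i < d \<Longrightarrow> u i = w i"
  shows "tinner d k T (tpow u) = tinner d k T (tpow w)"
  unfolding tinner_def tpow_def using assms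
  by (intro sum.cong refl arg_cong2[where f="(*)"] arg_cong[where f=prod_list] map_cong) (auto simp: tidx_def)

lemma tinner_tpow_scale: "tinner d k T (tpow (\<lambda>i. c * u i)) = c ^ k * tinner d k T (tpow u)"
proof -
  have "prod_list (map (\<lambda>i. c * u i) is) = c ^ length is * prod_list (map u is)" for "is"
    by (induction "is") auto
  then show ?thesis unfolding tinner_def tpow_def sum_distrib_left
    by (intro sum.cong refl) (auto simp: tidx_def)
qed

text \<open>Each differentiation along the ray prepends one index contracted with u, which is the
  recursion in \<open>sum_tidx_Suc\<close>.\<close>

lemma deriv_ray_tinner:
  assumes U: "openin (Rtop d) U" and C: "Ck_on d k U V" and k: "m < k" and x: "ray d x u t \<in> U"
  shows "((\<lambda>t. tinner d m (nabla V (ray d x u t)) (tpow u)) has_real_derivative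
     tinner d (Suc m) (nabla V (ray d x u t)) (tpow u)) (at t)"
proof -
  have "((\<lambda>t. \<Sum>is\<in>tidx d m. nabla V (ray d x u t) is * tpow u is) has_real_derivative
     (\<Sum>is\<in>tidx d m. (\<Sum>i<d. u i * pdiff i (\<lambda>x. nabla V x is) (ray d x u t)) * tpow u is)) (at t)"
  proof (rule DERIV_sum)
    fix "is" assume "is \<in> tidx d m"
    then have i: "set is \<subseteq> {..<d}" "length is = m" by (auto simp: tidx_def)
    have "k - length is = Suc (k - Suc m)" using i k by simp
    then have "Ck_on d (Suc (k - Suc m)) U (\<lambda>x. nabla V x is)"
      using Ck_on_nabla[OF C i(1)] i(2) k by (metis less_imp_le)
    from DERIV_cmult_right[OF deriv_along_ray[OF U this x]]
    show "((\<lambda>t. nabla V (ray d x u t) is * tpow u is) has_real_derivative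
       (\<Sum>i<d. u i * pdiff i (\<lambda>x. nabla V x is) (ray d x u t)) * tpow u is) (at t)" by simp
  qed
  moreover have "(\<Sum>is\<in>tidx d m. (\<Sum>i<d. u i * pdiff i (\<lambda>x. nabla V x is) (ray d x u t)) * tpow u is) =
     tinner d (Suc m) (nabla V (ray d x u t)) (tpow u)"
    unfolding tinner_def sum_tidx_Suc sum_distrib_right
    by (subst sum.swap) (simp add: nabla_def tpow_def mult_ac)
  ultimately show ?thesis by (simp add: tinner_def)
qed

lemma taylor_ray:
  assumes U: "openin (Rtop d) U" and C: "Ck_on d k U V" and k: "0 < k"
    and seg: "\<And>t. 0 \<le> t \<Longrightarrow> t \<le> 1 \<Longrightarrow> ray d x u t \<in> U"
  shows "\<exists>t. 0 < t \<and> t < 1 \<and> V (ray d x u 1) =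
    (\<Sum>m<k. tinner d m (nabla V (ray d x u 0)) (tpow u) / fact m) + tinner d k (nabla V (ray d x u t)) (tpow u) / fact k"
proof -
  have "\<exists>t. 0 < t \<and> t < 1 \<and> V (ray d x u 1) =
    (\<Sum>m<k. tinner d m (nabla V (ray d x u 0)) (tpow u) / fact m * 1 ^ m) + tinner d k (nabla V (ray d x u t)) (tpow u) / fact k * 1 ^ k"
    using k seg deriv_ray_tinner[OF U C]
    by (intro Maclaurin[where h=1 and f="\<lambda>t. V (ray d x u t)" and diff="\<lambda>m t. tinner d m (nabla V (ray d x u t)) (tpow u)"])
       (auto simp: tinner_def nabla_def tpow_def)
  then show ?thesis by simp
qed

lemma ray_eventually_in:
  assumes U: "openin (Rtop d) U" and x: "x \<in> U"
  shows "eventually (\<lambda>t. ray d x u t \<in> U) (nhds 0)"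
proof -
  obtain \<epsilon> where e: "\<epsilon> > 0" "\<And>y. y \<in> Rd d \<Longrightarrow> (\<And>i. i < d \<Longrightarrow> \<bar>y i - x i\<bar> < \<epsilon>) \<Longrightarrow> y \<in> U"
    using openin_Rtop_box[OF U x] by blast
  have "eventually (\<lambda>t. \<forall>i\<in>{..<d}. \<bar>t * u i\<bar> < \<epsilon>) (nhds 0)"
  proof (intro eventually_ball_finite ballI)
    fix i
    have "((\<lambda>t. \<bar>t * u i\<bar>) \<longlongrightarrow> \<bar>0 * u i\<bar>) (nhds 0)" by (intro tendsto_rabs tendsto_mult filterlim_ident tendsto_const)
    then show "eventually (\<lambda>t. \<bar>t * u i\<bar> < \<epsilon>) (nhds 0)"
      using e(1) by (auto dest!: order_tendstoD(2)[of _ _ _ \<epsilon>])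
  qed simp
  then show ?thesis
    by eventually_elim (rule e(2), auto simp: ray_def)
qed

lemma gradient_zero_at_min:
  assumes U: "openin (Rtop d) U" and C: "Ck_on d (Suc k) U V" and x: "x \<in> U"
    and min: "\<And>y. y \<in> U \<Longrightarrow> V x \<le> V y"
  shows "tinner d 1 (nabla V x) (tpow u) = 0"
proof -
  have xR: "x \<in> Rd d" using openin_Rtop_subset[OF U] x by blast
  have x0: "ray d x u 0 = x" using xR by (auto simp: ray_def fun_eq_iff PiE_def extensional_def)
  have D: "((\<lambda>t. V (ray d x u t)) has_real_derivative tinner d 1 (nabla V x) (tpow u)) (at 0)"
    using deriv_ray_tinner[OF U C, of 0 x u 0] x by (simp add: x0) (simp add: tinner_def nabla_def tpow_def)
  obtain \<delta> where "\<delta> > 0" "\<And>t. \<bar>t\<bar> < \<delta> \<Longrightarrow> ray d x u t \<in> U"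
    using ray_eventually_in[OF U x, of u] unfolding eventually_nhds_metric by (auto simp: dist_real_def)
  then show ?thesis
    by (intro DERIV_local_min[OF D]) (auto simp: x0 intro!: min)
qed

text \<open>The mean value theorem is applied first in the coordinate i to the difference in j, then
  in j to the partial derivative. The second difference itself is symmetric in i and j, the
  resulting mixed derivative is not obviously so.\<close>

lemma double_difference:
  assumes C: "Ck_on d 2 U g" and ij: "i < d" "j < d" "i \<noteq> j" and h: "h > 0"
    and box: "\<And>s t. \<bar>s - x i\<bar> \<le> h \<Longrightarrow> \<bar>t - x j\<bar> \<le> h \<Longrightarrow> x(i := s, j := t) \<in> U"
  shows "\<exists>s t. x i < s \<and> s < x i + h \<and> x j < t \<and> t < x j + h \<and>
    g (x(i := x i + h, j := x j + h)) - g (x(i := x i + h, j := x j)) - g (x(i := x i, j := x j + h)) + g (x(i := x i, j := x j))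
      = h * h * pdiff j (pdiff i g) (x(i := s, j := t))"
proof -
  have C2: "Ck_on d (Suc (Suc 0)) U g" using C by (simp only: numeral_2_eq_2)
  define \<phi> where "\<phi> s = g (x(i := s, j := x j + h)) - g (x(i := s, j := x j))" for s
  have D: "((\<lambda>s. g (x(i := s, j := t))) has_real_derivative pdiff i g (x(i := s, j := t))) (at s)"
    if "\<bar>s - x i\<bar> \<le> h" "\<bar>t - x j\<bar> \<le> h" for s t
    using Ck_on_deriv[OF C2 ij(1) box[OF that]] ij(3) by (simp add: fun_upd_twist)
  have "\<exists>s. x i < s \<and> s < x i + h \<and> \<phi> (x i + h) - \<phi> (x i) =
     (x i + h - x i) * (pdiff i g (x(i := s, j := x j + h)) - pdiff i g (x(i := s, j := x j)))"
    using h unfolding \<phi>_def by (intro MVT2) (auto intro!: DERIV_diff D simp del: fun_upd_apply)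
  then obtain s where s: "x i < s" "s < x i + h" "\<phi> (x i + h) - \<phi> (x i) =
     h * (pdiff i g (x(i := s, j := x j + h)) - pdiff i g (x(i := s, j := x j)))" by auto
  have D2: "((\<lambda>t. pdiff i g (x(i := s, j := t))) has_real_derivative pdiff j (pdiff i g) (x(i := s, j := t))) (at t)"
    if "\<bar>t - x j\<bar> \<le> h" for t
    using Ck_on_deriv[OF Ck_on_pdiff[OF C2 ij(1)] ij(2) box[of s t]] that s by simp
  have "\<exists>t. x j < t \<and> t < x j + h \<and> pdiff i g (x(i := s, j := x j + h)) - pdiff i g (x(i := s, j := x j)) =
     (x j + h - x j) * pdiff j (pdiff i g) (x(i := s, j := t))"
    using h by (intro MVT2) (auto intro!: D2 simp del: fun_upd_apply)
  then obtain t where t: "x j < t" "t < x j + h" "pdiff i g (x(i := s, j := x j + h)) - pdiff i g (x(i := s, j := x j)) =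
     h * pdiff j (pdiff i g) (x(i := s, j := t))" by auto
  show ?thesis
    using s t by (intro exI[of _ s] exI[of _ t]) (simp add: \<phi>_def mult.assoc del: fun_upd_apply)
qed

text \<open>Schwarz's theorem. On a small enough square both mixed derivatives stay within half
  their gap at x, while the two readings of the same second difference force them to agree at some
  points of that square.\<close>

lemma pdiff_commute:
  assumes U: "openin (Rtop d) U" and C: "Ck_on d 2 U g" and ij: "i < d" "j < d" and x: "x \<in> U"
  shows "pdiff j (pdiff i g) x = pdiff i (pdiff j g) x"
proof (rule ccontr)
  assume ne: "\<not> ?thesis"
  then have "i \<noteq> j" by auto
  have xR: "x \<in> Rd d" using openin_Rtop_subset[OF U] x by blast
  define P where "P = pdiff j (pdiff i g)"
  define Q where "Q = pdiff i (pdiff j g)"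
  define e where "e = \<bar>P x - Q x\<bar> / 2"
  have e: "e > 0" using ne by (simp add: e_def P_def Q_def)
  have c: "continuous_map (subtopology (Rtop d) U) euclideanreal P" "continuous_map (subtopology (Rtop d) U) euclideanreal Q"
    using C ij by (auto simp: P_def Q_def numeral_2_eq_2)
  obtain \<delta>1 where d1: "\<delta>1 > 0" "\<And>y. y \<in> Rd d \<Longrightarrow> (\<And>i. i < d \<Longrightarrow> \<bar>y i - x i\<bar> < \<delta>1) \<Longrightarrow> y \<in> U \<and> \<bar>P y - P x\<bar> < e"
    using continuous_map_Rtop_box[OF U c(1) x e] by blast
  obtain \<delta>2 where d2: "\<delta>2 > 0" "\<And>y. y \<in> Rd d \<Longrightarrow> (\<And>i. i < d \<Longrightarrow> \<bar>y i - x i\<bar> < \<delta>2) \<Longrightarrow> y \<in> U \<and> \<bar>Q y - Q x\<bar> < e"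
    using continuous_map_Rtop_box[OF U c(2) x e] by blast
  define h where "h = min \<delta>1 \<delta>2 / 2"
  have h: "h > 0" "h < \<delta>1" "h < \<delta>2" using d1(1) d2(1) by (auto simp: h_def min_def)
  have R: "x(i := s, j := t) \<in> Rd d" for s t using xR ij by (auto simp: PiE_iff extensional_def)
  have near: "x(i := s, j := t) \<in> U \<and> \<bar>P (x(i := s, j := t)) - P x\<bar> < e \<and> \<bar>Q (x(i := s, j := t)) - Q x\<bar> < e"
    if "\<bar>s - x i\<bar> \<le> h" "\<bar>t - x j\<bar> \<le> h" for s t
    using d1(2)[OF R, of s t] d2(2)[OF R, of s t] that h d1(1) d2(1) by simp
  have twist: "x(j := t, i := s) = x(i := s, j := t)" for s t using \<open>i \<noteq> j\<close> by (simp add: fun_upd_twist)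
  obtain s t where 1: "x i < s" "s < x i + h" "x j < t" "t < x j + h"
    "g (x(i := x i + h, j := x j + h)) - g (x(i := x i + h, j := x j)) - g (x(i := x i, j := x j + h)) + g (x(i := x i, j := x j))
      = h * h * P (x(i := s, j := t))"
    using double_difference[OF C ij \<open>i \<noteq> j\<close> h(1), of x] near unfolding P_def[symmetric] by blast
  obtain t' s' where 2: "x i < s'" "s' < x i + h" "x j < t'" "t' < x j + h"
    "g (x(i := x i + h, j := x j + h)) - g (x(i := x i, j := x j + h)) - g (x(i := x i + h, j := x j)) + g (x(i := x i, j := x j))
      = h * h * Q (x(i := s', j := t'))"
  proof -
    have "\<exists>t s. x j < t \<and> t < x j + h \<and> x i < s \<and> s < x i + h \<and>
      g (x(i := x i + h, j := x j + h)) - g (x(i := x i, j := x j + h)) - g (x(i := x i + h, j := x j)) + g (x(i := x i, j := x j))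
      = h * h * Q (x(i := s, j := t))"
      using double_difference[OF C ij(2,1) not_sym[OF \<open>i \<noteq> j\<close>] h(1), of x] near
      unfolding Q_def[symmetric] twist by (simp del: fun_upd_apply)
    then show thesis using that by blast
  qed
  have "h * h * P (x(i := s, j := t)) = h * h * Q (x(i := s', j := t'))" using 1(5) 2(5) by linarith
  then have "P (x(i := s, j := t)) = Q (x(i := s', j := t'))" using h by simp
  moreover have "\<bar>P (x(i := s, j := t)) - P x\<bar> < e" "\<bar>Q (x(i := s', j := t')) - Q x\<bar> < e"
    using near[of s t] near[of s' t'] 1 2 by auto
  moreover have "\<bar>P x - Q x\<bar> \<le> \<bar>P (x(i := s, j := t)) - P x\<bar> + \<bar>P (x(i := s, j := t)) - Q x\<bar>" by linarith
  ultimately have "\<bar>P x - Q x\<bar> < e + e" by simp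
  then show False by (simp add: e_def)
qed

lemma nabla3_commute:
  assumes U: "openin (Rtop d) U" and C: "Ck_on d 3 U V" and ijk: "i < d" "j < d" "k < d" and x: "x \<in> U"
  shows "nabla V x [i, j, k] = nabla V x [j, i, k]" "nabla V x [i, j, k] = nabla V x [i, k, j]"
proof -
  have C3: "Ck_on d (Suc 2) U V" using C by (simp only: numeral_3_eq_3 numeral_2_eq_2)
  have C2: "Ck_on d 2 U V" "Ck_on d 2 U (pdiff k V)"
    using Ck_on_Suc_D[OF C3] Ck_on_pdiff[OF C3 ijk(3)] by auto
  show "nabla V x [i, j, k] = nabla V x [j, i, k]"
    using pdiff_commute[OF U C2(2) ijk(2,1) x] by (simp add: nabla_def)
  have "pdiff i (pdiff j (pdiff k V)) x = pdiff i (pdiff k (pdiff j V)) x"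
    by (rule pdiff_cong(1)[OF U x ijk(1)]) (rule pdiff_commute[OF U C2(1) ijk(3,2)])
  then show "nabla V x [i, j, k] = nabla V x [i, k, j]" by (simp add: nabla_def)
qed

text \<open>Changing the coordinate k of y moves the image along the ray spanned by column k of B,
  so the chain rule reduces to a derivative along a ray.\<close>

lemma deriv_affine_comp:
  assumes U: "openin (Rtop d) U" and C: "Ck_on d (Suc m) U g" and k: "k < d"
    and y: "vadd d x0 (mvec d B y) \<in> U"
  shows "((\<lambda>t. g (vadd d x0 (mvec d B (y(k := t))))) has_real_derivative
     (\<Sum>a<d. B $$ (a, k) * pdiff a g (vadd d x0 (mvec d B y)))) (at (y k))"
    and "eventually (\<lambda>t. vadd d x0 (mvec d B (y(k := t))) \<in> U) (nhds (y k))"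
proof -
  let ?z = "vadd d x0 (mvec d B y)"
  have r: "vadd d x0 (mvec d B (y(k := t))) = ray d ?z (\<lambda>a. B $$ (a, k)) (t - y k)" for t
  proof -
    have "(\<Sum>j<d. B $$ (i, j) * (y(k := t)) j) = (\<Sum>j<d. B $$ (i, j) * y j) + (t - y k) * B $$ (i, k)" for i
      using k by (simp add: sum.remove[of "{..<d}" k] algebra_simps)
    then show ?thesis by (auto simp: vadd_def mvec_def ray_def fun_eq_iff)
  qed
  have "((\<lambda>t. g (ray d ?z (\<lambda>a. B $$ (a, k)) t)) has_real_derivative (\<Sum>a<d. B $$ (a, k) * pdiff a g ?z)) (at (y k - y k))"
    using deriv_along_ray_0[OF U C y] by simp
  then show "((\<lambda>t. g (vadd d x0 (mvec d B (y(k := t))))) has_real_derivative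
     (\<Sum>a<d. B $$ (a, k) * pdiff a g ?z)) (at (y k))"
    unfolding r using DERIV_shift[of "\<lambda>t. g (ray d ?z (\<lambda>a. B $$ (a, k)) t)" _ "y k" "- y k"] by simp
  have "filterlim (\<lambda>t. t - y k) (nhds 0) (nhds (y k))"
  proof -
    have "((\<lambda>t. t - y k) \<longlongrightarrow> y k - y k) (nhds (y k))" by (intro tendsto_diff filterlim_ident tendsto_const)
    then show ?thesis by simp
  qed
  from eventually_compose_filterlim[OF ray_eventually_in[OF U y] this]
  show "eventually (\<lambda>t. vadd d x0 (mvec d B (y(k := t))) \<in> U) (nhds (y k))" unfolding r .
qed

text \<open>Stated for finite combinations because the derivative is again one, so that the rule can
  be iterated. The form of f is assumed where the image lies in U, which is all that is known after
  one differentiation.\<close>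

lemma pdiff_affine_comp:
  assumes U: "openin (Rtop d) U" and m: "finite I" "\<And>b. b \<in> I \<Longrightarrow> Ck_on d (Suc m) U (g b)" and k: "k < d"
    and y: "vadd d x0 (mvec d B y) \<in> U"
    and f: "\<And>y. vadd d x0 (mvec d B y) \<in> U \<Longrightarrow> f y = (\<Sum>b\<in>I. c b * g b (vadd d x0 (mvec d B y)))"
  shows "pdiff k f y = (\<Sum>b\<in>I. c b * (\<Sum>a<d. B $$ (a, k) * pdiff a (g b) (vadd d x0 (mvec d B y))))"
proof -
  let ?\<psi> = "\<lambda>y. vadd d x0 (mvec d B y)"
  have "((\<lambda>t. \<Sum>b\<in>I. c b * g b (?\<psi> (y(k := t)))) has_real_derivative
     (\<Sum>b\<in>I. c b * (\<Sum>a<d. B $$ (a, k) * pdiff a (g b) (?\<psi> y)))) (at (y k))"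
    by (intro DERIV_sum DERIV_cmult deriv_affine_comp(1)[OF U m(2) k y])
  moreover have "eventually (\<lambda>t. ?\<psi> (y(k := t)) \<in> U) (nhds (y k))"
  proof -
    \<comment> \<open>The neighbourhood statement does not involve g; the zero function instantiates
      it even when I is empty.\<close>
    have "Ck_on d (Suc 0) U (\<lambda>_. 0)"
      by (auto simp: pdiff_def)
    from deriv_affine_comp(2)[OF U this k y] show ?thesis .
  qed
  ultimately have "((\<lambda>t. f (y(k := t))) has_real_derivative
     (\<Sum>b\<in>I. c b * (\<Sum>a<d. B $$ (a, k) * pdiff a (g b) (?\<psi> y)))) (at (y k))"
  proof -
    assume D: "((\<lambda>t. \<Sum>b\<in>I. c b * g b (?\<psi> (y(k := t)))) has_real_derivative
      (\<Sum>b\<in>I. c b * (\<Sum>a<d. B $$ (a, k) * pdiff a (g b) (?\<psi> y)))) (at (y k))"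
      and ev: "eventually (\<lambda>t. ?\<psi> (y(k := t)) \<in> U) (nhds (y k))"
    have "eventually (\<lambda>t. f (y(k := t)) = (\<Sum>b\<in>I. c b * g b (?\<psi> (y(k := t))))) (nhds (y k))"
      using ev by eventually_elim (rule f)
    from DERIV_cong_ev[OF refl this refl] D show ?thesis by blast
  qed
  then show ?thesis unfolding pdiff_def[of k f] by (rule DERIV_imp_deriv)
qed

lemma nabla3_affine_comp:
  assumes U: "openin (Rtop d) U" and C: "Ck_on d 3 U V" and ijk: "i < d" "j < d" "k < d"
    and y: "vadd d x0 (mvec d B y) \<in> U"
  shows "nabla (\<lambda>y. V (vadd d x0 (mvec d B y))) y [i, j, k] =
    (\<Sum>c<d. B $$ (c, k) * (\<Sum>b<d. B $$ (b, j) * (\<Sum>a<d. B $$ (a, i) * nabla V (vadd d x0 (mvec d B y)) [a, b, c])))"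
proof -
  let ?\<psi> = "\<lambda>y. vadd d x0 (mvec d B y)"
  let ?W = "\<lambda>y. V (?\<psi> y)"
  have C3: "Ck_on d (Suc 2) U V" using C by (simp only: numeral_3_eq_3 numeral_2_eq_2)
  have C2: "Ck_on d (Suc 1) U (pdiff c V)" if "c < d" for c using Ck_on_pdiff[OF C3 that] by (simp only: numeral_2_eq_2 One_nat_def)
  have C1: "Ck_on d (Suc 0) U (pdiff b (pdiff c V))" if "b < d" "c < d" for b c
    using Ck_on_pdiff[OF C2[OF that(2)] that(1)] by simp
  have 1: "pdiff k ?W z = (\<Sum>c<d. B $$ (c, k) * pdiff c V (?\<psi> z))" if "?\<psi> z \<in> U" for z
    using pdiff_affine_comp[OF U, of "{()}" 2 "\<lambda>_. V" k x0 B z ?W "\<lambda>_. 1"] C3 ijk(3) that by simp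
  have 2: "pdiff j (pdiff k ?W) z = (\<Sum>c<d. B $$ (c, k) * (\<Sum>b<d. B $$ (b, j) * pdiff b (pdiff c V) (?\<psi> z)))" if "?\<psi> z \<in> U" for z
    using pdiff_affine_comp[OF U, of "{..<d}" 1 "\<lambda>c. pdiff c V" j x0 B z "pdiff k ?W" "\<lambda>c. B $$ (c, k)"] C2 1 ijk(2) that by simp
  have two: "pdiff j (pdiff k ?W) z = (\<Sum>p\<in>{..<d}\<times>{..<d}. (B $$ (fst p, k) * B $$ (snd p, j)) * pdiff (snd p) (pdiff (fst p) V) (?\<psi> z))" if "?\<psi> z \<in> U" for z
    unfolding 2[OF that] by (simp add: sum.cartesian_product' sum_distrib_left mult.assoc)
  have 3: "pdiff i (pdiff j (pdiff k ?W)) y = (\<Sum>p\<in>{..<d}\<times>{..<d}. (B $$ (fst p, k) * B $$ (snd p, j)) *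
      (\<Sum>a<d. B $$ (a, i) * pdiff a (pdiff (snd p) (pdiff (fst p) V)) (?\<psi> y)))"
    by (rule pdiff_affine_comp[where I="{..<d}\<times>{..<d}" and c="\<lambda>p. B $$ (fst p, k) * B $$ (snd p, j)" and g="\<lambda>p. pdiff (snd p) (pdiff (fst p) V)" and m=0, OF U _ _ ijk(1) y two]) (auto simp del: Ck_on.simps intro!: C1)
  show ?thesis
    unfolding nabla_def by (simp add: 3 sum.cartesian_product' sum_distrib_left mult.assoc)
qed

section \<open>Whitening and the symmetric square root\<close>

definition bform :: "nat \<Rightarrow> (nat \<Rightarrow> nat \<Rightarrow> real) \<Rightarrow> (nat \<Rightarrow> real) \<Rightarrow> (nat \<Rightarrow> real) \<Rightarrow> real" where
  "bform n h x y = (\<Sum>i<n. \<Sum>j<n. x i * h i j * y j)"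

lemma bform_sum_left: "bform n h (\<lambda>i. \<Sum>k\<in>K. c k * f k i) y = (\<Sum>k\<in>K. c k * bform n h (f k) y)"
proof -
  have "bform n h (\<lambda>i. \<Sum>k\<in>K. c k * f k i) y = (\<Sum>i<n. \<Sum>j<n. \<Sum>k\<in>K. c k * (f k i * h i j * y j))"
    by (simp add: bform_def sum_distrib_left sum_distrib_right mult_ac)
  also have "\<dots> = (\<Sum>i<n. \<Sum>k\<in>K. \<Sum>j<n. c k * (f k i * h i j * y j))"
    by (intro sum.cong refl sum.swap)
  also have "\<dots> = (\<Sum>k\<in>K. \<Sum>i<n. \<Sum>j<n. c k * (f k i * h i j * y j))"
    by (rule sum.swap)
  finally show ?thesis by (simp add: bform_def sum_distrib_left)
qed

lemma bform_add_left: "bform n h (\<lambda>i. x i + z i) y = bform n h x y + bform n h z y"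
  by (simp add: bform_def sum.distrib algebra_simps)

lemma bform_diff_left: "bform n h (\<lambda>i. x i - z i) y = bform n h x y - bform n h z y"
  by (simp add: bform_def sum_subtractf algebra_simps)

lemma bform_scale_left: "bform n h (\<lambda>i. c * x i) y = c * bform n h x y"
  by (simp add: bform_def sum_distrib_left mult_ac)

lemma bform_swap: "(\<And>i j. i < n \<Longrightarrow> j < n \<Longrightarrow> h i j = h j i) \<Longrightarrow> bform n h x y = bform n h y x"
  unfolding bform_def by (subst sum.swap) (auto intro!: sum.cong)

text \<open>Gram--Schmidt with respect to \<open>h\<close>, applied to the standard basis.\<close>
lemma orthonormal_triangular_basis:
  assumes "\<And>i j. i < n \<Longrightarrow> j < n \<Longrightarrow> h i j = h j i"
    and "\<And>x. (\<exists>i<n. x i \<noteq> 0) \<Longrightarrow> 0 < bform n h x x"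
  shows "\<exists>a. (\<forall>i j. j < i \<longrightarrow> a i j = (0::real)) \<and> (\<forall>i<n. 0 < a i i) \<and>
    (\<forall>i<n. \<forall>j<n. bform n h (\<lambda>k. a k i) (\<lambda>k. a k j) = (if i = j then 1 else 0))"
  using assms
proof (induction n)
  case 0 then show ?case by (intro exI[of _ "\<lambda>_ _. 0"]) auto
next
  case (Suc n)
  have ext: "bform (Suc n) h x y = bform n h x y" if "x n = 0" "y n = 0" for x y
    using that by (simp add: bform_def sum.distrib)
  have pd: "0 < bform n h x x" if "\<exists>i<n. x i \<noteq> 0" for x
  proof -
    note ex = that
    have "bform n h x x = bform n h (x(n := 0)) (x(n := 0))" by (simp add: bform_def)
    also have "\<dots> = bform (Suc n) h (x(n := 0)) (x(n := 0))" by (rule ext[symmetric]) auto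
    also have "\<dots> > 0"
    proof (rule Suc.prems(2))
      obtain i where "i < n" "x i \<noteq> 0" using ex by blast
      then show "\<exists>i<Suc n. (x(n := 0)) i \<noteq> 0" by (intro exI[of _ i]) auto
    qed
    finally show ?thesis .
  qed
  from Suc.IH[OF Suc.prems(1)[OF less_SucI less_SucI] pd] obtain a where tri: "\<And>i j. j < i \<Longrightarrow> a i j = 0" and pos: "\<And>i. i < n \<Longrightarrow> 0 < a i i"
    and on: "\<And>i j. i < n \<Longrightarrow> j < n \<Longrightarrow> bform n h (\<lambda>k. a k i) (\<lambda>k. a k j) = (if i = j then 1 else 0)"
    by blast
  have sym: "bform (Suc n) h x y = bform (Suc n) h y x" for x y by (rule bform_swap) (rule Suc.prems(1))
  define e where "e = (\<lambda>i. if i = n then 1 else 0 :: real)"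
  define \<beta> where "\<beta> j = bform (Suc n) h e (\<lambda>k. a k j)" for j
  define v where "v = (\<lambda>i. e i - (\<Sum>j<n. \<beta> j * a i j))"
  have on': "bform (Suc n) h (\<lambda>k. a k i) (\<lambda>k. a k j) = (if i = j then 1 else 0)" if "i < n" "j < n" for i j
    using on[OF that] tri that by (subst ext) auto
  \<comment> \<open>The earlier columns vanish at n, so v has entry 1 there: it is nonzero, and the
    new diagonal entry is positive.\<close>
  have vn: "v n = 1" using tri by (simp add: v_def e_def)
  have orth: "bform (Suc n) h v (\<lambda>k. a k j) = 0" if "j < n" for j
    unfolding v_def bform_diff_left bform_sum_left using on' that by (simp add: \<beta>_def if_distrib[of "\<lambda>z. _ * z"] cong: if_cong)
  have vv: "0 < bform (Suc n) h v v" using vn by (intro Suc.prems(2) exI[of _ n]) auto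
  define \<alpha> where "\<alpha> = 1 / sqrt (bform (Suc n) h v v)"
  have \<alpha>: "\<alpha> > 0" "\<alpha> * \<alpha> * bform (Suc n) h v v = 1" using vv by (auto simp: \<alpha>_def)
  define a' where "a' i j = (if j = n then (if i \<le> n then \<alpha> * v i else 0) else a i j)" for i j
  have col: "bform (Suc n) h (\<lambda>k. a' k n) y = \<alpha> * bform (Suc n) h v y" for y
    unfolding bform_scale_left[symmetric] by (auto simp: bform_def a'_def intro!: sum.cong)
  have col': "bform (Suc n) h (\<lambda>k. a' k j) y = bform (Suc n) h (\<lambda>k. a k j) y" if "j < n" for j y
    using that by (simp add: a'_def)
  show ?case
  proof (intro exI[of _ a'] conjI allI impI)
    fix i j :: nat assume "j < i" then show "a' i j = 0" using tri by (auto simp: a'_def)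
  next
    fix i assume "i < Suc n" then show "0 < a' i i" using pos[of i] \<alpha> vn by (auto simp: a'_def)
  next
    fix i j assume ij: "i < Suc n" "j < Suc n"
    consider "i = n" "j = n" | "i = n" "j < n" | "i < n" "j = n" | "i < n" "j < n" using ij by linarith
    then show "bform (Suc n) h (\<lambda>k. a' k i) (\<lambda>k. a' k j) = (if i = j then 1 else 0)"
    proof cases
      case 1
      have "bform (Suc n) h v (\<lambda>k. a' k n) = \<alpha> * bform (Suc n) h v v" by (subst sym) (simp add: col)
      then show ?thesis using 1 \<alpha> by (simp add: col)
    next
      case 2
      have "bform (Suc n) h v (\<lambda>k. a' k j) = 0" using orth[OF 2(2)] 2 by (simp add: a'_def)
      then show ?thesis using 2 by (simp add: col)
    next
      case 3
      have "bform (Suc n) h v (\<lambda>k. a' k i) = 0" using orth[OF 3(1)] 3 by (simp add: a'_def)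
      then have "bform (Suc n) h (\<lambda>k. a' k n) (\<lambda>k. a' k i) = 0" by (simp add: col)
      then show ?thesis using 3 by (subst sym) simp
    next
      case 4
      have "bform (Suc n) h (\<lambda>k. a' k i) (\<lambda>k. a' k j) = bform (Suc n) h (\<lambda>k. a k i) (\<lambda>k. a k j)"
        using 4 by (simp add: a'_def)
      then show ?thesis using on' 4 by simp
    qed
  qed
qed

lemma quad_form_bform: "quad_form d A x = bform d (\<lambda>i j. A $$ (i, j)) x x"
  by (simp add: quad_form_def bform_def)

lemma pos_def_symD: "pos_def d A \<Longrightarrow> i < d \<Longrightarrow> j < d \<Longrightarrow> A $$ (i, j) = A $$ (j, i)"
  unfolding pos_def_def by (metis carrier_matD index_transpose_mat(1))

lemma minv_eqI:
  assumes A: "A \<in> carrier_mat d d" and B: "B \<in> carrier_mat d d" and AB: "A * B = 1\<^sub>m d"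
  shows "minv A = B"
proof -
  have BA: "B * A = 1\<^sub>m d" by (rule mat_mult_left_right_inverse[OF A B AB])
  have "mat_inverse A \<noteq> None"
  proof
    assume "mat_inverse A = None"
    from mat_inverse(1)[OF A this, of undefined] show False
      using A B AB BA by (auto simp: Units_def ring_mat_simps)
  qed
  then obtain C where C: "mat_inverse A = Some C" by auto
  have CA: "C * A = 1\<^sub>m d" "C \<in> carrier_mat d d" using mat_inverse(2)[OF A C] by auto
  have "C = C * (A * B)" using CA AB by simp
  also have "\<dots> = (C * A) * B" using A B CA by (intro assoc_mult_mat[symmetric]) auto
  also have "\<dots> = B" using CA B by simp
  finally show ?thesis by (simp add: minv_def C)
qed

lemma index_mult_mat_sum:
  "A \<in> carrier_mat d d \<Longrightarrow> B \<in> carrier_mat d d \<Longrightarrow> i < d \<Longrightarrow> j < d \<Longrightarrow> (A * B) $$ (i, j) = (\<Sum>k<d. A $$ (i, k) * B $$ (k, j))"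
  by (simp add: scalar_prod_def lessThan_atLeast0)

text \<open>The first three conditions determine \<open>a\<close>; the others are their consequences for \<open>H\<^bsup>-1\<^esup>\<close>.\<close>
definition whitening :: "nat \<Rightarrow> real mat \<Rightarrow> (nat \<Rightarrow> nat \<Rightarrow> real) \<Rightarrow> bool" where
  "whitening d H a \<longleftrightarrow> (\<forall>i j. j < i \<longrightarrow> a i j = 0) \<and> (\<forall>i<d. 0 < a i i) \<and>
    (\<forall>i<d. \<forall>j<d. (\<Sum>k<d. \<Sum>l<d. a k i * H $$ (k, l) * a l j) = (if i = j then 1 else 0)) \<and>
    (\<forall>i<d. \<forall>j<d. minv H $$ (i, j) = (\<Sum>k<d. a i k * a j k)) \<and>
    minv (minv H) = H \<and> det (minv H) = (\<Prod>i<d. a i i)\<^sup>2 \<and> minv H \<in> carrier_mat d d \<and>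
    (\<forall>i<d. \<forall>j<d. (\<Sum>k<d. minv H $$ (i, k) * H $$ (k, j)) = (if i = j then 1 else 0))"

lemma whiteningD:
  assumes "whitening d H a"
  shows "\<And>i j. j < i \<Longrightarrow> a i j = 0" "\<And>i. i < d \<Longrightarrow> 0 < a i i"
    "\<And>i j. i < d \<Longrightarrow> j < d \<Longrightarrow> (\<Sum>k<d. \<Sum>l<d. a k i * H $$ (k, l) * a l j) = (if i = j then 1 else 0)"
    "\<And>i j. i < d \<Longrightarrow> j < d \<Longrightarrow> minv H $$ (i, j) = (\<Sum>k<d. a i k * a j k)"
    "minv (minv H) = H" "det (minv H) = (\<Prod>i<d. a i i)\<^sup>2" "minv H \<in> carrier_mat d d"
    "\<And>i j. i < d \<Longrightarrow> j < d \<Longrightarrow> (\<Sum>k<d. minv H $$ (i, k) * H $$ (k, j)) = (if i = j then 1 else 0)"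
  using assms unfolding whitening_def by blast+

text \<open>For the triangular matrix A of the basis, A^T H A = 1. All matrices are square, so A
  times A^T H is the identity as well and A A^T is the inverse of H.\<close>

lemma pos_def_whitening:
  assumes H: "pos_def d H"
  obtains a where "whitening d H a"
proof -
  have Hc: "H \<in> carrier_mat d d" using H by (simp add: pos_def_def)
  have "\<exists>a. (\<forall>i j. j < i \<longrightarrow> a i j = (0::real)) \<and> (\<forall>i<d. 0 < a i i) \<and>
    (\<forall>i<d. \<forall>j<d. bform d (\<lambda>i j. H $$ (i, j)) (\<lambda>k. a k i) (\<lambda>k. a k j) = (if i = j then 1 else 0))"
    using H by (intro orthonormal_triangular_basis) (auto simp: pos_def_def quad_form_bform intro: pos_def_symD[OF H])
  then obtain a where tri: "\<And>i j. j < i \<Longrightarrow> a i j = 0" and pos: "\<And>i. i < d \<Longrightarrow> 0 < a i i"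
    and on: "\<And>i j. i < d \<Longrightarrow> j < d \<Longrightarrow> (\<Sum>k<d. \<Sum>l<d. a k i * H $$ (k, l) * a l j) = (if i = j then 1 else 0)"
    unfolding bform_def by blast
  define A where "A = mat d d (\<lambda>(i, j). a i j)"
  have Ac: "A \<in> carrier_mat d d" and ATc: "transpose_mat A \<in> carrier_mat d d" by (auto simp: A_def)
  have AHA: "(transpose_mat A * H) * A = 1\<^sub>m d"
  proof (rule eq_matI)
    fix i j assume "i < dim_row (1\<^sub>m d :: real mat)" "j < dim_col (1\<^sub>m d :: real mat)"
    then have ij: "i < d" "j < d" by auto
    have "((transpose_mat A * H) * A) $$ (i, j) = (\<Sum>l<d. (\<Sum>k<d. a k i * H $$ (k, l)) * a l j)"
    proof -
      have "(transpose_mat A * H) $$ (i, l) = (\<Sum>k<d. a k i * H $$ (k, l))" if "l < d" for l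
        using ij that by (subst index_mult_mat_sum[OF ATc Hc]) (auto simp: A_def)
      moreover have "A $$ (l, j) = a l j" if "l < d" for l using ij that by (simp add: A_def)
      ultimately show ?thesis
        using ij by (subst index_mult_mat_sum[OF mult_carrier_mat[OF ATc Hc] Ac]) auto
    qed
    also have "\<dots> = (\<Sum>k<d. \<Sum>l<d. a k i * H $$ (k, l) * a l j)"
      by (simp add: sum_distrib_right) (rule sum.swap)
    finally show "((transpose_mat A * H) * A) $$ (i, j) = 1\<^sub>m d $$ (i, j)" using on ij by simp
  qed (use Ac Hc in auto)
  have AAH: "A * (transpose_mat A * H) = 1\<^sub>m d"
    by (rule mat_mult_left_right_inverse[OF mult_carrier_mat[OF ATc Hc] Ac AHA])
  define P where "P = A * transpose_mat A"
  have Pc: "P \<in> carrier_mat d d" using Ac ATc by (auto simp: P_def)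
  have PH: "P * H = 1\<^sub>m d" using AAH assoc_mult_mat[OF Ac ATc Hc] by (simp add: P_def)
  have HP: "H * P = 1\<^sub>m d" by (rule mat_mult_left_right_inverse[OF Pc Hc PH])
  have mH: "minv H = P" by (rule minv_eqI[OF Hc Pc HP])
  have "det A = (\<Prod>i<d. a i i)"
  proof -
    have "upper_triangular A" using tri by (auto simp: upper_triangular_def A_def)
    then have "det A = prod_list (diag_mat A)" by (rule det_upper_triangular[OF _ Ac])
    also have "\<dots> = (\<Prod>i<d. a i i)"
      by (simp add: diag_mat_def A_def prod.distinct_set_conv_list[symmetric] lessThan_atLeast0)
    finally show ?thesis .
  qed
  then have dt: "det (minv H) = (\<Prod>i<d. a i i)\<^sup>2"
    unfolding mH P_def by (simp add: det_mult[OF Ac ATc] det_transpose[OF Ac] power2_eq_square)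
  have ent: "minv H $$ (i, j) = (\<Sum>k<d. a i k * a j k)" if "i < d" "j < d" for i j
    unfolding mH P_def using that by (subst index_mult_mat_sum[OF Ac ATc]) (auto simp: A_def)
  have inv: "(\<Sum>k<d. minv H $$ (i, k) * H $$ (k, j)) = (if i = j then 1 else 0)" if "i < d" "j < d" for i j
    using index_mult_mat_sum[OF Pc Hc that] PH that by (simp add: mH)
  have "minv (minv H) = H" unfolding mH by (rule minv_eqI[OF Pc Hc PH])
  then have "whitening d H a" unfolding whitening_def using tri pos on dt ent inv Pc mH by simp
  then show thesis by (rule that)
qed

text \<open>For X = B - C, equality of the squares gives B X + X C = 0. The trace of X times this is
  a sum of values of the two quadratic forms on columns of X, all nonnegative; so each is 0, and
  definiteness of B forces X = 0.\<close>

lemma pos_def_square_unique: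
  assumes B: "pos_def d B" and C: "pos_def d C" and eq: "B * B = C * C"
  shows "B = C"
proof -
  have Bc: "B \<in> carrier_mat d d" and Cc: "C \<in> carrier_mat d d" using B C by (auto simp: pos_def_def)
  define b where "b i j = B $$ (i, j)" for i j
  define c where "c i j = C $$ (i, j)" for i j
  define x where "x i j = b i j - c i j" for i j
  have bs: "b i j = b j i" if "i < d" "j < d" for i j using pos_def_symD[OF B that] by (simp add: b_def)
  have cs: "c i j = c j i" if "i < d" "j < d" for i j using pos_def_symD[OF C that] by (simp add: c_def)
  have xs: "x i j = x j i" if "i < d" "j < d" for i j using bs[OF that] cs[OF that] by (simp add: x_def)
  have sq: "(\<Sum>k<d. b i k * b k j) = (\<Sum>k<d. c i k * c k j)" if "i < d" "j < d" for i j
    using arg_cong[OF eq, of "\<lambda>M. M $$ (i, j)"] index_mult_mat_sum[OF Bc Bc that] index_mult_mat_sum[OF Cc Cc that]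
    by (simp add: b_def c_def)
  have zero: "(\<Sum>k<d. b i k * x k j) + (\<Sum>k<d. x i k * c k j) = 0" if "i < d" "j < d" for i j
    using sq[OF that] by (simp add: x_def algebra_simps sum_subtractf)
  have bf: "bform d b u u \<ge> 0" "(\<exists>i<d. u i \<noteq> 0) \<Longrightarrow> bform d b u u > 0" for u
    using B unfolding pos_def_def quad_form_bform b_def[symmetric]
    by (cases "\<exists>i<d. u i \<noteq> 0"; force simp: bform_def)+
  have cf: "bform d c u u \<ge> 0" for u
    using C unfolding pos_def_def quad_form_bform c_def[symmetric]
    by (cases "\<exists>i<d. u i \<noteq> 0"; force simp: bform_def)+
  have "0 = (\<Sum>j<d. \<Sum>i<d. x i j * ((\<Sum>k<d. b i k * x k j) + (\<Sum>k<d. x i k * c k j)))"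
    using zero by simp
  also have "\<dots> = (\<Sum>j<d. \<Sum>i<d. \<Sum>k<d. x i j * b i k * x k j) + (\<Sum>j<d. \<Sum>i<d. \<Sum>k<d. x i j * x i k * c k j)"
    by (simp add: sum.distrib distrib_left sum_distrib_left mult_ac)
  also have "(\<Sum>j<d. \<Sum>i<d. \<Sum>k<d. x i j * x i k * c k j) = (\<Sum>i<d. \<Sum>j<d. \<Sum>k<d. x i j * x i k * c k j)"
    by (rule sum.swap)
  also have "\<dots> = (\<Sum>i<d. bform d c (\<lambda>k. x k i) (\<lambda>k. x k i))"
    unfolding bform_def by (intro sum.cong refl) (auto simp: xs cs mult_ac intro!: sum.cong)
  also have "(\<Sum>j<d. \<Sum>i<d. \<Sum>k<d. x i j * b i k * x k j) = (\<Sum>j<d. bform d b (\<lambda>k. x k j) (\<lambda>k. x k j))"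
    by (simp add: bform_def)
  finally have s0: "(\<Sum>j<d. bform d b (\<lambda>k. x k j) (\<lambda>k. x k j)) + (\<Sum>i<d. bform d c (\<lambda>k. x k i) (\<lambda>k. x k i)) = 0" by simp
  have "(\<Sum>i<d. bform d c (\<lambda>k. x k i) (\<lambda>k. x k i)) \<ge> 0" by (intro sum_nonneg cf)
  moreover have "(\<Sum>j<d. bform d b (\<lambda>k. x k j) (\<lambda>k. x k j)) \<ge> 0" by (intro sum_nonneg bf)
  ultimately have "(\<Sum>j<d. bform d b (\<lambda>k. x k j) (\<lambda>k. x k j)) = 0" using s0 by linarith
  then have z: "bform d b (\<lambda>k. x k j) (\<lambda>k. x k j) = 0" if "j < d" for j
    using bf(1) that by (subst (asm) sum_nonneg_eq_0_iff) auto
  have "x i j = 0" if "i < d" "j < d" for i j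
    using bf(2)[of "\<lambda>k. x k j"] z[OF that(2)] that by force
  then show ?thesis using Bc Cc by (intro eq_matI) (auto simp: x_def b_def c_def)
qed

text \<open>For small t of the sign of b the linear term wins. This is the first-order optimality
  condition in the symmetry and kernel arguments below.\<close>

lemma linear_le_quadratic_zero:
  fixes b c :: real
  assumes "\<And>t. t * b \<le> t\<^sup>2 * c"
  shows "b = 0"
proof (rule ccontr)
  assume b: "b \<noteq> 0"
  define K where "K = \<bar>c\<bar> + 1"
  have K: "K > 0" "c \<le> K" by (auto simp: K_def)
  define t where "t = b / (2 * K)"
  have t: "t * b > 0" using b K by (auto simp: t_def zero_less_divide_iff zero_less_mult_iff)
  have "t\<^sup>2 * c \<le> t\<^sup>2 * K" using K by (intro mult_left_mono) auto
  also have "\<dots> = t * b / 2" using K by (simp add: t_def power2_eq_square field_simps)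
  also have "\<dots> < t * b" using t by linarith
  finally show False using assms[of t] by simp
qed

abbreviation kdelta :: "nat \<Rightarrow> nat \<Rightarrow> real" where "kdelta i j \<equiv> (if i = j then 1 else 0)"

definition orth_rows :: "nat \<Rightarrow> (nat \<Rightarrow> nat \<Rightarrow> real) \<Rightarrow> bool" where
  "orth_rows d Q \<longleftrightarrow> (\<forall>i<d. \<forall>j<d. (\<Sum>k<d. Q i k * Q j k) = kdelta i j)"

definition fmul :: "nat \<Rightarrow> (nat \<Rightarrow> nat \<Rightarrow> real) \<Rightarrow> (nat \<Rightarrow> nat \<Rightarrow> real) \<Rightarrow> nat \<Rightarrow> nat \<Rightarrow> real" where
  "fmul d X Y i j = (\<Sum>k<d. X i k * Y k j)"

lemma fmul_fmul_transpose:
  assumes "orth_rows d G" "i < d" "j < d"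
  shows "(\<Sum>k<d. fmul d X G i k * fmul d Y G j k) = (\<Sum>l<d. X i l * Y j l)"
proof -
  have "(\<Sum>k<d. fmul d X G i k * fmul d Y G j k) = (\<Sum>k<d. \<Sum>l<d. \<Sum>m<d. (X i l * Y j m) * (G l k * G m k))"
    by (simp add: fmul_def sum_product mult_ac)
  also have "\<dots> = (\<Sum>l<d. \<Sum>k<d. \<Sum>m<d. (X i l * Y j m) * (G l k * G m k))" by (rule sum.swap)
  also have "\<dots> = (\<Sum>l<d. \<Sum>m<d. \<Sum>k<d. (X i l * Y j m) * (G l k * G m k))"
    by (intro sum.cong refl sum.swap)
  also have "\<dots> = (\<Sum>l<d. \<Sum>m<d. (X i l * Y j m) * kdelta l m)"
    using assms(1) by (simp add: sum_distrib_left[symmetric] orth_rows_def)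
  also have "\<dots> = (\<Sum>l<d. X i l * Y j l)"
    by (simp add: if_distrib[of "\<lambda>z. _ * z"] cong: if_cong)
  finally show ?thesis .
qed

lemma orth_rows_fmul: "orth_rows d Q \<Longrightarrow> orth_rows d G \<Longrightarrow> orth_rows d (fmul d Q G)"
  by (simp add: orth_rows_def[of d "fmul d Q G"] fmul_fmul_transpose) (simp add: orth_rows_def)

text \<open>The Householder reflection I - 2 u u^T, orthogonal when u is a unit vector.\<close>

definition refl_mat :: "(nat \<Rightarrow> real) \<Rightarrow> nat \<Rightarrow> nat \<Rightarrow> real" where
  "refl_mat u i j = kdelta i j - 2 * u i * u j"

lemma sum_refl_mat: "l < d \<Longrightarrow> (\<Sum>m<d. refl_mat u l m * f m) = f l - 2 * u l * (\<Sum>m<d. u m * f m)"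
proof -
  assume l: "l < d"
  have "refl_mat u l m * f m = (if l = m then f m else 0) - 2 * u l * (u m * f m)" for m
    by (simp add: refl_mat_def algebra_simps)
  then show ?thesis using l by (simp add: sum_subtractf sum_distrib_left[symmetric])
qed

lemma refl_mat_sym: "refl_mat u i j = refl_mat u j i"
  by (simp add: refl_mat_def)

lemma orth_rows_refl_mat:
  assumes u: "(\<Sum>i<d. u i * u i) = 1"
  shows "orth_rows d (refl_mat u)"
  unfolding orth_rows_def
proof (intro allI impI)
  fix i j assume ij: "i < d" "j < d"
  have "(\<Sum>k<d. refl_mat u i k * refl_mat u j k) = refl_mat u j i - 2 * u i * (\<Sum>m<d. refl_mat u j m * u m)"
    using ij by (subst sum_refl_mat) (auto simp: mult_ac)
  also have "\<dots> = refl_mat u j i - 2 * u i * (u j - 2 * u j * 1)" using ij u by (subst sum_refl_mat) auto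
  also have "\<dots> = kdelta i j" by (simp add: refl_mat_def)
  finally show "(\<Sum>k<d. refl_mat u i k * refl_mat u j k) = kdelta i j" .
qed

text \<open>The orthogonal matrices form a closed subset of a cube, since the defining equations are
  polynomial and bound every entry by 1. The trace is continuous, so compactness gives a
  maximizer.\<close>

lemma orth_rows_maximizer:
  obtains Q where "orth_rows d Q" "\<And>R. orth_rows d R \<Longrightarrow> (\<Sum>i<d. fmul d a R i i) \<le> (\<Sum>i<d. fmul d a Q i i)"
proof -
  define I where "I = {..<d} \<times> {..<d}"
  define T where "T = product_topology (\<lambda>_. euclideanreal) I"
  define c where "c q = (\<lambda>i j. (q :: nat \<times> nat \<Rightarrow> real) (i, j))" for q
  define F where "F q = (\<Sum>i<d. fmul d a (c q) i i)" for q
  \<comment> \<open>\<open>insert (0, 0) I\<close> keeps the family nonempty when d = 0, and the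
    guard \<open>p \<in> I\<close> makes the extra member impose nothing.\<close>
  define S where "S = (\<Inter>p\<in>insert (0, 0) I. {q \<in> topspace T. p \<in> I \<longrightarrow> (\<Sum>k<d. q (fst p, k) * q (snd p, k)) \<in> {kdelta (fst p) (snd p)}})"
  have tsp: "topspace T = I \<rightarrow>\<^sub>E UNIV" by (simp add: T_def)
  have coord: "continuous_map T euclideanreal (\<lambda>q. q p)" if "p \<in> I" for p
    unfolding T_def using that by (rule continuous_map_product_projection)
  have S: "q \<in> S \<longleftrightarrow> q \<in> I \<rightarrow>\<^sub>E UNIV \<and> orth_rows d (c q)" for q
    unfolding S_def tsp orth_rows_def I_def c_def by auto
  have "closedin T S" unfolding S_def
  proof (rule closedin_INT)
    fix p assume "p \<in> insert (0, 0) I"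
    show "closedin T {q \<in> topspace T. p \<in> I \<longrightarrow> (\<Sum>k<d. q (fst p, k) * q (snd p, k)) \<in> {kdelta (fst p) (snd p)}}"
    proof (cases "p \<in> I")
      case True
      have "continuous_map T euclideanreal (\<lambda>q. \<Sum>k<d. q (fst p, k) * q (snd p, k))"
        using True by (intro continuous_map_sum continuous_map_real_mult coord) (auto simp: I_def)
      from closedin_continuous_map_preimage[OF this, of "{kdelta (fst p) (snd p)}"] True show ?thesis by simp
    qed simp
  qed auto
  moreover have "S \<subseteq> I \<rightarrow>\<^sub>E {-1..1}"
  proof
    fix q assume q: "q \<in> S"
    have "\<bar>q (i, k)\<bar> \<le> 1" if "i < d" "k < d" for i k
    proof -
      have "q (i, k) * q (i, k) \<le> (\<Sum>k<d. q (i, k) * q (i, k))" using that by (intro member_le_sum) auto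
      also have "\<dots> = 1" using q that unfolding S orth_rows_def c_def by simp
      finally have "\<bar>q (i, k)\<bar>\<^sup>2 \<le> 1\<^sup>2" by (simp add: power2_eq_square)
      then show ?thesis by (rule power2_le_imp_le) simp
    qed
    then show "q \<in> I \<rightarrow>\<^sub>E {-1..1}" using q unfolding S by (auto simp: I_def PiE_iff abs_le_iff minus_le_iff)
  qed
  moreover have "compactin T (I \<rightarrow>\<^sub>E {-1..1})" by (simp add: T_def compactin_PiE)
  ultimately have "compactin T S" by (metis closed_compactin)
  moreover have "continuous_map T euclideanreal F"
    unfolding F_def fmul_def c_def
    by (intro continuous_map_sum continuous_map_real_mult_left coord) (auto simp: I_def)
  ultimately have "compact (F ` S)" using image_compactin[of T S euclideanreal F] by simp
  moreover have "F ` S \<noteq> {}"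
  proof -
    have "orth_rows d (c (\<lambda>p\<in>I. kdelta (fst p) (snd p)))"
      by (auto simp: orth_rows_def c_def I_def if_distrib[of "\<lambda>z. z * _"] if_distrib[of "\<lambda>z. _ * z"] cong: if_cong)
    then have "(\<lambda>p\<in>I. kdelta (fst p) (snd p)) \<in> S" unfolding S by simp
    then show ?thesis by blast
  qed
  ultimately obtain q where q: "q \<in> S" "\<forall>r\<in>S. F r \<le> F q"
    using compact_attains_sup[of "F ` S"] by blast
  show thesis
  proof (rule that[of "c q"])
    show "orth_rows d (c q)" using q S by blast
    fix R assume R: "orth_rows d R"
    define r where "r = (\<lambda>p\<in>I. R (fst p) (snd p))"
    have "orth_rows d (c r)" using R by (simp add: orth_rows_def c_def r_def I_def)
    then have "r \<in> S" unfolding S by (simp add: r_def)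
    then have "F r \<le> F q" using q by blast
    moreover have "F r = (\<Sum>i<d. fmul d a R i i)" by (simp add: F_def fmul_def c_def r_def I_def)
    ultimately show "(\<Sum>i<d. fmul d a R i i) \<le> (\<Sum>i<d. fmul d a (c q) i i)" by (simp add: F_def)
  qed
qed

text \<open>
  Polar decomposition: if \<open>Q\<close> maximizes the trace of \<open>a Q\<close> over orthogonal matrices, then \<open>a Q\<close> is
  positive semidefinite (compare with \<open>Q\<close> times one reflection) and symmetric (compare with \<open>Q\<close>
  times the product of two nearby reflections).
\<close>
lemma polar_symmetric_factor:
  obtains S :: "nat \<Rightarrow> nat \<Rightarrow> real" where "\<And>i j. i < d \<Longrightarrow> j < d \<Longrightarrow> S i j = S j i"
    "\<And>x. bform d S x x \<ge> 0" "\<And>i j. i < d \<Longrightarrow> j < d \<Longrightarrow> (\<Sum>k<d. S i k * S j k) = (\<Sum>k<d. a i k * a j k)"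
proof -
  obtain Q where Q: "orth_rows d Q" and max: "\<And>R. orth_rows d R \<Longrightarrow> (\<Sum>i<d. fmul d a R i i) \<le> (\<Sum>i<d. fmul d a Q i i)"
    using orth_rows_maximizer by blast
  define S where "S = fmul d a Q"
  have tr: "(\<Sum>i<d. \<Sum>l<d. S i l * G l i) \<le> (\<Sum>i<d. S i i)" if "orth_rows d G" for G
  proof -
    have "fmul d a (fmul d Q G) i i = (\<Sum>l<d. S i l * G l i)" for i
      unfolding S_def fmul_def sum_distrib_left sum_distrib_right by (subst sum.swap) (simp add: mult_ac)
    then show ?thesis using max[OF orth_rows_fmul[OF Q that]] by (simp add: S_def)
  qed
  have trG: "(\<Sum>i<d. \<Sum>l<d. S i l * refl_mat u l i) = (\<Sum>i<d. S i i) - 2 * bform d S u u" for u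
    by (simp add: refl_mat_def bform_def right_diff_distrib sum_subtractf sum_distrib_left mult_ac if_distrib[of "\<lambda>z. _ * z"] if_distrib[of "\<lambda>z. z * _"] cong: if_cong)
  have unit_psd: "bform d S u u \<ge> 0" if "(\<Sum>i<d. u i * u i) = 1" for u
    using tr[OF orth_rows_refl_mat[OF that]] by (simp add: trG)
  have bs: "bform d S (\<lambda>i. c * x i) (\<lambda>i. c * x i) = c * c * bform d S x x" for c x
    by (simp add: bform_def sum_distrib_left mult_ac)
  have psd: "bform d S x x \<ge> 0" for x
  proof (cases "(\<Sum>i<d. x i * x i) = 0")
    case True
    then have "\<forall>i<d. x i = 0" by (subst (asm) sum_nonneg_eq_0_iff) auto
    then show ?thesis by (simp add: bform_def)
  next
    case False
    define r where "r = sqrt (\<Sum>i<d. x i * x i)"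
    have nn: "(\<Sum>i<d. x i * x i) \<ge> 0" by (intro sum_nonneg) auto
    then have r: "r > 0" "r * r = (\<Sum>i<d. x i * x i)" using False by (auto simp: r_def less_le)
    have "(\<Sum>i<d. (1/r * x i) * (1/r * x i)) = (1/r) * (1/r) * (\<Sum>i<d. x i * x i)"
      by (simp add: sum_distrib_left mult_ac)
    also have "\<dots> = 1" using r by (simp add: r(2)[symmetric])
    finally have "0 \<le> bform d S (\<lambda>i. 1/r * x i) (\<lambda>i. 1/r * x i)" by (rule unit_psd)
    then show ?thesis unfolding bs using mult_pos_pos[OF r(1) r(1)] by (auto simp: zero_le_divide_iff)
  qed
  \<comment> \<open>With p the inner product of u and w, the trace of S times both reflections is tr
    S - 2 u^T S u - 2 w^T S w + 4 p w^T S u; by maximality it is at most tr S.\<close>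
  have two: "2 * (\<Sum>i<d. u i * w i) * bform d S w u \<le> bform d S u u + bform d S w w"
    if u: "(\<Sum>i<d. u i * u i) = 1" and w: "(\<Sum>i<d. w i * w i) = 1" for u w
  proof -
    define p where "p = (\<Sum>i<d. u i * w i)"
    have "(\<Sum>l<d. S i l * fmul d (refl_mat u) (refl_mat w) l i) =
      (\<Sum>l<d. S i l * refl_mat w l i) - 2 * (\<Sum>l<d. S i l * u l) * (u i - 2 * p * w i)" if "i < d" for i
    proof -
      have "(\<Sum>m<d. u m * refl_mat w m i) = (\<Sum>m<d. refl_mat w i m * u m)" by (simp add: refl_mat_sym[of w i] mult_ac)
      also have "\<dots> = u i - 2 * p * w i" using that by (subst sum_refl_mat) (auto simp: mult_ac p_def)
      finally have e: "(\<Sum>m<d. u m * refl_mat w m i) = u i - 2 * p * w i" .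
      have "fmul d (refl_mat u) (refl_mat w) l i = refl_mat w l i - 2 * u l * (u i - 2 * p * w i)" if "l < d" for l
        unfolding fmul_def using that by (simp add: sum_refl_mat e)
      then show ?thesis by (simp add: right_diff_distrib sum_subtractf sum_distrib_left sum_distrib_right mult_ac)
    qed
    then have "(\<Sum>i<d. \<Sum>l<d. S i l * fmul d (refl_mat u) (refl_mat w) l i) =
      (\<Sum>i<d. \<Sum>l<d. S i l * refl_mat w l i) - (\<Sum>i<d. 2 * (\<Sum>l<d. S i l * u l) * (u i - 2 * p * w i))"
      by (simp add: sum_subtractf)
    also have "(\<Sum>i<d. 2 * (\<Sum>l<d. S i l * u l) * (u i - 2 * p * w i)) =
       2 * bform d S u u - 4 * p * bform d S w u"
    proof -
      have "2 * (\<Sum>l<d. S i l * u l) * (u i - 2 * p * w i) = 2 * (\<Sum>l<d. u i * S i l * u l) - 4 * p * (\<Sum>l<d. w i * S i l * u l)" for i p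
        by (simp add: sum_distrib_left algebra_simps sum_subtractf)
      then show ?thesis by (simp add: bform_def sum_subtractf sum_distrib_left)
    qed
    finally show ?thesis
      using tr[OF orth_rows_fmul[OF orth_rows_refl_mat[OF u] orth_rows_refl_mat[OF w]]] by (simp add: trG p_def[symmetric])
  qed
  have sym: "S q p = S p q" if pq: "p < d" "q < d" for p q
  proof (cases "p = q")
    case False
    define \<delta> where "\<delta> p i = kdelta p i" for p i
    have "t * (S q p - S p q) \<le> t\<^sup>2 * (S p p + S q q)" for t
    proof -
      define r where "r = sqrt (1 + t\<^sup>2)"
      have r: "r > 0" "r * r = 1 + t\<^sup>2" by (auto simp: r_def add_pos_nonneg)
      \<comment> \<open>A unit vector close to basis vector p, tilted by t towards basis vector q.
        The product of the two reflections is then a small rotation in that plane, and the terms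
        linear in t isolate \<open>S q p - S p q\<close>.\<close>
      define w where "w i = (\<delta> p i + t * \<delta> q i) / r" for i
      have s: "(\<Sum>i<d. \<delta> m i * f i) = f m" if "m < d" for m f
        using that by (simp add: \<delta>_def if_distrib[of "\<lambda>z. z * _"] cong: if_cong)
      have wf: "(\<Sum>i<d. w i * f i) = (f p + t * f q) / r" for f
      proof -
        have "(\<Sum>i<d. w i * f i) = ((\<Sum>i<d. \<delta> p i * f i) + t * (\<Sum>i<d. \<delta> q i * f i)) / r"
          by (simp add: w_def sum_divide_distrib sum_distrib_left sum.distrib algebra_simps add_divide_distrib)
        then show ?thesis using s pq by simp
      qed
      have fw: "(\<Sum>i<d. f i * w i) = (f p + t * f q) / r" for f using wf[of f] by (simp add: mult.commute)
      have fd: "(\<Sum>i<d. f i * \<delta> m i) = f m" if "m < d" for f m using s[OF that, of f] by (simp add: mult.commute)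
      have dw: "(\<Sum>i<d. \<delta> p i * w i) = 1 / r" using s[OF pq(1), of w] False by (simp add: w_def) (simp add: \<delta>_def)
      have ww: "(\<Sum>i<d. w i * w i) = 1"
      proof -
        have wpq: "w p = 1 / r" "w q = t / r" using False by (auto simp: w_def \<delta>_def)
        have "(\<Sum>i<d. w i * w i) = (w p + t * w q) / r" by (rule wf)
        also have "\<dots> = (1 + t\<^sup>2) / (r * r)" unfolding wpq using r(1) by (simp add: field_simps power2_eq_square)
        also have "\<dots> = 1" using r by (metis divide_self mult_pos_pos less_irrefl)
        finally show ?thesis .
      qed
      have dd: "(\<Sum>i<d. \<delta> p i * \<delta> p i) = 1" using s[OF pq(1), of "\<delta> p"] by (simp add: \<delta>_def)
      have B1: "bform d S w (\<delta> p) = (S p p + t * S q p) / r"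
        unfolding bform_def using pq by (simp add: fd mult.assoc sum_distrib_left[symmetric] wf)
      have B2: "bform d S (\<delta> p) (\<delta> p) = S p p"
        unfolding bform_def using pq by (simp add: fd s mult.assoc sum_distrib_left[symmetric])
      have B3: "bform d S w w = (S p p + t * S q p + t * (S p q + t * S q q)) / (r * r)"
      proof -
        have "bform d S w w = (\<Sum>i<d. w i * (\<Sum>j<d. S i j * w j))" by (simp add: bform_def sum_distrib_left mult.assoc)
        also have "\<dots> = (\<Sum>i<d. w i * ((S i p + t * S i q) / r))" by (simp only: fw)
        also have "\<dots> = ((S p p + t * S p q) / r + t * ((S q p + t * S q q) / r)) / r" by (rule wf)
        finally show ?thesis by (simp add: add_divide_distrib distrib_left)
      qed
      have "2 * (1 / r) * ((S p p + t * S q p) / r) \<le> S p p + (S p p + t * S q p + t * (S p q + t * S q q)) / (r * r)"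
        using two[OF dd ww] unfolding dw B1 B2 B3 .
      then have "(2 * (1 / r) * ((S p p + t * S q p) / r)) * (r * r) \<le> (S p p + (S p p + t * S q p + t * (S p q + t * S q q)) / (r * r)) * (r * r)"
        using r by (intro mult_right_mono) auto
      also have "(2 * (1 / r) * ((S p p + t * S q p) / r)) * (r * r) = 2 * (S p p + t * S q p)" using r(1) by (simp add: field_simps)
      also have "(S p p + (S p p + t * S q p + t * (S p q + t * S q q)) / (r * r)) * (r * r) = S p p * (r * r) + (S p p + t * S q p + t * (S p q + t * S q q))"
        using r(1) by (simp add: field_simps)
      finally show ?thesis unfolding r(2) by (simp add: algebra_simps power2_eq_square)
    qed
    from linear_le_quadratic_zero[OF this] show ?thesis by simp
  qed simp
  show thesis
  proof (rule that[of S])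
    show "(\<Sum>k<d. S i k * S j k) = (\<Sum>k<d. a i k * a j k)" if "i < d" "j < d" for i j
      unfolding S_def by (rule fmul_fmul_transpose[OF Q that])
  qed (use sym psd in auto)
qed

text \<open>The polar factor S is symmetric and semidefinite with S S = a a^T = H^-1. Its kernel is
  that of a^T, which is trivial because a is triangular with positive diagonal; so S is the required
  root, and uniqueness makes the definite description meaningful.\<close>

lemma inv_sqrt_mat_props:
  assumes H: "pos_def d H"
  shows "pos_def d (inv_sqrt_mat d H)" "inv_sqrt_mat d H * inv_sqrt_mat d H = minv H"
proof -
  obtain a where w: "whitening d H a" using pos_def_whitening[OF H] by blast
  note tri = whiteningD(1)[OF w] and pos = whiteningD(2)[OF w] and P = whiteningD(4)[OF w] and Pc = whiteningD(7)[OF w]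
  obtain S where sym: "\<And>i j. i < d \<Longrightarrow> j < d \<Longrightarrow> S i j = S j i"
    and psd: "\<And>x. bform d S x x \<ge> 0" and sq: "\<And>i j. i < d \<Longrightarrow> j < d \<Longrightarrow> (\<Sum>k<d. S i k * S j k) = (\<Sum>k<d. a i k * a j k)"
    using polar_symmetric_factor[of d a] by blast
  define B where "B = mat d d (\<lambda>(i, j). S i j)"
  have Bc: "B \<in> carrier_mat d d" by (simp add: B_def)
  have BB: "B * B = minv H"
  proof (rule eq_matI)
    fix i j assume "i < dim_row (minv H)" "j < dim_col (minv H)"
    then have ij: "i < d" "j < d" using Pc by auto
    have "(B * B) $$ (i, j) = (\<Sum>k<d. S i k * S k j)" using ij by (subst index_mult_mat_sum[OF Bc Bc]) (auto simp: B_def)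
    also have "\<dots> = (\<Sum>k<d. S i k * S j k)" using ij by (intro sum.cong refl) (auto simp: sym)
    finally show "(B * B) $$ (i, j) = minv H $$ (i, j)" using sq P ij by simp
  qed (use Bc Pc in auto)
  have "pos_def d B"
    unfolding pos_def_def
  proof (intro conjI allI impI Bc)
    show "transpose_mat B = B" using sym by (intro eq_matI) (auto simp: B_def)
    fix x :: "nat \<Rightarrow> real" assume x: "\<exists>i<d. x i \<noteq> 0"
    have qf: "quad_form d B x = bform d S x x" by (simp add: quad_form_def bform_def B_def)
    have "bform d S x x \<noteq> 0"
    proof
      assume z: "bform d S x x = 0"
      \<comment> \<open>A semidefinite form vanishes at x only if S x = 0: otherwise a small step
        from x along a basis vector would make it negative.\<close>
      have Sx: "(\<Sum>j<d. S p j * x j) = 0" if p: "p < d" for p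
      proof -
        define e where "e = kdelta p"
        have be: "bform d S e y = (\<Sum>j<d. S p j * y j)" for y
        proof -
          have "bform d S e y = (\<Sum>i<d. if p = i then (\<Sum>j<d. S i j * y j) else 0)"
            unfolding bform_def e_def by (intro sum.cong refl) simp
          then show ?thesis using p by simp
        qed
        have sw: "bform d S u w = bform d S w u" for u w by (rule bform_swap) (rule sym)
        have "t * (- 2 * bform d S e x) \<le> t\<^sup>2 * bform d S e e" for t
        proof -
          have "bform d S (\<lambda>i. x i + t * e i) (\<lambda>i. x i + t * e i) = bform d S x x + 2 * t * bform d S e x + t\<^sup>2 * bform d S e e"
          proof -
            have "bform d S (\<lambda>i. x i + t * e i) y = bform d S x y + t * bform d S e y" for y
              by (simp add: bform_add_left bform_scale_left)
            then show ?thesis using sw[of x "\<lambda>i. x i + t * e i"] sw[of e "\<lambda>i. x i + t * e i"] sw[of x e]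
              by (simp add: power2_eq_square algebra_simps)
          qed
          then show ?thesis using psd[of "\<lambda>i. x i + t * e i"] z by simp
        qed
        from linear_le_quadratic_zero[OF this] show ?thesis by (simp add: be)
      qed
      have "0 = (\<Sum>p<d. (\<Sum>j<d. S p j * x j) * (\<Sum>j<d. S p j * x j))" using Sx by simp
      also have "\<dots> = (\<Sum>p<d. \<Sum>i<d. \<Sum>j<d. (x i * x j) * (S i p * S j p))"
        by (intro sum.cong refl) (auto simp: sum_product sym mult_ac intro!: sum.cong)
      also have "\<dots> = (\<Sum>i<d. \<Sum>j<d. \<Sum>p<d. (x i * x j) * (S i p * S j p))"
        by (subst sum.swap, intro sum.cong refl sum.swap)
      also have "\<dots> = (\<Sum>i<d. \<Sum>j<d. \<Sum>p<d. (x i * x j) * (a i p * a j p))"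
        by (simp add: sum_distrib_left[symmetric] sq)
      also have "\<dots> = (\<Sum>p<d. \<Sum>i<d. \<Sum>j<d. (x i * x j) * (a i p * a j p))"
        by (subst (2) sum.swap, intro sum.cong refl sum.swap)
      also have "\<dots> = (\<Sum>p<d. (\<Sum>i<d. a i p * x i)\<^sup>2)"
        by (simp add: power2_eq_square sum_product mult_ac)
      finally have "(\<Sum>p<d. (\<Sum>i<d. a i p * x i)\<^sup>2) = 0" by simp
      then have ax: "(\<Sum>i<d. a i p * x i) = 0" if "p < d" for p
        using that by (subst (asm) sum_nonneg_eq_0_iff) auto
      \<comment> \<open>Forward substitution: equation i of a^T x = 0 involves the entries of x up
        to i only.\<close>
      have "x i = 0" if "i < d" for i using that
      proof (induction i rule: less_induct)
        case (less i)
        have "(\<Sum>k<d. a k i * x k) = a i i * x i"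
        proof -
          have "(\<Sum>k<d. a k i * x k) = (\<Sum>k<d. if k = i then a i i * x i else 0)"
            using less tri by (intro sum.cong refl) (metis (full_types) lessThan_iff linorder_neqE_nat mult_zero_left mult_zero_right)
          then show ?thesis using less by simp
        qed
        then show ?case using ax[OF less.prems] pos[OF less.prems] by simp
      qed
      then show False using x by blast
    qed
    then show "0 < quad_form d B x" using psd[of x] by (simp add: qf less_le)
  qed
  then have "\<exists>!B. pos_def d B \<and> B * B = minv H"
    using BB by (intro ex1I[of _ B]) (auto intro: pos_def_square_unique)
  from theI'[OF this] show "pos_def d (inv_sqrt_mat d H)" "inv_sqrt_mat d H * inv_sqrt_mat d H = minv H"
    unfolding inv_sqrt_mat_def by auto
qed

section \<open>Gaussian integrals of cubic forms\<close>

text \<open>A point is extended by 0 to a function on all naturals, where the product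
  \<sigma>-algebra is the Borel \<sigma>-algebra; U is the preimage of an open set under this
  map.\<close>

lemma sets_Leb_openin:
  assumes U: "openin (Rtop d) U"
  shows "U \<in> sets (Leb d)"
proof -
  define h where "h x = (\<lambda>i. if i < d then x i else (0::real))" for x :: "nat \<Rightarrow> real"
  have "h \<in> measurable (Leb d) (PiM UNIV (\<lambda>_. borel))"
    unfolding h_def
  proof (rule measurable_PiM_single')
    show "(\<lambda>x. if i < d then x i else 0) \<in> borel_measurable (Leb d)" for i by (cases "i < d") auto
  qed auto
  then have h: "h \<in> borel_measurable (Leb d)"
    by (simp add: measurable_cong_sets[OF refl sets_PiM_equal_borel])
  define W where "W = {z. restrict z {..<d} \<in> U}"
  have "continuous_map euclidean (Rtop d) (\<lambda>z :: nat \<Rightarrow> real. restrict z {..<d})"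
    by (auto simp: continuous_map_componentwise intro!: continuous_on_product_coordinates)
  from openin_continuous_map_preimage[OF this U] have "open W" by (simp add: W_def)
  from measurable_sets[OF h borel_open[OF this]] have "h -` W \<inter> space (Leb d) \<in> sets (Leb d)" .
  moreover have "h -` W \<inter> space (Leb d) = U"
  proof -
    have "restrict (h x) {..<d} = x" if "x \<in> Rd d" for x
      using that by (auto simp: h_def fun_eq_iff PiE_def extensional_def)
    then show ?thesis using openin_Rtop_subset[OF U] by (auto simp: W_def space_PiM)
  qed
  ultimately show ?thesis by simp
qed

lemma measurable_extend_continuous:
  assumes U: "openin (Rtop d) U" and f: "continuous_map (subtopology (Rtop d) U) euclideanreal f"
  shows "(\<lambda>x. if x \<in> U then f x else c) \<in> borel_measurable (Leb d)"
proof (rule borel_measurableI)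
  fix S :: "real set" assume S: "open S"
  have t: "topspace (subtopology (Rtop d) U) = U" using openin_Rtop_subset[OF U] by auto
  have "openin (subtopology (Rtop d) U) {x \<in> U. f x \<in> S}"
    using openin_continuous_map_preimage[OF f, of S] S unfolding t by simp
  then have "{x \<in> U. f x \<in> S} \<in> sets (Leb d)" by (intro sets_Leb_openin openin_trans_full[OF _ U])
  moreover have "(\<lambda>x. if x \<in> U then f x else c) -` S \<inter> space (Leb d) =
      (if c \<in> S then {x \<in> U. f x \<in> S} \<union> (space (Leb d) - U) else {x \<in> U. f x \<in> S})"
    using openin_Rtop_subset[OF U] by (auto simp: space_PiM split: if_splits)
  ultimately show "(\<lambda>x. if x \<in> U then f x else c) -` S \<inter> space (Leb d) \<in> sets (Leb d)"
    using sets_Leb_openin[OF U] by auto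
qed

lemma compactin_bounded_continuous:
  assumes U: "openin (Rtop d) U" and f: "continuous_map (subtopology (Rtop d) U) euclideanreal f"
    and K: "compactin (Rtop d) K" "K \<subseteq> U"
  obtains B where "\<And>x. x \<in> K \<Longrightarrow> \<bar>f x\<bar> \<le> B"
proof -
  have "compactin (subtopology (Rtop d) U) K" using K by (simp add: compactin_subtopology)
  from image_compactin[OF this f] have "bounded (f ` K)" by (simp add: compact_imp_bounded)
  then obtain B where "\<forall>z\<in>f ` K. norm z \<le> B" unfolding bounded_iff by blast
  then show thesis by (intro that[of B]) auto
qed

section \<open>Fourth moments and contractions of the cubic form\<close>

definition gmom :: "nat \<Rightarrow> real" where "gmom n = (\<integral>t. std_normal_density t * t ^ n \<partial>lborel)"

lemma gmom_values: "gmom 0 = 1" "gmom (Suc 0) = 0" "gmom 2 = 1" "gmom 3 = 0" "gmom 4 = 3"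
proof -
  have e: "gmom (2 * k) = fact (2 * k) / (2 ^ k * fact k)" for k
    unfolding gmom_def by (rule has_bochner_integral_integral_eq[OF std_normal_moment_even])
  have o: "gmom (2 * k + 1) = 0" for k
    unfolding gmom_def by (rule has_bochner_integral_integral_eq[OF std_normal_moment_odd])
  show "gmom 0 = 1" "gmom (Suc 0) = 0" "gmom 2 = 1" "gmom 3 = 0" "gmom 4 = 3"
    using e[of 0] e[of 1] e[of 2] o[of 0] o[of 1] by (simp_all add: fact_numeral numeral_3_eq_3)
qed

lemma gmom_Suc: "gmom (Suc (Suc 0)) = 1" "gmom (Suc (Suc (Suc 0))) = 0" "gmom (Suc (Suc (Suc (Suc 0)))) = 3"
  using gmom_values by (simp_all add: eval_nat_numeral)

lemma integrable_std_power: "integrable lborel (\<lambda>t. std_normal_density t * t ^ n)"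
proof (cases "even n")
  case True
  then obtain k where "n = 2 * k" by blast
  then show ?thesis using std_normal_moment_even[of k] by (auto simp: has_bochner_integral_iff)
next
  case False
  then obtain k where "n = 2 * k + 1" by (elim oddE)
  then show ?thesis using std_normal_moment_odd[of k] by (auto simp: has_bochner_integral_iff)
qed

lemma integral_gam_monomial:
  "(\<integral>y. (\<Prod>m<d. y m ^ e m) \<partial>gam d) = (\<Prod>m<d. gmom (e m))"
proof -
  have "(\<integral>y. (\<Prod>m<d. y m ^ e m) \<partial>gam d) = (\<integral>y. (\<Prod>m<d. std_normal_density (y m) * y m ^ e m) \<partial>Leb d)"
    by (subst integral_gam) (auto simp: gd_def prod.distrib)
  also have "\<dots> = (\<Prod>m<d. gmom (e m))"
    unfolding gmom_def by (rule Leb.product_integral_prod) (auto intro: integrable_std_power)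
  finally show ?thesis .
qed

text \<open>The integral factors over the coordinates; \<open>e\<close> counts how often a
  coordinate occurs among the four indices. An index that occurs once or three times kills the
  product, \<open>pair\<close> settles a repeated index, and the other cases are permutations of
  it.\<close>

lemma isserlis_4:
  assumes "i < d" "j < d" "k < d" "l < d"
  shows "(\<integral>y. y i * y j * y k * y l \<partial>gam d) = kdelta i j * kdelta k l + kdelta i k * kdelta j l + kdelta i l * kdelta j k"
proof -
  have pw: "y i = (\<Prod>m<d. y m ^ of_bool (i = m))" if "i < d" for i and y :: "nat \<Rightarrow> real"
  proof -
    have "(\<Prod>m<d. y m ^ of_bool (i = m)) = (\<Prod>m<d. if m = i then y m else 1)" by (intro prod.cong refl) auto
    then show ?thesis using that by simp
  qed
  define e where "e i j k l m = (of_bool (i = m) + of_bool (j = m) + of_bool (k = m) + of_bool (l = m) :: nat)" for i j k l m :: nat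
  have E: "(\<integral>y. y i * y j * y k * y l \<partial>gam d) = (\<Prod>m<d. gmom (e i j k l m))" if "i < d" "j < d" "k < d" "l < d" for i j k l
  proof -
    have "y i * y j * y k * y l = (\<Prod>m<d. y m ^ e i j k l m)" for y :: "nat \<Rightarrow> real"
      unfolding e_def power_add prod.distrib pw[symmetric, OF that(1)] pw[symmetric, OF that(2)] pw[symmetric, OF that(3)] pw[symmetric, OF that(4)] ..
    then show ?thesis by (simp add: integral_gam_monomial)
  qed
  have zero: "(\<Prod>m<d. gmom (f m)) = 0" if "p < d" "f p = 1 \<or> f p = 3" for f p
    using that by (intro prod_zero) (auto intro!: bexI[of _ p] simp: gmom_values)
  have pair: "(\<Prod>m<d. gmom (e i i k l m)) = kdelta k l + 2 * kdelta i k * kdelta i l"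
    if "i < d" "k < d" "l < d" for i k l
  proof -
    consider "k = l" "i = k" | "k = l" "i \<noteq> k" | "k \<noteq> l" "i = k" | "k \<noteq> l" "i \<noteq> k" by blast
    then show ?thesis
    proof cases
      case 1
      have "(\<Prod>m<d. gmom (e i i k l m)) = (\<Prod>m<d. if m = i then 3 else 1)"
        using 1 by (intro prod.cong refl) (auto simp: e_def gmom_values gmom_Suc)
      then show ?thesis using 1 that by simp
    next
      case 2
      have "(\<Prod>m<d. gmom (e i i k l m)) = (\<Prod>m<d. 1)"
        using 2 by (intro prod.cong refl) (auto simp: e_def gmom_values gmom_Suc)
      then show ?thesis using 2 by simp
    next
      case 3 then show ?thesis using that by (subst zero[of l]) (auto simp: e_def)
    next
      case 4 then show ?thesis using that by (subst zero[of k]) (auto simp: e_def)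
    qed
  qed
  have sw: "e i j k l = e i k j l" "e i j k l = e i l k j" for i j k l
    by (auto simp: e_def fun_eq_iff)
  consider "i = j" | "i \<noteq> j" "i = k" | "i \<noteq> j" "i \<noteq> k" "i = l" | "i \<noteq> j" "i \<noteq> k" "i \<noteq> l" by blast
  then show ?thesis
  proof cases
    case 1 then show ?thesis using pair[of i k l] assms by (simp add: E)
  next
    case 2 then show ?thesis using pair[of i j l] assms sw(1)[of i j i l] by (simp add: E)
  next
    case 3 then show ?thesis using pair[of i k j] assms sw(2)[of i j k i] by (simp add: E)
  next
    case 4 then show ?thesis using assms zero[of i "e i j k l"] by (simp add: E e_def)
  qed
qed

text \<open>The pullback of T under the linear map A, that is, the derivative tensor in whitened
  coordinates.\<close>

definition tcoef :: "nat \<Rightarrow> tensor \<Rightarrow> (nat \<Rightarrow> nat \<Rightarrow> real) \<Rightarrow> nat \<Rightarrow> nat \<Rightarrow> nat \<Rightarrow> real" where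
  "tcoef d T A i j k = (\<Sum>a<d. \<Sum>b<d. \<Sum>c<d. T [a, b, c] * A a i * A b j * A c k)"

definition lmap :: "nat \<Rightarrow> (nat \<Rightarrow> nat \<Rightarrow> real) \<Rightarrow> (nat \<Rightarrow> real) \<Rightarrow> nat \<Rightarrow> real" where
  "lmap d A y i = (\<Sum>j<d. A i j * y j)"

text \<open>Packing three sums into one lets a sixfold sum be reordered by a single swap.\<close>

lemma triple_sum: "(\<Sum>i<d. \<Sum>j<d. \<Sum>k<d. F i j k) = (\<Sum>p\<in>{..<d} \<times> {..<d} \<times> {..<(d::nat)}. F (fst p) (fst (snd p)) (snd (snd p)))"
  by (simp add: sum.cartesian_product' )

lemma sum_product3:
  fixes x :: real
  shows "x * ((\<Sum>i\<in>I. f i) * ((\<Sum>j\<in>J. g j) * (\<Sum>k\<in>K. h k))) = (\<Sum>i\<in>I. \<Sum>j\<in>J. \<Sum>k\<in>K. x * (f i * (g j * h k)))"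
  by (simp add: sum_distrib_left[symmetric] sum_distrib_right[symmetric])

lemma cub_tcoef: "cub d (tcoef d T A) y = tinner d 3 T (tpow (lmap d A y))"
proof -
  let ?P = "{..<d} \<times> {..<d} \<times> {..<d}"
  have "tinner d 3 T (tpow (lmap d A y)) = (\<Sum>a<d. \<Sum>b<d. \<Sum>c<d. T [a, b, c] * ((\<Sum>i<d. A a i * y i) * ((\<Sum>j<d. A b j * y j) * (\<Sum>k<d. A c k * y k))))"
    by (simp add: tinner_3 tpow_def lmap_def)
  also have "\<dots> = (\<Sum>a<d. \<Sum>b<d. \<Sum>c<d. \<Sum>i<d. \<Sum>j<d. \<Sum>k<d. T [a, b, c] * (A a i * y i * (A b j * y j * (A c k * y k))))"
    by (simp only: sum_product3)
  also have "\<dots> = (\<Sum>p\<in>?P. \<Sum>q\<in>?P. T [fst p, fst (snd p), snd (snd p)] *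
      (A (fst p) (fst q) * y (fst q) * (A (fst (snd p)) (fst (snd q)) * y (fst (snd q)) * (A (snd (snd p)) (snd (snd q)) * y (snd (snd q))))))"
    by (simp only: triple_sum)
  also have "\<dots> = (\<Sum>q\<in>?P. \<Sum>p\<in>?P. T [fst p, fst (snd p), snd (snd p)] *
      (A (fst p) (fst q) * y (fst q) * (A (fst (snd p)) (fst (snd q)) * y (fst (snd q)) * (A (snd (snd p)) (snd (snd q)) * y (snd (snd q))))))"
    by (rule sum.swap)
  also have "\<dots> = cub d (tcoef d T A) y"
    unfolding cub_def tri_def tcoef_def triple_sum sum_distrib_right by (simp add: mult_ac)
  finally show ?thesis ..
qed

lemma tcoef_swap:
  assumes "\<And>a b c. a < d \<Longrightarrow> b < d \<Longrightarrow> c < d \<Longrightarrow> T [a, b, c] = T [b, a, c]"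
    and "\<And>a b c. a < d \<Longrightarrow> b < d \<Longrightarrow> c < d \<Longrightarrow> T [a, b, c] = T [a, c, b]"
  shows "tcoef d T A i j k = tcoef d T A j i k" "tcoef d T A i j k = tcoef d T A i k j"
proof -
  show "tcoef d T A i j k = tcoef d T A j i k"
    unfolding tcoef_def by (subst sum.swap) (auto intro!: sum.cong simp: assms(1) mult_ac)
  show "tcoef d T A i j k = tcoef d T A i k j"
    unfolding tcoef_def by (rule sum.cong[OF refl], subst sum.swap) (auto intro!: sum.cong simp: assms(2) mult_ac)
qed

text \<open>Contracting two slots of the pullback sees A only through A A^T. This is what allows the
  triangular and the symmetric root to be exchanged.\<close>

lemma tcoef_trace:
  assumes P: "\<And>b c. b < d \<Longrightarrow> c < d \<Longrightarrow> (\<Sum>q<d. A b q * A c q) = P b c"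
  shows "(\<Sum>q<d. tcoef d T A j q q) = (\<Sum>a<d. A a j * (\<Sum>b<d. \<Sum>c<d. T [a, b, c] * P b c))"
proof -
  have "(\<Sum>q<d. tcoef d T A j q q) = (\<Sum>p\<in>{..<d} \<times> {..<d} \<times> {..<d}. \<Sum>q<d. T [fst p, fst (snd p), snd (snd p)] * A (fst p) j * A (fst (snd p)) q * A (snd (snd p)) q)"
    unfolding tcoef_def triple_sum by (rule sum.swap)
  also have "\<dots> = (\<Sum>p\<in>{..<d} \<times> {..<d} \<times> {..<d}. T [fst p, fst (snd p), snd (snd p)] * A (fst p) j * P (fst (snd p)) (snd (snd p)))"
    by (intro sum.cong refl) (auto simp: P[symmetric] sum_distrib_left mult_ac)
  also have "\<dots> = (\<Sum>a<d. \<Sum>b<d. \<Sum>c<d. T [a, b, c] * A a j * P b c)" unfolding triple_sum ..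
  finally show ?thesis by (simp add: sum_distrib_left mult_ac)
qed

text \<open>The squared norm of A^T p also depends on A A^T only, which removes the choice of the
  root from the slot left open by \<open>tcoef_trace\<close>.\<close>

lemma sum_sq_columns:
  fixes p :: "nat \<Rightarrow> real"
  assumes P: "\<And>b c. b < d \<Longrightarrow> c < d \<Longrightarrow> (\<Sum>q<d. A b q * A c q) = P b c"
  shows "(\<Sum>j<d. (\<Sum>a<d. A a j * p a)\<^sup>2) = (\<Sum>b<d. \<Sum>c<d. p b * p c * P b c)"
proof -
  have "(\<Sum>j<d. (\<Sum>a<d. A a j * p a)\<^sup>2) = (\<Sum>j<d. \<Sum>b<d. \<Sum>c<d. p b * p c * (A b j * A c j))"
    by (simp add: power2_eq_square sum_product mult_ac)
  also have "\<dots> = (\<Sum>b<d. \<Sum>j<d. \<Sum>c<d. p b * p c * (A b j * A c j))" by (rule sum.swap)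
  also have "\<dots> = (\<Sum>b<d. \<Sum>c<d. \<Sum>j<d. p b * p c * (A b j * A c j))" by (intro sum.cong refl sum.swap)
  also have "\<dots> = (\<Sum>b<d. \<Sum>c<d. p b * p c * P b c)" by (simp add: sum_distrib_left[symmetric] P)
  finally show ?thesis .
qed

text \<open>By Isserlis, coordinate j pairs with one of the three slots and the other two are
  traced.\<close>

lemma integral_coord_cub:
  assumes j: "j < d"
  shows "(\<integral>y. y j * cub d t y \<partial>gam d) = (\<Sum>q<d. t j q q + t q j q + t q q j)"
proof -
  let ?P = "{..<d} \<times> {..<d} \<times> {..<d}"
  have i: "integrable (gam d) (\<lambda>y. y j * y a * y b * y c)" if "a < d" "b < d" "c < d" for a b c
    using that j by (intro am_integrable am_mult am_coord)
  have "(\<integral>y. y j * cub d t y \<partial>gam d) = (\<integral>y. (\<Sum>p\<in>?P. t (fst p) (fst (snd p)) (snd (snd p)) * (y j * y (fst p) * y (fst (snd p)) * y (snd (snd p)))) \<partial>gam d)"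
    unfolding cub_def tri_def triple_sum sum_distrib_left by (simp add: mult_ac)
  also have "\<dots> = (\<Sum>p\<in>?P. t (fst p) (fst (snd p)) (snd (snd p)) * (\<integral>y. y j * y (fst p) * y (fst (snd p)) * y (snd (snd p)) \<partial>gam d))"
    using i by (subst Bochner_Integration.integral_sum) auto
  also have "\<dots> = (\<Sum>a<d. \<Sum>b<d. \<Sum>c<d. t a b c * (kdelta j a * kdelta b c + kdelta j b * kdelta a c + kdelta j c * kdelta a b))"
    unfolding triple_sum using j by (intro sum.cong refl) (auto simp: isserlis_4)
  also have "\<dots> = (\<Sum>a<d. \<Sum>b<d. \<Sum>c<d. t a b c * (kdelta j a * kdelta b c)) + (\<Sum>a<d. \<Sum>b<d. \<Sum>c<d. t a b c * (kdelta j b * kdelta a c)) + (\<Sum>a<d. \<Sum>b<d. \<Sum>c<d. t a b c * (kdelta j c * kdelta a b))"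
    by (simp only: distrib_left sum.distrib)
  also have "(\<Sum>a<d. \<Sum>b<d. \<Sum>c<d. t a b c * (kdelta j a * kdelta b c)) = (\<Sum>q<d. t j q q)"
  proof -
    have "(\<Sum>c<d. t a b c * (kdelta j a * kdelta b c)) = (if j = a then t a b b else 0)" if "b < d" for a b
      using that by (simp add: if_distrib[of "\<lambda>z. _ * z"] cong: if_cong)
    then have "(\<Sum>a<d. \<Sum>b<d. \<Sum>c<d. t a b c * (kdelta j a * kdelta b c)) = (\<Sum>a<d. if j = a then (\<Sum>b<d. t a b b) else 0)"
      by (intro sum.cong refl) auto
    then show ?thesis using j by simp
  qed
  also have "(\<Sum>a<d. \<Sum>b<d. \<Sum>c<d. t a b c * (kdelta j b * kdelta a c)) = (\<Sum>q<d. t q j q)"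
  proof -
    have "(\<Sum>c<d. t a b c * (kdelta j b * kdelta a c)) = (if j = b then t a b a else 0)" if "a < d" for a b
      using that by (simp add: if_distrib[of "\<lambda>z. _ * z"] cong: if_cong)
    then have "(\<Sum>a<d. \<Sum>b<d. \<Sum>c<d. t a b c * (kdelta j b * kdelta a c)) = (\<Sum>a<d. \<Sum>b<d. if j = b then t a b a else 0)"
      by (intro sum.cong refl) auto
    then show ?thesis using j by simp
  qed
  also have "(\<Sum>a<d. \<Sum>b<d. \<Sum>c<d. t a b c * (kdelta j c * kdelta a b)) = (\<Sum>q<d. t q q j)"
  proof -
    have "(\<Sum>c<d. t a b c * (kdelta j c * kdelta a b)) = (if a = b then t a b j else 0)" for a b
      using j by (simp add: if_distrib[of "\<lambda>z. _ * z"] if_distrib[of "\<lambda>z. z * _"] cong: if_cong)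
    then show ?thesis by simp
  qed
  finally show ?thesis by (simp add: sum.distrib)
qed

section \<open>The whitened potential\<close>

lemma coord_le_nrm: "i < d \<Longrightarrow> \<bar>y i\<bar> \<le> nrm d y"
proof -
  assume "i < d"
  then have "(y i)\<^sup>2 \<le> (nrm d y)\<^sup>2" unfolding nrm_sq by (intro member_le_sum) auto
  then show ?thesis using abs_le_square_iff[of "y i" "nrm d y"] by simp
qed

locale laplace_setup =
  fixes d :: nat and n :: real and \<Theta> :: "(nat \<Rightarrow> real) set" and v :: "(nat \<Rightarrow> real) \<Rightarrow> real"
    and xh :: "nat \<Rightarrow> real" and s0 c0 s C :: real and a :: "nat \<Rightarrow> nat \<Rightarrow> real"
  assumes d1: "d \<ge> 1" and n0: "n > 0" and op: "openin (Rtop d) \<Theta>" and A1: "A1 d \<Theta> v xh"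
    and C0: "C > 0" and A2: "A2 C d n \<Theta> v xh s0 c0" and ss: "s \<ge> s_star s0 c0"
    and UT: "local_region d n v xh s \<subseteq> \<Theta>"
    and wh: "whitening d (hessian d (\<lambda>x. n * v x) xh) a"
begin

definition V where "V = (\<lambda>x. n * v x)"
definition H where "H = hessian d V xh"
definition U where "U = local_region d n v xh s"
definition X where "X y = affine_map d xh a y"
definition L where "L = lmap d a"
abbreviation T where "T \<equiv> nabla V xh"
definition t where "t = tcoef d T a"

lemma d0: "real d > 0" using d1 by simp
lemma c0: "0 < c0" "c0 \<le> 1"
proof -
  have "0 < C / sqrt d" using C0 d0 by simp
  then show "0 < c0" "c0 \<le> 1" using A2 by (auto simp: A2_def)
qed

lemma slog: "s \<ge> 8 / c0 * ln (2 * exp 1 / c0)" and s_ge_s0: "s \<ge> s0"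
  using ss by (auto simp: s_star_def)

text \<open>For c0 <= 1 the second term of \<open>s_star\<close> is at least 8 (1 + ln 2), and ln 2
  >= 1/2 suffices for 12.\<close>

lemma s12: "s \<ge> 12"
proof -
  have "ln (2 * exp 1 / 1) \<le> ln (2 * exp 1 / c0)" using c0 by (subst ln_le_cancel_iff) (auto simp: field_simps)
  moreover have "ln (2 * exp 1 / 1) = ln 2 + (1::real)" by (simp add: ln_mult)
  ultimately have l: "3/2 \<le> ln (2 * exp 1 / c0)" using ln2_ge_two_thirds by linarith
  have "8 / 1 * (3/2) \<le> 8 / c0 * ln (2 * exp 1 / c0)"
    using c0 l by (intro mult_mono divide_left_mono) auto
  then show ?thesis using slog by simp
qed

lemma Ckv: "Ck_on d 4 \<Theta> v" and xhT: "xh \<in> \<Theta>" and vmin: "\<And>x. x \<in> \<Theta> \<Longrightarrow> v xh \<le> v x"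
  and Hv_pos: "pos_def d (hessian d v xh)"
  using A1 by (auto simp: A1_def less_imp_le)

lemma xhR: "xh \<in> Rd d" using openin_Rtop_subset[OF op] xhT by blast

lemma CkV: "Ck_on d 4 \<Theta> V" unfolding V_def by (rule Ck_on_cmult(1)[OF op Ckv])

lemma H_entry: "i < d \<Longrightarrow> j < d \<Longrightarrow> H $$ (i, j) = n * hessian d v xh $$ (i, j)"
  unfolding H_def hessian_def V_def by (simp add: nabla_cmult[OF op Ckv _ _ xhT])

lemma quad_H: "quad_form d H x = n * quad_form d (hessian d v xh) x"
  by (simp add: quad_form_def H_entry sum_distrib_left mult_ac)

lemma hnorm_H: "hnorm d H x = sqrt n * hnorm d (hessian d v xh) x"
  by (simp add: hnorm_def quad_H real_sqrt_mult)

lemma H_entry_T: "i < d \<Longrightarrow> j < d \<Longrightarrow> H $$ (i, j) = nabla V xh [i, j]"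
  by (simp add: H_def hessian_def)

lemma whH: "whitening d H a" using wh by (simp add: H_def V_def)
lemmas W = whiteningD[OF whH]

lemma U_iff: "x \<in> U \<longleftrightarrow> x \<in> Rd d \<and> hnorm d H (vsub d x xh) \<le> s * sqrt d"
proof -
  have "hnorm d (hessian d v xh) (vsub d x xh) \<le> s * sqrt (d / n) \<longleftrightarrow>
    sqrt n * hnorm d (hessian d v xh) (vsub d x xh) \<le> sqrt n * (s * sqrt (d / n))" using n0 by simp
  moreover have "sqrt n * (s * sqrt (d / n)) = s * sqrt d" using n0 by (simp add: real_sqrt_divide)
  ultimately show ?thesis by (simp add: U_def local_region_def hnorm_H)
qed

lemma X_eq: "X y = ray d xh (L y) 1"
proof -
  have "(\<Sum>j\<in>{i..<d}. a i j * y j) = (\<Sum>j<d. a i j * y j)" for i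
    by (rule sum.mono_neutral_left) (auto simp: W(1))
  then show ?thesis by (auto simp: X_def L_def affine_map_def ray_def lmap_def)
qed

lemma X_Rd: "X y \<in> Rd d" by (simp add: X_eq)

lemma vsub_X: "vsub d (X y) xh = restrict (L y) {..<d}"
  by (auto simp: X_eq ray_def vsub_def)

lemma hnorm_restrict: "hnorm d H (restrict x {..<d}) = hnorm d H x"
  by (simp add: hnorm_def quad_form_def)

lemma quad_L: "quad_form d H (L y) = (nrm d y)\<^sup>2"
proof -
  have "quad_form d H (L y) = (\<Sum>k<d. \<Sum>l<d. (\<Sum>i<d. a k i * y i) * H $$ (k, l) * (\<Sum>j<d. a l j * y j))"
    by (simp add: quad_form_def L_def lmap_def)
  also have "\<dots> = (\<Sum>k<d. \<Sum>l<d. \<Sum>i<d. \<Sum>j<d. (y i * y j) * (a k i * H $$ (k, l) * a l j))"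
    by (simp add: sum_distrib_left sum_distrib_right mult_ac)
  also have "\<dots> = (\<Sum>p\<in>{..<d}\<times>{..<d}. \<Sum>q\<in>{..<d}\<times>{..<d}. (y (fst q) * y (snd q)) * (a (fst p) (fst q) * H $$ (fst p, snd p) * a (snd p) (snd q)))"
    by (simp add: sum.cartesian_product')
  also have "\<dots> = (\<Sum>q\<in>{..<d}\<times>{..<d}. \<Sum>p\<in>{..<d}\<times>{..<d}. (y (fst q) * y (snd q)) * (a (fst p) (fst q) * H $$ (fst p, snd p) * a (snd p) (snd q)))"
    by (rule sum.swap)
  also have "\<dots> = (\<Sum>i<d. \<Sum>j<d. (y i * y j) * (\<Sum>k<d. \<Sum>l<d. a k i * H $$ (k, l) * a l j))"
    by (simp add: sum.cartesian_product' sum_distrib_left)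
  also have "\<dots> = (\<Sum>i<d. \<Sum>j<d. if i = j then y i * y j else 0)"
    by (intro sum.cong refl) (simp add: W(3))
  also have "\<dots> = (nrm d y)\<^sup>2" unfolding nrm_sq by (simp add: power2_eq_square)
  finally show ?thesis .
qed

lemma hnorm_L: "hnorm d H (L y) = nrm d y"
  by (simp add: hnorm_def quad_L)

lemma X_in_U: "X y \<in> U \<longleftrightarrow> nrm d y \<le> s * sqrt d"
  by (simp add: U_iff X_Rd vsub_X hnorm_restrict hnorm_L)

lemma L_surj: obtains y where "\<And>i. i < d \<Longrightarrow> L y i = u i"
\<comment> \<open>The preimage of u is a^T H u, since a a^T is the inverse of H.\<close>
proof (rule that[of "\<lambda>k. \<Sum>l<d. a l k * (\<Sum>j<d. H $$ (l, j) * u j)"])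
  fix i assume i: "i < d"
  have "L (\<lambda>k. \<Sum>l<d. a l k * (\<Sum>j<d. H $$ (l, j) * u j)) i = (\<Sum>k<d. \<Sum>l<d. (a i k * a l k) * (\<Sum>j<d. H $$ (l, j) * u j))"
    by (simp add: L_def lmap_def sum_distrib_left mult_ac)
  also have "\<dots> = (\<Sum>l<d. (\<Sum>k<d. a i k * a l k) * (\<Sum>j<d. H $$ (l, j) * u j))"
    by (subst sum.swap) (simp add: sum_distrib_right)
  also have "\<dots> = (\<Sum>l<d. minv H $$ (i, l) * (\<Sum>j<d. H $$ (l, j) * u j))"
    using i by (simp add: W(4))
  also have "\<dots> = (\<Sum>l<d. \<Sum>j<d. minv H $$ (i, l) * H $$ (l, j) * u j)" by (simp add: sum_distrib_left mult_ac)
  also have "\<dots> = (\<Sum>j<d. (\<Sum>l<d. minv H $$ (i, l) * H $$ (l, j)) * u j)"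
    by (subst sum.swap) (simp add: sum_distrib_right)
  also have "\<dots> = (\<Sum>j<d. if j = i then u j else 0)"
    using i by (intro sum.cong refl) (simp add: W(8))
  also have "\<dots> = u i" using i by simp
  finally show "L (\<lambda>k. \<Sum>l<d. a l k * (\<Sum>j<d. H $$ (l, j) * u j)) i = u i" .
qed

text \<open>A crude bound on the entries of H-unit vectors. It makes the suprema in the tensor norms
  range over bounded sets and leaves no trace in the final constants.\<close>

definition Ca where "Ca = (\<Sum>i<d. \<Sum>j<d. \<bar>a i j\<bar>)"

lemma Ca0: "Ca \<ge> 0" by (simp add: Ca_def sum_nonneg)

lemma L_bound: "i < d \<Longrightarrow> \<bar>L y i\<bar> \<le> Ca * nrm d y"
proof -
  assume i: "i < d"
  have "\<bar>L y i\<bar> \<le> (\<Sum>j<d. \<bar>a i j\<bar> * nrm d y)"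
    unfolding L_def lmap_def by (intro order_trans[OF sum_abs] sum_mono) (simp add: abs_mult mult_left_mono coord_le_nrm)
  also have "\<dots> = (\<Sum>j<d. \<bar>a i j\<bar>) * nrm d y" by (simp add: sum_distrib_right)
  also have "\<dots> \<le> Ca * nrm d y"
  proof (rule mult_right_mono)
    show "(\<Sum>j<d. \<bar>a i j\<bar>) \<le> Ca" unfolding Ca_def
      by (rule member_le_sum[where f="\<lambda>i. \<Sum>j<d. \<bar>a i j\<bar>"]) (use i in \<open>simp_all add: sum_nonneg\<close>)
  qed simp
  finally show ?thesis .
qed

lemma unit_coord: "hnorm d H u = 1 \<Longrightarrow> i < d \<Longrightarrow> \<bar>u i\<bar> \<le> Ca"
proof -
  assume u: "hnorm d H u = 1" and i: "i < d"
  obtain y where y: "\<And>i. i < d \<Longrightarrow> L y i = u i" using L_surj[of u] by blast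
  have "hnorm d H (L y) = hnorm d H u" using y by (simp add: hnorm_def quad_form_def)
  then have "nrm d y = 1" using u by (simp add: hnorm_L)
  then show ?thesis using L_bound[OF i, of y] y[OF i] by simp
qed

lemma tinner_unit_le:
  assumes u: "hnorm d H u = 1"
  shows "\<bar>tinner d k S (tpow u)\<bar> \<le> (\<Sum>is\<in>tidx d k. \<bar>S is\<bar> * Ca ^ k)"
  unfolding tinner_def
proof (intro order_trans[OF sum_abs] sum_mono)
  fix "is" assume i: "is \<in> tidx d k"
  have "\<bar>prod_list (map u is)\<bar> \<le> Ca ^ length is" if "set is \<subseteq> {..<d}"
    using that
  proof (induction "is")
    case (Cons j js)
    then show ?case using unit_coord[OF u, of j] Ca0 by (simp add: abs_mult mult_mono)
  qed simp
  then have "\<bar>tpow u is\<bar> \<le> Ca ^ k" using i by (auto simp: tpow_def tidx_def)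
  then show "\<bar>S is * tpow u is\<bar> \<le> \<bar>S is\<bar> * Ca ^ k" by (simp add: abs_mult mult_left_mono)
qed

lemma tnorm_bdd: "bdd_above ((\<lambda>u. \<bar>tinner d k S (tpow u)\<bar>) ` {u \<in> Rd d. hnorm d H u = 1})"
  using tinner_unit_le by (intro bdd_aboveI[of _ "\<Sum>is\<in>tidx d k. \<bar>S is\<bar> * Ca ^ k"]) auto

lemma unit_exists: "restrict (L (kdelta 0)) {..<d} \<in> {u \<in> Rd d. hnorm d H u = 1}"
proof -
  have "(nrm d (kdelta 0))\<^sup>2 = (\<Sum>i<d. if i = 0 then 1 else 0)" unfolding nrm_sq by (intro sum.cong refl) auto
  also have "\<dots> = 1" using d1 by simp
  finally have "nrm d (kdelta 0) = 1" using nrm_nonneg[of d "kdelta 0"] by (metis abs_of_nonneg real_sqrt_abs real_sqrt_one)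
  then show ?thesis by (simp add: hnorm_restrict hnorm_L)
qed

lemma tnorm_nonneg: "tnorm d k H S \<ge> 0"
  unfolding tnorm_def by (rule order_trans[OF abs_ge_zero cSUP_upper[OF unit_exists tnorm_bdd]])

lemma tnorm_le: "tnorm d k H S \<le> (\<Sum>is\<in>tidx d k. \<bar>S is\<bar> * Ca ^ k)"
  unfolding tnorm_def
proof (rule cSUP_least)
  show "{u \<in> Rd d. hnorm d H u = 1} \<noteq> {}" using unit_exists by blast
qed (auto intro: tinner_unit_le)

lemma tinner_L_le:
  assumes k: "k > 0"
  shows "\<bar>tinner d k S (tpow (L y))\<bar> \<le> tnorm d k H S * nrm d y ^ k"
proof (cases "nrm d y = 0")
  case True
  then have "L y i = 0 * L y i" if "i < d" for i by (simp add: L_def lmap_def nrm_zero_iff)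
  then have "tinner d k S (tpow (L y)) = tinner d k S (tpow (\<lambda>i. 0 * L y i))" by (intro tinner_tpow_cong) auto
  also have "\<dots> = 0 ^ k * tinner d k S (tpow (L y))" by (rule tinner_tpow_scale)
  also have "\<dots> = 0" using k by (simp add: zero_power)
  finally show ?thesis using True k by (simp add: zero_power)
next
  case False
  define c where "c = nrm d y"
  have c: "c > 0" using False nrm_nonneg[of d y] by (simp add: c_def less_le)
  define u where "u = restrict (L (\<lambda>j. (1/c) * y j)) {..<d}"
  have "hnorm d H u = 1" unfolding u_def hnorm_restrict hnorm_L nrm_scale using c by (simp add: c_def[symmetric])
  then have u: "u \<in> {u \<in> Rd d. hnorm d H u = 1}" by (simp add: u_def)
  have "L y i = c * u i" if "i < d" for i
    using that c by (simp add: u_def L_def lmap_def sum_distrib_left)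
  then have "tinner d k S (tpow (L y)) = c ^ k * tinner d k S (tpow u)"
    by (subst tinner_tpow_scale[symmetric], intro tinner_tpow_cong) auto
  then have "\<bar>tinner d k S (tpow (L y))\<bar> = c ^ k * \<bar>tinner d k S (tpow u)\<bar>" using c by (simp add: abs_mult)
  also have "\<dots> \<le> c ^ k * tnorm d k H S"
    unfolding tnorm_def using c by (intro mult_left_mono cSUP_upper[OF u tnorm_bdd]) auto
  finally show ?thesis by (simp add: c_def mult.commute)
qed

text \<open>U is the image of a closed Euclidean ball under the affine map X. Compactness bounds the
  continuous derivatives on U, so that the suprema in \<open>eps4\<close> and \<open>eps5\<close>
  are genuine upper bounds.\<close>

lemma compact_U: "compactin (Rtop d) U"
proof -
  let ?\<rho> = "s * sqrt d"
  define K where "K = {y \<in> topspace (Rtop d). (nrm d y)\<^sup>2 \<in> {..?\<rho>\<^sup>2}}"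
  have "0 \<le> ?\<rho>" using s12 by simp
  then have K: "y \<in> K \<longleftrightarrow> y \<in> Rd d \<and> nrm d y \<le> ?\<rho>" for y
    by (auto simp: K_def intro: power_mono power2_le_imp_le)
  have coord: "continuous_map (Rtop d) euclideanreal (\<lambda>y. y i)" if "i < d" for i
    using that by (intro continuous_map_product_projection) auto
  have "continuous_map (Rtop d) euclideanreal (\<lambda>y. (nrm d y)\<^sup>2)"
    unfolding nrm_sq unfolding power2_eq_square by (intro continuous_map_sum continuous_map_real_mult coord) auto
  then have "closedin (Rtop d) K" unfolding K_def by (rule closedin_continuous_map_preimage) simp
  moreover have "K \<subseteq> Pi\<^sub>E {..<d} (\<lambda>_. {-?\<rho>..?\<rho>})"
  proof
    fix y assume y: "y \<in> K"
    have "\<bar>y i\<bar> \<le> ?\<rho>" if "i < d" for i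
    proof -
      have "\<bar>y i\<bar> \<le> nrm d y" using that by (rule coord_le_nrm)
      then show ?thesis using y by (simp add: K)
    qed
    then show "y \<in> Pi\<^sub>E {..<d} (\<lambda>_. {-?\<rho>..?\<rho>})" using y by (auto simp: K PiE_iff abs_le_iff minus_le_iff)
  qed
  moreover have "compactin (Rtop d) (Pi\<^sub>E {..<d} (\<lambda>_. {-?\<rho>..?\<rho>}))" by (simp add: compactin_PiE)
  ultimately have "compactin (Rtop d) K" by (metis closed_compactin)
  moreover have "continuous_map (Rtop d) (Rtop d) X"
    unfolding continuous_map_componentwise X_eq ray_def L_def lmap_def
    by (auto intro!: continuous_map_add continuous_map_sum continuous_map_real_mult_left coord simp: extensional_def)
  ultimately have "compactin (Rtop d) (X ` K)" by (rule image_compactin)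
  moreover have "X ` K = U"
  proof
    show "X ` K \<subseteq> U" by (auto simp: K X_in_U)
    show "U \<subseteq> X ` K"
    proof
      fix x assume x: "x \<in> U"
      obtain y where y: "\<And>i. i < d \<Longrightarrow> L y i = x i - xh i" using L_surj[of "\<lambda>i. x i - xh i"] by blast
      have "X y = x" using x y by (auto simp: X_eq ray_def fun_eq_iff U_iff PiE_def extensional_def)
      moreover have "X y = X (restrict y {..<d})" by (simp add: X_eq ray_def L_def lmap_def)
      ultimately show "x \<in> X ` K"
        using x X_in_U[of y] by (intro image_eqI[of _ _ "restrict y {..<d}"]) (auto simp: K)
    qed
  qed
  ultimately show ?thesis by simp
qed

lemma UT': "U \<subseteq> \<Theta>" using UT by (simp add: U_def)

lemma xhU: "xh \<in> U"
  using xhR s12 by (simp add: U_iff vsub_def hnorm_def quad_form_def)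

lemma tnorm_bounded:
  assumes Ck: "Ck_on d k \<Theta> V"
  obtains B where "\<And>x. x \<in> U \<Longrightarrow> tnorm d k H (nabla V x) \<le> B"
proof -
  have "\<exists>B. \<forall>x\<in>U. \<bar>nabla V x is\<bar> \<le> B" if "is \<in> tidx d k" for "is"
  proof -
    have "Ck_on d (k - length is) \<Theta> (\<lambda>x. nabla V x is)" using that by (intro Ck_on_nabla[OF Ck]) (auto simp: tidx_def)
    then have "continuous_map (subtopology (Rtop d) \<Theta>) euclideanreal (\<lambda>x. nabla V x is)" by (rule Ck_on_continuous)
    from compactin_bounded_continuous[OF op this compact_U UT'] show ?thesis by metis
  qed
  then obtain B where B: "\<And>is x. is \<in> tidx d k \<Longrightarrow> x \<in> U \<Longrightarrow> \<bar>nabla V x is\<bar> \<le> B is" by metis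
  show thesis
  proof (rule that)
    fix x assume x: "x \<in> U"
    show "tnorm d k H (nabla V x) \<le> (\<Sum>is\<in>tidx d k. B is * Ca ^ k)"
      using x B Ca0 by (intro order_trans[OF tnorm_le] sum_mono mult_right_mono) auto
  qed
qed

abbreviation e3 where "e3 \<equiv> eps3 d V xh"
abbreviation e4 where "e4 \<equiv> eps4 d V xh U"
abbreviation e5 where "e5 \<equiv> eps5 d V xh U"

lemma e3_eq: "tnorm d 3 H T = e3 / d" using d0 by (simp add: eps3_def H_def)
lemma e3_nonneg: "e3 \<ge> 0" using tnorm_nonneg by (simp add: eps3_def H_def[symmetric])

lemma e4_tnorm: "x \<in> U \<Longrightarrow> tnorm d 4 H (nabla V x) \<le> (e4 / d)\<^sup>2" and e4_nonneg: "e4 \<ge> 0"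
proof -
  obtain B where B: "\<And>x. x \<in> U \<Longrightarrow> tnorm d 4 H (nabla V x) \<le> B" using tnorm_bounded[OF CkV] by blast
  have bdd: "bdd_above ((\<lambda>x. sqrt (tnorm d 4 H (nabla V x))) ` U)"
    using B by (intro bdd_aboveI[of _ "sqrt B"]) auto
  have e: "e4 / d = (SUP x\<in>U. sqrt (tnorm d 4 H (nabla V x)))" using d0 by (simp add: eps4_def H_def)
  have le: "sqrt (tnorm d 4 H (nabla V x)) \<le> e4 / d" if "x \<in> U" for x unfolding e by (rule cSUP_upper[OF that bdd])
  show "tnorm d 4 H (nabla V x) \<le> (e4 / d)\<^sup>2" if "x \<in> U"
  proof -
    have "(sqrt (tnorm d 4 H (nabla V x)))\<^sup>2 \<le> (e4 / d)\<^sup>2" using le[OF that] tnorm_nonneg by (intro power_mono) auto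
    then show ?thesis using tnorm_nonneg by simp
  qed
  have "0 \<le> e4 / d" using le[OF xhU] tnorm_nonneg[of 4 "nabla V xh"] by (meson order_trans real_sqrt_ge_zero)
  then show "e4 \<ge> 0" using d0 by (simp add: zero_le_divide_iff)
qed

lemma e5_tnorm:
  assumes C5: "Ck_on d 5 \<Theta> v"
  shows "x \<in> U \<Longrightarrow> tnorm d 5 H (nabla V x) \<le> (e5 / d) ^ 3" and "e5 \<ge> 0"
proof -
  have C5V: "Ck_on d 5 \<Theta> V" unfolding V_def by (rule Ck_on_cmult(1)[OF op C5])
  obtain B where B: "\<And>x. x \<in> U \<Longrightarrow> tnorm d 5 H (nabla V x) \<le> B" using tnorm_bounded[OF C5V] by blast
  have bdd: "bdd_above ((\<lambda>x. root 3 (tnorm d 5 H (nabla V x))) ` U)"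
    using B by (intro bdd_aboveI[of _ "root 3 B"]) auto
  have e: "e5 / d = (SUP x\<in>U. root 3 (tnorm d 5 H (nabla V x)))" using d0 by (simp add: eps5_def H_def)
  have le: "root 3 (tnorm d 5 H (nabla V x)) \<le> e5 / d" if "x \<in> U" for x unfolding e by (rule cSUP_upper[OF that bdd])
  show "tnorm d 5 H (nabla V x) \<le> (e5 / d) ^ 3" if "x \<in> U"
  proof -
    have "(root 3 (tnorm d 5 H (nabla V x))) ^ 3 \<le> (e5 / d) ^ 3" using le[OF that] tnorm_nonneg by (intro power_mono) auto
    then show ?thesis using tnorm_nonneg by simp
  qed
  have "0 \<le> root 3 (tnorm d 5 H (nabla V xh))" using tnorm_nonneg by simp
  then have "0 \<le> e5 / d" using le[OF xhU] by linarith
  then show "e5 \<ge> 0" using d0 by (simp add: zero_le_divide_iff)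
qed

lemma cub_t: "cub d t y = tinner d 3 T (tpow (L y))"
  by (simp add: t_def cub_tcoef L_def)

lemma cub_t_le: "\<bar>cub d t y\<bar> \<le> e3 / d * nrm d y ^ 3"
  unfolding cub_t e3_eq[symmetric] by (rule tinner_L_le) simp

definition w where "w y = (if X y \<in> \<Theta> then exp (- (V (X y) - V xh)) else 0)"
text \<open>Outside \<open>\<Theta>\<close>, \<open>r\<close> uses the junk value \<open>ln 0 = 0\<close>; only the ball matters.\<close>
definition r where "r y = - ln (w y) - (nrm d y)\<^sup>2 / 2 - cub d t y / 6"

lemma measurable_X [measurable]: "X \<in> measurable (Leb d) (Leb d)"
  unfolding X_def[abs_def] by (rule measurable_affine_map)

lemma measurable_weight [measurable]: "(\<lambda>x. if x \<in> \<Theta> then exp (- (V x - V xh)) else 0) \<in> borel_measurable (Leb d)"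
proof -
  have "(\<lambda>x. if x \<in> \<Theta> then V x else 0) \<in> borel_measurable (Leb d)"
    by (rule measurable_extend_continuous[OF op Ck_on_continuous[OF CkV]])
  then have "(\<lambda>x. indicator \<Theta> x * exp (- ((if x \<in> \<Theta> then V x else 0) - V xh))) \<in> borel_measurable (Leb d)"
    using sets_Leb_openin[OF op] by measurable
  moreover have "indicator \<Theta> x * exp (- ((if x \<in> \<Theta> then V x else 0) - V xh)) = (if x \<in> \<Theta> then exp (- (V x - V xh)) else 0)" for x
    by simp
  ultimately show ?thesis by simp
qed

lemma measurable_w [measurable]: "w \<in> borel_measurable (Leb d)"
  unfolding w_def by (rule measurable_compose[OF measurable_X measurable_weight])

lemma measurable_r [measurable]: "r \<in> borel_measurable (Leb d)"
  unfolding r_def by measurable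

lemma seg_U:
  assumes "nrm d y \<le> s * sqrt d" "0 \<le> u" "u \<le> 1"
  shows "ray d xh (L y) u \<in> U"
proof -
  have "ray d xh (L y) u = X (\<lambda>j. u * y j)"
    by (auto simp: X_eq ray_def L_def lmap_def sum_distrib_left mult_ac)
  moreover have "nrm d (\<lambda>j. u * y j) \<le> s * sqrt d"
  proof -
    have "u * nrm d y \<le> 1 * nrm d y" using assms by (intro mult_right_mono) auto
    then show ?thesis using assms by (simp add: nrm_scale)
  qed
  ultimately show ?thesis by (simp add: X_in_U)
qed

lemma ray_0: "ray d xh (L y) 0 = xh"
  using xhR by (auto simp: ray_def fun_eq_iff PiE_def extensional_def)

text \<open>At the minimizer the first-order term vanishes, the second is half the squared norm in
  whitened coordinates, and the third is \<open>cub d t y / 6\<close>; r is what remains. The cases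
  k = 4 and k = 5 give the two remainder bounds.\<close>

lemma taylor:
  assumes Ck: "Ck_on d k \<Theta> V" and k: "k \<ge> 4" and y: "nrm d y \<le> s * sqrt d"
  shows "\<exists>x\<in>U. r y = (\<Sum>m\<in>{4..<k}. tinner d m T (tpow (L y)) / fact m) + tinner d k (nabla V x) (tpow (L y)) / fact k"
proof -
  have seg: "ray d xh (L y) u \<in> \<Theta>" if "0 \<le> u" "u \<le> 1" for u using seg_U[OF y that] UT' by blast
  obtain u where u: "0 < u" "u < 1" and eq: "V (ray d xh (L y) 1) =
    (\<Sum>m<k. tinner d m (nabla V (ray d xh (L y) 0)) (tpow (L y)) / fact m) + tinner d k (nabla V (ray d xh (L y) u)) (tpow (L y)) / fact k"
    using taylor_ray[OF op Ck _ seg] k by force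
  have "(4::nat) = Suc 3" by simp
  then have "Ck_on d (Suc 3) \<Theta> V" using CkV by metis
  then have g: "tinner d 1 T (tpow (L y)) = 0"
    by (rule gradient_zero_at_min[OF op _ xhT]) (use vmin n0 in \<open>simp add: V_def\<close>)
  have h: "tinner d 2 T (tpow (L y)) = (nrm d y)\<^sup>2"
    unfolding quad_L[symmetric] tinner_2 quad_form_def by (intro sum.cong refl) (simp add: H_entry_T tpow_def)
  have z: "tinner d 0 T (tpow (L y)) = V xh" by (simp add: tinner_def nabla_def tpow_def)
  have "{..<k} = {0, 1, 2, 3} \<union> {4..<k}" using k by auto
  then have "(\<Sum>m<k. tinner d m T (tpow (L y)) / fact m) = (\<Sum>m\<in>{0, 1, 2, 3}. tinner d m T (tpow (L y)) / fact m) + (\<Sum>m\<in>{4..<k}. tinner d m T (tpow (L y)) / fact m)"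
    by (simp only:) (rule sum.union_disjoint, auto)
  also have "(\<Sum>m\<in>{0, 1, 2, 3}. tinner d m T (tpow (L y)) / fact m) = V xh + (nrm d y)\<^sup>2 / 2 + cub d t y / 6"
    using g h z by (simp add: cub_t fact_numeral)
  finally have "V (X y) - V xh = (nrm d y)\<^sup>2 / 2 + cub d t y / 6 + (\<Sum>m\<in>{4..<k}. tinner d m T (tpow (L y)) / fact m)
     + tinner d k (nabla V (ray d xh (L y) u)) (tpow (L y)) / fact k"
    using eq unfolding ray_0 X_eq[symmetric] by simp
  moreover have "r y = V (X y) - V xh - (nrm d y)\<^sup>2 / 2 - cub d t y / 6"
    using X_in_U[of y] y UT' by (auto simp: r_def w_def)
  ultimately show ?thesis using seg_U[OF y, of u] u by (intro bexI[of _ "ray d xh (L y) u"]) auto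
qed

lemma r_le: "nrm d y \<le> s * sqrt d \<Longrightarrow> \<bar>r y\<bar> \<le> (e4 / d)\<^sup>2 / 24 * nrm d y ^ 4"
proof -
  assume y: "nrm d y \<le> s * sqrt d"
  obtain x where x: "x \<in> U" "r y = tinner d 4 (nabla V x) (tpow (L y)) / fact 4"
    using taylor[OF CkV _ y] by auto
  have "\<bar>tinner d 4 (nabla V x) (tpow (L y))\<bar> \<le> tnorm d 4 H (nabla V x) * nrm d y ^ 4" by (rule tinner_L_le) simp
  also have "\<dots> \<le> (e4 / d)\<^sup>2 * nrm d y ^ 4" using e4_tnorm[OF x(1)] by (intro mult_right_mono) auto
  finally show ?thesis unfolding x(2) by (simp add: abs_divide fact_numeral)
qed

text \<open>The quartic Taylor term at xh itself. Unlike r, whose tensor sits at an intermediate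
  point, it is even in y.\<close>

definition q where "q y = tinner d 4 T (tpow (L y)) / 24"

lemma q_le:
  assumes C5: "Ck_on d 5 \<Theta> v" and y: "nrm d y \<le> s * sqrt d"
  shows "\<bar>r y - q y\<bar> \<le> (e5 / d) ^ 3 / 120 * nrm d y ^ 5"
proof -
  have C5V: "Ck_on d 5 \<Theta> V" unfolding V_def by (rule Ck_on_cmult(1)[OF op C5])
  have "{4..<5::nat} = {4}" by auto
  then obtain x where x: "x \<in> U" "r y = tinner d 4 T (tpow (L y)) / fact 4 + tinner d 5 (nabla V x) (tpow (L y)) / fact 5"
    using taylor[OF C5V _ y] by auto
  have "\<bar>tinner d 5 (nabla V x) (tpow (L y))\<bar> \<le> tnorm d 5 H (nabla V x) * nrm d y ^ 5" by (rule tinner_L_le) simp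
  also have "\<dots> \<le> (e5 / d) ^ 3 * nrm d y ^ 5" using e5_tnorm(1)[OF C5 x(1)] by (intro mult_right_mono) auto
  finally show ?thesis unfolding x(2) q_def by (simp add: abs_divide fact_numeral)
qed

lemma q_even: "q (\<lambda>i\<in>{..<d}. - y i) = q y"
proof -
  have "tinner d 4 T (tpow (L (\<lambda>i\<in>{..<d}. - y i))) = tinner d 4 T (tpow (\<lambda>i. (-1) * L y i))"
    by (intro tinner_tpow_cong) (simp add: L_def lmap_def sum_negf)
  then show ?thesis unfolding q_def tinner_tpow_scale by simp
qed

lemma measurable_q [measurable]: "q \<in> borel_measurable (Leb d)"
proof -
  have [measurable]: "(\<lambda>y. L y i) \<in> borel_measurable (Leb d)" for i unfolding L_def lmap_def by measurable
  have "(\<lambda>y. prod_list (map (L y) is)) \<in> borel_measurable (Leb d)" for "is" by (induction "is") auto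
  then show ?thesis unfolding q_def tinner_def tpow_def by measurable
qed

text \<open>Outside U the point is also outside the region of radius s0, so A2 applies there. The
  powers of n cancel because the norm in H is sqrt n times the norm in the Hessian of v.\<close>

lemma w_out:
  assumes y: "s * sqrt d < nrm d y"
  shows "w y \<le> exp (- c0 * (sqrt d * nrm d y))"
proof (cases "X y \<in> \<Theta>")
  case True
  have nh: "sqrt n * hnorm d (hessian d v xh) (vsub d (X y) xh) = nrm d y"
    unfolding hnorm_H[symmetric] vsub_X hnorm_restrict hnorm_L ..
  have "X y \<notin> local_region d n v xh s0"
  proof
    assume "X y \<in> local_region d n v xh s0"
    then have "hnorm d (hessian d v xh) (vsub d (X y) xh) \<le> s0 * sqrt (d / n)" by (simp add: local_region_def)
    also have "\<dots> \<le> s * sqrt (d / n)" using s_ge_s0 n0 by (intro mult_right_mono) auto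
    finally have "X y \<in> U" by (simp add: U_def local_region_def X_Rd)
    then show False using y by (simp add: X_in_U)
  qed
  then have "v (X y) - v xh \<ge> c0 * sqrt (d / n) * hnorm d (hessian d v xh) (vsub d (X y) xh)"
    using A2 True by (auto simp: A2_def)
  then have "n * (c0 * sqrt (d / n) * hnorm d (hessian d v xh) (vsub d (X y) xh)) \<le> n * (v (X y) - v xh)"
    using n0 by (intro mult_left_mono) auto
  moreover have "n * (c0 * sqrt (d / n) * hnorm d (hessian d v xh) (vsub d (X y) xh)) = c0 * (sqrt d * nrm d y)"
  proof -
    have "n * (c0 * sqrt (d / n) * hnorm d (hessian d v xh) (vsub d (X y) xh)) =
      c0 * sqrt d * (n / sqrt n * hnorm d (hessian d v xh) (vsub d (X y) xh))" by (simp add: real_sqrt_divide)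
    also have "n / sqrt n = sqrt n" using n0 by (simp add: real_div_sqrt)
    finally show ?thesis unfolding nh by simp
  qed
  ultimately have "c0 * (sqrt d * nrm d y) \<le> V (X y) - V xh" by (simp add: V_def right_diff_distrib)
  then show ?thesis using True by (simp add: w_def)
qed (simp add: w_def)

end

section \<open>The posterior mean\<close>

text \<open>The extremal test vector is x divided by its norm.\<close>

lemma nrm_le_dual:
  assumes B: "B \<ge> 0" and u: "\<And>u. nrm d u = 1 \<Longrightarrow> \<bar>dotp d u x\<bar> \<le> B"
  shows "nrm d x \<le> B"
proof (cases "nrm d x = 0")
  case False
  define c where "c = nrm d x"
  have c: "c > 0" using False nrm_nonneg[of d x] by (simp add: c_def less_le)
  have "nrm d (\<lambda>i. (1/c) * x i) = 1" unfolding nrm_scale using c by (simp add: c_def[symmetric])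
  from u[OF this] have "\<bar>dotp d (\<lambda>i. (1/c) * x i) x\<bar> \<le> B" .
  moreover have "dotp d (\<lambda>i. (1/c) * x i) x = (1/c) * dotp d x x" by (simp add: dotp_def sum_distrib_left mult_ac)
  moreover have "(1/c) * dotp d x x = c" using c by (simp add: dotp_self c_def[symmetric] power2_eq_square)
  ultimately show ?thesis using c by (simp add: c_def)
qed (use B in simp)

lemma pos_def_scaled_hessian:
  assumes op: "openin (Rtop d) \<Theta>" and A1: "A1 d \<Theta> v xh" and n: "n > 0"
  shows "pos_def d (hessian d (\<lambda>x. n * v x) xh)"
proof -
  have C: "Ck_on d 4 \<Theta> v" and xhT: "xh \<in> \<Theta>" and P: "pos_def d (hessian d v xh)" using A1 by (auto simp: A1_def)
  have e: "hessian d (\<lambda>x. n * v x) xh $$ (i, j) = n * hessian d v xh $$ (i, j)" if "i < d" "j < d" for i j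
    using that by (simp add: hessian_def nabla_cmult[OF op C _ _ xhT])
  show ?thesis unfolding pos_def_def
  proof (intro conjI allI impI)
    show c: "hessian d (\<lambda>x. n * v x) xh \<in> carrier_mat d d" by (simp add: hessian_def)
    show "transpose_mat (hessian d (\<lambda>x. n * v x) xh) = hessian d (\<lambda>x. n * v x) xh"
    proof (rule eq_matI)
      fix i j assume "i < dim_row (hessian d (\<lambda>x. n * v x) xh)" "j < dim_col (hessian d (\<lambda>x. n * v x) xh)"
      then have ij: "i < d" "j < d" using c by auto
      then show "transpose_mat (hessian d (\<lambda>x. n * v x) xh) $$ (i, j) = hessian d (\<lambda>x. n * v x) xh $$ (i, j)"
        using c pos_def_symD[OF P ij] by (simp add: e)
    qed (use c in auto)
    fix x :: "nat \<Rightarrow> real" assume "\<exists>i<d. x i \<noteq> 0"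
    then have "0 < quad_form d (hessian d v xh) x" using P by (simp add: pos_def_def)
    moreover have "quad_form d (hessian d (\<lambda>x. n * v x) xh) x = n * quad_form d (hessian d v xh) x"
      by (simp add: quad_form_def e sum_distrib_left mult_ac)
    ultimately show "0 < quad_form d (hessian d (\<lambda>x. n * v x) xh) x" using n by simp
  qed
qed

context laplace_setup
begin

definition pa where "pa = (\<Prod>i<d. a i i)"

lemma pa_pos: "pa > 0" unfolding pa_def using W(2) by (intro prod_pos) auto

lemma pa_abs: "(\<Prod>i<d. \<bar>a i i\<bar>) = pa"
  unfolding pa_def using W(2) by (intro prod.cong refl) (auto simp: less_imp_le)

lemma integral_X:
  fixes F :: "(nat \<Rightarrow> real) \<Rightarrow> real"
  assumes F: "F \<in> borel_measurable (Leb d)"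
  shows "(\<integral>x. F x \<partial>Leb d) = pa * (\<integral>y. F (X y) \<partial>Leb d)"
  using integral_Leb_affine[OF F, of a xh] W(2) by (simp add: pa_abs X_def less_imp_neq[THEN not_sym])

lemma X_coord: "i < d \<Longrightarrow> X y i = xh i + L y i"
  by (simp add: X_eq ray_def)

text \<open>The Gaussian normalization contains sqrt (det H^-1), which is the product of the
  diagonal of a and cancels the Jacobian of X.\<close>

lemma integral_laplace:
  fixes F :: "(nat \<Rightarrow> real) \<Rightarrow> real"
  assumes F [measurable]: "F \<in> borel_measurable (Leb d)"
  shows "(\<integral>x. F x \<partial>laplace d V xh) = (\<integral>y. F (X y) \<partial>gam d)"
proof -
  define D where "D x = exp (- (1/2) * quad_form d H (vsub d x xh)) / sqrt ((2 * pi) ^ d * det (minv H))" for x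
  have [measurable]: "D \<in> borel_measurable (Leb d)"
    unfolding D_def quad_form_def vsub_def by measurable
  have D0: "D x \<ge> 0" for x using W(6) by (simp add: D_def)
  have "laplace d V xh = density (Leb d) (\<lambda>x. ennreal (D x))"
    unfolding laplace_def gaussian_def H_def[symmetric] W(5) D_def ..
  then have "(\<integral>x. F x \<partial>laplace d V xh) = (\<integral>x. D x * F x \<partial>Leb d)"
    using D0 by (simp add: integral_density)
  also have "\<dots> = pa * (\<integral>y. D (X y) * F (X y) \<partial>Leb d)" by (rule integral_X) measurable
  also have "\<dots> = (\<integral>y. pa * (D (X y) * F (X y)) \<partial>Leb d)" by simp
  also have "\<dots> = (\<integral>y. gd d y * F (X y) \<partial>Leb d)"
  proof (intro Bochner_Integration.integral_cong refl)
    fix y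
    have "quad_form d H (vsub d (X y) xh) = quad_form d H (L y)" by (simp add: vsub_X quad_form_def)
    moreover have "sqrt ((2 * pi) ^ d * det (minv H)) = sqrt (2 * pi) ^ d * pa"
      unfolding W(6) pa_def[symmetric] using pa_pos by (simp add: real_sqrt_mult real_sqrt_power power_mult_distrib)
    ultimately have "D (X y) = exp (- (1/2) * (nrm d y)\<^sup>2) / (sqrt (2 * pi) ^ d * pa)"
      unfolding D_def by (simp add: quad_L)
    then have "pa * D (X y) = gd d y" using pa_pos by (simp add: gd_eq)
    then show "pa * (D (X y) * F (X y)) = gd d y * F (X y)" by (metis mult.assoc)
  qed
  also have "\<dots> = (\<integral>y. F (X y) \<partial>gam d)" by (rule integral_gam[symmetric]) measurable
  finally show ?thesis .
qed

lemma Scorr_X: "Scorr d V xh (X y) = - (cub d t y / 6)"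
proof -
  have "tinner d 3 T (tpow (vsub d (X y) xh)) = tinner d 3 T (tpow (L y))"
    unfolding vsub_X by (intro tinner_tpow_cong) simp
  then show ?thesis by (simp add: Scorr_def cub_t)
qed

lemma measurable_Scorr [measurable]: "Scorr d V xh \<in> borel_measurable (Leb d)"
proof -
  have [measurable]: "(\<lambda>x. vsub d x xh i) \<in> borel_measurable (Leb d)" for i
    unfolding vsub_def by (cases "i < d") auto
  have "(\<lambda>x. prod_list (map (vsub d x xh) is)) \<in> borel_measurable (Leb d)" for "is" by (induction "is") auto
  then show ?thesis unfolding Scorr_def tinner_def tpow_def by measurable
qed

text \<open>The correction \<open>delta_xh\<close> in whitened coordinates, see
  \<open>delta_coord\<close>.\<close>

definition \<Delta> where "\<Delta> j = - (\<integral>y. y j * (cub d t y / 6) \<partial>gam d)"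

lemma am_L: "i < d \<Longrightarrow> all_moments d (\<lambda>y. L y i)"
  unfolding L_def lmap_def by (intro am_sum am_mult am_const am_coord) auto

lemma am_cub6: "all_moments d (\<lambda>y. cub d t y / 6)" by (intro am_divide am_cub)

lemma integral_cub_0: "(\<integral>y. cub d t y / 6 \<partial>gam d) = 0"
  by (rule integral_gam_odd) auto

lemma integral_L_cub: "i < d \<Longrightarrow> (\<integral>y. L y i * (cub d t y / 6) \<partial>gam d) = - L \<Delta> i"
proof -
  assume i: "i < d"
  have int: "integrable (gam d) (\<lambda>y. y j * (cub d t y / 6))" if "j < d" for j
    using that by (intro am_integrable am_mult am_coord am_cub6)
  have "(\<integral>y. L y i * (cub d t y / 6) \<partial>gam d) = (\<integral>y. (\<Sum>j<d. a i j * (y j * (cub d t y / 6))) \<partial>gam d)"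
    by (intro Bochner_Integration.integral_cong refl) (simp only: L_def lmap_def sum_distrib_right mult.assoc)
  also have "\<dots> = (\<Sum>j<d. a i j * (\<integral>y. y j * (cub d t y / 6) \<partial>gam d))"
    using integrable_mult_right[OF int]
    by (subst Bochner_Integration.integral_sum) (simp_all only: lessThan_iff integral_mult_right_zero)
  finally show ?thesis by (simp add: L_def lmap_def \<Delta>_def sum_negf)
qed

lemma delta_coord: "i < d \<Longrightarrow> delta_xh d V xh i = L \<Delta> i"
proof -
  assume i: "i < d"
  have "delta_xh d V xh i = (\<integral>x. x i * Scorr d V xh x \<partial>laplace d V xh)" using i by (simp add: delta_xh_def)
  also have "\<dots> = (\<integral>y. X y i * Scorr d V xh (X y) \<partial>gam d)" using i by (intro integral_laplace) measurable
  also have "\<dots> = (\<integral>y. - (xh i * (cub d t y / 6)) - L y i * (cub d t y / 6) \<partial>gam d)"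
    unfolding Scorr_X X_coord[OF i] by (intro Bochner_Integration.integral_cong refl) (simp add: algebra_simps)
  also have "\<dots> = - (xh i * (\<integral>y. cub d t y / 6 \<partial>gam d)) - (\<integral>y. L y i * (cub d t y / 6) \<partial>gam d)"
  proof -
    have i1: "integrable (gam d) (\<lambda>y. - (xh i * (cub d t y / 6)))"
      using am_integrable[OF am_cub6] by (intro Bochner_Integration.integrable_minus integrable_mult_right)
    show ?thesis
      unfolding Bochner_Integration.integral_diff[OF i1 am_integrable[OF am_mult[OF am_L[OF i] am_cub6]]]
        Bochner_Integration.integral_minus integral_mult_right_zero ..
  qed
  also have "\<dots> = L \<Delta> i" by (simp only: integral_cub_0 integral_L_cub[OF i] mult_zero_right minus_zero diff_0 minus_minus)
  finally show ?thesis .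
qed

lemma integral_L_0: "i < d \<Longrightarrow> (\<integral>y. L y i \<partial>gam d) = 0"
  by (rule integral_gam_odd) (auto simp: am_measurable[OF am_L] L_def lmap_def sum_negf)

lemma xh_S_coord: "i < d \<Longrightarrow> xh_S d V xh i = xh i + L \<Delta> i"
proof -
  assume i: "i < d"
  interpret prob_space "gam d" by (rule prob_space_gam)
  have int: "integrable (gam d) (\<lambda>y. L y i)" "integrable (gam d) (\<lambda>y. cub d t y / 6)" "integrable (gam d) (\<lambda>y. L y i * (cub d t y / 6))"
    by (rule am_integrable[OF am_L[OF i]] am_integrable[OF am_cub6] am_integrable[OF am_mult[OF am_L[OF i] am_cub6]])+
  have "xh_S d V xh i = (\<integral>x. x i * (1 + Scorr d V xh x) \<partial>laplace d V xh)" using i by (simp add: xh_S_def)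
  also have "\<dots> = (\<integral>y. X y i * (1 + Scorr d V xh (X y)) \<partial>gam d)" using i by (intro integral_laplace) measurable
  also have "\<dots> = (\<integral>y. ((xh i + L y i) - xh i * (cub d t y / 6)) - L y i * (cub d t y / 6) \<partial>gam d)"
    unfolding Scorr_X X_coord[OF i] by (intro Bochner_Integration.integral_cong refl) (simp add: algebra_simps)
  also have "\<dots> = ((xh i + (\<integral>y. L y i \<partial>gam d)) - xh i * (\<integral>y. cub d t y / 6 \<partial>gam d)) - (\<integral>y. L y i * (cub d t y / 6) \<partial>gam d)"
  proof -
    have i1: "integrable (gam d) (\<lambda>y. xh i + L y i)" using int(1) by (intro Bochner_Integration.integrable_add integrable_const)
    have i2: "integrable (gam d) (\<lambda>y. xh i * (cub d t y / 6))" using int(2) by (rule integrable_mult_right)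
    have "(\<integral>y. xh i + L y i \<partial>gam d) = xh i + (\<integral>y. L y i \<partial>gam d)"
      using int(1) prob_space by (subst Bochner_Integration.integral_add) auto
    then show ?thesis
      unfolding Bochner_Integration.integral_diff[OF Bochner_Integration.integrable_diff[OF i1 i2] int(3)]
        Bochner_Integration.integral_diff[OF i1 i2] integral_mult_right_zero by (simp only:)
  qed
  also have "\<dots> = xh i + L \<Delta> i" by (simp only: integral_L_0[OF i] integral_cub_0 integral_L_cub[OF i] mult_zero_right add_0_right diff_zero diff_minus_eq_add)
  finally show ?thesis .
qed

definition Iw where "Iw = (\<integral>y. w y \<partial>Leb d)"
text \<open>The posterior mean in whitened coordinates, relative to xh; see
  \<open>posterior_mean\<close>.\<close>

definition m where "m j = (\<integral>y. y j * w y \<partial>Leb d) / Iw"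

lemma T_sym:
  assumes "i < d" "j < d" "k < d"
  shows "T [i, j, k] = T [j, i, k]" "T [i, j, k] = T [i, k, j]"
proof -
  have "Ck_on d 3 \<Theta> V" by (rule Ck_on_mono[OF CkV]) simp
  then show "T [i, j, k] = T [j, i, k]" "T [i, j, k] = T [i, k, j]"
    using nabla3_commute[OF op _ assms xhT] by auto
qed

definition p where "p i = (\<Sum>b<d. \<Sum>c<d. T [i, b, c] * minv H $$ (b, c))"

text \<open>The derivative tensor is symmetric, so the three traces in
  \<open>integral_coord_cub\<close> coincide and 3/6 gives the factor 1/2.\<close>

lemma Delta_eq: "j < d \<Longrightarrow> \<Delta> j = - (1/2) * (\<Sum>i<d. a i j * p i)"
proof -
  assume j: "j < d"
  note swap = tcoef_swap[of d T, OF T_sym(1) T_sym(2)]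
  have sw: "t q j q = t j q q" for q
    unfolding t_def by (rule swap(1)) assumption+
  have sw': "t q q j = t j q q" for q
    unfolding sw[symmetric] unfolding t_def by (rule swap(2)) assumption+
  have i: "integrable (gam d) (\<lambda>y. y j * cub d t y)" using j by (intro am_integrable am_mult am_coord am_cub)
  have "\<Delta> j = - ((\<integral>y. y j * cub d t y \<partial>gam d) / 6)" by (simp add: \<Delta>_def)
  also have "\<dots> = - (1/2) * (\<Sum>q<d. t j q q)"
    unfolding integral_coord_cub[OF j] sw sw' by (simp add: sum_distrib_left[symmetric])
  also have "(\<Sum>q<d. t j q q) = (\<Sum>i<d. a i j * p i)"
    unfolding t_def p_def by (rule tcoef_trace) (simp add: W(4))
  finally show ?thesis .
qed

lemma delta_formula: "delta_xh d V xh = vscale d (- (1/2)) (mvec d (minv H) (contract3 d T (minv H)))"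
proof
  fix i
  show "delta_xh d V xh i = vscale d (- (1/2)) (mvec d (minv H) (contract3 d T (minv H))) i"
  proof (cases "i < d")
    case True
    have "L \<Delta> i = - (1/2) * (\<Sum>j<d. \<Sum>k<d. a i j * a k j * p k)"
      unfolding L_def lmap_def by (simp add: Delta_eq sum_distrib_left mult_ac)
    also have "(\<Sum>j<d. \<Sum>k<d. a i j * a k j * p k) = (\<Sum>k<d. (\<Sum>j<d. a i j * a k j) * p k)"
      by (subst sum.swap) (simp add: sum_distrib_right)
    also have "\<dots> = (\<Sum>k<d. minv H $$ (i, k) * p k)" using True by (simp add: W(4))
    finally show ?thesis using True by (simp add: delta_coord vscale_def mvec_def contract3_def p_def)
  qed (simp add: delta_xh_def vscale_def)
qed

lemma hnorm_L_eq: "(\<And>i. i < d \<Longrightarrow> x i = L y i) \<Longrightarrow> hnorm d H x = nrm d y"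
  using hnorm_L[of y] by (simp add: hnorm_def quad_form_def)

lemma H_pos: "pos_def d H"
  unfolding H_def V_def by (rule pos_def_scaled_hessian[OF op A1 n0])

text \<open>
  The symmetric square root of \<open>H\<^bsup>-1\<^esup>\<close> may be replaced by \<open>a\<close>, since the contraction term
  depends only on \<open>a a\<^bsup>T\<^esup>\<close>.
\<close>
lemma delta_le_eps3bar: "nrm d \<Delta> \<le> eps3bar d V xh"
proof -
  define B where "B = inv_sqrt_mat d H"
  have B: "pos_def d B" "B * B = minv H" unfolding B_def by (rule inv_sqrt_mat_props[OF H_pos])+
  have Bc: "B \<in> carrier_mat d d" using B(1) by (simp add: pos_def_def)
  have BB: "(\<Sum>q<d. B $$ (b, q) * B $$ (c, q)) = minv H $$ (b, c)" if "b < d" "c < d" for b c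
  proof -
    have "(\<Sum>q<d. B $$ (b, q) * B $$ (c, q)) = (\<Sum>q<d. B $$ (b, q) * B $$ (q, c))"
      using pos_def_symD[OF B(1)] that by (intro sum.cong refl) auto
    also have "\<dots> = (B * B) $$ (b, c)" by (rule index_mult_mat_sum[OF Bc Bc that, symmetric])
    finally show ?thesis by (simp only: B(2))
  qed
  define W' where "W' = (\<lambda>x. V (vadd d xh (mvec d B x)))"
  define o0 where "o0 = (\<lambda>i\<in>{..<d}. 0 :: real)"
  have z: "vadd d xh (mvec d B o0) = xh"
    using xhR by (auto simp: vadd_def mvec_def o0_def fun_eq_iff PiE_def extensional_def)
  have C3: "Ck_on d 3 \<Theta> V" by (rule Ck_on_mono[OF CkV]) simp
  have nab: "nabla W' o0 [i, j, k] = tcoef d T (\<lambda>a i. B $$ (a, i)) i j k" if "i < d" "j < d" "k < d" for i j k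
  proof -
    have "nabla W' o0 [i, j, k] = (\<Sum>c<d. \<Sum>b<d. \<Sum>a<d. T [a, b, c] * B $$ (a, i) * B $$ (b, j) * B $$ (c, k))"
      unfolding W'_def using nabla3_affine_comp[OF op C3 that, of xh B o0] xhT by (simp add: z sum_distrib_left mult_ac)
    also have "\<dots> = (\<Sum>c<d. \<Sum>a<d. \<Sum>b<d. T [a, b, c] * B $$ (a, i) * B $$ (b, j) * B $$ (c, k))"
      by (intro sum.cong refl sum.swap)
    also have "\<dots> = (\<Sum>a<d. \<Sum>c<d. \<Sum>b<d. T [a, b, c] * B $$ (a, i) * B $$ (b, j) * B $$ (c, k))" by (rule sum.swap)
    also have "\<dots> = tcoef d T (\<lambda>a i. B $$ (a, i)) i j k" unfolding tcoef_def by (intro sum.cong refl sum.swap)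
    finally show ?thesis .
  qed
  have con: "contract3 d (nabla W' o0) (1\<^sub>m d) i = (\<Sum>a<d. B $$ (a, i) * p a)" if "i < d" for i
  proof -
    have "contract3 d (nabla W' o0) (1\<^sub>m d) i = (\<Sum>j<d. \<Sum>k<d. if j = k then nabla W' o0 [i, j, k] else 0)"
      using that unfolding contract3_def by (simp only: restrict_apply lessThan_iff if_True, intro sum.cong refl) (auto simp: one_mat_def)
    also have "\<dots> = (\<Sum>j<d. nabla W' o0 [i, j, j])" by (intro sum.cong refl) simp
    also have "\<dots> = (\<Sum>j<d. tcoef d T (\<lambda>a i. B $$ (a, i)) i j j)" using that by (intro sum.cong refl) (auto intro!: nab)
    also have "\<dots> = (\<Sum>a<d. B $$ (a, i) * p a)" unfolding p_def by (rule tcoef_trace) (rule BB)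
    finally show ?thesis .
  qed
  have "(nrm d \<Delta>)\<^sup>2 = (\<Sum>j<d. 1/4 * (\<Sum>i<d. a i j * p i)\<^sup>2)"
    unfolding nrm_sq by (intro sum.cong refl) (simp add: Delta_eq power_mult_distrib power_divide)
  also have "\<dots> = 1/4 * (\<Sum>j<d. (\<Sum>i<d. a i j * p i)\<^sup>2)" by (simp add: sum_distrib_left)
  also have "(\<Sum>j<d. (\<Sum>i<d. a i j * p i)\<^sup>2) = (\<Sum>b<d. \<Sum>c<d. p b * p c * minv H $$ (b, c))"
    by (rule sum_sq_columns) (simp add: W(4))
  also have "\<dots> = (\<Sum>j<d. (\<Sum>i<d. B $$ (i, j) * p i)\<^sup>2)"
    by (rule sum_sq_columns[symmetric]) (rule BB)
  also have "\<dots> = (L2_set (contract3 d (nabla W' o0) (1\<^sub>m d)) {..<d})\<^sup>2"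
    by (simp add: L2_set_def sum_nonneg con)
  finally have "(nrm d \<Delta>)\<^sup>2 = 1/4 * (L2_set (contract3 d (nabla W' o0) (1\<^sub>m d)) {..<d})\<^sup>2" .
  then have "(nrm d \<Delta>)\<^sup>2 \<le> 1/6 * (frob_norm d 3 (nabla W' o0))\<^sup>2 + 1/4 * (L2_set (contract3 d (nabla W' o0) (1\<^sub>m d)) {..<d})\<^sup>2"
    using zero_le_power2[of "frob_norm d 3 (nabla W' o0)"] by linarith
  then have "nrm d \<Delta> \<le> sqrt (1/6 * (frob_norm d 3 (nabla W' o0))\<^sup>2 + 1/4 * (L2_set (contract3 d (nabla W' o0) (1\<^sub>m d)) {..<d})\<^sup>2)"
    by (rule real_le_rsqrt)
  then show ?thesis unfolding eps3bar_def Let_def H_def[symmetric] B_def[symmetric] W'_def o0_def .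
qed

end

locale laplace_setup_small = laplace_setup d n \<Theta> v xh s0 c0 s C a
  for d n \<Theta> v xh s0 c0 s C M a +
  assumes e3M: "eps3 d (\<lambda>x. n * v x) xh \<le> M"
    and e4M: "eps4 d (\<lambda>x. n * v x) xh (local_region d n v xh s) \<le> M"
begin

sublocale LC: laplace_core d t e3 e4 s c0 M w r
proof
  fix y assume y: "nrm d y \<le> s * sqrt d"
  \<comment> \<open>The ball is mapped into \<Theta>, so w is positive there and the logarithm in
    the definition of r is inverted by the exponential.\<close>
  then have "w y > 0" using X_in_U[of y] UT' by (auto simp: w_def)
  then show "w y = exp (- (nrm d y)\<^sup>2 / 2 - cub d t y / 6 - r y)" by (simp add: r_def)
qed (use d1 e3_nonneg e4_nonneg e3M e4M c0 s12 slog cub_t_le r_le w_out in \<open>auto simp: V_def[symmetric] U_def[symmetric] w_def[abs_def, symmetric]\<close>, simp add: w_def)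

text \<open>\<open>LC.D\<close> has no argument u, but its defining equation was exported from the
  context that fixes a unit vector; some unit vector is needed to unfold it.\<close>

lemma unit_vector: "nrm d (kdelta 0) = 1"
proof -
  have "(nrm d (kdelta 0))\<^sup>2 = (\<Sum>i<d. if i = 0 then 1 else 0)" unfolding nrm_sq by (intro sum.cong refl) auto
  also have "\<dots> = 1" using d1 by simp
  finally show ?thesis using nrm_nonneg[of d "kdelta 0"] by (metis abs_of_nonneg real_sqrt_abs real_sqrt_one)
qed

lemma Iw_eq: "Iw = LC.Z * LC.D"
  using LC.Z1 by (simp add: Iw_def LC.D_def[OF unit_vector])

lemma Iw_pos: "Iw > 0"
proof -
  have "LC.D > 0" using LC.D_ge[OF unit_vector] KD_pos[of M] by linarith
  then show ?thesis using LC.Z1 by (simp add: Iw_eq)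
qed

lemma integrable_w: "integrable (Leb d) w"
  using LC.integral_w(1)[OF am_const[of d 1]] by simp

lemma integrable_coord_w: "j < d \<Longrightarrow> integrable (Leb d) (\<lambda>y. y j * w y)"
proof -
  assume j: "j < d"
  have "\<bar>y j\<bar> \<le> 1 + nrm d y" for y using coord_le_nrm[OF j, of y] by linarith
  then show ?thesis by (rule LC.integral_w(1)[OF am_coord[OF j]])
qed

text \<open>The peak value exp (- V xh) and the Jacobian occur in both the density and its
  normalizing integral and cancel.\<close>

lemma posterior_mean: "i < d \<Longrightarrow> mean d (posterior d \<Theta> V) i = xh i + L m i"
proof -
  assume i: "i < d"
  define wt where "wt x = (if x \<in> \<Theta> then exp (- (V x - V xh)) else 0)" for x
  have [measurable]: "wt \<in> borel_measurable (Leb d)" unfolding wt_def by (rule measurable_weight)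
  have wX: "wt (X y) = w y" for y by (simp add: wt_def w_def)
  have ind: "indicator \<Theta> x * exp (- V x) = exp (- V xh) * wt x" for x
    by (simp add: wt_def exp_add[symmetric])
  have Zp: "(\<integral>y. indicator \<Theta> y * exp (- V y) \<partial>Leb d) = exp (- V xh) * (pa * Iw)"
  proof -
    have "(\<integral>x. wt x \<partial>Leb d) = pa * (\<integral>y. wt (X y) \<partial>Leb d)" by (rule integral_X) measurable
    then show ?thesis unfolding ind by (simp add: wX Iw_def)
  qed
  have dens: "indicator \<Theta> x * exp (- V x) / (exp (- V xh) * (pa * Iw)) = wt x / (pa * Iw)" for x
    unfolding ind by simp
  have wt0: "wt x / (pa * Iw) \<ge> 0" for x using pa_pos Iw_pos by (simp add: wt_def)
  have "mean d (posterior d \<Theta> V) i = (\<integral>x. x i \<partial>density (Leb d) (\<lambda>x. ennreal (wt x / (pa * Iw))))"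
    using i unfolding mean_def posterior_def Zp dens by simp
  also have "\<dots> = (\<integral>x. wt x / (pa * Iw) * x i \<partial>Leb d)"
    using i wt0 by (subst integral_density) auto
  also have "\<dots> = pa * (\<integral>y. w y / (pa * Iw) * X y i \<partial>Leb d)"
    using i by (subst integral_X) (auto simp: wX)
  also have "\<dots> = pa * (\<integral>y. (1 / (pa * Iw)) * (xh i * w y + (\<Sum>j<d. a i j * (y j * w y))) \<partial>Leb d)"
  proof -
    have "w y / (pa * Iw) * X y i = (1 / (pa * Iw)) * (xh i * w y + (\<Sum>j<d. a i j * (y j * w y)))" for y
    proof -
      have "w y * X y i = xh i * w y + (\<Sum>j<d. a i j * (y j * w y))"
        unfolding X_coord[OF i] L_def lmap_def distrib_left sum_distrib_left by (simp add: mult_ac)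
      then show ?thesis by (metis times_divide_eq_left mult_1)
    qed
    then show ?thesis by (simp only:)
  qed
  also have "\<dots> = pa * ((1 / (pa * Iw)) * (xh i * Iw + (\<Sum>j<d. a i j * (\<integral>y. y j * w y \<partial>Leb d))))"
  proof -
    have i1: "integrable (Leb d) (\<lambda>y. xh i * w y)" using integrable_w by (rule integrable_mult_right)
    have i2: "integrable (Leb d) (\<lambda>y. a i j * (y j * w y))" if "j \<in> {..<d}" for j
      using integrable_coord_w that by (intro integrable_mult_right) auto
    have "(\<integral>y. xh i * w y + (\<Sum>j<d. a i j * (y j * w y)) \<partial>Leb d) = xh i * Iw + (\<Sum>j<d. a i j * (\<integral>y. y j * w y \<partial>Leb d))"
      using i1 i2 by (subst Bochner_Integration.integral_add) (auto simp: Bochner_Integration.integral_sum Iw_def)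
    then show ?thesis by simp
  qed
  also have "\<dots> = xh i + L m i"
  proof -
    define Q where "Q = (\<Sum>j<d. a i j * (\<integral>y. y j * w y \<partial>Leb d))"
    have "L m i = Q / Iw" by (simp add: L_def lmap_def m_def Q_def sum_divide_distrib)
    moreover have "pa * ((1 / (pa * Iw)) * (xh i * Iw + Q)) = xh i + Q / Iw"
      using pa_pos Iw_pos by (simp add: field_simps)
    ultimately show ?thesis by (simp add: Q_def)
  qed
  finally show ?thesis .
qed

lemma ratio_eq:
  assumes u: "nrm d u = 1"
  shows "LC.N u / LC.D - LC.\<Delta> u = dotp d u (\<lambda>j. m j - \<Delta> j)"
proof -
  have "(\<integral>y. dotp d u y * w y \<partial>Leb d) = (\<integral>y. (\<Sum>j<d. u j * (y j * w y)) \<partial>Leb d)"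
    by (simp add: dotp_def sum_distrib_right mult.assoc)
  also have "\<dots> = (\<Sum>j<d. u j * (\<integral>y. y j * w y \<partial>Leb d))"
    using integrable_coord_w by (subst Bochner_Integration.integral_sum) auto
  finally have N: "LC.N u / LC.D = dotp d u m"
    using LC.Z1 by (simp add: LC.N_def[OF u] LC.D_def[OF u] dotp_def m_def Iw_def sum_divide_distrib[symmetric])
  have i: "integrable (gam d) (\<lambda>y. y j * (cub d t y / 6))" if "j < d" for j
    using that by (intro am_integrable am_mult am_coord am_cub6)
  have "(\<integral>y. dotp d u y * LC.f y \<partial>gam d) = (\<integral>y. (\<Sum>j<d. u j * (y j * (cub d t y / 6))) \<partial>gam d)"
    by (intro Bochner_Integration.integral_cong refl) (simp only: dotp_def LC.f_def sum_distrib_right mult.assoc)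
  also have "\<dots> = (\<Sum>j<d. u j * (\<integral>y. y j * (cub d t y / 6) \<partial>gam d))"
    using integrable_mult_right[OF i]
    by (subst Bochner_Integration.integral_sum) (simp_all only: lessThan_iff integral_mult_right_zero)
  finally have "LC.\<Delta> u = dotp d u \<Delta>"
    by (simp add: LC.\<Delta>_def[OF u] dotp_def \<Delta>_def sum_negf)
  then show ?thesis using N by (simp add: dotp_def right_diff_distrib sum_subtractf)
qed

lemma E_eq: "Efac e3 e4 s = LC.E" "e3\<^sup>2 + e4\<^sup>2 = LC.S" "tau d c0 s = d * LC.\<beta>"
  by (simp_all add: Efac_def LC.E_def LC.S_def tau_def LC.\<beta>_def)

lemma tau_nonneg: "tau d c0 s \<ge> 0" by (simp add: tau_def)

lemma bound1: "nrm d (\<lambda>j. m j - \<Delta> j) \<le> K1 M * (Efac e3 e4 s * (e3\<^sup>2 + e4\<^sup>2) + tau d c0 s)"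
proof (rule nrm_le_dual)
  show "0 \<le> K1 M * (Efac e3 e4 s * (e3\<^sup>2 + e4\<^sup>2) + tau d c0 s)"
    using K1_pos[OF LC.M0] tau_nonneg by (intro mult_nonneg_nonneg add_nonneg_nonneg) (auto simp: Efac_def)
  fix u assume u: "nrm d u = 1"
  from LC.first_order_bound[OF u]
  show "\<bar>dotp d u (\<lambda>j. m j - \<Delta> j)\<bar> \<le> K1 M * (Efac e3 e4 s * (e3\<^sup>2 + e4\<^sup>2) + tau d c0 s)"
    unfolding ratio_eq[OF u] E_eq .
qed

lemma bound2:
  assumes C5: "Ck_on d 5 \<Theta> v"
  shows "nrm d (\<lambda>j. m j - \<Delta> j) \<le> K2 M * (Efac e3 e4 s * (e3\<^sup>2 + e4\<^sup>2) * (e3 + e4\<^sup>2) + e5 ^ 3 / sqrt d + tau d c0 s)"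
proof (rule nrm_le_dual)
  note e5 = e5_tnorm(2)[OF C5]
  show "0 \<le> K2 M * (Efac e3 e4 s * (e3\<^sup>2 + e4\<^sup>2) * (e3 + e4\<^sup>2) + e5 ^ 3 / sqrt d + tau d c0 s)"
    using K2_pos[OF LC.M0] tau_nonneg e5 e3_nonneg by (intro mult_nonneg_nonneg add_nonneg_nonneg) (auto simp: Efac_def)
  fix u assume u: "nrm d u = 1"
  show "\<bar>dotp d u (\<lambda>j. m j - \<Delta> j)\<bar> \<le> K2 M * (Efac e3 e4 s * (e3\<^sup>2 + e4\<^sup>2) * (e3 + e4\<^sup>2) + e5 ^ 3 / sqrt d + tau d c0 s)"
    using LC.second_order_bound[OF u measurable_q q_even e5 q_le[OF C5]] unfolding ratio_eq[OF u] E_eq .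
qed

lemma conclusion:
  fixes K :: real
  defines "xbar \<equiv> mean d (posterior d \<Theta> V)" and "\<delta> \<equiv> delta_xh d V xh" and "xS \<equiv> xh_S d V xh"
  defines "R \<equiv> vsub d (vsub d xbar xh) \<delta>"
  assumes K: "K1 M \<le> K" "K2 M \<le> K"
  shows "xS = vadd d xh \<delta>"
    and "\<delta> = vscale d (- (1/2)) (mvec d (minv H) (contract3 d T (minv H)))"
    and "hnorm d H R = hnorm d H (vsub d xbar xS)"
    and "hnorm d H R \<le> K * (Efac e3 e4 s * (e3\<^sup>2 + e4\<^sup>2) + tau d c0 s)"
    and "Ck_on d 5 \<Theta> v \<Longrightarrow> hnorm d H (vsub d xbar xS)
           \<le> K * (Efac e3 e4 s * (e3\<^sup>2 + e4\<^sup>2) * (e3 + e4\<^sup>2) + e5 ^ 3 / sqrt d + tau d c0 s)"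
    and "hnorm d H \<delta> \<le> eps3bar d V xh"
    and "hnorm d H (vsub d xbar xh) \<le> eps3bar d V xh + hnorm d H R"
proof -
  show xS: "xS = vadd d xh \<delta>"
    by (auto simp: xS_def \<delta>_def vadd_def fun_eq_iff xh_S_coord delta_coord) (simp add: xh_S_def)
  show "\<delta> = vscale d (- (1/2)) (mvec d (minv H) (contract3 d T (minv H)))" unfolding \<delta>_def by (rule delta_formula)
  have "vsub d xbar xS = R" by (auto simp: xS R_def vsub_def vadd_def fun_eq_iff)
  then show RS: "hnorm d H R = hnorm d H (vsub d xbar xS)" by simp
  have hR: "hnorm d H R = nrm d (\<lambda>j. m j - \<Delta> j)"
    by (rule hnorm_L_eq) (simp add: R_def vsub_def xbar_def \<delta>_def posterior_mean delta_coord L_def lmap_def sum_subtractf right_diff_distrib)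
  have h\<delta>: "hnorm d H \<delta> = nrm d \<Delta>" by (rule hnorm_L_eq) (simp add: \<delta>_def delta_coord)
  have hx: "hnorm d H (vsub d xbar xh) = nrm d m" by (rule hnorm_L_eq) (simp add: vsub_def xbar_def posterior_mean)
  show "hnorm d H R \<le> K * (Efac e3 e4 s * (e3\<^sup>2 + e4\<^sup>2) + tau d c0 s)"
    unfolding hR using tau_nonneg by (intro order_trans[OF bound1] mult_right_mono K add_nonneg_nonneg) (auto simp: Efac_def)
  show "hnorm d H (vsub d xbar xS)
           \<le> K * (Efac e3 e4 s * (e3\<^sup>2 + e4\<^sup>2) * (e3 + e4\<^sup>2) + e5 ^ 3 / sqrt d + tau d c0 s)" if C5: "Ck_on d 5 \<Theta> v"
    unfolding RS[symmetric] hR using tau_nonneg e5_tnorm(2)[OF C5] e3_nonneg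
    by (intro order_trans[OF bound2[OF C5]] mult_right_mono K add_nonneg_nonneg) (auto simp: Efac_def)
  show "hnorm d H \<delta> \<le> eps3bar d V xh" unfolding h\<delta> by (rule delta_le_eps3bar)
  have "nrm d m = nrm d (\<lambda>j. \<Delta> j + (m j - \<Delta> j))" by simp
  also have "\<dots> \<le> nrm d \<Delta> + nrm d (\<lambda>j. m j - \<Delta> j)" by (rule nrm_triangle)
  finally show "hnorm d H (vsub d xbar xh) \<le> eps3bar d V xh + hnorm d H R"
    unfolding hx hR using delta_le_eps3bar by linarith
qed

end

theorem corollary2p24:
  fixes C M :: real
  assumes "C > 0" and "M > 0"
  shows "\<exists>K>0. \<forall>(d::nat) (n::real) (\<Theta> :: (nat \<Rightarrow> real) set) (v :: (nat \<Rightarrow> real) \<Rightarrow> real)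
      (xh :: nat \<Rightarrow> real) (s0::real) (c0::real) (s::real).
    d \<ge> 1 \<longrightarrow> n > 0 \<longrightarrow> openin (Rtop d) \<Theta> \<longrightarrow>
    A1 d \<Theta> v xh \<longrightarrow> A2 C d n \<Theta> v xh s0 c0 \<longrightarrow>
    s \<ge> s_star s0 c0 \<longrightarrow> local_region d n v xh s \<subseteq> \<Theta> \<longrightarrow>
    (let V = (\<lambda>x. n * v x);
         H = hessian d V xh;
         U = local_region d n v xh s;
         e3 = eps3 d V xh;
         e4 = eps4 d V xh U;
         e5 = eps5 d V xh U;
         E = Efac e3 e4 s;
         \<tau> = tau d c0 s;
         xbar = mean d (posterior d \<Theta> V);
         \<delta> = delta_xh d V xh;
         xS = xh_S d V xh;
         R = vsub d (vsub d xbar xh) \<delta>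
     in e3 \<le> M \<longrightarrow> e4 \<le> M \<longrightarrow>
        xS = vadd d xh \<delta> \<and>
        \<delta> = vscale d (- (1/2)) (mvec d (minv H) (contract3 d (nabla V xh) (minv H))) \<and>
        hnorm d H R = hnorm d H (vsub d xbar xS) \<and>
        hnorm d H R \<le> K * (E * (e3\<^sup>2 + e4\<^sup>2) + \<tau>) \<and>
        (Ck_on d 5 \<Theta> v \<longrightarrow>
          hnorm d H (vsub d xbar xS)
            \<le> K * (E * (e3\<^sup>2 + e4\<^sup>2) * (e3 + e4\<^sup>2) + e5 ^ 3 / sqrt d + \<tau>)) \<and>
        hnorm d H \<delta> \<le> eps3bar d V xh \<and>
        hnorm d H (vsub d xbar xh) \<le> eps3bar d V xh + hnorm d H R)"
proof (intro exI[of _ "max (K1 M) (K2 M)"] conjI allI impI, goal_cases)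
  case 1
  show ?case using K1_pos[of M] assms(2) by simp
next
  case (2 d n \<Theta> v xh s0 c0 s)
  obtain a where a: "whitening d (hessian d (\<lambda>x. n * v x) xh) a"
    using pos_def_whitening[OF pos_def_scaled_hessian[OF 2(3,4,2)]] by blast
  have ls: "laplace_setup d n \<Theta> v xh s0 c0 s C a"
    using 2 a assms(1) by unfold_locales
  \<comment> \<open>The bounds on e3 and e4 stand inside the let, so they stay premises here and are
    discharged when the conclusions are applied.\<close>
  have lss: "laplace_setup_small d n \<Theta> v xh s0 c0 s C M a"
    if "eps3 d (\<lambda>x. n * v x) xh \<le> M" "eps4 d (\<lambda>x. n * v x) xh (local_region d n v xh s) \<le> M"
    using ls that by (intro laplace_setup_small.intro laplace_setup_small_axioms.intro)
  have K: "K1 M \<le> max (K1 M) (K2 M)" "K2 M \<le> max (K1 M) (K2 M)" by auto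
  note c = laplace_setup_small.conclusion[OF lss K, unfolded laplace_setup.H_def[OF ls] laplace_setup.V_def[OF ls] laplace_setup.U_def[OF ls]]
  show ?case unfolding Let_def by (intro impI conjI c; assumption)
qed

end
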